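(* Given a CNF formula $F$ over $n$ variables and $m$ clauses and of size $s$, and a branch decomposition $(T,\delta)$ of $F$ of $\mathtt{ps}$-width $k$, one can solve \textsc{MaxSAT}, \textsc{\#SAT} and weighted \textsc{MaxSAT} on $F$ in time $\mathcal{O}(k^3 s(m+n))$.
   Context: A literal is a propositional variable $x$ or its negation $\neg x$; a clause is a finite set of literals; a CNF formula $F$ is a finite multiset of clauses, and $\mathtt{cla}(F)$ denotes its clauses (equal clauses are treated as distinct elements). For a clause $C$, $\mathtt{var}(C)$ is the set of variables of its literals, and $\mathtt{var}(F)=\bigcup_{C\in\mathtt{cla}(F)}\mathtt{var}(C)$. The size of $F$ is $s=|\mathtt{cla}(F)|+\sum_{C\in\mathtt{cla}(F)}|C|$. An assignment of a set $X$ of variables is a map $\tau:X\to\{0,1\}$, extended to literals by $\tau(\neg x)=1-\tau(x)$; it satisfies a clause if some literal of the clause gets value $1$ (the empty clause is never satisfied). \textsc{\#SAT}: compute the number of assignments of $\mathtt{var}(F)$ satisfying all clauses of $F$. Weighted \textsc{MaxSAT}: given also $w:\mathtt{cla}(F)\to\mathbb{N}$ (with total weight at most $2^{\mathcal{O}(|\mathtt{cla}(F)|)}$, so that additions of weights take time linear in $|\mathtt{cla}(F)|$), find an assignment $\tau$ of $\mathtt{var}(F)$ maximizing the sum of $w(C)$ over clauses $C$ satisfied by $\tau$. \textsc{MaxSAT} is weighted \textsc{MaxSAT} with all weights equal to $1$. For a clause $C$ and a set $X$ of variables, $C|_X=\{\ell\in C:\mathtt{var}(\ell)\in X\}$. For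 $\mathcal{C}\subseteq\mathtt{cla}(F)$ and $X\subseteq\mathtt{var}(F)$, $F_{\mathcal{C},X}$ is the formula with clauses $\{C|_X : C\in\mathcal{C}\}$. For a formula $F$ and an assignment $\tau$ of $\mathtt{var}(F)$, $\mathtt{sat}(F,\tau)$ is the set of clauses of $F$ satisfied by $\tau$, and $\mathtt{PS}(F)=\{\mathtt{sat}(F,\tau):\tau \text{ an assignment of } \mathtt{var}(F)\}$. A branch decomposition of $F$ is a pair $(T,\delta)$ where $T$ is a rooted binary tree and $\delta$ is a bijection from the leaves of $T$ to $\mathtt{cla}(F)\cup\mathtt{var}(F)$. For a node $v$ of $T$, $\delta(v)$ is the set of $\delta(l)$ over leaves $l$ of the subtree rooted at $v$. Writing $\delta(v)=\mathcal{C}\cup X$ with $\mathcal{C}\subseteq\mathtt{cla}(F)$, $X\subseteq\mathtt{var}(F)$, let $F_v=F_{\mathtt{cla}(F)\setminus\mathcal{C},\,X}$ and $F_{\overline{v}}=F_{\mathcal{C},\,\mathtt{var}(F)\setminus X}$; the $\mathtt{ps}$-value of $\delta(v)$ is $\max\{|\mathtt{PS}(F_v)|,|\mathtt{PS}(F_{\overline{v}})|\}$, and the $\mathtt{ps}$-width of $(T,\delta)$ is the maximum $\mathtt{ps}$-value over all nodes $v$ of $T$. *)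

theory Defs
  imports "HOL-Library.FuncSet"
begin

section \<open>CNF formulas\<close>

datatype 'v literal = Pos (lvar: 'v) | Neg (lvar: 'v)

type_synonym 'v clause = "'v literal set"

text \<open>
  A finite multiset of clauses whose equal members count as distinct elements is a finite
  family of clauses: the elements of \<open>cla F\<close> are the indices (names) of the family, and
  \<open>the (F C)\<close> is the set of literals of the clause named \<open>C\<close>.
\<close>
type_synonym ('c, 'v) formula = "'c \<Rightarrow> 'v clause option"

definition cla :: "('c, 'v) formula \<Rightarrow> 'c set" where
  "cla F = dom F"

definition lits :: "('c, 'v) formula \<Rightarrow> 'c \<Rightarrow> 'v clause" where
  "lits F C = the (F C)"

definition cnf :: "('c, 'v) formula \<Rightarrow> bool" where
  "cnf F \<longleftrightarrow> finite (cla F) \<and> (\<forall>C\<in>cla F. finite (lits F C))"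

definition vars :: "('c, 'v) formula \<Rightarrow> 'v set" where
  "vars F = (\<Union>C\<in>cla F. lvar ` lits F C)"

definition fsize :: "('c, 'v) formula \<Rightarrow> nat" where
  "fsize F = card (cla F) + (\<Sum>C\<in>cla F. card (lits F C))"

definition assignments :: "'v set \<Rightarrow> ('v \<Rightarrow> bool) set" where
  "assignments X = X \<rightarrow>\<^sub>E UNIV"

fun lit_val :: "('v \<Rightarrow> bool) \<Rightarrow> 'v literal \<Rightarrow> bool" where
  "lit_val \<tau> (Pos x) = \<tau> x"
| "lit_val \<tau> (Neg x) = (\<not> \<tau> x)"

definition sat :: "('c, 'v) formula \<Rightarrow> ('v \<Rightarrow> bool) \<Rightarrow> 'c set" where
  "sat F \<tau> = {C \<in> cla F. \<exists>l\<in>lits F C. lit_val \<tau> l}"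

definition PS :: "('c, 'v) formula \<Rightarrow> 'c set set" where
  "PS F = {sat F \<tau> | \<tau>. \<tau> \<in> assignments (vars F)}"

definition clause_restrict :: "'v clause \<Rightarrow> 'v set \<Rightarrow> 'v clause" where
  "clause_restrict D X = {l \<in> D. lvar l \<in> X}"

definition subformula :: "('c, 'v) formula \<Rightarrow> 'c set \<Rightarrow> 'v set \<Rightarrow> ('c, 'v) formula" where
  "subformula F \<C> X = (\<lambda>C. if C \<in> \<C> then map_option (\<lambda>D. clause_restrict D X) (F C) else None)"

definition number_sat :: "('c, 'v) formula \<Rightarrow> nat" where
  "number_sat F = card {\<tau> \<in> assignments (vars F). sat F \<tau> = cla F}"

definition weighted_maxsat :: "('c, 'v) formula \<Rightarrow> ('c \<Rightarrow> nat) \<Rightarrow> ('v \<Rightarrow> bool) \<Rightarrow> bool" where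
  "weighted_maxsat F w \<tau> \<longleftrightarrow>
     is_arg_max (\<lambda>\<tau>. \<Sum>C\<in>sat F \<tau>. w C) (\<lambda>\<tau>. \<tau> \<in> assignments (vars F)) \<tau>"

definition maxsat :: "('c, 'v) formula \<Rightarrow> ('v \<Rightarrow> bool) \<Rightarrow> bool" where
  "maxsat F \<tau> \<longleftrightarrow> weighted_maxsat F (\<lambda>_. 1) \<tau>"

section \<open>Branch decompositions and ps-width\<close>

text \<open>Every inner node has exactly two children. The leaves carry identities of type \<open>'l\<close>;
  when these are distinct, the nodes of the tree are in bijection with its subtrees.\<close>
datatype 'l btree = Leaf 'l | Node "'l btree" "'l btree"

fun leaves :: "'l btree \<Rightarrow> 'l list" where
  "leaves (Leaf l) = [l]"
| "leaves (Node T1 T2) = leaves T1 @ leaves T2"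

fun nodes :: "'l btree \<Rightarrow> 'l btree set" where
  "nodes (Leaf l) = {Leaf l}"
| "nodes (Node T1 T2) = insert (Node T1 T2) (nodes T1 \<union> nodes T2)"

definition branch_decomposition ::
  "('c, 'v) formula \<Rightarrow> 'l btree \<Rightarrow> ('l \<Rightarrow> 'c + 'v) \<Rightarrow> bool" where
  "branch_decomposition F T \<delta> \<longleftrightarrow>
     distinct (leaves T) \<and> bij_betw \<delta> (set (leaves T)) (cla F <+> vars F)"

definition node_clauses :: "('l \<Rightarrow> 'c + 'v) \<Rightarrow> 'l btree \<Rightarrow> 'c set" where
  "node_clauses \<delta> v = {C. Inl C \<in> \<delta> ` set (leaves v)}"

definition node_vars :: "('l \<Rightarrow> 'c + 'v) \<Rightarrow> 'l btree \<Rightarrow> 'v set" where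
  "node_vars \<delta> v = {x. Inr x \<in> \<delta> ` set (leaves v)}"

definition ps_value :: "('c, 'v) formula \<Rightarrow> ('l \<Rightarrow> 'c + 'v) \<Rightarrow> 'l btree \<Rightarrow> nat" where
  "ps_value F \<delta> v =
     max (card (PS (subformula F (cla F - node_clauses \<delta> v) (node_vars \<delta> v))))
         (card (PS (subformula F (node_clauses \<delta> v) (vars F - node_vars \<delta> v))))"

definition ps_width :: "('c, 'v) formula \<Rightarrow> 'l btree \<Rightarrow> ('l \<Rightarrow> 'c + 'v) \<Rightarrow> nat" where
  "ps_width F T \<delta> = Max (ps_value F \<delta> ` nodes T)"

section \<open>A word RAM\<close>

text \<open>
  Programs are structured word-RAM programs over finitely many registers and a memory with
  indirect addressing. Every elementary instruction and every test takes one unit of time.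
  \<open>exec W p \<sigma> t \<sigma>'\<close> says that \<open>p\<close>, started in \<open>\<sigma>\<close>, halts in \<open>\<sigma>'\<close> after exactly \<open>t\<close> steps and
  that every value it produces (hence every address it uses) is below \<open>W\<close>. There is no
  wrap-around: a program that would produce a larger value has no execution.
\<close>

type_synonym reg = nat

datatype binop = Plus | Minus | Times | Div

datatype com =
    Skip
  | Const reg nat
  | Op binop reg reg reg
  | Load reg reg
  | Store reg reg
  | Seq com com
  | IfLess reg reg com com
  | WhileLess reg reg com

type_synonym state = "(reg \<Rightarrow> nat) \<times> (nat \<Rightarrow> nat)"

fun binop_val :: "binop \<Rightarrow> nat \<Rightarrow> nat \<Rightarrow> nat" where
  "binop_val Plus a b = a + b"
| "binop_val Minus a b = a - b"
| "binop_val Times a b = a * b"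
| "binop_val Div a b = a div b"

inductive exec :: "nat \<Rightarrow> com \<Rightarrow> state \<Rightarrow> nat \<Rightarrow> state \<Rightarrow> bool" for W :: nat where
  exec_Skip: "exec W Skip \<sigma> 1 \<sigma>"
| exec_Const: "i < W \<Longrightarrow> exec W (Const r i) (R, M) 1 (R(r := i), M)"
| exec_Op: "binop_val f (R a) (R b) < W \<Longrightarrow>
    exec W (Op f r a b) (R, M) 1 (R(r := binop_val f (R a) (R b)), M)"
| exec_Load: "exec W (Load r a) (R, M) 1 (R(r := M (R a)), M)"
| exec_Store: "exec W (Store a b) (R, M) 1 (R, M(R a := R b))"
| exec_Seq: "exec W p \<sigma> t \<sigma>' \<Longrightarrow> exec W q \<sigma>' u \<sigma>'' \<Longrightarrow> exec W (Seq p q) \<sigma> (t + u) \<sigma>''"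
| exec_IfTrue: "R a < R b \<Longrightarrow> exec W p (R, M) t \<sigma> \<Longrightarrow>
    exec W (IfLess a b p q) (R, M) (1 + t) \<sigma>"
| exec_IfFalse: "\<not> R a < R b \<Longrightarrow> exec W q (R, M) t \<sigma> \<Longrightarrow>
    exec W (IfLess a b p q) (R, M) (1 + t) \<sigma>"
| exec_WhileFalse: "\<not> R a < R b \<Longrightarrow> exec W (WhileLess a b p) (R, M) 1 (R, M)"
| exec_WhileTrue: "R a < R b \<Longrightarrow> exec W p (R, M) t \<sigma> \<Longrightarrow>
    exec W (WhileLess a b p) \<sigma> u \<sigma>' \<Longrightarrow> exec W (WhileLess a b p) (R, M) (1 + t + u) \<sigma>'"

text \<open>The input occupies the memory cells from address 0 on, and its length is in register 0;
  everything else is initially 0. On termination register 0 holds the length and register 1 the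
  start address of the output.\<close>

definition init_state :: "nat list \<Rightarrow> state" where
  "init_state inp = ((\<lambda>_. 0)(0 := length inp), \<lambda>i. if i < length inp then inp ! i else 0)"

definition result :: "state \<Rightarrow> nat list" where
  "result \<sigma> = (case \<sigma> of (R, M) \<Rightarrow> map (\<lambda>i. M (R 1 + i)) [0..<R 0])"

definition computes :: "com \<Rightarrow> nat \<Rightarrow> nat \<Rightarrow> nat list \<Rightarrow> (nat list \<Rightarrow> bool) \<Rightarrow> bool" where
  "computes P W B inp Q \<longleftrightarrow>
     length inp < W \<and> (\<forall>i\<in>set inp. i < W) \<and>
     (\<exists>t \<sigma>. exec W P (init_state inp) t \<sigma> \<and> t \<le> B \<and> Q (result \<sigma>))"

section \<open>Encoding of instances\<close>

text \<open>An instance is presented through an arbitrary enumeration of its clauses, of its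
  variables, and of the literals of each clause.\<close>
definition listing ::
  "('c, 'v) formula \<Rightarrow> 'c list \<Rightarrow> 'v list \<Rightarrow> ('c \<Rightarrow> 'v literal list) \<Rightarrow> bool" where
  "listing F cs vs ls \<longleftrightarrow>
     distinct cs \<and> set cs = cla F \<and> distinct vs \<and> set vs = vars F \<and>
     (\<forall>C\<in>cla F. distinct (ls C) \<and> set (ls C) = lits F C)"

definition position :: "'a list \<Rightarrow> 'a \<Rightarrow> nat" where
  "position xs x = length (takeWhile (\<lambda>y. y \<noteq> x) xs)"

text \<open>Little-endian, without leading zeros; the number 0 has the empty representation.\<close>
fun binary :: "nat \<Rightarrow> nat list" where
  "binary i = (if i = 0 then [] else i mod 2 # binary (i div 2))"

declare binary.simps [simp del]

fun enc_literal :: "'v list \<Rightarrow> 'v literal \<Rightarrow> nat list" where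
  "enc_literal vs (Pos x) = [position vs x, 1]"
| "enc_literal vs (Neg x) = [position vs x, 0]"

definition enc_clause :: "'v list \<Rightarrow> 'v literal list \<Rightarrow> nat list" where
  "enc_clause vs D = length D # concat (map (enc_literal vs) D)"

fun enc_tree :: "'c list \<Rightarrow> 'v list \<Rightarrow> ('l \<Rightarrow> 'c + 'v) \<Rightarrow> 'l btree \<Rightarrow> nat list" where
  "enc_tree cs vs \<delta> (Leaf l) =
     (case \<delta> l of Inl C \<Rightarrow> [0, position cs C] | Inr x \<Rightarrow> [1, position vs x])"
| "enc_tree cs vs \<delta> (Node T1 T2) = 2 # enc_tree cs vs \<delta> T1 @ enc_tree cs vs \<delta> T2"

definition enc_instance ::
  "'c list \<Rightarrow> 'v list \<Rightarrow> ('c \<Rightarrow> 'v literal list) \<Rightarrow> 'l btree \<Rightarrow> ('l \<Rightarrow> 'c + 'v) \<Rightarrow> nat list" where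
  "enc_instance cs vs ls T \<delta> =
     [length cs, length vs] @ concat (map (\<lambda>C. enc_clause vs (ls C)) cs) @ enc_tree cs vs \<delta> T"

text \<open>Weights may be exponentially large, so they are given one bit per memory cell.\<close>
definition enc_weights :: "'c list \<Rightarrow> ('c \<Rightarrow> nat) \<Rightarrow> nat list" where
  "enc_weights cs w = concat (map (\<lambda>C. length (binary (w C)) # binary (w C)) cs)"

definition enc_assignment :: "'v list \<Rightarrow> ('v \<Rightarrow> bool) \<Rightarrow> nat list" where
  "enc_assignment vs \<tau> = map (\<lambda>x. of_bool (\<tau> x)) vs"

text \<open>Words have \<open>O(log (k + s))\<close> bits, \<open>k\<close> being the ps-width and \<open>s\<close> the size of the formula;
  long numbers must therefore be handled in multi-word arithmetic.\<close>
definition word_bound :: "nat \<Rightarrow> nat \<Rightarrow> nat \<Rightarrow> nat" where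
  "word_bound c k s = (k + s + 2) ^ c"

end

theory Submission
  imports Defs
begin

text \<open>
  Let \<open>v\<close> be a node with clauses \<open>C\<close> and variables \<open>X\<close>. An assignment of \<open>X\<close> matters to the rest of the
  formula only through the set \<open>A \<in> PS(F\<^sub>v)\<close> of clauses outside \<open>C\<close> that it satisfies, and the rest
  matters to \<open>v\<close> only through the set \<open>B \<in> PS(F\<^sub>\<not>\<^sub>v)\<close> of clauses of \<open>C\<close> that it satisfies. For every pair
  \<open>(A, B)\<close> the table of \<open>v\<close> stores the number of assignments of \<open>X\<close> with outside effect \<open>A\<close> that together
  with \<open>B\<close> satisfy all of \<open>C\<close>, or a best such assignment. For a node with children \<open>a\<close>, \<open>b\<close> and each of the
  at most \<open>k\<^sup>3\<close> triples \<open>(A\<^sub>a, A\<^sub>b, B)\<close>, the sets \<open>A\<close>, \<open>B\<^sub>a\<close> and \<open>B\<^sub>b\<close> are determined, and one multiplication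
  or addition of table entries accounts for the triple.

  The sets \<open>PS(F\<^sub>v)\<close> are computed bottom-up and the sets \<open>PS(F\<^sub>\<not>\<^sub>v)\<close> top-down, as lists without
  repetitions: at most \<open>k\<^sup>2\<close> candidates of \<open>m\<close> bits are compared with at most \<open>k\<close> list entries, so a node
  costs \<open>O(k\<^sup>3 m)\<close>. The counts below \<open>v\<close> have as many bits as the subtree has nodes, up to a constant, and
  schoolbook multiplication costs the product of the sizes of the two subtrees; this product counts pairs
  of nodes with lowest common ancestor \<open>v\<close>, so over the whole tree it adds up to \<open>O((m + n)\<^sup>2)\<close>. Since
  \<open>m + n \<le> s\<close>, everything fits into \<open>O(k\<^sup>3 s (m + n))\<close>.
\<close>

section \<open>A structured language and its compilation to the word RAM\<close>

text \<open>A time bound on a word RAM calls for an actual machine program. The algorithm is written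
  in a small language with list-indexed arrays, and one compiler for it is verified once; it costs a
  constant factor. Expressions only increment and subtract, so a run of cost \<open>c\<close>
  exceeds its input values by at most O(\<open>c\<close>), and the polynomial address map keeps all
  addresses polynomial. Thus the word bound follows from the time bound. Words are too short for
  counts and weights, which are therefore bit arrays. The factor \<open>k ^ 3\<close> per node would
  be lost if each triple had to search for the sets that it determines. While the lists are built,
  every combination records the position of its result, so that a triple later needs three lookups.
  Counting and maximization share the traversal but not the accounting. Paying
  \<open>(m + n)\<^sup>2\<close> for each product of counts would be too much, hence the charge to
  pairs of nodes. Weights have O(\<open>m\<close>) bits and stored assignments \<open>n\<close> bits
  at every node, so a triple of the maximization simply pays O(\<open>m + n\<close>).\<close>

text \<open>
  A store is a family of arrays of arbitrary dimension: the head of an index is the name of the array,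
  and a scalar variable \<open>t\<close> is the cell with index \<open>[t]\<close>. The bound of a \<open>For\<close> loop is evaluated once.
\<close>

datatype exp = N nat | At nat "exp list" | Inc exp | Sub exp exp

datatype prog =
    Asg nat "exp list" exp
  | Sq prog prog (infixr \<open>;;\<close> 60)
  | Ife exp exp prog prog
  | For nat exp prog

type_synonym store = "nat list \<Rightarrow> nat"

fun val :: "store \<Rightarrow> exp \<Rightarrow> nat" where
  "val s (N c) = c"
| "val s (At t es) = s (t # map (val s) es)"
| "val s (Inc e) = Suc (val s e)"
| "val s (Sub a b) = val s a - val s b"

text \<open>Loop bounds are fixed on entry, so every program terminates and its effect is a plain
  recursive function.\<close>

primrec run_prog :: "prog \<Rightarrow> store \<Rightarrow> store" where
  "run_prog (Asg t es e) s = s(t # map (val s) es := val s e)"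
| "run_prog (p ;; q) s = run_prog q (run_prog p s)"
| "run_prog (Ife a b p q) s = (if val s a < val s b then run_prog p s else run_prog q s)"
| "run_prog (For x e p) s = fold (\<lambda>j u. run_prog p (u([x] := j))) [0..<val s e] s"

definition iter :: "nat \<Rightarrow> prog \<Rightarrow> nat \<Rightarrow> store \<Rightarrow> store" where
  "iter x p j s = fold (\<lambda>j u. run_prog p (u([x] := j))) [0..<j] s"

text \<open>Evaluating an expression is free here: it takes a number of machine steps that depends
  on the program text only and is accounted for by \<open>time_factor\<close>.\<close>

primrec cost :: "prog \<Rightarrow> store \<Rightarrow> nat" where
  "cost (Asg t es e) s = 1"
| "cost (p ;; q) s = cost p s + cost q (run_prog p s)"
| "cost (Ife a b p q) s = Suc (if val s a < val s b then cost p s else cost q s)"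
| "cost (For x e p) s = Suc (\<Sum>j<val s e. Suc (cost p ((iter x p j s)([x] := j))))"

lemma iter_0 [simp]: "iter x p 0 s = s"
  by (simp add: iter_def)

lemma iter_Suc [simp]: "iter x p (Suc j) s = run_prog p ((iter x p j s)([x] := j))"
  by (simp add: iter_def)

lemma eff_For: "run_prog (For x e p) s = iter x p (val s e) s"
  by (simp add: iter_def)

declare run_prog.simps(4) [simp del]
declare eff_For [simp]

text \<open>
  The address of a cell. Injectivity makes the arrays disjoint, and as a polynomial in the entries of the
  index it keeps all addresses of cells in use below the word bound.
\<close>

fun enc :: "nat list \<Rightarrow> nat" where
  "enc [] = 0"
| "enc (x # xs) = Suc ((x + enc xs)\<^sup>2 + enc xs)"

text \<open>The number \<open>(a + b)\<^sup>2 + b\<close> lies below the next square, so its integer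
  root gives \<open>a + b\<close> and the remainder gives \<open>b\<close>. This pairing takes two
  additions and one multiplication, without any division.\<close>

lemma square_pair_inj:
  fixes a b c d :: nat
  assumes "(a + b)\<^sup>2 + b = (c + d)\<^sup>2 + d"
  shows "a = c \<and> b = d"
proof -
  have less: "(x + y)\<^sup>2 + y < (z + w)\<^sup>2 + w" if "x + y < z + w" for x y z w :: nat
  proof -
    have "(Suc (x + y))\<^sup>2 \<le> (z + w)\<^sup>2" using that by (intro power_mono) auto
    then show ?thesis by (simp add: power2_eq_square)
  qed
  have "a + b = c + d"
    using assms less[of a b c d] less[of c d a b] by (cases "a + b < c + d"; cases "c + d < a + b") auto
  with assms show ?thesis by auto
qed

lemma enc_inj: "enc xs = enc ys \<Longrightarrow> xs = ys"
proof (induction xs arbitrary: ys)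
  case Nil then show ?case by (cases ys) auto
next
  case (Cons x xs)
  then obtain y ys' where ys: "ys = y # ys'" by (cases ys) auto
  with Cons.prems have "(x + enc xs)\<^sup>2 + enc xs = (y + enc ys')\<^sup>2 + enc ys'" by simp
  from square_pair_inj[OF this] Cons.IH ys show ?case by auto
qed

section \<open>Polynomial bounds on addresses and values\<close>

text \<open>The value of \<open>enc\<close> on \<open>d\<close> copies of \<open>Z\<close>, hence
  the largest code of a list of that length with entries up to \<open>Z\<close>.\<close>

fun gbound :: "nat \<Rightarrow> nat \<Rightarrow> nat" where
  "gbound Z 0 = 0"
| "gbound Z (Suc d) = Suc ((Z + gbound Z d)\<^sup>2 + gbound Z d)"

lemma gbound_mono_depth: "d \<le> d' \<Longrightarrow> gbound Z d \<le> gbound Z d'"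
  by (rule lift_Suc_mono_le[of "gbound Z"]) auto

lemma gbound_mono: "Z \<le> Z' \<Longrightarrow> gbound Z d \<le> gbound Z' d"
  by (induction d) (auto intro!: add_mono power_mono)

lemma enc_le_length: "\<forall>x\<in>set l. x \<le> Z \<Longrightarrow> enc l \<le> gbound Z (length l)"
  by (induction l) (auto intro!: add_mono power_mono)

lemma enc_le: "\<forall>x\<in>set l. x \<le> Z \<Longrightarrow> length l \<le> d \<Longrightarrow> enc l \<le> gbound Z d"
  using enc_le_length gbound_mono_depth order_trans by blast

text \<open>Each level squares, so the exponent about doubles with \<open>d\<close>. This does no
  harm because \<open>d\<close> will be bounded by the size of a fixed program.\<close>

lemma gbound_poly: "\<exists>q. \<forall>Z. gbound Z d + 1 \<le> (Z + 2) ^ q"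
proof (induction d)
  case 0 then show ?case by (intro exI[of _ 0]) auto
next
  case (Suc d)
  then obtain q where q: "gbound Z d + 1 \<le> (Z + 2) ^ q" for Z by blast
  have "gbound Z (Suc d) + 1 \<le> (Z + 2) ^ (2 * (q + 3))" for Z
  proof -
    let ?Y = "(Z + 2) ^ q"
    have "gbound Z (Suc d) + 1 \<le> (Z + ?Y)\<^sup>2 + ?Y + 1"
    proof -
      have "gbound Z d \<le> ?Y" using q[of Z] by simp
      then have "(Z + gbound Z d)\<^sup>2 \<le> (Z + ?Y)\<^sup>2" by (intro power_mono) auto
      then show ?thesis using q[of Z] by (simp only: gbound.simps)
    qed
    also have "\<dots> \<le> (Z + 2 * ?Y)\<^sup>2"
    proof -
      have "1 \<le> Y \<Longrightarrow> (Z + Y)\<^sup>2 + Y + 1 \<le> (Z + 2 * Y)\<^sup>2" for Y :: nat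
        by (cases Y) (auto simp: power2_eq_square algebra_simps)
      then show ?thesis by simp
    qed
    also have "\<dots> \<le> ((Z + 2) ^ (q + 3))\<^sup>2"
    proof (intro power_mono)
      have "Z + 2 * ?Y \<le> (Z + 2) * ?Y" using \<open>gbound Z d + 1 \<le> ?Y\<close> by (cases ?Y) auto
      also have "\<dots> \<le> (Z + 2) ^ (q + 3)"
        using power_increasing[of "Suc q" "q + 3" "Z + 2"] by simp
      finally show "Z + 2 * ?Y \<le> (Z + 2) ^ (q + 3)" .
    qed simp
    finally show ?thesis by (simp only: power_mult[symmetric] mult.commute)
  qed
  then show ?case by blast
qed

text \<open>One weight that bounds the constants, array names and index lengths inside an
  expression, and also the amount by which its value can exceed the largest cell.\<close>

fun esize :: "exp \<Rightarrow> nat" and esizes :: "exp list \<Rightarrow> nat" where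
  "esize (N c) = c"
| "esize (At t es) = Suc (t + esizes es)"
| "esize (Inc e) = Suc (esize e)"
| "esize (Sub a b) = esize a + esize b"
| "esizes [] = 0"
| "esizes (e # es) = Suc (esize e + esizes es)"

lemma length_le_esizes: "length es \<le> esizes es"
  by (induction es) auto

lemma esize_le_esizes: "e \<in> set es \<Longrightarrow> esize e \<le> esizes es"
  by (induction es) auto

lemma le_sum_Suc: "j \<le> (\<Sum>i<j. Suc (f i))"
  by (induction j) auto

lemma val_le: "\<forall>l. s l \<le> X \<Longrightarrow> val s e \<le> X + esize e"
  by (induction e) (auto simp: le_SucI trans_le_add1 intro: order_trans[OF diff_le_self])

lemma vals_le:
  assumes "\<forall>l. s l \<le> X" "Suc (t + esizes es) \<le> K"
  shows "\<forall>x\<in>set (t # map (val s) es). x \<le> X + K"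
proof -
  have "val s e \<le> X + K" if "e \<in> set es" for e
    using val_le[OF assms(1), of e] esize_le_esizes[OF that] assms(2) by linarith
  then show ?thesis using assms(2) by auto
qed

section \<open>Compilation of expressions\<close>

text \<open>One step of \<open>enc\<close>, with the head in register \<open>r\<close> and the code
  of the tail in the next register.\<close>

definition cpair :: "nat \<Rightarrow> com" where
  "cpair r = Seq (Op Plus r r (Suc r)) (Seq (Op Times r r r) (Seq (Op Plus r r (Suc r))
     (Seq (Const (Suc r) 1) (Op Plus r r (Suc r)))))"

text \<open>Registers form a stack: the value ends up in \<open>r\<close>, and everything below
  \<open>r\<close> is preserved. Register 0 permanently holds the base address of the store, which
  is the input length and thus present from the start.\<close>

fun compile_exp :: "exp \<Rightarrow> nat \<Rightarrow> com" and compile_exps :: "exp list \<Rightarrow> nat \<Rightarrow> com" where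
  "compile_exp (N c) r = Const r c"
| "compile_exp (At t es) r = Seq (Seq (Const r t) (Seq (compile_exps es (Suc r)) (Seq (cpair r) (Op Plus r r 0)))) (Load r r)"
| "compile_exp (Inc e) r = Seq (compile_exp e r) (Seq (Const (Suc r) 1) (Op Plus r r (Suc r)))"
| "compile_exp (Sub a b) r = Seq (compile_exp a r) (Seq (compile_exp b (Suc r)) (Op Minus r r (Suc r)))"
| "compile_exps [] r = Const r 0"
| "compile_exps (e # es) r = Seq (compile_exp e r) (Seq (compile_exps es (Suc r)) (cpair r))"

abbreviation caddr :: "nat \<Rightarrow> exp list \<Rightarrow> nat \<Rightarrow> com" where
  "caddr t es r \<equiv> Seq (Const r t) (Seq (compile_exps es (Suc r)) (Seq (cpair r) (Op Plus r r 0)))"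

fun time_exp :: "exp \<Rightarrow> nat" and time_exps :: "exp list \<Rightarrow> nat" where
  "time_exp (N c) = 1"
| "time_exp (At t es) = time_exps es + 8"
| "time_exp (Inc e) = time_exp e + 2"
| "time_exp (Sub a b) = time_exp a + time_exp b + 1"
| "time_exps [] = 1"
| "time_exps (e # es) = time_exp e + time_exps es + 5"

definition run :: "nat \<Rightarrow> com \<Rightarrow> state \<Rightarrow> nat \<Rightarrow> state \<Rightarrow> bool" where
  "run W p \<sigma> T \<sigma>' \<longleftrightarrow> (\<exists>t\<le>T. exec W p \<sigma> t \<sigma>')"

lemma run_Seq: "run W p \<sigma> T \<sigma>' \<Longrightarrow> run W q \<sigma>' U \<sigma>'' \<Longrightarrow> T + U \<le> V \<Longrightarrow> run W (Seq p q) \<sigma> V \<sigma>''"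
  unfolding run_def by (meson add_mono exec_Seq order_trans)

lemma run_mono: "run W p \<sigma> T \<sigma>' \<Longrightarrow> T \<le> U \<Longrightarrow> run W p \<sigma> U \<sigma>'"
  unfolding run_def by (meson order_trans)

lemma run_Const: "c < W \<Longrightarrow> run W (Const r c) (R, M) 1 (R(r := c), M)"
  unfolding run_def by (intro exI[of _ 1]) (auto intro: exec.intros simp del: One_nat_def)

lemma run_Op: "binop_val f (R a) (R b) = c \<Longrightarrow> c < W \<Longrightarrow> run W (Op f r a b) (R, M) 1 (R(r := c), M)"
  unfolding run_def by (intro exI[of _ 1]) (auto intro: exec.intros simp del: One_nat_def)

lemma run_Load: "M (R a) = c \<Longrightarrow> run W (Load r a) (R, M) 1 (R(r := c), M)"
  unfolding run_def by (intro exI[of _ 1]) (auto intro: exec.intros simp del: One_nat_def)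

lemma run_Store: "R a = x \<Longrightarrow> R b = y \<Longrightarrow> run W (Store a b) (R, M) 1 (R, M(x := y))"
  unfolding run_def by (intro exI[of _ 1]) (auto intro: exec.intros simp del: One_nat_def)

lemma run_IfLess:
  assumes "R a < R b \<Longrightarrow> run W p (R, M) T \<sigma>" "\<not> R a < R b \<Longrightarrow> run W q (R, M) T \<sigma>"
  shows "run W (IfLess a b p q) (R, M) (Suc T) \<sigma>"
  using assms unfolding run_def
  by (metis Suc_le_mono exec_IfFalse exec_IfTrue plus_1_eq_Suc)

lemma run_WhileFalse: "\<not> R a < R b \<Longrightarrow> run W (WhileLess a b p) (R, M) 1 (R, M)"
  unfolding run_def by (intro exI[of _ 1]) (auto intro: exec.intros simp del: One_nat_def)

lemma run_WhileTrue:
  assumes "R a < R b" "run W p (R, M) T \<sigma>" "run W (WhileLess a b p) \<sigma> U \<sigma>'"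
  shows "run W (WhileLess a b p) (R, M) (Suc (T + U)) \<sigma>'"
proof -
  obtain t u where "t \<le> T" "u \<le> U" "exec W p (R, M) t \<sigma>" "exec W (WhileLess a b p) \<sigma> u \<sigma>'"
    using assms(2,3) unfolding run_def by blast
  then show ?thesis unfolding run_def
    using exec_WhileTrue[where R=R, OF assms(1), of W p M t \<sigma> u \<sigma>'] by (intro exI[of _ "1 + t + u"]) auto
qed

lemma run_cpair:
  assumes "R r = x" "R (Suc r) = y" "Suc ((x + y)\<^sup>2 + y) < W"
  shows "\<exists>R'. run W (cpair r) (R, M) 5 (R', M) \<and> R' r = Suc ((x + y)\<^sup>2 + y) \<and> (\<forall>q<r. R' q = R q)"
proof -
  have le: "x + y \<le> (x + y)\<^sup>2" by (simp add: power2_eq_square)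
  with assms(3) have le': "x + y < W" by linarith
  let ?R1 = "R(r := x + y)"
  let ?R2 = "?R1(r := (x + y)\<^sup>2)"
  let ?R3 = "?R2(r := (x + y)\<^sup>2 + y)"
  let ?R4 = "?R3(Suc r := 1)"
  let ?R5 = "?R4(r := Suc ((x + y)\<^sup>2 + y))"
  have "run W (cpair r) (R, M) 5 (?R5, M)"
    unfolding cpair_def
    by (rule run_Seq[where T=1 and U=4, OF run_Op run_Seq[where T=1 and U=3, OF run_Op
        run_Seq[where T=1 and U=2, OF run_Op run_Seq[where T=1 and U=1, OF run_Const run_Op]]]])
      (use assms le' in \<open>auto simp: power2_eq_square\<close>)
  then show ?thesis by (intro exI[of _ ?R5]) auto
qed

text \<open>The store lives from address \<open>b\<close> on. Machine cells below \<open>b\<close>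
  are unconstrained, which leaves the input in place while it is being copied.\<close>

definition rel :: "nat \<Rightarrow> store \<Rightarrow> (nat \<Rightarrow> nat) \<Rightarrow> bool" where
  "rel b s M \<longleftrightarrow> (\<forall>l. M (b + enc l) = s l)"

lemma rel_update: "rel b s M \<Longrightarrow> rel b (s(l := v)) (M(b + enc l := v))"
  unfolding rel_def using enc_inj by auto

text \<open>A sufficient word size when all cells are at most \<open>X\<close> and the program has
  size at most \<open>K\<close>: it exceeds every address \<open>b + enc l\<close> with at most
  \<open>K\<close> entries up to \<open>X + K\<close>, and every value up to
  \<open>X + K\<close>.\<close>

definition cap :: "nat \<Rightarrow> nat \<Rightarrow> nat \<Rightarrow> nat" where
  "cap b X K = b + gbound (X + K) K + X + K + 2"

lemma cap_mono: "X \<le> X' \<Longrightarrow> cap b X K \<le> cap b X' K"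
  unfolding cap_def using gbound_mono[of "X + K" "X' + K" K] by linarith

lemma cap_addr:
  assumes "\<forall>l. s l \<le> X" "Suc (t + esizes es) \<le> K"
  shows "b + enc (t # map (val s) es) + 2 \<le> cap b X K"
proof -
  have "length (t # map (val s) es) \<le> K" using length_le_esizes[of es] assms(2) by simp
  then have "enc (t # map (val s) es) \<le> gbound (X + K) K" using enc_le vals_le[OF assms] by blast
  then show ?thesis unfolding cap_def by simp
qed

lemma run_caddr_aux:
  assumes "\<forall>l. s l \<le> X" "cap b X K \<le> W" "Suc (t + esizes es) \<le> K" "0 < r" "R 0 = b"
    and R2: "run W (compile_exps es (Suc r)) (R(r := t), M) (time_exps es) (R2, M)"
      "R2 (Suc r) = enc (map (val s) es)" "\<forall>q<Suc r. R2 q = (R(r := t)) q"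
  shows "\<exists>R'. run W (caddr t es r) (R, M) (time_exps es + 7) (R', M) \<and>
    R' r = b + enc (t # map (val s) es) \<and> (\<forall>q<r. R' q = R q)"
proof -
  let ?l = "t # map (val s) es"
  have enc: "b + enc ?l + 2 \<le> W" using cap_addr[OF assms(1,3), of b] assms(2) by linarith
  obtain R3 where R3: "run W (cpair r) (R2, M) 5 (R3, M)" "R3 r = enc ?l" "\<forall>q<r. R3 q = R2 q"
    using run_cpair[of R2 r t "enc (map (val s) es)" W M] R2 enc by auto
  let ?R4 = "R3(r := b + enc ?l)"
  have r0: "R3 0 = b" using R3(3) R2(3) assms(4,5) by auto
  have op: "run W (Op Plus r r 0) (R3, M) 1 (?R4, M)"
    by (rule run_Op) (use R3 r0 enc in auto)
  have const: "run W (Const r t) (R, M) 1 (R(r := t), M)"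
    by (rule run_Const) (use assms in \<open>simp add: cap_def\<close>)
  have "run W (caddr t es r) (R, M) (time_exps es + 7) (?R4, M)"
    by (rule run_Seq[OF const run_Seq[OF R2(1) run_Seq[OF R3(1) op order_refl] order_refl]]) simp
  then show ?thesis using R3 R2 by (intro exI[of _ ?R4]) auto
qed

lemma run_ce_cels:
  assumes rel: "rel b s M" and X: "\<forall>l. s l \<le> X" and W: "cap b X K \<le> W"
  shows "esize e \<le> K \<Longrightarrow> 0 < r \<Longrightarrow> R 0 = b \<Longrightarrow>
      \<exists>R'. run W (compile_exp e r) (R, M) (time_exp e) (R', M) \<and> R' r = val s e \<and> (\<forall>q<r. R' q = R q)"
    and "esizes es \<le> K \<Longrightarrow> 0 < r \<Longrightarrow> R 0 = b \<Longrightarrow>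
      \<exists>R'. run W (compile_exps es r) (R, M) (time_exps es) (R', M) \<and> R' r = enc (map (val s) es) \<and> (\<forall>q<r. R' q = R q)"
proof (induction e r and es r arbitrary: R and R rule: compile_exp_compile_exps.induct)
  case (1 c r)
  then have "run W (Const r c) (R, M) 1 (R(r := c), M)"
    by (intro run_Const) (use W in \<open>simp add: cap_def\<close>)
  then show ?case unfolding compile_exp.simps time_exp.simps compile_exps.simps time_exps.simps
    by (intro exI conjI, assumption) simp_all
next
  case (2 t es r)
  let ?R1 = "R(r := t)"
  have "esizes es \<le> K" "0 < Suc r" "?R1 0 = b" using 2 by auto
  from "2.IH"[of ?R1, OF this] obtain R2 where R2: "run W (compile_exps es (Suc r)) (?R1, M) (time_exps es) (R2, M)"
      "R2 (Suc r) = enc (map (val s) es)" "\<forall>q<Suc r. R2 q = ?R1 q" by blast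
  obtain R4 where R4: "run W (caddr t es r) (R, M) (time_exps es + 7) (R4, M)"
      "R4 r = b + enc (t # map (val s) es)" "\<forall>q<r. R4 q = R q"
    using run_caddr_aux[OF X W _ _ _ R2] "2.prems" by auto
  let ?R5 = "R4(r := s (t # map (val s) es))"
  have load: "run W (Load r r) (R4, M) 1 (?R5, M)"
    by (rule run_Load) (use rel R4(2) in \<open>simp add: rel_def del: enc.simps\<close>)
  have "run W (compile_exp (At t es) r) (R, M) (time_exp (At t es)) (?R5, M)"
    unfolding compile_exp.simps by (rule run_Seq[OF R4(1) load]) simp
  then show ?case using R4 by (intro exI conjI) (assumption, auto)
next
  case (3 e r)
  then obtain R1 where R1: "run W (compile_exp e r) (R, M) (time_exp e) (R1, M)" "R1 r = val s e" "\<forall>q<r. R1 q = R q"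
    by auto
  let ?R2 = "R1(Suc r := 1)" 
  let ?R3 = "?R2(r := Suc (val s e))"
  have "val s e \<le> X + esize e" using val_le[OF X] .
  then have v: "Suc (val s e) < W" using W "3.prems" by (simp add: cap_def)
  have c: "run W (Const (Suc r) 1) (R1, M) 1 (?R2, M)" by (rule run_Const) (use v in simp)
  have o: "run W (Op Plus r r (Suc r)) (?R2, M) 1 (?R3, M)" by (rule run_Op) (use v R1 in auto)
  have "run W (compile_exp (Inc e) r) (R, M) (time_exp (Inc e)) (?R3, M)"
    unfolding compile_exp.simps by (rule run_Seq[OF R1(1) run_Seq[OF c o order_refl]]) simp
  then show ?case using R1 by (intro exI conjI) (assumption, auto)
next
  case (4 a b' r)
  then obtain R1 where R1: "run W (compile_exp a r) (R, M) (time_exp a) (R1, M)" "R1 r = val s a" "\<forall>q<r. R1 q = R q"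
    by (metis add_leD1 esize.simps(4))
  from 4 R1 obtain R2 where R2: "run W (compile_exp b' (Suc r)) (R1, M) (time_exp b') (R2, M)"
      "R2 (Suc r) = val s b'" "\<forall>q<Suc r. R2 q = R1 q"
    by (metis add_leD2 esize.simps(4) zero_less_Suc)
  let ?R3 = "R2(r := val s a - val s b')"
  have "val s a \<le> X + esize a" using val_le[OF X] .
  then have o: "run W (Op Minus r r (Suc r)) (R2, M) 1 (?R3, M)"
    by (intro run_Op) (use R1 R2 W "4.prems" in \<open>auto simp: cap_def\<close>)
  have "run W (compile_exp (Sub a b') r) (R, M) (time_exp (Sub a b')) (?R3, M)"
    unfolding compile_exp.simps by (rule run_Seq[OF R1(1) run_Seq[OF R2(1) o order_refl]]) simp
  then show ?case using R1 R2 by (intro exI conjI) (assumption, auto)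
next
  case (5 r)
  have "run W (Const r 0) (R, M) 1 (R(r := 0), M)"
    by (intro run_Const) (use W in \<open>simp add: cap_def\<close>)
  then show ?case unfolding compile_exp.simps time_exp.simps compile_exps.simps time_exps.simps
    by (intro exI conjI, assumption) simp_all
next
  case (6 e es r)
  then obtain R1 where R1: "run W (compile_exp e r) (R, M) (time_exp e) (R1, M)" "R1 r = val s e" "\<forall>q<r. R1 q = R q"
    by (metis add_leD1 add_leD2 esizes.simps(2) plus_1_eq_Suc)
  have "esizes es \<le> K" using 6 by simp
  with 6 R1 obtain R2 where R2: "run W (compile_exps es (Suc r)) (R1, M) (time_exps es) (R2, M)"
      "R2 (Suc r) = enc (map (val s) es)" "\<forall>q<Suc r. R2 q = R1 q"
    by (metis zero_less_Suc)
  let ?l = "map (val s) (e # es)"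
  have "\<forall>x\<in>set ?l. x \<le> X + K"
    using val_le[OF X] "6.prems" esize_le_esizes[of _ "e # es"]
    by (metis add_le_mono image_iff le_refl list.set_map order_trans)
  moreover have "length ?l \<le> K" using length_le_esizes[of "e # es"] "6.prems" by simp
  ultimately have enc: "enc ?l \<le> gbound (X + K) K" using enc_le by blast
  obtain R3 where R3: "run W (cpair r) (R2, M) 5 (R3, M)" "R3 r = enc ?l" "\<forall>q<r. R3 q = R2 q"
    using run_cpair[of R2 r "val s e" "enc (map (val s) es)" W M] R1 R2 enc W by (auto simp: cap_def)
  have "run W (compile_exps (e # es) r) (R, M) (time_exps (e # es)) (R3, M)"
    unfolding compile_exps.simps by (rule run_Seq[OF R1(1) run_Seq[OF R2(1) R3(1) order_refl]]) simp
  then show ?case using R1 R2 R3 by (intro exI conjI) (assumption, auto)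
qed

lemma run_ce:
  assumes "rel b s M" "\<forall>l. s l \<le> X" "cap b X K \<le> W" "esize e \<le> K" "0 < r" "R 0 = b"
  obtains R' where "run W (compile_exp e r) (R, M) (time_exp e) (R', M)" "R' r = val s e" "\<forall>q<r. R' q = R q"
  using run_ce_cels(1)[where R=R, OF assms] by blast

lemma run_cels:
  assumes "rel b s M" "\<forall>l. s l \<le> X" "cap b X K \<le> W" "esizes es \<le> K" "0 < r" "R 0 = b"
  obtains R' where "run W (compile_exps es r) (R, M) (time_exps es) (R', M)" "R' r = enc (map (val s) es)"
    "\<forall>q<r. R' q = R q"
  using run_ce_cels(2)[where R=R, OF assms] by blast

lemma run_caddr:
  assumes "rel b s M" "\<forall>l. s l \<le> X" "cap b X K \<le> W" "Suc (t + esizes es) \<le> K" "0 < r" "R 0 = b"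
  obtains R' where "run W (caddr t es r) (R, M) (time_exps es + 7) (R', M)"
    "R' r = b + enc (t # map (val s) es)" "\<forall>q<r. R' q = R q"
proof -
  let ?R1 = "R(r := t)"
  obtain R2 where R2: "run W (compile_exps es (Suc r)) (?R1, M) (time_exps es) (R2, M)"
      "R2 (Suc r) = enc (map (val s) es)" "\<forall>q<Suc r. R2 q = ?R1 q"
    using run_cels[OF assms(1-3), of es "Suc r" ?R1] assms(4-6) by auto
  from run_caddr_aux[OF assms(2,3,4,5,6) R2] show thesis using assms(4-6) that by blast
qed

section \<open>Compilation of programs and its simulation proof\<close>

primrec psize :: "prog \<Rightarrow> nat" where
  "psize (Asg t es e) = Suc (t + esizes es + esize e)"
| "psize (p ;; q) = psize p + psize q"
| "psize (Ife a b p q) = esize a + esize b + psize p + psize q"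
| "psize (For x e p) = Suc (Suc (x + esize e + psize p))"

text \<open>A loop keeps its limit in \<open>r\<close> and its counter in \<open>Suc r\<close>, out
  of reach of the body, which is compiled above them. The loop variable in the store is only a copy
  of the counter.\<close>

primrec compile_prog :: "prog \<Rightarrow> nat \<Rightarrow> com" where
  "compile_prog (Asg t es e) r = Seq (caddr t es r) (Seq (compile_exp e (Suc r)) (Store r (Suc r)))"
| "compile_prog (p ;; q) r = Seq (compile_prog p r) (compile_prog q r)"
| "compile_prog (Ife a b p q) r = Seq (compile_exp a r) (Seq (compile_exp b (Suc r)) (IfLess r (Suc r) (compile_prog p r) (compile_prog q r)))"
| "compile_prog (For x e p) r = Seq (compile_exp e r) (Seq (Const (Suc r) 0) (WhileLess (Suc r) r
     (Seq (Seq (caddr x [] (r + 2)) (Store (r + 2) (Suc r)))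
       (Seq (compile_prog p (r + 2)) (Seq (Const (r + 2) 1) (Op Plus (Suc r) (Suc r) (r + 2)))))))"

text \<open>An upper bound for the machine steps per unit of \<open>cost\<close>, depending on the
  program text alone.\<close>

primrec time_factor :: "prog \<Rightarrow> nat" where
  "time_factor (Asg t es e) = time_exps es + time_exp e + 8"
| "time_factor (p ;; q) = time_factor p + time_factor q"
| "time_factor (Ife a b p q) = time_exp a + time_exp b + time_factor p + time_factor q + 1"
| "time_factor (For x e p) = time_exp e + time_factor p + 12"

lemma le_scaled:
  fixes j c K X :: nat
  assumes "1 \<le> K" "j \<le> c"
  shows "j \<le> X + K * c"
proof -
  have "c \<le> K * c" using assms(1) by (cases K) auto
  then show ?thesis using assms(2) by linarith
qed

lemma update_le: "\<forall>l. s l \<le> Z \<Longrightarrow> v \<le> Z \<Longrightarrow> \<forall>l. (s(a := v)) l \<le> (Z :: nat)"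
  by simp

text \<open>A unit of cost raises the largest cell by at most \<open>K\<close>, because expressions
  add only constants, and a loop counter is paid for by the iterations before it. This is how a
  bound on the cost becomes a bound on all values.\<close>

lemma eff_growth:
  assumes "psize p \<le> K" "\<forall>l. s l \<le> X" "1 \<le> K"
  shows "run_prog p s l \<le> X + K * cost p s"
  using assms
proof (induction p arbitrary: s X l)
  case (Asg t es e)
  have "val s e \<le> X + esize e" using val_le Asg by blast
  with Asg show ?case by (auto simp: trans_le_add1)
next
  case (Sq p q)
  then have "\<forall>l. run_prog p s l \<le> X + K * cost p s" by simp
  then have "run_prog q (run_prog p s) l \<le> X + K * cost p s + K * cost q (run_prog p s)"
    using Sq.IH(2)[of "run_prog p s" "X + K * cost p s"] Sq.prems by simp
  then show ?case by (simp add: algebra_simps)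
next
  case (Ife a b p q)
  then have "val s a < val s b \<Longrightarrow> run_prog p s l \<le> X + K * cost p s"
    "\<not> val s a < val s b \<Longrightarrow> run_prog q s l \<le> X + K * cost q s" by auto
  then show ?case by (auto simp: trans_le_add1 algebra_simps)
next
  case (For x e p)
  have "\<forall>l. iter x p j s l \<le> X + K * (\<Sum>i<j. Suc (cost p ((iter x p i s)([x] := i))))" for j
  proof (induction j)
    case 0 then show ?case using For.prems by simp
  next
    case (Suc j)
    let ?c = "\<Sum>i<j. Suc (cost p ((iter x p i s)([x] := i)))"
    have "j \<le> ?c" by (rule le_sum_Suc)
    then have "j \<le> X + K * ?c" using For.prems by (intro le_scaled) auto
    from update_le[OF Suc this] have "\<forall>l. ((iter x p j s)([x] := j)) l \<le> X + K * ?c" .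
    moreover have "psize p \<le> K" using For.prems by simp
    ultimately have "run_prog p ((iter x p j s)([x] := j)) l \<le> X + K * ?c + K * cost p ((iter x p j s)([x] := j))" for l
      using For.IH For.prems(3) by blast
    moreover have "X + K * C + K * D \<le> X + K * (C + Suc D)" for C D by (simp add: add_mult_distrib2)
      ultimately show ?case unfolding iter_Suc sum.lessThan_Suc using order_trans by blast
  qed
  moreover have "X + K * C \<le> X + K * Suc C" for C by simp
  ultimately show ?case unfolding cost.simps eff_For using order_trans by blast
qed

text \<open>The word size is demanded once, for the largest value that the whole run can reach by
  \<open>eff_growth\<close>; every part of the run inherits it by monotonicity of
  \<open>cap\<close>.\<close>

lemma run_cp:
  assumes "psize p \<le> K" "1 \<le> K" "rel b s M" "\<forall>l. s l \<le> X" "cap b (X + K * cost p s) K \<le> W"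
    "0 < r" "R 0 = b"
  shows "\<exists>R' M'. run W (compile_prog p r) (R, M) (time_factor p * cost p s) (R', M') \<and> rel b (run_prog p s) M' \<and> (\<forall>q<r. R' q = R q)"
  using assms
proof (induction p arbitrary: s X r R M)
  case (Asg t es e)
  have W: "cap b X K \<le> W" using Asg.prems(5) cap_mono[of X "X + K * cost (Asg t es e) s" b K] by simp
  obtain R1 where R1: "run W (caddr t es r) (R, M) (time_exps es + 7) (R1, M)"
    "R1 r = b + enc (t # map (val s) es)" "\<forall>q<r. R1 q = R q"
    using run_caddr[OF Asg.prems(3,4) W, of t es r R] Asg.prems by auto
  obtain R2 where R2: "run W (compile_exp e (Suc r)) (R1, M) (time_exp e) (R2, M)" "R2 (Suc r) = val s e"
    "\<forall>q<Suc r. R2 q = R1 q"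
    using run_ce[OF Asg.prems(3,4) W, of e "Suc r" R1] Asg.prems R1 by auto
  let ?M = "M(b + enc (t # map (val s) es) := val s e)"
  have "run W (Store r (Suc r)) (R2, M) 1 (R2, ?M)"
    by (rule run_Store) (use R1 R2 in auto)
  then have "run W (compile_prog (Asg t es e) r) (R, M) (time_factor (Asg t es e) * cost (Asg t es e) s) (R2, ?M)"
    unfolding compile_prog.simps by (intro run_Seq[OF R1(1) run_Seq[OF R2(1) _ order_refl]]) auto
  moreover have "rel b (run_prog (Asg t es e) s) ?M" using rel_update[OF Asg.prems(3)] by (simp del: enc.simps)
  moreover have "\<forall>q<r. R2 q = R q" using R1 R2 by simp
  ultimately show ?case by blast
next
  case (Sq p q)
  have X: "\<forall>l. run_prog p s l \<le> X + K * cost p s" using eff_growth Sq.prems by simp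
  have W1: "cap b (X + K * cost p s) K \<le> W"
    using Sq.prems(5) cap_mono[of "X + K * cost p s" "X + K * cost (p ;; q) s" b K] by simp
  have W2: "cap b (X + K * cost p s + K * cost q (run_prog p s)) K \<le> W"
    using Sq.prems(5) by (simp add: algebra_simps)
  obtain R1 M1 where 1: "run W (compile_prog p r) (R, M) (time_factor p * cost p s) (R1, M1)" "rel b (run_prog p s) M1"
      "\<forall>q<r. R1 q = R q"
    using Sq.IH(1)[OF _ _ Sq.prems(3,4) W1, of r R] Sq.prems by auto
  obtain R2 M2 where 2: "run W (compile_prog q r) (R1, M1) (time_factor q * cost q (run_prog p s)) (R2, M2)"
      "rel b (run_prog q (run_prog p s)) M2" "\<forall>q<r. R2 q = R1 q"
    using Sq.IH(2)[OF _ _ 1(2) X W2, of r R1] Sq.prems 1 by auto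
  have "run W (compile_prog (p ;; q) r) (R, M) (time_factor (p ;; q) * cost (p ;; q) s) (R2, M2)"
    unfolding compile_prog.simps by (rule run_Seq[OF 1(1) 2(1)]) (simp add: algebra_simps)
  moreover have "rel b (run_prog (p ;; q) s) M2" using 2 by simp
  moreover have "\<forall>q<r. R2 q = R q" using 1 2 by simp
  ultimately show ?case by blast
next
  case (Ife a b' p q)
  have W: "cap b X K \<le> W" using Ife.prems(5) cap_mono[of X "X + K * cost (Ife a b' p q) s" b K] by simp
  obtain R1 where R1: "run W (compile_exp a r) (R, M) (time_exp a) (R1, M)" "R1 r = val s a" "\<forall>q<r. R1 q = R q"
    using run_ce[OF Ife.prems(3,4) W, of a r R] Ife.prems by auto
  obtain R2 where R2: "run W (compile_exp b' (Suc r)) (R1, M) (time_exp b') (R2, M)" "R2 (Suc r) = val s b'"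
    "\<forall>q<Suc r. R2 q = R1 q"
    using run_ce[OF Ife.prems(3,4) W, of b' "Suc r" R1] Ife.prems R1 by auto
  let ?p = "if val s a < val s b' then p else q"
  have W1: "cap b (X + K * cost ?p s) K \<le> W"
    using Ife.prems(5) cap_mono[of "X + K * cost ?p s" "X + K * cost (Ife a b' p q) s" b K]
    by (auto split: if_splits)
  have "\<exists>R' M'. run W (compile_prog ?p r) (R2, M) (time_factor ?p * cost ?p s) (R', M') \<and> rel b (run_prog ?p s) M'
      \<and> (\<forall>q<r. R' q = R2 q)"
    using Ife.IH(1)[OF _ _ Ife.prems(3,4), of r R2] Ife.IH(2)[OF _ _ Ife.prems(3,4), of r R2]
      Ife.prems W1 R1 R2 by auto
  then obtain R3 M3 where 3: "run W (compile_prog ?p r) (R2, M) (time_factor ?p * cost ?p s) (R3, M3)"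
      "rel b (run_prog ?p s) M3" "\<forall>q<r. R3 q = R2 q" by blast
  have "run W (IfLess r (Suc r) (compile_prog p r) (compile_prog q r)) (R2, M) (Suc (time_factor ?p * cost ?p s)) (R3, M3)"
    by (rule run_IfLess) (use 3 R1 R2 in auto)
  then have "run W (compile_prog (Ife a b' p q) r) (R, M) (time_exp a + (time_exp b' + Suc (time_factor ?p * cost ?p s))) (R3, M3)"
    unfolding compile_prog.simps by (intro run_Seq[OF R1(1) run_Seq[OF R2(1) _ order_refl] order_refl])
  moreover have "time_exp a + (time_exp b' + Suc (time_factor ?p * cost ?p s)) \<le> time_factor (Ife a b' p q) * cost (Ife a b' p q) s"
    by (auto simp: algebra_simps)
  ultimately have "run W (compile_prog (Ife a b' p q) r) (R, M) (time_factor (Ife a b' p q) * cost (Ife a b' p q) s) (R3, M3)"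
    by (rule run_mono)
  moreover have "rel b (run_prog (Ife a b' p q) s) M3" using 3 by (simp split: if_splits)
  moreover have "\<forall>q<r. R3 q = R q" using R1 R2 3 by simp
  ultimately show ?case by blast
next
  case (For x e p)
  let ?s = "\<lambda>j. iter x p j s"
  let ?n = "val s e"
  let ?cc = "\<lambda>j. cost p ((?s j)([x] := j))"
  let ?c = "\<lambda>j. \<Sum>i<j. Suc (?cc i)"
  have W0: "cap b X K \<le> W" using For.prems(5) cap_mono[of X "X + K * cost (For x e p) s" b K] by simp
  have cn: "cost (For x e p) s = Suc (?c ?n)" by simp
  have grow: "\<forall>l. ?s j l \<le> X + K * ?c j" for j
  proof -
    have "\<forall>l. ?s j l \<le> X + K * ?c j"
    proof (induction j)
      case 0 then show ?case using For.prems by simp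
    next
      case (Suc j)
      have "j \<le> ?c j" by (rule le_sum_Suc)
      then have "j \<le> X + K * ?c j" using For.prems by (intro le_scaled) auto
      from update_le[OF Suc this] have "\<forall>l. ((?s j)([x] := j)) l \<le> X + K * ?c j" .
      moreover have "psize p \<le> K" using For.prems by simp
      ultimately have "run_prog p ((?s j)([x] := j)) l \<le> X + K * ?c j + K * ?cc j" for l
        using eff_growth For.prems(2) by blast
      moreover have "X + K * C + K * D \<le> X + K * (C + Suc D)" for C D by (simp add: add_mult_distrib2)
      ultimately show ?case unfolding iter_Suc sum.lessThan_Suc using order_trans by blast
    qed
    then show ?thesis .
  qed
  obtain R1 where R1: "run W (compile_exp e r) (R, M) (time_exp e) (R1, M)" "R1 r = ?n" "\<forall>q<r. R1 q = R q"
    using run_ce[OF For.prems(3,4) W0, of e r R] For.prems by auto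
  let ?R2 = "R1(Suc r := 0)"
  have c0: "run W (Const (Suc r) 0) (R1, M) 1 (?R2, M)" by (rule run_Const) (use W0 in \<open>auto simp: cap_def\<close>)
  let ?body = "Seq (Seq (caddr x [] (r + 2)) (Store (r + 2) (Suc r)))
       (Seq (compile_prog p (r + 2)) (Seq (Const (r + 2) 1) (Op Plus (Suc r) (Suc r) (r + 2))))"
  \<comment> \<open>Induction on the number of remaining iterations. The allowance is the cost of
    the iterations still to come; of the 12 extra steps, 9 store the counter, 2 increment it and 1
    tests it.\<close>
  have loop: "\<exists>R' M'. run W (WhileLess (Suc r) r ?body) (R3, M3)
      (1 + (time_factor p + 12) * (?c ?n - ?c j)) (R', M') \<and> rel b (?s ?n) M' \<and> (\<forall>q<r. R' q = R3 q)"
    if "j \<le> ?n" "R3 r = ?n" "R3 (Suc r) = j" "R3 0 = b" "rel b (?s j) M3" for j R3 M3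
    using that
  proof (induction "?n - j" arbitrary: j R3 M3)
    case 0
    then have "\<not> R3 (Suc r) < R3 r" by simp
    from run_WhileFalse[of R3 "Suc r" r W ?body M3, OF this]
    have "run W (WhileLess (Suc r) r ?body) (R3, M3) (1 + (time_factor p + 12) * (?c ?n - ?c j)) (R3, M3)"
      by (rule run_mono) simp
    moreover have "j = ?n" using 0 by simp
    ultimately show ?case using 0 by blast
  next
    case (Suc d)
    then have j: "j < ?n" by simp
    let ?u = "(?s j)([x] := j)"
    have cj: "?c (Suc j) \<le> ?c ?n" using j by (intro sum_mono2) auto
    have jc: "j \<le> ?c j" by (rule le_sum_Suc)
    then have "j \<le> X + K * ?c j" using For.prems by (intro le_scaled) auto
    from update_le[OF grow this] have growu: "\<forall>l. ?u l \<le> X + K * ?c j" .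
    have leW: "cap b Y K \<le> W" if "Y \<le> X + K * Suc (?c ?n)" for Y
      using cap_mono[OF that, of b K] For.prems(5) cn by simp
    have W1: "cap b (X + K * ?c j) K \<le> W"
      by (rule leW) (use cj in \<open>intro add_mono mult_le_mono, auto\<close>)
    have W2: "cap b (X + K * ?c j + K * ?cc j) K \<le> W"
    proof (rule leW)
      have "?c j + ?cc j \<le> Suc (?c ?n)" using cj by simp
      then show "X + K * ?c j + K * ?cc j \<le> X + K * Suc (?c ?n)"
        using mult_le_mono2[of "?c j + ?cc j" "Suc (?c ?n)" K] by (simp add: distrib_left)
    qed
    obtain R4 where R4: "run W (caddr x [] (r + 2)) (R3, M3) (time_exps [] + 7) (R4, M3)"
      "R4 (r + 2) = b + enc (x # map (val (?s j)) [])" "\<forall>q<r+2. R4 q = R3 q"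
      using run_caddr[OF Suc.prems(5) grow W1, of x "[]" "r + 2" R3] For.prems Suc.prems by auto
    let ?M4 = "M3(b + enc [x] := j)"
    have 5: "run W (Store (r + 2) (Suc r)) (R4, M3) 1 (R4, ?M4)"
      by (rule run_Store) (use R4 Suc.prems in auto)
    have rel4: "rel b ?u ?M4" using rel_update[OF Suc.prems(5)] by (simp del: enc.simps)
    have pk: "psize p \<le> K" and r2: "0 < r + 2" and r40: "R4 0 = b"
      using For.prems R4 Suc.prems by auto
    obtain R6 M6 where 6: "run W (compile_prog p (r + 2)) (R4, ?M4) (time_factor p * ?cc j) (R6, M6)" "rel b (run_prog p ?u) M6"
        "\<forall>q<r+2. R6 q = R4 q"
      using For.IH[of ?u ?M4 "X + K * ?c j" "r + 2" R4, OF pk For.prems(2) rel4 growu W2 r2 r40] by blast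
    let ?R7 = "R6(r + 2 := 1)"
    let ?R8 = "?R7(Suc r := Suc j)"
    have 7: "run W (Const (r + 2) 1) (R6, M6) 1 (?R7, M6)"
      by (rule run_Const) (use W0 in \<open>auto simp: cap_def\<close>)
    have "j + 1 < W"
    proof -
      have "?c j \<le> Suc (?c ?n)" using cj by simp
      then have "j \<le> X + K * Suc (?c ?n)"
        using jc For.prems by (intro le_scaled) auto
      then show ?thesis using leW[of "X + K * Suc (?c ?n)"] by (simp add: cap_def)
    qed
    then have 8: "run W (Op Plus (Suc r) (Suc r) (r + 2)) (?R7, M6) 1 (?R8, M6)"
      by (intro run_Op) (use R4 6 Suc.prems in auto)
    have body: "run W ?body (R3, M3) (time_factor p * ?cc j + 11) (?R8, M6)"
      by (rule run_Seq[OF run_Seq[OF R4(1) 5 order_refl] run_Seq[OF 6(1) run_Seq[OF 7 8 order_refl] order_refl]]) simp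
    have keep: "\<forall>q<r. ?R8 q = R3 q" using R4 6 by auto
    have s': "?s (Suc j) = run_prog p ?u" by simp
    have h: "d = ?n - Suc j" "Suc j \<le> ?n" "?R8 r = ?n" "?R8 (Suc r) = Suc j" "?R8 0 = b"
      "rel b (?s (Suc j)) M6"
      subgoal using Suc.hyps(2) by simp
      subgoal using j by simp
      subgoal using R4 6 Suc.prems by simp
      subgoal by simp
      subgoal using R4 6 Suc.prems For.prems(6) by simp
      subgoal using 6 unfolding s' by simp
      done
    obtain R9 M9 where 9: "run W (WhileLess (Suc r) r ?body) (?R8, M6)
        (1 + (time_factor p + 12) * (?c ?n - ?c (Suc j))) (R9, M9)" "rel b (?s ?n) M9" "\<forall>q<r. R9 q = ?R8 q"
      using Suc.hyps(1)[OF h] by blast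
    have "run W (WhileLess (Suc r) r ?body) (R3, M3)
        (Suc ((time_factor p * ?cc j + 11) + (1 + (time_factor p + 12) * (?c ?n - ?c (Suc j))))) (R9, M9)"
      by (rule run_WhileTrue[of R3 "Suc r" r W ?body M3, OF _ body 9(1)]) (use Suc.prems j in auto)
    moreover have "Suc ((time_factor p * ?cc j + 11) + (1 + (time_factor p + 12) * (?c ?n - ?c (Suc j))))
       \<le> 1 + (time_factor p + 12) * (?c ?n - ?c j)"
    proof -
      have "?c ?n - ?c j = (?c ?n - ?c (Suc j)) + Suc (?cc j)"
        using cj sum.lessThan_Suc[of "\<lambda>i. Suc (?cc i)" j] by linarith
      moreover have "D = E + Suc c \<Longrightarrow> Suc ((u * c + 11) + (1 + (u + 12) * E)) \<le> 1 + (u + 12) * D"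
        for D E c u :: nat by (simp add: algebra_simps)
      ultimately show ?thesis by blast
    qed
    ultimately have "run W (WhileLess (Suc r) r ?body) (R3, M3) (1 + (time_factor p + 12) * (?c ?n - ?c j)) (R9, M9)"
      by (rule run_mono)
    moreover have "\<forall>q<r. R9 q = R3 q" using 9(3) keep by metis
    ultimately show ?case using 9(2) by blast
  qed
  obtain R3 M3 where 3: "run W (WhileLess (Suc r) r ?body) (?R2, M) (1 + (time_factor p + 12) * (?c ?n - ?c 0)) (R3, M3)"
      "rel b (?s ?n) M3" "\<forall>q<r. R3 q = ?R2 q"
    using loop[of 0 ?R2 M] R1 For.prems by auto
  have "run W (compile_prog (For x e p) r) (R, M) (time_exp e + (1 + (1 + (time_factor p + 12) * ?c ?n))) (R3, M3)"
    unfolding compile_prog.simps using 3(1)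
    by (intro run_Seq[OF R1(1) run_Seq[OF c0 _ order_refl] order_refl]) simp
  moreover have "time_exp e + (1 + (1 + (time_factor p + 12) * ?c ?n)) \<le> time_factor (For x e p) * cost (For x e p) s"
    unfolding cn by (simp add: algebra_simps)
  ultimately have "run W (compile_prog (For x e p) r) (R, M) (time_factor (For x e p) * cost (For x e p) s) (R3, M3)"
    by (rule run_mono)
  moreover have "rel b (run_prog (For x e p) s) M3" using 3 by simp
  moreover have "\<forall>q<r. R3 q = R q" using 3 R1 by simp
  ultimately show ?case by blast
qed

section \<open>Moving input and output between machine and store\<close>

text \<open>The index sits in a machine register, out of reach of compiled expressions. The zero in
  register \<open>r + 2\<close> serves twice, for copying the index and as the code of the empty
  list.\<close>

definition caddr2 :: "nat \<Rightarrow> nat \<Rightarrow> nat \<Rightarrow> com" where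
  "caddr2 r t q = Seq (Const r t) (Seq (Const (r + 2) 0) (Seq (Op Plus (r + 1) q (r + 2))
     (Seq (cpair (r + 1)) (Seq (cpair r) (Op Plus r r 0)))))"

lemma run_caddr2:
  assumes "q < r" "R q = i" "R 0 = b" "b + enc [t, i] + t + i + 2 \<le> W"
  shows "\<exists>R'. run W (caddr2 r t q) (R, M) 14 (R', M) \<and> R' r = b + enc [t, i] \<and> (\<forall>q<r. R' q = R q)"
proof -
  let ?R1 = "R(r := t)"
  let ?R2 = "?R1(r + 2 := 0)"
  let ?R3 = "?R2(r + 1 := i)"
  have 1: "run W (Const r t) (R, M) 1 (?R1, M)" by (rule run_Const) (use assms in simp)
  have 2: "run W (Const (r + 2) 0) (?R1, M) 1 (?R2, M)" by (rule run_Const) (use assms in simp)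
  have 3: "run W (Op Plus (r + 1) q (r + 2)) (?R2, M) 1 (?R3, M)" by (rule run_Op) (use assms in auto)
  have e: "enc [i] < enc [t, i]" by simp
  obtain R4 where 4: "run W (cpair (r + 1)) (?R3, M) 5 (R4, M)" "R4 (r + 1) = enc [i]"
      "\<forall>q<r+1. R4 q = ?R3 q"
    using run_cpair[of ?R3 "r + 1" i 0 W M] assms(4) e by auto
  have "R4 r = t" using 4(3) by simp
  then obtain R5 where 5: "run W (cpair r) (R4, M) 5 (R5, M)" "R5 r = enc [t, i]" "\<forall>q<r. R5 q = R4 q"
    using run_cpair[of R4 r t "enc [i]" W M] 4(2) assms(4) by auto
  let ?R6 = "R5(r := b + enc [t, i])"
  have "R5 0 = b" using 5(3) 4(3) assms by (cases r) auto
  then have 6: "run W (Op Plus r r 0) (R5, M) 1 (?R6, M)"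
    by (intro run_Op) (use 5(2) assms(4) in \<open>simp_all del: enc.simps\<close>)
  have "run W (caddr2 r t q) (R, M) 14 (?R6, M)"
    unfolding caddr2_def
    by (rule run_Seq[OF 1 run_Seq[OF 2 run_Seq[OF 3 run_Seq[OF 4(1) run_Seq[OF 5(1) 6 order_refl]
        order_refl] order_refl] order_refl]]) simp
  moreover have "\<forall>q<r. ?R6 q = R q" using 5(3) 4(3) by simp
  moreover have "?R6 r = b + enc [t, i]" by simp
  ultimately show ?thesis by blast
qed

definition input_store :: "nat list \<Rightarrow> store" where
  "input_store inp l = (if \<exists>i<length inp. l = [0, i] then inp ! (l ! 1) else 0)"

definition outputs :: "store \<Rightarrow> nat list" where
  "outputs s = map (\<lambda>i. s [1, i]) [0..<s [2]]"

definition prelude :: com where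
  "prelude = WhileLess 1 0 (Seq (Load 2 1) (Seq (caddr2 3 0 1) (Seq (Store 3 2)
     (Seq (Const 2 1) (Op Plus 1 1 2)))))"

definition epilogue :: com where
  "epilogue = Seq (compile_exp (At 2 []) 2) (Seq (Const 3 0) (Seq (WhileLess 3 2
     (Seq (caddr2 4 1 3) (Seq (Load 4 4) (Seq (Store 3 4) (Seq (Const 4 1) (Op Plus 3 3 4))))))
     (Seq (Const 1 0) (Op Plus 0 2 1))))"

text \<open>Copies land at addresses from \<open>b\<close> on while the input lies below
  \<open>b\<close>, so the unread part of the input survives.\<close>

lemma run_prelude_aux:
  fixes inp :: "nat list"
  defines "b \<equiv> length inp"
  assumes W: "\<forall>i\<le>b. b + enc [0, i] + i + 2 \<le> W"
  shows "j \<le> b \<Longrightarrow> R 0 = b \<Longrightarrow> R 1 = j \<Longrightarrow> \<forall>i<b. M i = inp ! i \<Longrightarrow> rel b s M \<Longrightarrow>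
     \<exists>R' M'. run W prelude (R, M) (1 + 19 * (b - j)) (R', M') \<and> R' 0 = b \<and>
       rel b (\<lambda>l. if \<exists>i. j \<le> i \<and> i < b \<and> l = [0, i] then inp ! (l ! 1) else s l) M'"
proof (induction "b - j" arbitrary: j R M s)
  case 0
  then have "\<not> R 1 < R 0" by simp
  from run_WhileFalse[of R 1 0 W _ M, OF this] have "run W prelude (R, M) (1 + 19 * (b - j)) (R, M)"
    unfolding prelude_def by (rule run_mono) simp
  moreover have "(\<lambda>l. if \<exists>i. j \<le> i \<and> i < b \<and> l = [0, i] then inp ! (l ! 1) else s l) = s"
    using 0 by (auto simp: fun_eq_iff)
  moreover have "rel b s M" "R 0 = b" using 0 by auto
  ultimately show ?case by (intro exI conjI) (assumption, assumption, simp)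
next
  case (Suc d)
  then have j: "j < b" by simp
  let ?R1 = "R(2 := inp ! j)"
  have 1: "run W (Load 2 1) (R, M) 1 (?R1, M)" by (rule run_Load) (use Suc.prems j in simp)
  obtain R2 where 2: "run W (caddr2 3 0 1) (?R1, M) 14 (R2, M)" "R2 3 = b + enc [0, j]"
     "\<forall>q<3. R2 q = ?R1 q"
    using run_caddr2[of 1 3 ?R1 j b 0 W M] Suc.prems W[rule_format, of j] j by auto
  let ?M = "M(b + enc [0, j] := inp ! j)"
  have 3: "run W (Store 3 2) (R2, M) 1 (R2, ?M)" by (rule run_Store) (use 2 in auto)
  let ?R3 = "R2(2 := 1)"
  have 4: "run W (Const 2 1) (R2, ?M) 1 (?R3, ?M)" by (rule run_Const) (use W in auto)
  let ?R4 = "?R3(1 := Suc j)"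
  have 5: "run W (Op Plus 1 1 2) (?R3, ?M) 1 (?R4, ?M)"
    by (rule run_Op) (use W[rule_format, of j] j 2 Suc.prems in auto)
  have body: "run W (Seq (Load 2 1) (Seq (caddr2 3 0 1) (Seq (Store 3 2)
     (Seq (Const 2 1) (Op Plus 1 1 2))))) (R, M) 18 (?R4, ?M)"
    by (rule run_Seq[OF 1 run_Seq[OF 2(1) run_Seq[OF 3 run_Seq[OF 4 5 order_refl] order_refl] order_refl]]) simp
  have h: "d = b - Suc j" "Suc j \<le> b" "?R4 0 = b" "?R4 1 = Suc j" "\<forall>i<b. ?M i = inp ! i"
    "rel b (s([0, j] := inp ! j)) ?M"
    using Suc.hyps(2) j 2 Suc.prems rel_update by (auto simp del: enc.simps)
  obtain R' M' where 6: "run W prelude (?R4, ?M) (1 + 19 * (b - Suc j)) (R', M')" "R' 0 = b"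
    "rel b (\<lambda>l. if \<exists>i. Suc j \<le> i \<and> i < b \<and> l = [0, i] then inp ! (l ! 1) else (s([0, j] := inp ! j)) l) M'"
    using Suc.hyps(1)[OF h] by blast
  have "R 1 < R 0" using j Suc.prems by simp
  from run_WhileTrue[OF this body[folded prelude_def] 6(1)[unfolded prelude_def]]
  have "run W prelude (R, M) (1 + 19 * (b - j)) (R', M')"
    unfolding prelude_def by (rule run_mono) (use j in auto)
  moreover have "(\<lambda>l. if \<exists>i. Suc j \<le> i \<and> i < b \<and> l = [0, i] then inp ! (l ! 1) else (s([0, j] := inp ! j)) l)
     = (\<lambda>l. if \<exists>i. j \<le> i \<and> i < b \<and> l = [0, i] then inp ! (l ! 1) else s l)"
    using j by (auto simp: fun_eq_iff Suc_le_eq le_less)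
  ultimately show ?case using 6(2,3) by (intro exI conjI) (assumption, assumption, simp)
qed

lemma run_prelude:
  assumes W: "\<forall>i\<le>length inp. length inp + enc [0, i] + i + 2 \<le> W"
  shows "\<exists>R' M'. run W prelude (init_state inp) (1 + 19 * length inp) (R', M') \<and> R' 0 = length inp \<and>
    rel (length inp) (input_store inp) M'"
proof -
  have "rel (length inp) (\<lambda>_. 0) (\<lambda>i. if i < length inp then inp ! i else 0)"
    by (simp add: rel_def)
  from run_prelude_aux[OF W, of 0 "(\<lambda>_. 0)(0 := length inp)", OF _ _ _ _ this]
  show ?thesis unfolding init_state_def input_store_def[abs_def] by auto
qed

text \<open>The output is moved to the bottom of the memory, possibly over cells of the store. Since
  entry \<open>i\<close> is read from an address above \<open>i\<close>, writing in increasing order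
  destroys no entry that is still to be read.\<close>

lemma le_enc_pair: "i < enc [t, i]"
proof -
  have "i \<le> i\<^sup>2" by (simp add: power2_eq_square)
  then show ?thesis by (simp add: trans_le_add2 le_SucI less_Suc_eq_le)
qed

lemma run_epilogue_loop:
  assumes W: "\<forall>i\<le>n. b + enc [1, i] + i + 3 \<le> W"
  shows "j \<le> n \<Longrightarrow> R 0 = b \<Longrightarrow> R 2 = n \<Longrightarrow> R 3 = j \<Longrightarrow> \<forall>i<j. M i = s [1, i] \<Longrightarrow>
     \<forall>i\<ge>j. M (b + enc [1, i]) = s [1, i] \<Longrightarrow>
     \<exists>R' M'. run W (WhileLess 3 2
     (Seq (caddr2 4 1 3) (Seq (Load 4 4) (Seq (Store 3 4) (Seq (Const 4 1) (Op Plus 3 3 4))))))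
       (R, M) (1 + 19 * (n - j)) (R', M') \<and> R' 2 = n \<and> (\<forall>i<n. M' i = s [1, i])"
proof (induction "n - j" arbitrary: j R M)
  case 0
  then have "\<not> R 3 < R 2" by simp
  from run_mono[OF run_WhileFalse[of R 3 2 W _ M, OF this], of "1 + 19 * (n - j)"]
  show ?case using 0 by (intro exI[of _ R] exI[of _ M] conjI) auto
next
  case (Suc d)
  let ?body = "Seq (caddr2 4 1 3) (Seq (Load 4 4) (Seq (Store 3 4) (Seq (Const 4 1) (Op Plus 3 3 4))))"
  have j: "j < n" using Suc by simp
  obtain R2 where 2: "run W (caddr2 4 1 3) (R, M) 14 (R2, M)" "R2 4 = b + enc [1, j]"
     "\<forall>q<4. R2 q = R q"
    using run_caddr2[of 3 4 R j b 1 W M] Suc.prems W[rule_format, of j] j by auto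
  let ?v = "s [1, j]"
  let ?R3 = "R2(4 := ?v)"
  have 3: "run W (Load 4 4) (R2, M) 1 (?R3, M)"
    by (rule run_Load) (use 2 Suc.prems in \<open>simp del: enc.simps\<close>)
  let ?M = "M(j := ?v)"
  have 4: "run W (Store 3 4) (?R3, M) 1 (?R3, ?M)"
    by (rule run_Store) (use 2 Suc.prems in auto)
  let ?R4 = "?R3(4 := 1)"
  have 5: "run W (Const 4 1) (?R3, ?M) 1 (?R4, ?M)" by (rule run_Const) (use W in auto)
  let ?R5 = "?R4(3 := Suc j)"
  have 6: "run W (Op Plus 3 3 4) (?R4, ?M) 1 (?R5, ?M)"
    by (rule run_Op) (use W[rule_format, of j] j 2 Suc.prems in auto)
  have body: "run W ?body (R, M) 18 (?R5, ?M)"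
    by (rule run_Seq[OF 2(1) run_Seq[OF 3 run_Seq[OF 4 run_Seq[OF 5 6 order_refl] order_refl] order_refl]]) simp
  have ne: "b + enc [1, i] \<noteq> j" if "i \<ge> Suc j" for i
    using le_enc_pair[of i 1] that by linarith
  have h: "d = n - Suc j" "Suc j \<le> n" "?R5 0 = b" "?R5 2 = n" "?R5 3 = Suc j" "\<forall>i<Suc j. ?M i = s [1, i]"
    "\<forall>i\<ge>Suc j. ?M (b + enc [1, i]) = s [1, i]"
    subgoal using Suc.hyps(2) by simp
    subgoal using j by simp
    subgoal using 2 Suc.prems by simp
    subgoal using 2 Suc.prems by simp
    subgoal by simp
    subgoal using Suc.prems by (simp add: less_Suc_eq)
    subgoal using ne Suc.prems by (simp del: enc.simps)
    done
  obtain R' M' where 7: "run W (WhileLess 3 2 ?body) (?R5, ?M) (1 + 19 * (n - Suc j)) (R', M')" "R' 2 = n"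
    "\<forall>i<n. M' i = s [1, i]"
    using Suc.hyps(1)[OF h] by blast
  have "R 3 < R 2" using j Suc.prems by simp
  from run_WhileTrue[of R 3 2, OF this body 7(1)]
  have "run W (WhileLess 3 2 ?body) (R, M) (1 + 19 * (n - j)) (R', M')"
    by (rule run_mono) (use j in auto)
  with 7 show ?case by blast
qed

lemma run_epilogue:
  assumes "rel b s M" "\<forall>l. s l \<le> X" "cap b X K \<le> W" "3 \<le> K" "R 0 = b"
  shows "\<exists>\<sigma>. run W epilogue (R, M) (20 * s [2] + 15) \<sigma> \<and> result \<sigma> = outputs s"
proof -
  let ?n = "s [2]"
  obtain R1 where 1: "run W (compile_exp (At 2 []) 2) (R, M) (time_exp (At 2 [])) (R1, M)" "R1 2 = ?n" "\<forall>q<2. R1 q = R q"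
    using run_ce[OF assms(1-3), of "At 2 []" 2 R] assms by auto
  let ?R2 = "R1(3 := 0)"
  have 2: "run W (Const 3 0) (R1, M) 1 (?R2, M)" by (rule run_Const) (use assms in \<open>auto simp: cap_def\<close>)
  have n: "?n \<le> X" using assms by simp
  have W: "\<forall>i\<le>?n. b + enc [1, i] + i + 3 \<le> W"
  proof (intro allI impI)
    fix i assume "i \<le> ?n"
    then have "\<forall>x\<in>set [1, i]. x \<le> X + K" using n assms(4) by auto
    then have "enc [1, i] \<le> gbound (X + K) K" by (rule enc_le) (use assms in simp)
    then show "b + enc [1, i] + i + 3 \<le> W" using assms \<open>i \<le> ?n\<close> n unfolding cap_def by linarith
  qed
  have m: "\<forall>i\<ge>0. M (b + enc [1, i]) = s [1, i]" using assms(1) unfolding rel_def by (simp del: enc.simps)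
  obtain R3 M3 where 3: "run W (WhileLess 3 2
     (Seq (caddr2 4 1 3) (Seq (Load 4 4) (Seq (Store 3 4) (Seq (Const 4 1) (Op Plus 3 3 4))))))
       (?R2, M) (1 + 19 * (?n - 0)) (R3, M3)" "R3 2 = ?n" "(\<forall>i<?n. M3 i = s [1, i])"
    using run_epilogue_loop[OF W, of 0 ?R2 M s, OF _ _ _ _ _ m] 1 assms by auto
  let ?R4 = "R3(1 := 0)"
  have 4: "run W (Const 1 0) (R3, M3) 1 (?R4, M3)" by (rule run_Const) (use assms in \<open>auto simp: cap_def\<close>)
  let ?R5 = "?R4(0 := ?n)"
  have 5: "run W (Op Plus 0 2 1) (?R4, M3) 1 (?R5, M3)"
  proof (rule run_Op)
    show "?n < W" using n assms(3) unfolding cap_def by linarith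
  qed (use 3 in simp)
  have "run W epilogue (R, M) (20 * s [2] + 15) (?R5, M3)"
    unfolding epilogue_def
    by (rule run_Seq[OF 1(1) run_Seq[OF 2 run_Seq[OF 3(1) run_Seq[OF 4 5 order_refl] order_refl] order_refl]]) simp
  moreover have "result (?R5, M3) = outputs s"
    using 3 by (auto simp: result_def outputs_def)
  ultimately show ?thesis by blast
qed

text \<open>The parameter \<open>t\<close> acts as base address, as bound on the initial cells and
  as bound on the cost at once; \<open>K\<close> belongs to the program, so only the degree depends
  on the program.\<close>

lemma cap_poly: "\<exists>q. \<forall>t. cap t (t + K * t) K \<le> (t + 2) ^ q"
proof -
  obtain q0 where q0: "\<And>Z. gbound Z K + 1 \<le> (Z + 2) ^ q0" using gbound_poly[of K] by blast
  have lin: "c * (t + 2) \<le> (t + 2) ^ Suc c" for c t :: nat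
  proof -
    have "c \<le> 2 ^ c" by (rule less_imp_le[OF less_exp])
    also have "\<dots> \<le> (t + 2) ^ c" by (rule power_mono) auto
    finally have "c * (t + 2) \<le> (t + 2) ^ c * (t + 2)" by (rule mult_le_mono1)
    then show ?thesis by (simp only: power_Suc mult.commute)
  qed
  have "Suc (K + 3) = K + 4" by simp
  with lin[of "K + 3"] have lin3: "(K + 3) * (t + 2) \<le> (t + 2) ^ (K + 4)" for t by metis
  let ?q = "(K + 4) * q0 + K + 5"
  have "cap t (t + K * t) K \<le> (t + 2) ^ ?q" for t
  proof -
    let ?Z = "t + K * t + K"
    have "?Z + 2 \<le> (K + 3) * (t + 2)" by (simp add: algebra_simps)
    also have "\<dots> \<le> (t + 2) ^ (K + 4)" by (rule lin3)
    finally have "(?Z + 2) ^ q0 \<le> ((t + 2) ^ (K + 4)) ^ q0" by (rule power_mono) simp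
    then have g: "gbound ?Z K + 1 \<le> (t + 2) ^ ((K + 4) * q0)" using q0[of ?Z] by (simp add: power_mult)
    have "cap t (t + K * t) K \<le> gbound ?Z K + (K + 3) * (t + 2)"
      unfolding cap_def by (simp add: algebra_simps)
    also have "\<dots> \<le> (t + 2) ^ ((K + 4) * q0) + (t + 2) ^ (K + 4)"
      using g lin3[of t] by (intro add_mono) linarith+
    also have "\<dots> \<le> (t + 2) ^ ((K + 4) * q0 + K + 4) + (t + 2) ^ ((K + 4) * q0 + K + 4)"
      by (intro add_mono power_increasing) auto
    also have "\<dots> = 2 * (t + 2) ^ ((K + 4) * q0 + K + 4)" by simp
    also have "\<dots> \<le> (t + 2) * (t + 2) ^ ((K + 4) * q0 + K + 4)" by (rule mult_le_mono1) simp
    also have "\<dots> = (t + 2) ^ Suc ((K + 4) * q0 + K + 4)" by (rule power_Suc[symmetric])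
    also have "Suc ((K + 4) * q0 + K + 4) = ?q" by simp
    finally show ?thesis .
  qed
  then show ?thesis by blast
qed

text \<open>The order of quantifiers is the point: program, time factor and degree are chosen before
  the input, and \<open>t\<close> may be any common bound on input length, input entries, cost and
  output length.\<close>

lemma compile_correct:
  "\<exists>P C q. \<forall>inp t Q W. length inp \<le> t \<longrightarrow> (\<forall>x\<in>set inp. x \<le> t) \<longrightarrow> cost p (input_store inp) \<le> t \<longrightarrow>
     run_prog p (input_store inp) [2] \<le> t \<longrightarrow> Q (outputs (run_prog p (input_store inp))) \<longrightarrow> (t + 2) ^ q \<le> W \<longrightarrow>
     computes P W (C * (t + 1)) inp Q"
proof -
  define K where "K = psize p + 3"
  obtain q where q: "\<And>t. cap t (t + K * t) K \<le> (t + 2) ^ q" using cap_poly by blast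
  let ?P = "Seq prelude (Seq (compile_prog p 2) epilogue)"
  let ?C = "time_factor p + 60"
  have "computes ?P W (?C * (t + 1)) inp Q"
    if t: "length inp \<le> t" "\<forall>x\<in>set inp. x \<le> t" "cost p (input_store inp) \<le> t"
     "run_prog p (input_store inp) [2] \<le> t" and Q: "Q (outputs (run_prog p (input_store inp)))" and W: "(t + 2) ^ q \<le> W"
    for inp t Q W
  proof -
    let ?b = "length inp" and ?s = "input_store inp"
    let ?s' = "run_prog p ?s"
    let ?X = "t + K * cost p ?s"
    have "cap ?b ?X K \<le> cap t (t + K * t) K"
    proof -
      have "?X \<le> t + K * t" using t by simp
      from cap_mono[OF this, of t K] show ?thesis using t(1) unfolding cap_def by linarith
    qed
    with q[of t] W have cap: "cap ?b ?X K \<le> W" by linarith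
    have K: "psize p \<le> K" "1 \<le> K" "3 \<le> K" by (auto simp: K_def)
    have X0: "\<forall>l. ?s l \<le> t" using t(2) by (auto simp: input_store_def)
    have X1: "\<forall>l. ?s' l \<le> ?X" using eff_growth[OF K(1) X0 K(2)] by blast
    have W1: "\<forall>i\<le>?b. ?b + enc [0, i] + i + 2 \<le> W"
    proof (intro allI impI)
      fix i assume "i \<le> ?b"
      then have "\<forall>x\<in>set [0, i]. x \<le> ?X + K" using t by auto
      then have "enc [0, i] \<le> gbound (?X + K) K" by (rule enc_le) (use K in simp)
      then show "?b + enc [0, i] + i + 2 \<le> W" using cap \<open>i \<le> ?b\<close> t unfolding cap_def by linarith
    qed
    obtain R1 M1 where 1: "run W prelude (init_state inp) (1 + 19 * ?b) (R1, M1)" "R1 0 = ?b" "rel ?b ?s M1"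
      using run_prelude[OF W1] by blast
    obtain R2 M2 where 2: "run W (compile_prog p 2) (R1, M1) (time_factor p * cost p ?s) (R2, M2)" "rel ?b ?s' M2"
      "\<forall>q<2. R2 q = R1 q"
      using run_cp[OF K(1,2) 1(3) X0 cap, of 2 R1] 1 by auto
    obtain \<sigma> where 3: "run W epilogue (R2, M2) (20 * ?s' [2] + 15) \<sigma>" "result \<sigma> = outputs ?s'"
      using run_epilogue[OF 2(2) X1 cap K(3), of R2] 1 2 by auto
    have "run W ?P (init_state inp) (?C * (t + 1)) \<sigma>"
    proof (rule run_Seq[OF 1(1) run_Seq[OF 2(1) 3(1) order_refl]])
      have "time_factor p * cost p ?s \<le> time_factor p * t" using t by simp
      then show "1 + 19 * ?b + (time_factor p * cost p ?s + (20 * ?s' [2] + 15)) \<le> ?C * (t + 1)"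
        using t by (simp only: distrib_left distrib_right mult_1_right)
    qed
    moreover have "?b < W" "\<forall>x\<in>set inp. x < W" using cap t unfolding cap_def by fastforce+
    ultimately show ?thesis unfolding computes_def run_def using 3(2) Q by metis
  qed
  then show ?thesis by blast
qed

section \<open>Program specifications\<close>

abbreviation V :: "nat \<Rightarrow> exp" where "V t \<equiv> At t []"

text \<open>
  The writes of a program: \<open>(t, None)\<close> allows any cell of array \<open>t\<close>, and \<open>(t, Some x)\<close> only cells whose
  first coordinate is the value of the scalar \<open>x\<close>. The second kind is informative only if \<open>x\<close> is not
  written itself.
\<close>

fun writes :: "prog \<Rightarrow> (nat \<times> nat option) set" where
  "writes (Asg t (At v [] # es) e) = {(t, Some v)}"
| "writes (Asg t es e) = {(t, None)}"
| "writes (p ;; q) = writes p \<union> writes q"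
| "writes (Ife a b p q) = writes p \<union> writes q"
| "writes (For x e p) = insert (x, None) (writes p)"

section \<open>Frames of programs\<close>

text \<open>An index scalar that is itself never written keeps its value during the run, so it may
  be read off in the initial store \<open>s\<close>.\<close>

definition untouched :: "(nat \<times> nat option) set \<Rightarrow> store \<Rightarrow> nat list \<Rightarrow> bool" where
  "untouched w s l \<longleftrightarrow> (\<forall>t oo r. (t, oo) \<in> w \<longrightarrow> l = t # r \<longrightarrow>
     (\<exists>v i r'. oo = Some v \<and> v \<notin> fst ` w \<and> r = i # r' \<and> i \<noteq> s [v]))"

lemma untouchedE:
  assumes "untouched w s (t # r)" "(t, oo) \<in> w"
  obtains v i r' where "oo = Some v" "v \<notin> fst ` w" "r = i # r'" "i \<noteq> s [v]"
  using assms(1)[unfolded untouched_def, rule_format, OF assms(2) refl] by blast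

definition agree :: "(nat \<times> nat option) set \<Rightarrow> store \<Rightarrow> store \<Rightarrow> bool" where
  "agree w s u \<longleftrightarrow> (\<forall>l. untouched w s l \<longrightarrow> u l = s l)"

lemma agree_refl [simp]: "agree w s s"
  by (simp add: agree_def)

lemma agree_tag: "agree w s u \<Longrightarrow> t \<notin> fst ` w \<Longrightarrow> u (t # r) = s (t # r)"
proof -
  assume "agree w s u" and t: "t \<notin> fst ` w"
  moreover have "untouched w s (t # r)" using t unfolding untouched_def by force
  ultimately show ?thesis unfolding agree_def by blast
qed

lemma agree_index:
  assumes "agree w s u" "\<And>oo. (t, oo) \<in> w \<Longrightarrow> \<exists>v. oo = Some v \<and> v \<notin> fst ` w \<and> i \<noteq> s [v]"
  shows "u (t # i # r) = s (t # i # r)"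
proof -
  have "untouched w s (t # i # r)" using assms(2) unfolding untouched_def by blast
  then show ?thesis using assms(1) unfolding agree_def by blast
qed

lemma untouched_cong: 
  assumes "agree w s u"
  shows "untouched w u l = untouched w s l"
proof -
  have "v \<notin> fst ` w \<and> r = i # r' \<and> i \<noteq> u [v] \<longleftrightarrow> v \<notin> fst ` w \<and> r = i # r' \<and> i \<noteq> s [v]"
    for v i r and r' :: "nat list"
    using agree_tag[OF assms, of v "[]"] by auto
  then show ?thesis unfolding untouched_def by simp
qed

lemma agree_trans:
  assumes "agree w s u" "agree w u u'"
  shows "agree w s u'"
  unfolding agree_def
proof (intro allI impI)
  fix l assume l: "untouched w s l"
  then have "u l = s l" using assms(1) unfolding agree_def by blast
  moreover have "untouched w u l" using l by (simp only: untouched_cong[OF assms(1)])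
  then have "u' l = u l" using assms(2) unfolding agree_def by blast
  ultimately show "u' l = s l" by simp
qed

lemma agree_update:
  assumes "agree w s u" "(t, oo) \<in> w" "\<And>v. oo = Some v \<Longrightarrow> v \<notin> fst ` w \<Longrightarrow> \<exists>r'. r = s [v] # r'"
  shows "agree w s (u(t # r := x))"
proof -
  have "l \<noteq> t # r" if "untouched w s l" for l
  proof
    assume "l = t # r"
    with that have "untouched w s (t # r)" by simp
    from untouchedE[OF this assms(2)] obtain v i r'
      where "oo = Some v" "v \<notin> fst ` w" "r = i # r'" "i \<noteq> s [v]" .
    then show False using assms(3) by blast
  qed
  then show ?thesis using assms(1) unfolding agree_def by auto
qed

lemma agree_mono: 
  assumes "agree w s u" "w \<subseteq> w'"
  shows "agree w' s u"
proof -
  have "untouched w s l" if "untouched w' s l" for l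
    unfolding untouched_def
  proof (intro allI impI)
    fix t oo r assume l: "l = t # r" and "(t, oo) \<in> w"
    then have "(t, oo) \<in> w'" using assms(2) by blast
    from untouchedE[OF that[unfolded l] this] obtain v i r'
      where "oo = Some v" "v \<notin> fst ` w'" "r = i # r'" "i \<noteq> s [v]" .
    moreover from this(2) have "v \<notin> fst ` w" using image_mono[OF assms(2), of fst] by (meson subsetD)
    ultimately show "\<exists>v i r'. oo = Some v \<and> v \<notin> fst ` w \<and> r = i # r' \<and> i \<noteq> s [v]" by blast
  qed
  then show ?thesis using assms(1) unfolding agree_def by blast
qed

text \<open>The frame is taken with respect to a fixed earlier store \<open>s\<close> and any larger
  set \<open>w\<close> of writes; in this form it passes through sequences and loop iterations
  without loss.\<close>

lemma agree_eff: "writes p \<subseteq> w \<Longrightarrow> agree w s u \<Longrightarrow> agree w s (run_prog p u)"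
proof (induction p arbitrary: u rule: writes.induct)
  case (1 t v es e)
  have "\<exists>r'. u [v] # map (val u) es = s [v'] # r'" if "Some v = Some v'" "v' \<notin> fst ` w" for v'
    using agree_tag[OF 1(2) that(2), of "[]"] that(1) by simp
  then have "agree w s (u(t # map (val u) (At v [] # es) := val u e))"
    using 1 by (intro agree_update[where oo="Some v"]) auto
  then show ?case by (simp only: run_prog.simps)
next
  case (5 x e p)
  have "agree w s (iter x p j u)" for j
  proof (induction j)
    case (Suc j)
    have "agree w s ((iter x p j u)([x] := j))"
      using Suc 5(2) by (intro agree_update[where oo=None]) auto
    then show ?case using "5.IH" 5(2) by simp
  qed (use 5 in simp)
  then show ?case by simp
qed (auto intro!: agree_update[where oo=None])

section \<open>Rules for joint correctness and cost\<close>

definition spec :: "prog \<Rightarrow> store \<Rightarrow> (store \<Rightarrow> bool) \<Rightarrow> nat \<Rightarrow> bool" where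
  "spec p s Q c \<longleftrightarrow> Q (run_prog p s) \<and> cost p s \<le> c"

lemma spec_mono: "spec p s Q c \<Longrightarrow> (\<And>u. Q u \<Longrightarrow> agree (writes p) s u \<Longrightarrow> Q' u) \<Longrightarrow> c \<le> c' \<Longrightarrow> spec p s Q' c'"
  unfolding spec_def using agree_eff[of p "writes p" s s] by auto

lemma spec_Seq:
  "spec p s R c1 \<Longrightarrow> (\<And>u. R u \<Longrightarrow> agree (writes p) s u \<Longrightarrow> spec q u Q c2) \<Longrightarrow> c1 + c2 \<le> c \<Longrightarrow> spec (p ;; q) s Q c"
  unfolding spec_def using agree_eff[of p "writes p" s s] by fastforce

lemma spec_AsgSeq: "spec q (s(t # map (val s) es := val s e)) Q c \<Longrightarrow> spec (Asg t es e ;; q) s Q (Suc c)"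
  unfolding spec_def by simp

lemma spec_Ife:
  "(val s a < val s b \<Longrightarrow> spec p s Q c) \<Longrightarrow> (\<not> val s a < val s b \<Longrightarrow> spec q s Q c) \<Longrightarrow> Suc c \<le> c' \<Longrightarrow>
    spec (Ife a b p q) s Q c'"
  unfolding spec_def by auto

text \<open>Each step receives the frame of the whole loop, so an invariant only has to mention what
  the loop changes. The cost \<open>c j\<close> may vary with the iteration, as it does with the
  node in the tree traversal.\<close>

lemma spec_For:
  assumes I0: "I 0 s" and n: "val s e = n"
    and step: "\<And>j u. j < n \<Longrightarrow> I j u \<Longrightarrow> agree (writes (For x e p)) s u \<Longrightarrow> spec p (u([x] := j)) (I (Suc j)) (c j)"
    and Q: "\<And>u. I n u \<Longrightarrow> agree (writes (For x e p)) s u \<Longrightarrow> Q u"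
    and c: "Suc (\<Sum>j<n. Suc (c j)) \<le> c'"
  shows "spec (For x e p) s Q c'"
proof -
  let ?w = "writes (For x e p)"
  have inv: "j \<le> n \<Longrightarrow> I j (iter x p j s) \<and> agree ?w s (iter x p j s) \<and>
     (\<Sum>i<j. Suc (cost p ((iter x p i s)([x] := i)))) \<le> (\<Sum>i<j. Suc (c i))" for j
  proof (induction j)
    case 0 then show ?case using I0 by simp
  next
    case (Suc j)
    let ?u = "(iter x p j s)([x] := j)"
    have j: "j < n" using Suc.prems by simp
    note IH = Suc.IH[OF less_imp_le[OF j]]
    have I: "I j (iter x p j s)" and ag: "agree ?w s (iter x p j s)"
      and cs: "(\<Sum>i<j. Suc (cost p ((iter x p i s)([x] := i)))) \<le> (\<Sum>i<j. Suc (c i))" using IH by blast+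
    have "agree ?w s ?u" by (rule agree_update[where oo=None, OF ag]) auto
    then have "agree ?w s (run_prog p ?u)" by (rule agree_eff[rotated]) auto
    moreover have "I (Suc j) (run_prog p ?u) \<and> cost p ?u \<le> c j" using step[OF j I ag] by (simp add: spec_def)
    ultimately show ?case using cs unfolding iter_Suc sum.lessThan_Suc by linarith
  qed
  note i = inv[OF order_refl]
  have "Q (iter x p n s)" using i Q by blast
  moreover have "Suc (\<Sum>j<n. Suc (cost p ((iter x p j s)([x] := j)))) \<le> c'" using i c by linarith
  ultimately show ?thesis unfolding spec_def eff_For cost.simps n by blast
qed

lemma spec_For_const:
  assumes "I 0 s" "val s e = n"
    and "\<And>j u. j < n \<Longrightarrow> I j u \<Longrightarrow> agree (writes (For x e p)) s u \<Longrightarrow> spec p (u([x] := j)) (I (Suc j)) c"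
    and "\<And>u. I n u \<Longrightarrow> agree (writes (For x e p)) s u \<Longrightarrow> Q u"
    and "Suc (n * Suc c) \<le> c'"
  shows "spec (For x e p) s Q c'"
  using assms by (intro spec_For[where c="\<lambda>_. c" and I=I]) auto

section \<open>Lists of sets without repetitions\<close>

text \<open>
  Names of arrays are numbers. The input is array \<open>0\<close> with cursor \<open>[3]\<close>, the output is array \<open>1\<close> with
  length \<open>[2]\<close>. Below, names starting with \<open>s\<close> or \<open>l\<close> denote scalars and names starting with \<open>a\<close> denote arrays.
\<close>

abbreviation (input) "sm \<equiv> 4 :: nat"
abbreviation (input) "sidx \<equiv> 10 :: nat"
abbreviation (input) "sdiff \<equiv> 11 :: nat"
abbreviation (input) "lc \<equiv> 22 :: nat"
abbreviation (input) "li \<equiv> 23 :: nat"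
abbreviation (input) "l1 \<equiv> 24 :: nat"
abbreviation (input) "l2 \<equiv> 25 :: nat"
abbreviation (input) "aCand \<equiv> 52 :: nat"

text \<open>The language has no empty statement. The self-assignment leaves the store as it is but
  puts \<open>sdiff\<close> among the written names.\<close>

abbreviation skip :: prog where "skip \<equiv> Asg sdiff [] (V sdiff)"

text \<open>
  Inserts the set in \<open>aCand\<close> into the list of sets at node \<open>nd\<close> (length in array \<open>tc\<close>, characteristic
  vectors in array \<open>ta\<close>) unless it occurs there, and leaves its position in \<open>sidx\<close>.
\<close>

definition insert_cand :: "nat \<Rightarrow> nat \<Rightarrow> nat \<Rightarrow> prog" where
  "insert_cand nd tc ta =
    Asg sidx [] (At tc [V nd]) ;;
    For li (At tc [V nd]) (
      Asg sdiff [] (N 0) ;;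
      For lc (V sm) (
        Ife (At ta [V nd, V li, V lc]) (At aCand [V lc]) (Asg sdiff [] (N 1)) skip ;;
        Ife (At aCand [V lc]) (At ta [V nd, V li, V lc]) (Asg sdiff [] (N 1)) skip) ;;
      Ife (V sdiff) (N 1) (Asg sidx [] (V li)) skip) ;;
    Ife (V sidx) (At tc [V nd]) skip (
      For lc (V sm) (Asg ta [V nd, V sidx, V lc] (At aCand [V lc])) ;;
      Asg tc [V nd] (Inc (V sidx)))"

definition islist :: "store \<Rightarrow> nat \<Rightarrow> nat \<Rightarrow> nat \<Rightarrow> nat set list \<Rightarrow> bool" where
  "islist s tc ta v xs \<longleftrightarrow> s [tc, v] = length xs \<and> distinct xs \<and> set xs \<subseteq> Pow {..<s [sm]} \<and>
     (\<forall>i<length xs. \<forall>c<s [sm]. s [ta, v, i, c] = of_bool (c \<in> xs ! i))"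

definition ins_cost :: "nat \<Rightarrow> nat \<Rightarrow> nat" where
  "ins_cost k m = 9 + k * (6 + 5 * m) + 2 * m"

lemma wr_ins: "writes (insert_cand nd tc ta) = {(sidx, None), (li, None), (sdiff, None), (lc, None), (ta, Some nd), (tc, Some nd)}"
  unfolding insert_cand_def by auto

text \<open>A new set is appended at the end, so the list only grows and positions recorded earlier
  remain valid; \<open>gen_correct\<close> relies on this for its table.\<close>

lemma ins_correct:
  assumes dist: "distinct [nd, tc, ta, sm, sidx, sdiff, lc, li, aCand]"
    and v: "s [nd] = v" and m: "s [sm] = m" and xs: "islist s tc ta v xs" "length xs \<le> k"
    and D: "D \<subseteq> {..<m}" "\<forall>c<m. s [aCand, c] = of_bool (c \<in> D)"
  shows "spec (insert_cand nd tc ta) s (\<lambda>u. \<exists>ys. islist u tc ta v (xs @ ys) \<and> set (xs @ ys) = insert D (set xs) \<and>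
     u [sidx] < length (xs @ ys) \<and> (xs @ ys) ! (u [sidx]) = D) (ins_cost k m)"
proof -
  let ?K = "length xs"
  have K: "s [tc, v] = ?K" and bits: "\<And>i c. i < ?K \<Longrightarrow> c < m \<Longrightarrow> s [ta, v, i, c] = of_bool (c \<in> xs ! i)"
    and dxs: "distinct xs" and sub: "set xs \<subseteq> Pow {..<m}" using xs m by (auto simp: islist_def)
  have dn: "tc \<noteq> nd" "ta \<noteq> nd" "ta \<noteq> tc" "nd \<notin> {4,10,11,22,23,52}" "tc \<notin> {4,10,11,22,23,52}" "ta \<notin> {4,10,11,22,23,52}"
    using dist by auto
  let ?inner = "For lc (V sm) (
        Ife (At ta [V nd, V li, V lc]) (At aCand [V lc]) (Asg sdiff [] (N 1)) skip ;;
        Ife (At aCand [V lc]) (At ta [V nd, V li, V lc]) (Asg sdiff [] (N 1)) skip)"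
  let ?search = "For li (At tc [V nd]) (
      Asg sdiff [] (N 0) ;; ?inner ;;
      Ife (V sdiff) (N 1) (Asg sidx [] (V li)) skip)"
  \<comment> \<open>Two strict comparisons per bit detect a difference in either direction. The
    frame of \<open>insert_cand\<close> permits writes to \<open>ta\<close> at this node, so the
    fact that \<open>ta\<close> is still unchanged is carried separately.\<close>
  have inner: "spec ?inner u (\<lambda>u'. u' [sdiff] = of_bool (D \<noteq> xs ! i)) (1 + 5 * m)"
    if ag: "agree (writes (insert_cand nd tc ta)) s u" and ta: "\<forall>l. u (ta # l) = s (ta # l)" and i: "i < ?K" "u [li] = i"
      and z: "u [sdiff] = 0" for u i
  proof (rule spec_For_const[where I="\<lambda>j u'. u' [sdiff] = of_bool (\<exists>c<j. (c \<in> D) \<noteq> (c \<in> xs ! i))" and n=m and c=4])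
    show "u [sdiff] = of_bool (\<exists>c<0. (c \<in> D) \<noteq> (c \<in> xs ! i))" using z by simp
    show "val u (V sm) = m" using agree_tag[OF ag, of sm] dn m by (simp add: wr_ins)
  next
    fix j u' assume j: "j < m" and I: "u' [sdiff] = of_bool (\<exists>c<j. (c \<in> D) \<noteq> (c \<in> xs ! i))"
      and ag': "agree (writes ?inner) u u'"
    have 1: "u' [nd] = v" "u' [li] = i" "u' [aCand, j] = of_bool (j \<in> D)" "u' [ta, v, i, j] = of_bool (j \<in> xs ! i)"
      using agree_tag[OF ag', of nd] agree_tag[OF ag', of li] agree_tag[OF ag', of aCand] agree_tag[OF ag', of ta]
        agree_tag[OF ag, of nd] agree_tag[OF ag, of aCand] ta dn v i D j bits[of i j]
      by (auto simp: wr_ins)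
    show "spec (Ife (At ta [V nd, V li, V lc]) (At aCand [V lc]) (Asg sdiff [] (N 1)) skip ;;
        Ife (At aCand [V lc]) (At ta [V nd, V li, V lc]) (Asg sdiff [] (N 1)) skip) (u'([lc] := j))
        (\<lambda>u'. u' [sdiff] = of_bool (\<exists>c<Suc j. (c \<in> D) \<noteq> (c \<in> xs ! i))) 4"
      unfolding spec_def using 1 dn I by (auto simp: less_Suc_eq)
  next
    fix u' assume I: "u' [sdiff] = of_bool (\<exists>c<m. (c \<in> D) \<noteq> (c \<in> xs ! i))"
    have "xs ! i \<subseteq> {..<m}" using sub i nth_mem by blast
    then have "(\<exists>c<m. (c \<in> D) \<noteq> (c \<in> xs ! i)) = (D \<noteq> xs ! i)" using D(1) by auto
    then show "u' [sdiff] = of_bool (D \<noteq> xs ! i)" using I by simp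
  qed simp
  \<comment> \<open>The initial value \<open>?K\<close> of \<open>sidx\<close> means "not found" and
    is at the same time the position at which a new set will be stored.\<close>
  have search: "spec ?search (s([sidx] := ?K)) (\<lambda>u. ((u [sidx] = ?K \<and> D \<notin> set xs) \<or> (u [sidx] < ?K \<and> xs ! (u [sidx]) = D))
      \<and> (\<forall>l. u (ta # l) = s (ta # l)) \<and> agree (writes (insert_cand nd tc ta)) s u) (1 + ?K * (6 + 5 * m))"
  proof (rule spec_For_const[where n="?K" and c="5 + 5 * m" and I="\<lambda>i u.
      ((u [sidx] = ?K \<and> (\<forall>i'<i. xs ! i' \<noteq> D)) \<or> (u [sidx] < i \<and> xs ! (u [sidx]) = D))
      \<and> (\<forall>l. u (ta # l) = s (ta # l)) \<and> agree (writes (insert_cand nd tc ta)) s u"])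
    show "(((s([sidx] := ?K)) [sidx] = ?K \<and> (\<forall>i'<0. xs ! i' \<noteq> D)) \<or>
        ((s([sidx] := ?K)) [sidx] < 0 \<and> xs ! ((s([sidx] := ?K)) [sidx]) = D)) \<and>
        (\<forall>l. (s([sidx] := ?K)) (ta # l) = s (ta # l)) \<and> agree (writes (insert_cand nd tc ta)) s (s([sidx] := ?K))"
      using dn by (auto simp: wr_ins intro!: agree_update[where oo=None])
    show "val (s([sidx] := ?K)) (At tc [V nd]) = ?K" using K v dn by simp
  next
    fix i u assume i: "i < ?K" and I: "((u [sidx] = ?K \<and> (\<forall>i'<i. xs ! i' \<noteq> D)) \<or> (u [sidx] < i \<and> xs ! (u [sidx]) = D))
      \<and> (\<forall>l. u (ta # l) = s (ta # l)) \<and> agree (writes (insert_cand nd tc ta)) s u"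
    let ?u = "u([li] := i, [sdiff] := 0)"
    have ag: "agree (writes (insert_cand nd tc ta)) s ?u"
      using I by (auto simp: wr_ins intro!: agree_update[where oo=None])
    have sp: "spec ?inner ?u (\<lambda>u'. u' [sdiff] = of_bool (D \<noteq> xs ! i)) (1 + 5 * m)"
      by (rule inner[OF ag _ i]) (use I dn in auto)
    show "spec (Asg sdiff [] (N 0) ;; ?inner ;; Ife (V sdiff) (N 1) (Asg sidx [] (V li)) skip) (u([li] := i))
      (\<lambda>u. ((u [sidx] = ?K \<and> (\<forall>i'<Suc i. xs ! i' \<noteq> D)) \<or> (u [sidx] < Suc i \<and> xs ! (u [sidx]) = D))
      \<and> (\<forall>l. u (ta # l) = s (ta # l)) \<and> agree (writes (insert_cand nd tc ta)) s u) (5 + 5 * m)"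
    proof (rule spec_mono[OF spec_AsgSeq])
      show "spec (?inner ;; Ife (V sdiff) (N 1) (Asg sidx [] (V li)) skip) ((u([li] := i))
         (sdiff # map (val (u([li] := i))) [] := val (u([li] := i)) (N 0)))
      (\<lambda>u. ((u [sidx] = ?K \<and> (\<forall>i'<Suc i. xs ! i' \<noteq> D)) \<or> (u [sidx] < Suc i \<and> xs ! (u [sidx]) = D))
      \<and> (\<forall>l. u (ta # l) = s (ta # l)) \<and> agree (writes (insert_cand nd tc ta)) s u) ((1 + 5 * m) + 2)"
      proof (rule spec_Seq[where ?c1.0="1 + 5 * m" and ?c2.0=2 and R="\<lambda>u'. u' [sdiff] = of_bool (D \<noteq> xs ! i)"])
        fix u' assume d: "u' [sdiff] = of_bool (D \<noteq> xs ! i)" and 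
          "agree (writes ?inner) ((u([li] := i)) (sdiff # map (val (u([li] := i))) [] := val (u([li] := i)) (N 0))) u'"
        then have ag': "agree (writes ?inner) ?u u'" by simp
        have 1: "u' [sidx] = u [sidx]" "u' [li] = i" "\<forall>l. u' (ta # l) = s (ta # l)"
          using agree_tag[OF ag', of sidx] agree_tag[OF ag', of li] agree_tag[OF ag', of ta] I dn by auto
        have "agree (writes (insert_cand nd tc ta)) ?u u'" by (rule agree_mono[OF ag']) (auto simp: wr_ins)
        then have ag2: "agree (writes (insert_cand nd tc ta)) s u'" using ag agree_trans by blast
        then have "agree (writes (insert_cand nd tc ta)) s (u'([sidx] := i))"
          by (auto simp: wr_ins intro!: agree_update[where oo=None])
        moreover have "agree (writes (insert_cand nd tc ta)) s (u'([sdiff] := x))" for x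
          using ag2 by (auto simp: wr_ins intro!: agree_update[where oo=None])
        ultimately show "spec (Ife (V sdiff) (N 1) (Asg sidx [] (V li)) skip) u' 
          (\<lambda>u. ((u [sidx] = ?K \<and> (\<forall>i'<Suc i. xs ! i' \<noteq> D)) \<or> (u [sidx] < Suc i \<and> xs ! (u [sidx]) = D))
          \<and> (\<forall>l. u (ta # l) = s (ta # l)) \<and> agree (writes (insert_cand nd tc ta)) s u) 2"
          unfolding spec_def using 1 d I ag2 dn by (auto simp: less_Suc_eq)
      qed (use sp in simp_all)
    qed auto
  next
    fix u assume "((u [sidx] = ?K \<and> (\<forall>i'<?K. xs ! i' \<noteq> D)) \<or> (u [sidx] < ?K \<and> xs ! (u [sidx]) = D))
      \<and> (\<forall>l. u (ta # l) = s (ta # l)) \<and> agree (writes (insert_cand nd tc ta)) s u"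
    then show "((u [sidx] = ?K \<and> D \<notin> set xs) \<or> (u [sidx] < ?K \<and> xs ! (u [sidx]) = D))
      \<and> (\<forall>l. u (ta # l) = s (ta # l)) \<and> agree (writes (insert_cand nd tc ta)) s u"
      by (auto simp: in_set_conv_nth)
  qed simp
  let ?copy = "For lc (V sm) (Asg ta [V nd, V sidx, V lc] (At aCand [V lc]))"
  show ?thesis
    unfolding insert_cand_def
  proof (rule spec_mono[OF spec_AsgSeq])
    show "spec (?search ;; Ife (V sidx) (At tc [V nd]) skip (?copy ;; Asg tc [V nd] (Inc (V sidx))))
       (s(sidx # map (val s) [] := val s (At tc [V nd])))
       (\<lambda>u. \<exists>ys. islist u tc ta v (xs @ ys) \<and> set (xs @ ys) = insert D (set xs) \<and>
     u [sidx] < length (xs @ ys) \<and> (xs @ ys) ! (u [sidx]) = D) ((1 + ?K * (6 + 5 * m)) + (3 + 2 * m))"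
    proof (rule spec_Seq[OF _ _ order_refl])
      show "spec ?search (s(sidx # map (val s) [] := val s (At tc [V nd]))) (\<lambda>u. ((u [sidx] = ?K \<and> D \<notin> set xs) \<or> (u [sidx] < ?K \<and> xs ! (u [sidx]) = D))
      \<and> (\<forall>l. u (ta # l) = s (ta # l)) \<and> agree (writes (insert_cand nd tc ta)) s u) (1 + ?K * (6 + 5 * m))"
        using search K v by simp
    next
      fix u assume u: "((u [sidx] = ?K \<and> D \<notin> set xs) \<or> (u [sidx] < ?K \<and> xs ! (u [sidx]) = D))
        \<and> (\<forall>l. u (ta # l) = s (ta # l)) \<and> agree (writes (insert_cand nd tc ta)) s u"
        and "agree (writes ?search) (s(sidx # map (val s) [] := val s (At tc [V nd]))) u"
      then have ag: "agree (writes ?search) (s([sidx] := ?K)) u" using K v by simp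
      have 1: "u [nd] = v" "u [sm] = m" "u [tc, v] = ?K" "\<And>c. u [aCand, c] = s [aCand, c]"
        using agree_tag[OF ag, of nd] agree_tag[OF ag, of sm] agree_tag[OF ag, of tc] agree_tag[OF ag, of aCand]
          dn v m K by auto
      show "spec (Ife (V sidx) (At tc [V nd]) skip (?copy ;; Asg tc [V nd] (Inc (V sidx)))) u
        (\<lambda>u. \<exists>ys. islist u tc ta v (xs @ ys) \<and> set (xs @ ys) = insert D (set xs) \<and>
           u [sidx] < length (xs @ ys) \<and> (xs @ ys) ! (u [sidx]) = D) (3 + 2 * m)"
      proof (rule spec_Ife[where c="2 + 2 * m"])
        assume "val u (V sidx) < val u (At tc [V nd])"
        then have idx: "u [sidx] < ?K" "xs ! (u [sidx]) = D" using 1 u by auto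
        then have "islist u tc ta v xs" "insert D (set xs) = set xs"
          using 1 u bits dxs sub m by (auto simp: islist_def)
        then show "spec skip u (\<lambda>u. \<exists>ys. islist u tc ta v (xs @ ys) \<and> set (xs @ ys) = insert D (set xs) \<and>
           u [sidx] < length (xs @ ys) \<and> (xs @ ys) ! (u [sidx]) = D) (2 + 2 * m)"
          unfolding spec_def using idx by (auto intro!: exI[of _ "[]"])
      next
        assume "\<not> val u (V sidx) < val u (At tc [V nd])"
        then have idx: "u [sidx] = ?K" "D \<notin> set xs" using 1 u by auto
        show "spec (?copy ;; Asg tc [V nd] (Inc (V sidx))) u
          (\<lambda>u. \<exists>ys. islist u tc ta v (xs @ ys) \<and> set (xs @ ys) = insert D (set xs) \<and>
           u [sidx] < length (xs @ ys) \<and> (xs @ ys) ! (u [sidx]) = D) (2 + 2 * m)"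
        proof (rule spec_Seq)
          show "spec ?copy u (\<lambda>u'. (\<forall>i<?K. \<forall>c<m. u' [ta, v, i, c] = of_bool (c \<in> xs ! i)) \<and>
             (\<forall>c<m. u' [ta, v, ?K, c] = of_bool (c \<in> D))) (1 + 2 * m)"
          proof (rule spec_For_const[where n=m and c=1 and I="\<lambda>j u'. (\<forall>i<?K. \<forall>c<m. u' [ta, v, i, c] = of_bool (c \<in> xs ! i)) \<and>
             (\<forall>c<j. u' [ta, v, ?K, c] = of_bool (c \<in> D))"])
            fix j u' assume j: "j < m" and I: "(\<forall>i<?K. \<forall>c<m. u' [ta, v, i, c] = of_bool (c \<in> xs ! i)) \<and>
               (\<forall>c<j. u' [ta, v, ?K, c] = of_bool (c \<in> D))" and ag: "agree (writes ?copy) u u'"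
            have 2: "u' [nd] = v" "u' [sidx] = ?K" "\<And>c. u' [aCand, c] = s [aCand, c]"
              using agree_tag[OF ag, of nd] agree_tag[OF ag, of sidx] agree_tag[OF ag, of aCand] dn 1 idx by auto
            show "spec (Asg ta [V nd, V sidx, V lc] (At aCand [V lc])) (u'([lc] := j))
              (\<lambda>u'. (\<forall>i<?K. \<forall>c<m. u' [ta, v, i, c] = of_bool (c \<in> xs ! i)) \<and>
               (\<forall>c<Suc j. u' [ta, v, ?K, c] = of_bool (c \<in> D))) 1"
              unfolding spec_def using 2 I dn j D by (auto simp: less_Suc_eq)
          qed (use 1 u bits in auto)
        next
          fix u' assume I: "(\<forall>i<?K. \<forall>c<m. u' [ta, v, i, c] = of_bool (c \<in> xs ! i)) \<and>
             (\<forall>c<m. u' [ta, v, ?K, c] = of_bool (c \<in> D))" and ag: "agree (writes ?copy) u u'"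
          have 2: "u' [nd] = v" "u' [sidx] = ?K" "u' [sm] = m"
            using agree_tag[OF ag, of nd] agree_tag[OF ag, of sidx] agree_tag[OF ag, of sm] dn 1 idx by auto
          show "spec (Asg tc [V nd] (Inc (V sidx))) u' (\<lambda>u. \<exists>ys. islist u tc ta v (xs @ ys) \<and> set (xs @ ys) = insert D (set xs) \<and>
           u [sidx] < length (xs @ ys) \<and> (xs @ ys) ! (u [sidx]) = D) 1"
            unfolding spec_def using I 2 dn idx dxs sub D(1)
            by (auto simp: islist_def nth_append less_Suc_eq intro!: exI[of _ "[D]"])
        qed simp
      qed simp
    qed
  next
    have "?K * (6 + 5 * m) \<le> k * (6 + 5 * m)" using xs(2) by (rule mult_le_mono1)
    then show "Suc (1 + ?K * (6 + 5 * m) + (3 + 2 * m)) \<le> ins_cost k m" unfolding ins_cost_def by linarith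
  qed
qed

section \<open>Tabulating the combinations of two lists\<close>

text \<open>The common pattern of all set computations, with \<open>E\<close> as the characteristic
  function of the combined set. The positions kept in \<open>tJ\<close> spare the dynamic program
  every search.\<close>

definition gen_table :: "nat \<Rightarrow> nat \<Rightarrow> nat \<Rightarrow> nat \<Rightarrow> exp \<Rightarrow> exp \<Rightarrow> exp \<Rightarrow> prog" where
  "gen_table nd tc ta tJ e1 e2 E =
    For l1 e1 (For l2 e2 (
      For lc (V sm) (Asg aCand [V lc] E) ;;
      insert_cand nd tc ta ;;
      Asg tJ [V nd, V l1, V l2] (V sidx)))"

lemma wr_gen: "writes (gen_table nd tc ta tJ e1 e2 E) = {(l1, None), (l2, None), (tJ, Some nd), (sidx, None), (li, None),
   (sdiff, None), (lc, None), (ta, Some nd), (tc, Some nd), (lc, None), (aCand, Some lc)}"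
  unfolding gen_table_def by (simp add: wr_ins)

definition gen_cost :: "nat \<Rightarrow> nat \<Rightarrow> nat \<Rightarrow> nat \<Rightarrow> nat" where
  "gen_cost n1 n2 k m = 1 + n1 * (2 + n2 * (3 + 2 * m + ins_cost k m))"

definition table :: "store \<Rightarrow> nat \<Rightarrow> nat \<Rightarrow> (nat \<Rightarrow> nat \<Rightarrow> nat set) \<Rightarrow> nat set list \<Rightarrow> (nat \<times> nat) set \<Rightarrow> bool" where
  "table s tJ v f xs Z \<longleftrightarrow> (\<forall>(i1, i2)\<in>Z. s [tJ, v, i1, i2] < length xs \<and> xs ! (s [tJ, v, i1, i2]) = f i1 i2)"

lemma islist_cong:
  assumes "u [tc, v] = s [tc, v]" "\<And>l. u (ta # v # l) = s (ta # v # l)" "u [sm] = s [sm]"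
  shows "islist u tc ta v xs = islist s tc ta v xs"
  using assms unfolding islist_def by simp

lemma table_cong:
  assumes "\<And>l. u (tJ # v # l) = s (tJ # v # l)"
  shows "table u tJ v f xs Z = table s tJ v f xs Z"
  using assms unfolding table_def by simp

text \<open>The inner bound \<open>e2\<close> and the expression \<open>E\<close> are evaluated
  while the loops run, hence their values are prescribed in every store that agrees with
  \<open>s\<close>; the outer bound is evaluated in \<open>s\<close> itself.\<close>

lemma gen_correct:
  assumes dist: "distinct [nd, tc, ta, tJ, sm, sidx, sdiff, lc, li, l1, l2, aCand]"
    and v: "s [nd] = v" and m: "s [sm] = m" and empty: "s [tc, v] = 0"
    and n1: "val s e1 = n1" and n2: "\<And>u. agree (writes (gen_table nd tc ta tJ e1 e2 E)) s u \<Longrightarrow> val u e2 = n2"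
    and E: "\<And>u i1 i2 c. agree (writes (gen_table nd tc ta tJ e1 e2 E)) s u \<Longrightarrow> i1 < n1 \<Longrightarrow> i2 < n2 \<Longrightarrow> c < m \<Longrightarrow>
       u [l1] = i1 \<Longrightarrow> u [l2] = i2 \<Longrightarrow> u [lc] = c \<Longrightarrow> val u E = of_bool (c \<in> f i1 i2)"
    and f: "\<And>i1 i2. i1 < n1 \<Longrightarrow> i2 < n2 \<Longrightarrow> f i1 i2 \<subseteq> {..<m}"
    and k: "card (case_prod f ` ({..<n1} \<times> {..<n2})) \<le> k"
  shows "spec (gen_table nd tc ta tJ e1 e2 E) s (\<lambda>u. \<exists>xs. islist u tc ta v xs \<and>
     set xs = case_prod f ` ({..<n1} \<times> {..<n2}) \<and> table u tJ v f xs ({..<n1} \<times> {..<n2})) (gen_cost n1 n2 k m)"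
proof -
  let ?W = "writes (gen_table nd tc ta tJ e1 e2 E)"
  let ?F = "case_prod f ` ({..<n1} \<times> {..<n2})"
  define P where "P Z u \<longleftrightarrow> (\<exists>xs. islist u tc ta v xs \<and> set xs = case_prod f ` Z \<and> table u tJ v f xs Z)"
    for Z and u :: store
  have dn: "tc \<noteq> nd" "ta \<noteq> nd" "ta \<noteq> tc" "tJ \<noteq> nd" "tJ \<noteq> tc" "tJ \<noteq> ta"
    "nd \<notin> {4,10,11,22,23,24,25,52}" "tc \<notin> {4,10,11,22,23,24,25,52}"
    "ta \<notin> {4,10,11,22,23,24,25,52}" "tJ \<notin> {4,10,11,22,23,24,25,52}"
    using dist by auto
  have P_upd: "P Z (u([x] := j)) = P Z u" if "x \<noteq> sm" for Z u x j
    unfolding P_def using that by (simp add: islist_def table_def)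
  have ndv: "u [nd] = v" "u [sm] = m" if "agree ?W s u" for u
    using agree_tag[OF that, of nd] agree_tag[OF that, of sm] dn v m by (auto simp: wr_gen)
  let ?cand = "For lc (V sm) (Asg aCand [V lc] E)"
  let ?body = "?cand ;; insert_cand nd tc ta ;; Asg tJ [V nd, V l1, V l2] (V sidx)"
  have body: "spec ?body u (P (insert (a, b) Z)) (2 + 2 * m + ins_cost k m)"
    if ag: "agree ?W s u" and ab: "a < n1" "b < n2" "u [l1] = a" "u [l2] = b" and P: "P Z u"
      and Z: "Z \<subseteq> {..<n1} \<times> {..<n2}" for u a b Z
  proof (rule spec_Seq)
    show "spec ?cand u (\<lambda>u'. (\<forall>c<m. u' [aCand, c] = of_bool (c \<in> f a b)) \<and> agree ?W s u' \<and> u' [l1] = a \<and> u' [l2] = b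
       \<and> P Z u') (1 + 2 * m)"
    proof (rule spec_For_const[where n=m and c=1 and I="\<lambda>j u'. (\<forall>c<j. u' [aCand, c] = of_bool (c \<in> f a b))"])
      show "val u (V 4) = m" using ndv[OF ag] by simp
    next
      fix j u' assume j: "j < m" and I: "\<forall>c<j. u' [aCand, c] = of_bool (c \<in> f a b)"
        and ag': "agree (writes ?cand) u u'"
      have "agree ?W u u'" by (rule agree_mono[OF ag']) (auto simp: wr_gen)
      with ag have "agree ?W s u'" by (rule agree_trans)
      then have "agree ?W s (u'([lc] := j))" by (auto simp: wr_gen intro!: agree_update[where oo=None])
      from E[OF this ab(1,2) j] have "val (u'([lc] := j)) E = of_bool (j \<in> f a b)"
        using ab agree_tag[OF ag', of l1] agree_tag[OF ag', of l2] by simp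
      then show "spec (Asg aCand [V lc] E) (u'([lc] := j)) (\<lambda>u'. \<forall>c<Suc j. u' [aCand, c] = of_bool (c \<in> f a b)) 1"
        unfolding spec_def using I by (auto simp: less_Suc_eq)
    next
      fix u' assume I: "\<forall>c<m. u' [aCand, c] = of_bool (c \<in> f a b)" and ag': "agree (writes ?cand) u u'"
      have "agree ?W u u'" by (rule agree_mono[OF ag']) (auto simp: wr_gen)
      with ag have agW: "agree ?W s u'" by (rule agree_trans)
      have "P Z u' = P Z u" unfolding P_def
        using agree_tag[OF ag', of tc] agree_tag[OF ag', of ta] agree_tag[OF ag', of tJ] agree_tag[OF ag', of sm] dn
        by (simp add: islist_cong[of u' tc v u ta] table_cong[of u' tJ v u])
      then show "(\<forall>c<m. u' [aCand, c] = of_bool (c \<in> f a b)) \<and> agree ?W s u' \<and> u' [l1] = a \<and> u' [l2] = b \<and> P Z u'"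
        using I agW P ab agree_tag[OF ag', of l1] agree_tag[OF ag', of l2] by simp
    qed simp_all
  next
    fix u1 assume u1: "(\<forall>c<m. u1 [aCand, c] = of_bool (c \<in> f a b)) \<and> agree ?W s u1 \<and> u1 [l1] = a \<and> u1 [l2] = b \<and> P Z u1"
    then obtain xs where xs: "islist u1 tc ta v xs" "set xs = case_prod f ` Z" "table u1 tJ v f xs Z"
      unfolding P_def by blast
    \<comment> \<open>At every moment the list is a part, without repetitions, of the final family.
      So no search meets more than \<open>k\<close> entries, although there may be many more
      pairs.\<close>
    have len: "length xs \<le> k"
    proof -
      have "length xs = card (set xs)" using xs(1) by (simp add: islist_def distinct_card)
      also have "\<dots> \<le> card ?F" unfolding xs(2) using Z by (intro card_mono image_mono) auto
      finally show ?thesis using k by simp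
    qed
    show "spec (insert_cand nd tc ta ;; Asg tJ [V nd, V l1, V l2] (V sidx)) u1 (P (insert (a, b) Z)) (ins_cost k m + 1)"
    proof (rule spec_Seq[OF ins_correct])
      show "distinct [nd, tc, ta, sm, sidx, sdiff, lc, li, aCand]" using dist by auto
      show "islist u1 tc ta v xs" "length xs \<le> k" "u1 [nd] = v" "u1 [sm] = m" "f a b \<subseteq> {..<m}"
        "\<forall>c<m. u1 [aCand, c] = of_bool (c \<in> f a b)"
        using xs len ndv u1 f ab by auto
    next
      fix u2 assume "\<exists>ys. islist u2 tc ta v (xs @ ys) \<and> set (xs @ ys) = insert (f a b) (set xs) \<and>
        u2 [sidx] < length (xs @ ys) \<and> (xs @ ys) ! (u2 [sidx]) = f a b"
        and ag2: "agree (writes (insert_cand nd tc ta)) u1 u2"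
      then obtain ys where ys: "islist u2 tc ta v (xs @ ys)" "set (xs @ ys) = insert (f a b) (set xs)"
        "u2 [sidx] < length (xs @ ys)" "(xs @ ys) ! (u2 [sidx]) = f a b" by blast
      have 2: "u2 [nd] = v" "u2 [l1] = a" "u2 [l2] = b" "\<And>l. u2 (tJ # l) = u1 (tJ # l)"
        using agree_tag[OF ag2, of nd] agree_tag[OF ag2, of l1] agree_tag[OF ag2, of l2] agree_tag[OF ag2, of tJ]
          u1 ndv dn by (auto simp: wr_ins)
      let ?u = "u2([tJ, v, a, b] := u2 [sidx])"
      have "islist ?u tc ta v (xs @ ys)" using ys(1) dn by (simp add: islist_def)
      moreover have "table ?u tJ v f (xs @ ys) (insert (a, b) Z)"
        using xs(3) ys 2 unfolding table_def by (auto simp: nth_append)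
      ultimately have "P (insert (a, b) Z) ?u" unfolding P_def using ys(2) xs(2) by (metis case_prod_conv image_insert)
      then show "spec (Asg tJ [V nd, V l1, V l2] (V sidx)) u2 (P (insert (a, b) Z)) 1"
        unfolding spec_def using 2 by simp
    qed simp
  qed simp
  let ?C = "2 + 2 * m + ins_cost k m"
  have loop2: "spec (For l2 e2 ?body) u (\<lambda>u'. P ({..<Suc a} \<times> {..<n2}) u') (1 + n2 * Suc ?C)"
    if ag: "agree ?W s u" and a: "a < n1" "u [l1] = a" and P: "P ({..<a} \<times> {..<n2}) u" for u a
  proof (rule spec_For_const[where n=n2 and c="?C" and I="\<lambda>b u'. P ({..<a} \<times> {..<n2} \<union> {a} \<times> {..<b}) u'"])
    show "val u e2 = n2" using n2[OF ag] .
  next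
    fix b u' assume b: "b < n2" and I: "P ({..<a} \<times> {..<n2} \<union> {a} \<times> {..<b}) u'"
      and ag': "agree (writes (For l2 e2 ?body)) u u'"
    have "agree ?W u u'" by (rule agree_mono[OF ag']) (auto simp: wr_gen gen_table_def)
    with ag have "agree ?W s u'" by (rule agree_trans)
    then have agW: "agree ?W s (u'([l2] := b))" by (auto simp: wr_gen intro!: agree_update[where oo=None])
    have eq: "insert (a, b) ({..<a} \<times> {..<n2} \<union> {a} \<times> {..<b}) = {..<a} \<times> {..<n2} \<union> {a} \<times> {..<Suc b}"
      by auto
    show "spec ?body (u'([l2] := b)) (P ({..<a} \<times> {..<n2} \<union> {a} \<times> {..<Suc b})) ?C"
      unfolding eq[symmetric]
    proof (rule body[OF agW a(1) b])
      show "(u'([l2] := b)) [l1] = a" using a agree_tag[OF ag', of l1] dn by (simp add: wr_ins)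
      show "P ({..<a} \<times> {..<n2} \<union> {a} \<times> {..<b}) (u'([l2] := b))" using I P_upd by simp
    qed (use a b in auto)
  next
    fix u' assume "P ({..<a} \<times> {..<n2} \<union> {a} \<times> {..<n2}) u'"
    moreover have "{..<a} \<times> {..<n2} \<union> {a} \<times> {..<n2} = {..<Suc a} \<times> {..<n2}" by auto
    ultimately show "P ({..<Suc a} \<times> {..<n2}) u'" by simp
  qed (use P in simp_all)
  show ?thesis
    unfolding gen_table_def
  proof (rule spec_For_const[where n=n1 and c="1 + n2 * Suc ?C" and I="\<lambda>a u'. P ({..<a} \<times> {..<n2}) u'"])
    show "P ({..<0} \<times> {..<n2}) s" unfolding P_def table_def
      using empty by (auto simp: islist_def)
    show "val s e1 = n1" by fact
  next
    fix a u assume a: "a < n1" and P: "P ({..<a} \<times> {..<n2}) u" and ag: "agree (writes (For l1 e1 (For l2 e2 ?body))) s u"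
    have "agree ?W s u" using ag unfolding gen_table_def .
    then have "agree ?W s (u([l1] := a))" by (auto simp: wr_gen intro!: agree_update[where oo=None])
    then show "spec (For l2 e2 ?body) (u([l1] := a)) (P ({..<Suc a} \<times> {..<n2})) (1 + n2 * Suc ?C)"
      by (rule loop2) (use a P P_upd in auto)
  qed (auto simp: P_def gen_cost_def algebra_simps)
qed

section \<open>The recurrences of the dynamic program\<close>

fun pre :: "'l btree \<Rightarrow> 'l btree list" where
  "pre (Leaf l) = [Leaf l]"
| "pre (Node a b) = Node a b # pre a @ pre b"

abbreviation sz :: "'l btree \<Rightarrow> nat" where "sz t \<equiv> length (pre t)"

lemma sz_pos [simp]: "0 < sz t"
  by (cases t) auto

lemma pre_not_Nil [simp]: "pre t \<noteq> []"
  by (cases t) auto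

lemma pre_0: "pre t ! 0 = t"
  by (cases t) auto

lemma set_pre: "set (pre t) = nodes t"
  by (induction t) auto

lemma sz_leaves: "Suc (sz t) = 2 * length (leaves t)"
  by (induction t) auto

lemma leaves_not_Nil [simp]: "leaves t \<noteq> []"
  by (induction t) auto

lemma sub_le: "v < sz t \<Longrightarrow> v + sz (pre t ! v) \<le> sz t"
proof (induction t arbitrary: v)
  case (Node a b)
  show ?case
  proof (cases v)
    case (Suc u)
    show ?thesis
    proof (cases "u < sz a")
      case True then show ?thesis using Node.IH(1)[OF True] Suc by (simp add: nth_append)
    next
      case False
      then have "u - sz a < sz b" using Node.prems Suc by simp
      from Node.IH(2)[OF this] show ?thesis using Suc False by (simp add: nth_append)
    qed
  qed simp
qed simp

text \<open>A subtree occupies a contiguous block of the preorder, so its nodes are reached by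
  offsets from its root.\<close>

lemma pre_nth:
  "v < sz t \<Longrightarrow> i < sz (pre t ! v) \<Longrightarrow> pre t ! (v + i) = pre (pre t ! v) ! i"
proof (induction t arbitrary: v)
  case (Node a b)
  show ?case
  proof (cases v)
    case (Suc u)
    show ?thesis
    proof (cases "u < sz a")
      case True
      with Node.prems Suc have i: "i < sz (pre a ! u)" by (simp add: nth_append)
      with sub_le[OF True] have "u + i < sz a" by simp
      then show ?thesis using Node.IH(1)[OF True i] Suc True by (simp add: nth_append)
    next
      case False
      then have u: "u - sz a < sz b" using Node.prems Suc by simp
      have "i < sz (pre b ! (u - sz a))" using Node.prems Suc False by (simp add: nth_append)
      from Node.IH(2)[OF u this] show ?thesis using Suc False by (simp add: nth_append)
    qed
  qed simp
qed simp

lemma pre_children: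
  assumes "v < sz t" "pre t ! v = Node a b"
  shows "v + 1 < sz t" "pre t ! (v + 1) = a" "v + 1 + sz a < sz t" "pre t ! (v + 1 + sz a) = b"
proof -
  have "0 < sz a" "0 < sz b" by (rule sz_pos)+
  moreover have "v + Suc (sz a + sz b) \<le> sz t" using sub_le[OF assms(1)] unfolding assms(2) by simp
  ultimately show "v + 1 < sz t" "v + 1 + sz a < sz t" by linarith+
  show "pre t ! (v + 1) = a" "pre t ! (v + 1 + sz a) = b"
    using pre_nth[OF assms(1), of 1] pre_nth[OF assms(1), of "1 + sz a"] unfolding assms(2)
    by (simp_all add: nth_append pre_0)
qed

definition child :: "'l btree \<Rightarrow> nat \<Rightarrow> nat \<Rightarrow> bool" where
  "child t v w \<longleftrightarrow> v < sz t \<and> (\<exists>a b. pre t ! v = Node a b \<and> (w = v + 1 \<or> w = v + 1 + sz a))"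

lemma child_Node: "child (Node a b) v w \<longleftrightarrow>
   (v = 0 \<and> (w = 1 \<or> w = 1 + sz a)) \<or>
   (0 < v \<and> v \<le> sz a \<and> child a (v - 1) (w - 1) \<and> 0 < w) \<or>
   (sz a < v \<and> child b (v - 1 - sz a) (w - 1 - sz a) \<and> sz a < w)"
proof (cases v)
  case 0 then show ?thesis by (auto simp: child_def)
next
  case (Suc u)
  show ?thesis
  proof (cases "u < sz a")
    case True
    then show ?thesis using Suc by (auto simp: child_def nth_append)
  next
    case False
    then show ?thesis using Suc by (auto simp: child_def nth_append)
  qed
qed

lemma child_bounds: "child t v w \<Longrightarrow> v < w \<and> w < sz t"
proof -
  assume "child t v w"
  then obtain a b where "v < sz t" "pre t ! v = Node a b" "w = v + 1 \<or> w = v + 1 + sz a"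
    unfolding child_def by blast
  with pre_children[OF this(1,2)] show ?thesis by auto
qed

lemma child_Node_cases:
  assumes "child (Node a b) v w"
  obtains "v = 0" "w = 1 \<or> w = 1 + sz a"
    | "0 < v" "child a (v - 1) (w - 1)" "1 < w" "w < 1 + sz a"
    | "sz a < v" "child b (v - 1 - sz a) (w - 1 - sz a)" "1 + sz a < w"
  using assms unfolding child_Node
proof (elim disjE conjE)
  assume "0 < v" "v \<le> sz a" "child a (v - 1) (w - 1)" "0 < w"
  moreover from child_bounds[OF this(3)] have "1 < w" "w < 1 + sz a" by linarith+
  ultimately show thesis using that(2) by blast
next
  assume "sz a < v" "child b (v - 1 - sz a) (w - 1 - sz a)" "sz a < w"
  moreover from child_bounds[OF this(2)] have "1 + sz a < w" by linarith
  ultimately show thesis using that(3) by blast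
qed (use that(1) in auto)

text \<open>Guarantees for the top-down pass that the lists written for the children of one node are
  not overwritten while another node is treated.\<close>

lemma child_unique: "child t v w \<Longrightarrow> child t v' w \<Longrightarrow> v = v'"
proof (induction t arbitrary: v v' w)
  case (Node a b)
  from Node.prems(1) show ?case
  proof (cases rule: child_Node_cases)
    case 1
    with Node.prems(2) show ?thesis by (cases rule: child_Node_cases) auto
  next
    case 2
    from Node.prems(2) show ?thesis
    proof (cases rule: child_Node_cases)
      case v': 2
      have "v - 1 = v' - 1" using Node.IH(1)[OF 2(2) v'(2)] .
      then show ?thesis using 2 v' by linarith
    qed (use 2 in auto)
  next
    case 3
    from Node.prems(2) show ?thesis
    proof (cases rule: child_Node_cases)
      case v': 3
      have "v - 1 - sz a = v' - 1 - sz a" using Node.IH(2)[OF 3(2) v'(2)] .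
      then show ?thesis using 3 v' by linarith
    qed (use 3 in auto)
  qed
qed (auto simp: child_def)

text \<open>Guarantees for the top-down pass that every node below the root gets its list from some
  parent.\<close>

lemma child_exists: "0 < w \<Longrightarrow> w < sz t \<Longrightarrow> \<exists>v. child t v w"
proof (induction t arbitrary: w)
  case (Node a b)
  consider "w = 1 \<or> w = 1 + sz a" | "1 < w" "w < 1 + sz a" | "1 + sz a < w"
    using Node.prems by linarith
  then show ?case
  proof cases
    case 1 then show ?thesis unfolding child_Node by blast
  next
    case 2
    then have "0 < w - 1" "w - 1 < sz a" by linarith+
    then obtain v where v: "child a v (w - 1)" using Node.IH(1) by blast
    then have "child (Node a b) (Suc v) w" unfolding child_Node using 2 child_bounds[OF v] by simp
    then show ?thesis by blast
  next
    case 3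
    then have "0 < w - 1 - sz a" "w - 1 - sz a < sz b" using Node.prems by auto
    then obtain v where v: "child b v (w - 1 - sz a)" using Node.IH(2) by blast
    then have "child (Node a b) (Suc (v + sz a)) w" unfolding child_Node using 3 by simp
    then show ?thesis by blast
  qed
qed simp

fun merge_cost :: "'l btree \<Rightarrow> nat" where
  "merge_cost (Leaf l) = 1"
| "merge_cost (Node a b) = sz a * sz b"

text \<open>In the induction, \<open>(1 + x + y)\<^sup>2\<close> leaves room for
  \<open>x\<^sup>2 + y\<^sup>2\<close> from the two subtrees and for the product
  \<open>x * y\<close> at their parent.\<close>

lemma sum_merge_cost: "(\<Sum>v<sz t. merge_cost (pre t ! v)) \<le> (sz t)\<^sup>2"
proof -
  have "sum_list (map merge_cost (pre t)) \<le> (sz t)\<^sup>2"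
    by (induction t) (auto simp: power2_eq_square algebra_simps)
  then show ?thesis by (simp add: sum_list_sum_nth atLeast0LessThan)
qed

definition cls :: "(nat + nat) btree \<Rightarrow> nat set" where "cls t = {c. Inl c \<in> set (leaves t)}"
definition vrs :: "(nat + nat) btree \<Rightarrow> nat set" where "vrs t = {x. Inr x \<in> set (leaves t)}"

lemma cls_simps [simp]: "cls (Leaf (Inl c)) = {c}" "cls (Leaf (Inr x)) = {}" "cls (Node a b) = cls a \<union> cls b"
  by (auto simp: cls_def)

lemma vrs_simps [simp]: "vrs (Leaf (Inl c)) = {}" "vrs (Leaf (Inr x)) = {x}" "vrs (Node a b) = vrs a \<union> vrs b"
  by (auto simp: vrs_def)

lemma finite_cls_vrs [simp]: "finite (cls t)" "finite (vrs t)"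
proof -
  have "Inl ` cls t \<subseteq> set (leaves t)" "Inr ` vrs t \<subseteq> set (leaves t)" by (auto simp: cls_def vrs_def)
  then show "finite (cls t)" "finite (vrs t)"
    by (meson finite_set finite_imageD finite_subset inj_Inl inj_Inr inj_onI sum.inject)+
qed

lemma leaves_nodes: "u \<in> nodes t \<Longrightarrow> set (leaves u) \<subseteq> set (leaves t)"
  by (induction t) auto

lemma distinct_nodes: "distinct (leaves t) \<Longrightarrow> u \<in> nodes t \<Longrightarrow> distinct (leaves u)"
  by (induction t) auto

text \<open>If the effect of a combined object depends only on the effects of its two parts, the
  family of all effects is obtained from the two smaller families. Exponentially many assignments
  thus reduce to few effects.\<close>

lemma image_image_product:
  assumes "\<And>x y. x \<in> P \<Longrightarrow> y \<in> Q \<Longrightarrow> h (g x y) = F (p x) (q y)"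
  shows "h ` ((\<lambda>(x, y). g x y) ` (P \<times> Q)) = (\<lambda>(x, y). F x y) ` (p ` P \<times> q ` Q)"
proof (intro equalityI subsetI)
  fix z assume "z \<in> h ` ((\<lambda>(x, y). g x y) ` (P \<times> Q))"
  then obtain x y where "x \<in> P" "y \<in> Q" "z = h (g x y)" by auto
  then have "z = F (p x) (q y)" "p x \<in> p ` P" "q y \<in> q ` Q" using assms by auto
  then show "z \<in> (\<lambda>(x, y). F x y) ` (p ` P \<times> q ` Q)" by (intro image_eqI[of _ _ "(p x, q y)"]) auto
next
  fix z assume "z \<in> (\<lambda>(x, y). F x y) ` (p ` P \<times> q ` Q)"
  then obtain x y where "x \<in> P" "y \<in> Q" "z = F (p x) (q y)" by auto
  then have "z = h (g x y)" "(x, y) \<in> P \<times> Q" using assms by auto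
  then show "z \<in> h ` ((\<lambda>(x, y). g x y) ` (P \<times> Q))" by (intro image_eqI[of _ _ "g x y"]) force+
qed

section \<open>Effects of partial assignments\<close>

text \<open>\<open>occ b x c\<close> means that giving the value \<open>b\<close> to variable
  \<open>x\<close> satisfies clause \<open>c\<close>. Clauses and variables are numbers, and leaves
  carry these numbers directly.\<close>

locale instance_data =
  fixes m n :: nat and occ :: "bool \<Rightarrow> nat \<Rightarrow> nat \<Rightarrow> bool" and T :: "(nat + nat) btree"
  assumes distinct_leaves: "distinct (leaves T)"
    and set_leaves: "set (leaves T) = Inl ` {..<m} \<union> Inr ` {..<n}"
begin

text \<open>
  An assignment is given by the set of its true variables, so that assignments of \<open>X\<close> are subsets of \<open>X\<close>.
  Then \<open>psA t\<close> is \<open>PS(F\<^sub>v)\<close> and \<open>psB t\<close> is \<open>PS(F\<^sub>\<not>\<^sub>v)\<close> for the subtree \<open>t\<close> at \<open>v\<close>.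
\<close>

definition satX :: "nat set \<Rightarrow> nat set \<Rightarrow> nat set" where
  "satX X \<tau> = {c. c < m \<and> (\<exists>x\<in>X. occ (x \<in> \<tau>) x c)}"

definition psA :: "(nat + nat) btree \<Rightarrow> nat set set" where
  "psA t = (\<lambda>\<tau>. satX (vrs t) \<tau> - cls t) ` Pow (vrs t)"

definition psB :: "(nat + nat) btree \<Rightarrow> nat set set" where
  "psB t = (\<lambda>\<tau>. satX ({..<n} - vrs t) \<tau> \<inter> cls t) ` Pow ({..<n} - vrs t)"

definition sols :: "(nat + nat) btree \<Rightarrow> nat set \<Rightarrow> nat set set" where
  "sols t A = {\<tau>. \<tau> \<subseteq> vrs t \<and> satX (vrs t) \<tau> - cls t = A}"

definition covered :: "(nat + nat) btree \<Rightarrow> nat set \<Rightarrow> nat set \<Rightarrow> nat set" where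
  "covered t B \<tau> = (satX (vrs t) \<tau> \<union> B) \<inter> cls t"

lemma node_facts:
  assumes "u \<in> nodes T"
  shows "cls u \<subseteq> {..<m}" "vrs u \<subseteq> {..<n}" "distinct (leaves u)"
  using leaves_nodes[OF assms] set_leaves distinct_nodes[OF distinct_leaves assms]
  by (auto simp: cls_def vrs_def)

lemma cls_T: "cls T = {..<m}" and vrs_T: "vrs T = {..<n}"
  using set_leaves by (auto simp: cls_def vrs_def)

lemma sz_T: "Suc (sz T) = 2 * (m + n)"
proof -
  have "length (leaves T) = card (Inl ` {..<m} \<union> Inr ` {..<n} :: (nat + nat) set)"
    using distinct_card[OF distinct_leaves] set_leaves by simp
  also have "\<dots> = m + n" by (subst card_Un_disjoint) (auto simp: card_image)
  finally show ?thesis using sz_leaves[of T] by simp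
qed

lemma finite_sols [simp]: "finite (sols t A)"
  by (rule finite_subset[of _ "Pow (vrs t)"]) (auto simp: sols_def)

lemma psA_sub: "A \<in> psA t \<Longrightarrow> A \<subseteq> {..<m}" by (auto simp: psA_def satX_def)

text \<open>Disjointness ensures that joining \<open>\<sigma>\<close> to \<open>\<tau>\<close> does
  not change the value of any variable of \<open>X\<close>, and conversely.\<close>

lemma satX_Un:
  assumes "X \<inter> Y = {}" "\<tau> \<subseteq> X" "\<sigma> \<subseteq> Y"
  shows "satX (X \<union> Y) (\<tau> \<union> \<sigma>) = satX X \<tau> \<union> satX Y \<sigma>"
proof -
  have "x \<in> X \<Longrightarrow> (x \<in> \<tau> \<union> \<sigma>) = (x \<in> \<tau>)" "x \<in> Y \<Longrightarrow> (x \<in> \<tau> \<union> \<sigma>) = (x \<in> \<sigma>)" for x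
    using assms by blast+
  then have "(\<exists>x\<in>X. occ (x \<in> \<tau> \<union> \<sigma>) x c) = (\<exists>x\<in>X. occ (x \<in> \<tau>) x c)"
    "(\<exists>x\<in>Y. occ (x \<in> \<tau> \<union> \<sigma>) x c) = (\<exists>x\<in>Y. occ (x \<in> \<sigma>) x c)" for c
    by (auto intro!: bex_cong simp del: Un_iff)
  then show ?thesis unfolding satX_def bex_Un by blast
qed

lemma Pow_Un_image: "Pow (X \<union> Y) = (\<lambda>(\<tau>, \<sigma>). \<tau> \<union> \<sigma>) ` (Pow X \<times> Pow Y)"
proof -
  have "Z = (Z \<inter> X) \<union> (Z \<inter> Y)" if "Z \<subseteq> X \<union> Y" for Z using that by blast
  then show ?thesis by (auto simp: image_iff)
qed

context
  fixes a b
  assumes ab: "Node a b \<in> nodes T"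
begin

lemma disj: "cls a \<inter> cls b = {}" "vrs a \<inter> vrs b = {}"
  using node_facts(3)[OF ab] by (auto simp: cls_def vrs_def)

text \<open>The clauses removed from the effect of a child lie below the node, so they are removed
  from the effect of the node anyway.\<close>

lemma psA_Node: "psA (Node a b) = (\<lambda>(A1, A2). (A1 \<union> A2) - cls (Node a b)) ` (psA a \<times> psA b)"
proof -
  have "satX (vrs a \<union> vrs b) (\<tau> \<union> \<sigma>) - (cls a \<union> cls b)
     = ((satX (vrs a) \<tau> - cls a) \<union> (satX (vrs b) \<sigma> - cls b)) - (cls a \<union> cls b)"
    if "\<tau> \<in> Pow (vrs a)" "\<sigma> \<in> Pow (vrs b)" for \<tau> \<sigma>
    unfolding satX_Un[OF disj(2) that[unfolded Pow_iff]] by blast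
  then show ?thesis
    unfolding psA_def vrs_simps cls_simps Pow_Un_image by (rule image_image_product)
qed

text \<open>The variables outside a child are those outside the parent together with those of the
  sibling. The clauses lost in \<open>B\<close> lie outside the parent and those lost in the effect
  of the sibling lie below the sibling, so neither belong to the child.\<close>

lemma psB_child:
  shows "psB a = (\<lambda>(B, A2). (B \<union> A2) \<inter> cls a) ` (psB (Node a b) \<times> psA b)"
    and "psB b = (\<lambda>(B, A1). (B \<union> A1) \<inter> cls b) ` (psB (Node a b) \<times> psA a)"
proof -
  let ?O = "{..<n} - vrs (Node a b)"
  have out: "{..<n} - vrs a = ?O \<union> vrs b" "{..<n} - vrs b = ?O \<union> vrs a"
    "?O \<inter> vrs b = {}" "?O \<inter> vrs a = {}"
    using node_facts(2)[OF ab] disj by auto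
  have 1: "satX (?O \<union> vrs b) (\<tau> \<union> \<sigma>) \<inter> cls a = ((satX ?O \<tau> \<inter> cls (Node a b)) \<union> (satX (vrs b) \<sigma> - cls b)) \<inter> cls a"
    if "\<tau> \<in> Pow ?O" "\<sigma> \<in> Pow (vrs b)" for \<tau> \<sigma>
    unfolding satX_Un[OF out(3) that[unfolded Pow_iff]] using disj by auto
  have 2: "satX (?O \<union> vrs a) (\<tau> \<union> \<sigma>) \<inter> cls b = ((satX ?O \<tau> \<inter> cls (Node a b)) \<union> (satX (vrs a) \<sigma> - cls a)) \<inter> cls b"
    if "\<tau> \<in> Pow ?O" "\<sigma> \<in> Pow (vrs a)" for \<tau> \<sigma>
    unfolding satX_Un[OF out(4) that[unfolded Pow_iff]] using disj by auto
  show "psB a = (\<lambda>(B, A2). (B \<union> A2) \<inter> cls a) ` (psB (Node a b) \<times> psA b)"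
    unfolding psB_def psA_def out(1) Pow_Un_image using 1 by (rule image_image_product)
  show "psB b = (\<lambda>(B, A1). (B \<union> A1) \<inter> cls b) ` (psB (Node a b) \<times> psA a)"
    unfolding psB_def psA_def out(2) Pow_Un_image using 2 by (rule image_image_product)
qed

definition joined :: "nat set \<Rightarrow> nat set \<Rightarrow> nat set set" where
  "joined A1 A2 = (\<lambda>(\<tau>, \<sigma>). \<tau> \<union> \<sigma>) ` (sols a A1 \<times> sols b A2)"

lemma joined_inj: "inj_on (\<lambda>(\<tau>, \<sigma>). \<tau> \<union> \<sigma>) (sols a A1 \<times> sols b A2)"
proof (rule inj_onI, clarify)
  fix \<tau> \<sigma> \<tau>' \<sigma>' assume "\<tau> \<in> sols a A1" "\<sigma> \<in> sols b A2" "\<tau>' \<in> sols a A1" "\<sigma>' \<in> sols b A2"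
    and eq: "\<tau> \<union> \<sigma> = \<tau>' \<union> \<sigma>'"
  then have "\<tau> \<subseteq> vrs a" "\<tau>' \<subseteq> vrs a" "\<sigma> \<subseteq> vrs b" "\<sigma>' \<subseteq> vrs b" by (auto simp: sols_def)
  with eq disj(2) show "\<tau> = \<tau>' \<and> \<sigma> = \<sigma>'" by blast
qed

text \<open>A union determines its two parts because the variables of the children are disjoint, and
  each part determines its effect. Hence no assignment is contributed by two pairs of
  effects.\<close>

lemma joined_disjoint:
  assumes "(A1, A2) \<noteq> (A1', A2')"
  shows "joined A1 A2 \<inter> joined A1' A2' = {}"
proof (rule ccontr)
  assume "joined A1 A2 \<inter> joined A1' A2' \<noteq> {}"
  then obtain \<tau> \<sigma> \<tau>' \<sigma>' where 1: "\<tau> \<in> sols a A1" "\<sigma> \<in> sols b A2" "\<tau>' \<in> sols a A1'" "\<sigma>' \<in> sols b A2'"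
    "\<tau> \<union> \<sigma> = \<tau>' \<union> \<sigma>'" by (auto simp: joined_def)
  then have "\<tau> \<subseteq> vrs a" "\<tau>' \<subseteq> vrs a" "\<sigma> \<subseteq> vrs b" "\<sigma>' \<subseteq> vrs b" by (auto simp: sols_def)
  with 1(5) disj(2) have "\<tau> = \<tau>' \<and> \<sigma> = \<sigma>'" by blast
  with 1 assms show False by (auto simp: sols_def)
qed

text \<open>Splitting an assignment along the variables of the children yields exactly one pair of
  child effects; the pairs compatible with \<open>A\<close> therefore exhaust its solutions.\<close>

lemma sols_Node:
  "sols (Node a b) A = (\<Union>(A1, A2) \<in> {(A1, A2). A1 \<in> psA a \<and> A2 \<in> psA b \<and> (A1 \<union> A2) - cls (Node a b) = A}. joined A1 A2)"
proof -
  have eq: "satX (vrs a \<union> vrs b) (\<tau> \<union> \<sigma>) - (cls a \<union> cls b)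
     = ((satX (vrs a) \<tau> - cls a) \<union> (satX (vrs b) \<sigma> - cls b)) - (cls a \<union> cls b)"
    if "\<tau> \<subseteq> vrs a" "\<sigma> \<subseteq> vrs b" for \<tau> \<sigma>
    unfolding satX_Un[OF disj(2) that] by blast
  show ?thesis (is "?L = ?R")
  proof
    show "?L \<subseteq> ?R"
    proof
      fix \<rho> assume r: "\<rho> \<in> ?L"
      let ?t = "\<rho> \<inter> vrs a" and ?s = "\<rho> \<inter> vrs b"
      have \<rho>: "\<rho> = ?t \<union> ?s" using r by (auto simp: sols_def)
      let ?A1 = "satX (vrs a) ?t - cls a" and ?A2 = "satX (vrs b) ?s - cls b"
      have h: "?t \<in> sols a ?A1" "?s \<in> sols b ?A2" by (auto simp: sols_def)
      have "?A1 \<in> psA a" "?A2 \<in> psA b" unfolding psA_def by blast+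
      moreover have "\<rho> \<in> joined ?A1 ?A2" unfolding joined_def
      proof (rule image_eqI)
        show "\<rho> = (case (?t, ?s) of (\<tau>, \<sigma>) \<Rightarrow> \<tau> \<union> \<sigma>)" unfolding prod.case by (rule \<rho>)
      qed (use h in simp)
      moreover have "(?A1 \<union> ?A2) - cls (Node a b) = A"
        using r eq[of ?t ?s] \<rho>[symmetric] by (simp add: sols_def)
      ultimately show "\<rho> \<in> ?R" by blast
    qed
    show "?R \<subseteq> ?L"
    proof
      fix \<rho> assume "\<rho> \<in> ?R"
      then obtain A1 A2 \<tau> \<sigma> where 1: "(A1 \<union> A2) - cls (Node a b) = A" "\<tau> \<in> sols a A1" "\<sigma> \<in> sols b A2" "\<rho> = \<tau> \<union> \<sigma>"
        by (auto simp: joined_def)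
      then show "\<rho> \<in> ?L" using eq[of \<tau> \<sigma>] by (auto simp: sols_def)
    qed
  qed
qed

text \<open>On the clauses of \<open>a\<close>, the assignment of \<open>b\<close> acts only through
  its outside effect \<open>A2\<close>, so \<open>B\<close> and \<open>A2\<close> together are all
  the help that \<open>a\<close> receives; \<open>b\<close> is symmetric. The two parts on the right
  are disjoint, so counts multiply and weights add.\<close>

lemma covered_Node:
  assumes "\<tau> \<in> sols a A1" "\<sigma> \<in> sols b A2"
  shows "covered (Node a b) B (\<tau> \<union> \<sigma>)
     = covered a ((B \<union> A2) \<inter> cls a) \<tau> \<union> covered b ((B \<union> A1) \<inter> cls b) \<sigma>"
proof -
  have 1: "\<tau> \<subseteq> vrs a" "\<sigma> \<subseteq> vrs b" "A1 = satX (vrs a) \<tau> - cls a" "A2 = satX (vrs b) \<sigma> - cls b"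
    using assms by (auto simp: sols_def)
  show ?thesis
    unfolding covered_def vrs_simps satX_Un[OF disj(2) 1(1,2)] 1(3,4) cls_simps using disj(1) by auto
qed

lemma covered_disj: "covered a B \<tau> \<inter> covered b B' \<sigma> = {}"
  using disj(1) by (auto simp: covered_def)

end

lemma psA_leaf: "psA (Leaf (Inl c)) = {{}}"
   "psA (Leaf (Inr x)) = {{c. c < m \<and> occ False x c}, {c. c < m \<and> occ True x c}}"
proof -
  show "psA (Leaf (Inl c)) = {{}}" by (auto simp: psA_def satX_def)
  have "Pow {x} = {{}, {x}}" by auto
  then show "psA (Leaf (Inr x)) = {{c. c < m \<and> occ False x c}, {c. c < m \<and> occ True x c}}"
    by (simp add: psA_def satX_def)
qed

lemma psB_T: "psB T = {{}}" and psA_T: "psA T = {{}}"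
  by (auto simp: psB_def psA_def vrs_T cls_T satX_def)

lemma psB_var: "psB (Leaf (Inr x)) = {{}}"
  by (auto simp: psB_def)

end

section \<open>Computing the lists of precisely satisfiable clause sets\<close>

text \<open>
  Nodes are numbered in preorder. For the node \<open>v\<close>, \<open>aTag\<close> and \<open>aArg\<close> hold its kind and label, \<open>aEnd\<close>
  the first number behind its subtree, \<open>aInn\<close> the clauses in its subtree, and \<open>aA\<close>, \<open>aB\<close> the lists for \<open>psA\<close>, \<open>psB\<close>
  with lengths \<open>acA\<close>, \<open>acB\<close>. The position in \<open>aA\<close> of the set arising from the sets \<open>i\<close>, \<open>j\<close> of the children is
  \<open>aI[v, i, j]\<close>; the position in \<open>aB\<close> of the set arising from the set \<open>j\<close> of the parent of \<open>v\<close> and the set \<open>i\<close>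
  of the sibling of \<open>v\<close> is \<open>aJ[v, j, i]\<close>.
\<close>

abbreviation (input) "sn \<equiv> 5 :: nat"
abbreviation (input) "sN \<equiv> 6 :: nat"
abbreviation (input) "sv \<equiv> 7 :: nat"
abbreviation (input) "sl \<equiv> 8 :: nat"
abbreviation (input) "sr \<equiv> 9 :: nat"
abbreviation (input) "lv \<equiv> 27 :: nat"
abbreviation (input) "aOcc \<equiv> 40 :: nat"
abbreviation (input) "aTag \<equiv> 41 :: nat"
abbreviation (input) "aArg \<equiv> 42 :: nat"
abbreviation (input) "aEnd \<equiv> 43 :: nat"
abbreviation (input) "aInn \<equiv> 44 :: nat"
abbreviation (input) "acA \<equiv> 45 :: nat"
abbreviation (input) "aA \<equiv> 46 :: nat"
abbreviation (input) "acB \<equiv> 47 :: nat"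
abbreviation (input) "aB \<equiv> 48 :: nat"
abbreviation (input) "aI \<equiv> 49 :: nat"
abbreviation (input) "aJ \<equiv> 50 :: nat"

text \<open>Disjunction of bits through truncated subtraction, the only binary operation of the
  language.\<close>

definition bor :: "exp \<Rightarrow> exp \<Rightarrow> exp" where
  "bor a b = Sub (N 1) (Sub (Sub (N 1) a) b)"

lemma val_bor: "val s a = of_bool P \<Longrightarrow> val s b = of_bool Q \<Longrightarrow> val s (bor a b) = of_bool (P \<or> Q)"
  by (simp add: bor_def)

section \<open>Bottom-up pass for the outside effects\<close>

text \<open>The only outside effect is the empty set, whose characteristic vector is already present
  in memory that has never been written.\<close>

definition clause_leafA :: prog where
  "clause_leafA = (Asg aEnd [V sv] (Inc (V sv)) ;; Asg aInn [V sv, At aArg [V sv]] (N 1) ;; Asg acA [V sv] (N 1))"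

text \<open>The two truth values play the role of the sets of a left child; the second loop has a
  single dummy index.\<close>

definition var_leafA :: prog where
  "var_leafA = (Asg aEnd [V sv] (Inc (V sv)) ;;
     gen_table sv acA aA aI (N 2) (N 1) (At aOcc [V l1, At aArg [V sv], V lc]))"

definition innerA :: prog where
  "innerA = (Asg sl [] (Inc (V sv)) ;; Asg sr [] (At aEnd [V sl]) ;; Asg aEnd [V sv] (At aEnd [V sr]) ;;
     For lc (V sm) (Asg aInn [V sv, V lc] (bor (At aInn [V sl, V lc]) (At aInn [V sr, V lc]))) ;;
     gen_table sv acA aA aI (At acA [V sl]) (At acA [V sr])
       (Sub (bor (At aA [V sl, V l1, V lc]) (At aA [V sr, V l2, V lc])) (At aInn [V sv, V lc])))"

definition nodeA :: prog where
  "nodeA = Ife (At aTag [V sv]) (N 1) clause_leafA (Ife (At aTag [V sv]) (N 2) var_leafA innerA)"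

text \<open>Decreasing preorder numbers visit children before their parent.\<close>

definition treeA :: prog where
  "treeA = (Asg sv [] (V sN) ;; For lv (V sN) (Asg sv [] (Sub (V sv) (N 1)) ;; nodeA))"

lemma wr_nodeA: "writes nodeA = {(43, Some 7), (44, Some 7), (45, Some 7), (24, None), (25, None), (49, Some 7),
    (10, None), (23, None), (11, None), (22, None), (46, Some 7), (52, Some 22), (8, None), (9, None)}"
  unfolding nodeA_def clause_leafA_def var_leafA_def innerA_def
  by (simp add: wr_gen insert_commute)

lemma nodeA_keep:
  assumes ag: "agree (writes nodeA) s u" and t: "t \<in> {43, 44, 45, 46, 49}" and w: "w \<noteq> s [sv]"
  shows "u (t # w # l) = s (t # w # l)"
proof (rule agree_index[OF ag])
  fix oo assume "(t, oo) \<in> writes nodeA"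
  then have "oo = Some sv" using t by (auto simp: wr_nodeA)
  then show "\<exists>v. oo = Some v \<and> v \<notin> fst ` writes nodeA \<and> w \<noteq> s [v]" using w by (simp add: wr_nodeA)
qed

lemma image_nth_product:
  "case_prod (\<lambda>i j. g (xs ! i) (ys ! j)) ` ({..<length xs} \<times> {..<length ys}) = (\<lambda>(x, y). g x y) ` (set xs \<times> set ys)"
proof -
  have "(\<lambda>(x, y). g x y) ` ((\<lambda>i. xs ! i) ` {..<length xs} \<times> (\<lambda>j. ys ! j) ` {..<length ys})
     = (\<lambda>p. p) ` ((\<lambda>(i, j). g (xs ! i) (ys ! j)) ` ({..<length xs} \<times> {..<length ys}))"
    by (rule image_image_product[symmetric]) simp
  moreover have "(\<lambda>i. xs ! i) ` {..<length xs} = set xs" "(\<lambda>i. ys ! i) ` {..<length ys} = set ys"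
    by (auto simp: set_conv_nth)
  ultimately show ?thesis by (simp only: image_ident)
qed

context instance_data
begin

definition rt :: "nat \<Rightarrow> nat" where "rt v = v + 1 + sz (pre T ! (v + 1))"

definition occs :: "nat \<Rightarrow> nat \<Rightarrow> nat set" where "occs b x = {c. c < m \<and> occ (b = 1) x c}"

fun tagged :: "store \<Rightarrow> nat \<Rightarrow> (nat + nat) btree \<Rightarrow> bool" where
  "tagged s v (Leaf (Inl c)) \<longleftrightarrow> s [aTag, v] = 0 \<and> s [aArg, v] = c"
| "tagged s v (Leaf (Inr x)) \<longleftrightarrow> s [aTag, v] = 1 \<and> s [aArg, v] = x"
| "tagged s v (Node a b) \<longleftrightarrow> s [aTag, v] = 2"

definition static :: "store \<Rightarrow> bool" where
  "static s \<longleftrightarrow> s [sm] = m \<and> s [sn] = n \<and> s [sN] = sz T \<and> (\<forall>v<sz T. tagged s v (pre T ! v)) \<and>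
     (\<forall>b<2. \<forall>x<n. \<forall>c<m. s [aOcc, b, x, c] = of_bool (c \<in> occs b x))"

lemma tagged_cong: "u [aTag, v] = s [aTag, v] \<Longrightarrow> u [aArg, v] = s [aArg, v] \<Longrightarrow> tagged u v t = tagged s v t"
  by (cases "(s, v, t)" rule: tagged.cases) auto

lemma static_agree:
  assumes "agree w s u" "{4, 5, 6, 40, 41, 42} \<inter> fst ` w = {}"
  shows "static u = static s"
proof -
  have "u (t # l) = s (t # l)" if "t \<in> {4, 5, 6, 40, 41, 42}" for t l
    using that assms(2) by (intro agree_tag[OF assms(1)]) blast
  then show ?thesis unfolding static_def by (simp add: tagged_cong[of u _ s])
qed

fun tableA :: "store \<Rightarrow> (nat \<Rightarrow> nat set list) \<Rightarrow> nat \<Rightarrow> (nat + nat) btree \<Rightarrow> bool" where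
  "tableA s LA v (Leaf (Inl c)) \<longleftrightarrow> True"
| "tableA s LA v (Leaf (Inr x)) \<longleftrightarrow> table s aI v (\<lambda>b _. occs b x) (LA v) ({..<2} \<times> {..<1::nat})"
| "tableA s LA v (Node a b) \<longleftrightarrow> table s aI v (\<lambda>i1 i2. (LA (v + 1) ! i1 \<union> LA (rt v) ! i2) - cls (Node a b)) (LA v)
     ({..<length (LA (v + 1))} \<times> {..<length (LA (rt v))})"

text \<open>\<open>LA\<close> names the lists that the arrays represent. It is not part of the store
  and is extended by one node at a time in the induction.\<close>

definition doneA :: "store \<Rightarrow> (nat \<Rightarrow> nat set list) \<Rightarrow> nat \<Rightarrow> bool" where
  "doneA s LA v \<longleftrightarrow> s [aEnd, v] = v + sz (pre T ! v) \<and>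
     (\<forall>c<m. s [aInn, v, c] = of_bool (c \<in> cls (pre T ! v))) \<and>
     islist s acA aA v (LA v) \<and> set (LA v) = psA (pre T ! v) \<and> tableA s LA v (pre T ! v)"

lemma tableA_cong:
  assumes "\<And>l. u (aI # v # l) = s (aI # v # l)" "LA' v = LA v" "LA' (v + 1) = LA (v + 1)" "LA' (rt v) = LA (rt v)"
  shows "tableA u LA' v t = tableA s LA v t"
  using assms by (cases "(s, LA, v, t)" rule: tableA.cases) (auto simp: table_cong[of u aI v s])

lemma doneA_cong:
  assumes "\<And>t l. t \<in> {aEnd, aInn, acA, aA, aI} \<Longrightarrow> u (t # v # l) = s (t # v # l)" "u [sm] = s [sm]"
    "LA' v = LA v" "LA' (v + 1) = LA (v + 1)" "LA' (rt v) = LA (rt v)"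
  shows "doneA u LA' v = doneA s LA v"
  using assms unfolding doneA_def by (simp add: tableA_cong[of u v s LA' LA] islist_cong[of u acA v s aA])

lemma doneA_agree:
  assumes "agree w s u" "{4, 43, 44, 45, 46, 49} \<inter> fst ` w = {}"
  shows "doneA u LA v = doneA s LA v"
proof -
  have "u (t # l) = s (t # l)" if "t \<in> {4, 43, 44, 45, 46, 49}" for t l
    using that assms(2) by (intro agree_tag[OF assms(1)]) blast
  then show ?thesis by (intro doneA_cong) auto
qed

text \<open>Zeros at nodes not yet treated have three uses: new lists have length 0, the leaves rely
  on zero bits in \<open>aInn\<close>, and a clause leaf finds its empty set in
  \<open>aA\<close>.\<close>

definition freshA :: "store \<Rightarrow> nat \<Rightarrow> bool" where
  "freshA s b \<longleftrightarrow> (\<forall>w<b. \<forall>l. s (acA # w # l) = 0 \<and> s (aA # w # l) = 0 \<and> s (aInn # w # l) = 0)"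

lemma pre_in_nodes: "v < sz T \<Longrightarrow> pre T ! v \<in> nodes T"
  using set_pre[of T] nth_mem by blast

lemma length_psA: "doneA s LA v \<Longrightarrow> length (LA v) = card (psA (pre T ! v))"
  unfolding doneA_def islist_def by (metis distinct_card)

lemma rt_Node: "v < sz T \<Longrightarrow> pre T ! v = Node a b \<Longrightarrow> rt v = v + 1 + sz a \<and> pre T ! (v + 1) = a \<and> pre T ! rt v = b
   \<and> v + 1 < sz T \<and> rt v < sz T"
  using pre_children[of v T a b] by (simp add: rt_def)

context
  fixes k :: nat
  assumes k: "\<And>t. t \<in> nodes T \<Longrightarrow> card (psA t) \<le> k" "\<And>t. t \<in> nodes T \<Longrightarrow> card (psB t) \<le> k"
begin

definition costA :: nat where
  "costA = gen_cost k k k m + gen_cost 2 1 k m + 2 * m + 10"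

lemma nodeA_correct:
  assumes v: "s [sv] = v" "v < sz T" and st: "static s"
    and later: "\<And>w. v < w \<Longrightarrow> w < sz T \<Longrightarrow> doneA s LA w" and fresh: "freshA s (Suc v)"
  shows "spec nodeA s (\<lambda>u. \<exists>xs. doneA u (LA(v := xs)) v) costA"
proof -
  let ?t = "pre T ! v"
  have t: "?t \<in> nodes T" using v pre_in_nodes by blast
  have tag: "tagged s v ?t" and sm: "s [sm] = m" using st v by (auto simp: static_def)
  have zA: "s [acA, v] = 0" using fresh by (simp add: freshA_def)
  show ?thesis
  proof (cases ?t)
    case (Leaf y)
    show ?thesis
    proof (cases y)
      case (Inl c)
      let ?u = "s([aEnd, v] := Suc v, [aInn, v, c] := 1, [acA, v] := 1)"
      have "doneA ?u (LA(v := [{}])) v"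
        using fresh sm unfolding doneA_def Leaf Inl
        by (auto simp: psA_leaf islist_def freshA_def)
      moreover have "spec clause_leafA s (\<lambda>u. u = ?u) 3"
        unfolding clause_leafA_def spec_def using v tag Leaf Inl by auto
      ultimately show ?thesis
        unfolding nodeA_def spec_def using v tag Leaf Inl by (auto simp: costA_def simp del: fun_upd_apply)
    next
      case (Inr x)
      let ?E = "At aOcc [V l1, At aArg [V sv], V lc]"
      let ?s = "s([aEnd, v] := Suc v)"
      have x: "x < n" using node_facts(2)[OF t] Leaf Inr by auto
      have im: "case_prod (\<lambda>b _. occs b x) ` ({..<2} \<times> {..<1::nat}) = psA ?t"
      proof -
        have p: "{..<2} \<times> {..<1} = {(0, 0), (1 :: nat, 0 :: nat)}" by auto
        show ?thesis unfolding Leaf Inr psA_leaf p by (simp add: occs_def)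
      qed
      have sp: "spec (gen_table sv acA aA aI (N 2) (N 1) ?E) ?s (\<lambda>u. \<exists>xs. islist u acA aA v xs \<and>
         set xs = case_prod (\<lambda>b _. occs b x) ` ({..<2} \<times> {..<1::nat}) \<and> table u aI v (\<lambda>b _. occs b x) xs ({..<2} \<times> {..<1::nat}))
         (gen_cost 2 1 k m)"
      proof (rule gen_correct)
        fix u i1 i2 c assume ag: "agree (writes (gen_table sv acA aA aI (N 2) (N 1) ?E)) ?s u"
          and h: "i1 < 2" "c < m" "u [l1] = i1" "u [lc] = c"
        have "u [sv] = v" "u [aArg, v] = x" "u [aOcc, i1, x, c] = s [aOcc, i1, x, c]"
          using agree_tag[OF ag, of sv] agree_tag[OF ag, of aArg] agree_tag[OF ag, of aOcc] v tag Leaf Inr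
          by (auto simp: wr_gen)
        then show "val u ?E = of_bool (c \<in> occs i1 x)" using h x st by (simp add: static_def)
      next
        show "card (case_prod (\<lambda>b _. occs b x) ` ({..<2} \<times> {..<1::nat})) \<le> k"
          unfolding im using k(1)[OF t] .
      qed (use v sm zA in \<open>auto simp: occs_def\<close>)
      have "spec var_leafA s (\<lambda>u. \<exists>xs. doneA u (LA(v := xs)) v) (Suc (gen_cost 2 1 k m))"
        unfolding var_leafA_def
      proof (rule spec_AsgSeq, rule spec_mono)
        show "spec (gen_table sv acA aA aI (N 2) (N 1) ?E) (s(aEnd # map (val s) [V sv] := val s (Inc (V sv))))
          (\<lambda>u. \<exists>xs. islist u acA aA v xs \<and>
         set xs = case_prod (\<lambda>b _. occs b x) ` ({..<2} \<times> {..<1::nat}) \<and> table u aI v (\<lambda>b _. occs b x) xs ({..<2} \<times> {..<1::nat}))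
         (gen_cost 2 1 k m)" using sp v by simp
      next
        fix u assume "\<exists>xs. islist u acA aA v xs \<and>
         set xs = case_prod (\<lambda>b _. occs b x) ` ({..<2} \<times> {..<1::nat}) \<and> table u aI v (\<lambda>b _. occs b x) xs ({..<2} \<times> {..<1::nat})"
         and "agree (writes (gen_table sv acA aA aI (N 2) (N 1) ?E)) (s(aEnd # map (val s) [V sv] := val s (Inc (V sv)))) u"
        then obtain xs where xs: "islist u acA aA v xs" "set xs = psA ?t" "table u aI v (\<lambda>b _. occs b x) xs ({..<2} \<times> {..<1::nat})"
          and ag: "agree (writes (gen_table sv acA aA aI (N 2) (N 1) ?E)) ?s u" using v unfolding im by auto
        have "u [aEnd, v] = Suc v" "\<And>c. u [aInn, v, c] = 0"
          using agree_tag[OF ag, of aEnd] agree_tag[OF ag, of aInn] fresh by (auto simp: wr_gen freshA_def)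
        then have "doneA u (LA(v := xs)) v" using xs unfolding doneA_def by (simp add: Leaf Inr)
        then show "\<exists>xs. doneA u (LA(v := xs)) v" by blast
      qed simp
      then show ?thesis
        unfolding nodeA_def using tag Leaf Inr v
        by (intro spec_Ife[where c="Suc (Suc (gen_cost 2 1 k m))"] spec_Ife[where c="Suc (gen_cost 2 1 k m)"])
          (auto simp: costA_def)
    qed
  next
    case (Node a b)
    let ?l = "v + 1" and ?r = "rt v"
    have lr: "?r = v + 1 + sz a" "pre T ! ?l = a" "pre T ! ?r = b" "?l < sz T" "?r < sz T"
      using rt_Node[OF v(2) Node] by auto
    have vr: "v < ?r" using lr by simp
    have dl: "doneA s LA ?l" and dr: "doneA s LA ?r" using later lr vr by auto
    have ta: "a \<in> nodes T" "b \<in> nodes T" using pre_in_nodes lr by metis+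
    let ?s = "s([sl] := ?l, [sr] := ?r, [aEnd, v] := v + sz ?t)"
    let ?f = "\<lambda>i1 i2. (LA ?l ! i1 \<union> LA ?r ! i2) - cls ?t"
    let ?nl = "length (LA ?l)" and ?nr = "length (LA ?r)"
    have len: "?nl \<le> k" "?nr \<le> k" using length_psA[OF dl] length_psA[OF dr] k(1) ta lr by auto
    have im: "case_prod ?f ` ({..<?nl} \<times> {..<?nr}) = psA ?t"
    proof -
      have "case_prod ?f ` ({..<?nl} \<times> {..<?nr}) = (\<lambda>(x, y). (x \<union> y) - cls ?t) ` (set (LA ?l) \<times> set (LA ?r))"
        by (rule image_nth_product)
      moreover have "set (LA ?l) = psA a" "set (LA ?r) = psA b" using dl dr lr by (auto simp: doneA_def)
      ultimately show ?thesis using psA_Node[of a b] t Node by simp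
    qed
    let ?E = "Sub (bor (At aA [V sl, V l1, V lc]) (At aA [V sr, V l2, V lc])) (At aInn [V sv, V lc])"
    let ?gen = "gen_table sv acA aA aI (At acA [V sl]) (At acA [V sr]) ?E"
    let ?inn = "For lc (V sm) (Asg aInn [V sv, V lc] (bor (At aInn [V sl, V lc]) (At aInn [V sr, V lc])))"
    have inn: "spec ?inn ?s (\<lambda>u. \<forall>c<m. u [aInn, v, c] = of_bool (c \<in> cls ?t)) (1 + 2 * m)"
    proof (rule spec_For_const[where n=m and c=1 and I="\<lambda>j u. \<forall>c<j. u [aInn, v, c] = of_bool (c \<in> cls ?t)"])
      fix j u assume j: "j < m" and I: "\<forall>c<j. u [aInn, v, c] = of_bool (c \<in> cls ?t)" and ag: "agree (writes ?inn) ?s u"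
      have 1: "u [sv] = v" "u [sl] = ?l" "u [sr] = ?r"
        using agree_tag[OF ag, of sv] agree_tag[OF ag, of sl] agree_tag[OF ag, of sr] v by auto
      have "u [aInn, ?l, j] = s [aInn, ?l, j]" "u [aInn, ?r, j] = s [aInn, ?r, j]"
        using agree_index[OF ag, of aInn] v vr by auto
      then have "u [aInn, ?l, j] = of_bool (j \<in> cls a)" "u [aInn, ?r, j] = of_bool (j \<in> cls b)"
        using dl dr lr j by (auto simp: doneA_def)
      then have "val (u([lc] := j)) (bor (At aInn [V sl, V lc]) (At aInn [V sr, V lc])) = of_bool (j \<in> cls a \<or> j \<in> cls b)"
        using 1 by (intro val_bor) auto
      then show "spec (Asg aInn [V sv, V lc] (bor (At aInn [V sl, V lc]) (At aInn [V sr, V lc]))) (u([lc] := j))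
        (\<lambda>u. \<forall>c<Suc j. u [aInn, v, c] = of_bool (c \<in> cls ?t)) 1"
        unfolding spec_def using 1 I Node by (auto simp: less_Suc_eq)
    qed (use sm in auto)
    have spec2: "spec (?inn ;; ?gen) ?s (\<lambda>u. \<exists>xs. doneA u (LA(v := xs)) v) (1 + 2 * m + gen_cost ?nl ?nr k m)"
    proof (rule spec_Seq[OF inn])
      fix u assume I: "\<forall>c<m. u [aInn, v, c] = of_bool (c \<in> cls ?t)" and ag: "agree (writes ?inn) ?s u"
      have u: "u [sv] = v" "u [sl] = ?l" "u [sr] = ?r" "u [sm] = m" "u [aEnd, v] = v + sz ?t"
         "\<And>w l. u (acA # w # l) = s (acA # w # l)" "\<And>w l. u (aA # w # l) = s (aA # w # l)"
        using agree_tag[OF ag, of sv] agree_tag[OF ag, of sl] agree_tag[OF ag, of sr] agree_tag[OF ag, of sm]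
          agree_tag[OF ag, of aEnd] agree_tag[OF ag, of acA] agree_tag[OF ag, of aA] v sm by auto
      show "spec ?gen u (\<lambda>u. \<exists>xs. doneA u (LA(v := xs)) v) (gen_cost ?nl ?nr k m)"
      proof (rule spec_mono[OF gen_correct])
        show "val u (At acA [V sl]) = ?nl" using u dl by (simp add: doneA_def islist_def)
      next
        fix u' assume ag': "agree (writes ?gen) u u'"
        have "u' [sr] = ?r" "u' [acA, ?r] = u [acA, ?r]"
          using agree_tag[OF ag', of sr] agree_index[OF ag', of acA ?r] u vr by (auto simp: wr_gen)
        then show "val u' (At acA [V sr]) = ?nr" using u dr by (simp add: doneA_def islist_def)
      next
        fix u' i1 i2 c assume ag': "agree (writes ?gen) u u'" and h: "i1 < ?nl" "i2 < ?nr" "c < m" "u' [l1] = i1" "u' [l2] = i2" "u' [lc] = c"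
        have 1: "u' [sr] = ?r" "u' [sl] = ?l" "u' [sv] = v" "u' [aA, ?r, i2, c] = s [aA, ?r, i2, c]"
          "u' [aA, ?l, i1, c] = s [aA, ?l, i1, c]" "u' [aInn, v, c] = of_bool (c \<in> cls ?t)"
          using agree_tag[OF ag', of sr] agree_tag[OF ag', of sl] agree_tag[OF ag', of sv]
            agree_index[OF ag', of aA ?r] agree_index[OF ag', of aA ?l] agree_tag[OF ag', of aInn] u vr I h
          by (auto simp: wr_gen)
        have "val u' (bor (At aA [V sl, V l1, V lc]) (At aA [V sr, V l2, V lc])) = of_bool (c \<in> LA ?l ! i1 \<or> c \<in> LA ?r ! i2)"
          using 1 h dl dr sm by (intro val_bor) (auto simp: doneA_def islist_def)
        then show "val u' ?E = of_bool (c \<in> ?f i1 i2)" using 1 h by simp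
      next
        fix i1 i2 assume "i1 < ?nl" "i2 < ?nr"
        then have "LA ?l ! i1 \<in> psA a" "LA ?r ! i2 \<in> psA b" using dl dr lr unfolding doneA_def by (metis nth_mem)+
        then show "?f i1 i2 \<subseteq> {..<m}" using psA_sub by blast
      next
        show "card (case_prod ?f ` ({..<?nl} \<times> {..<?nr})) \<le> k" unfolding im using k(1)[OF t] .
      next
        fix u' assume "\<exists>xs. islist u' acA aA v xs \<and> set xs = case_prod ?f ` ({..<?nl} \<times> {..<?nr})
          \<and> table u' aI v ?f xs ({..<?nl} \<times> {..<?nr})" and ag': "agree (writes ?gen) u u'"
        then obtain xs where xs: "islist u' acA aA v xs" "set xs = psA ?t" "table u' aI v ?f xs ({..<?nl} \<times> {..<?nr})"
          unfolding im by blast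
        have "u' [aEnd, v] = v + sz ?t" "\<forall>c<m. u' [aInn, v, c] = of_bool (c \<in> cls ?t)"
          using agree_tag[OF ag', of aEnd] agree_tag[OF ag', of aInn] u I by (auto simp: wr_gen)
        then have "doneA u' (LA(v := xs)) v" using xs vr unfolding doneA_def by (simp add: Node)
        then show "\<exists>xs. doneA u' (LA(v := xs)) v" by blast
      qed (use u zA in auto)
    qed simp
    \<comment> \<open>The first number behind the left subtree is the right child, and the first
      number behind the right subtree is also the first behind the whole node.\<close>
    have E: "s [aEnd, ?l] = ?r" "s [aEnd, ?r] = v + sz ?t" using dl dr lr Node by (auto simp: doneA_def)
    have "spec innerA s (\<lambda>u. \<exists>xs. doneA u (LA(v := xs)) v) (Suc (Suc (Suc (1 + 2 * m + gen_cost ?nl ?nr k m))))"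
      unfolding innerA_def
      by (intro spec_AsgSeq) (use spec2 v E in simp)
    then have "spec innerA s (\<lambda>u. \<exists>xs. doneA u (LA(v := xs)) v) (4 + 2 * m + gen_cost k k k m)"
    proof (rule spec_mono)
      have "gen_cost ?nl ?nr k m \<le> gen_cost k k k m"
        unfolding gen_cost_def using len by (intro add_mono mult_le_mono) auto
      then show "Suc (Suc (Suc (1 + 2 * m + gen_cost ?nl ?nr k m))) \<le> 4 + 2 * m + gen_cost k k k m" by simp
    qed
    then show ?thesis
      unfolding nodeA_def using tag Node v
      by (intro spec_Ife[where c="Suc (4 + 2 * m + gen_cost k k k m)"] spec_Ife[where c="4 + 2 * m + gen_cost k k k m"])
        (auto simp: costA_def)
  qed
qed

lemma treeA_correct:
  assumes st: "static s" and fresh: "freshA s (sz T)"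
  shows "spec treeA s (\<lambda>u. \<exists>LA. \<forall>v<sz T. doneA u LA v) (2 + sz T * (2 + costA))"
  unfolding treeA_def
proof (rule spec_mono[OF spec_AsgSeq])
  let ?N = "sz T"
  have N: "s [sN] = ?N" using st by (simp add: static_def)
  let ?s = "s([sv] := ?N)"
  let ?body = "Asg sv [] (Sub (V sv) (N 1)) ;; nodeA"
  have "spec (For lv (V sN) ?body) ?s (\<lambda>u. \<exists>LA. \<forall>v<sz T. doneA u LA v) (1 + ?N * (2 + costA))"
  proof (rule spec_For_const[where n="?N" and c="Suc costA" and I="\<lambda>j u. u [sv] = ?N - j \<and> freshA u (?N - j) \<and>
      (\<exists>LA. \<forall>v. ?N - j \<le> v \<and> v < ?N \<longrightarrow> doneA u LA v)"])
    show "?s [sv] = ?N - 0 \<and> freshA ?s (?N - 0) \<and> (\<exists>LA. \<forall>v. ?N - 0 \<le> v \<and> v < ?N \<longrightarrow> doneA ?s LA v)"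
      using fresh by (auto simp: freshA_def)
  next
    fix j u assume j: "j < ?N" and I: "u [sv] = ?N - j \<and> freshA u (?N - j) \<and>
      (\<exists>LA. \<forall>v. ?N - j \<le> v \<and> v < ?N \<longrightarrow> doneA u LA v)" and ag: "agree (writes (For lv (V sN) ?body)) ?s u"
    then obtain LA where LA: "\<And>v. ?N - j \<le> v \<Longrightarrow> v < ?N \<Longrightarrow> doneA u LA v" by blast
    let ?v = "?N - Suc j"
    let ?u = "u([lv] := j, [sv] := ?v)"
    have "static ?s" using st by (simp add: static_def tagged_cong[of "s([7] := sz T)" _ s])
    then have "static u" using static_agree[OF ag] by (auto simp: wr_nodeA)
    then have stu: "static ?u" by (simp add: static_def tagged_cong[of ?u _ u])
    have vN: "?N - j = Suc ?v" using j by simp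
    have dn: "doneA ?u LA w = doneA u LA w" for w by (rule doneA_cong) auto
    have fr: "freshA ?u (Suc ?v)" using I unfolding vN by (simp add: freshA_def)
    have "spec nodeA ?u (\<lambda>u'. u' [sv] = ?N - Suc j \<and> freshA u' (?N - Suc j) \<and>
      (\<exists>LA. \<forall>v. ?N - Suc j \<le> v \<and> v < ?N \<longrightarrow> doneA u' LA v)) costA"
    proof (rule spec_mono[OF nodeA_correct])
      show "?u [sv] = ?v" "?v < ?N" "static ?u" "freshA ?u (Suc ?v)" using j stu fr by auto
    next
      fix w assume "?v < w" "w < ?N" then show "doneA ?u LA w" using LA vN unfolding dn by simp
    next
      fix u' assume "\<exists>xs. doneA u' (LA(?v := xs)) ?v" and ag': "agree (writes nodeA) ?u u'"
      then obtain xs where xs: "doneA u' (LA(?v := xs)) ?v" by blast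
      have keep: "u' (t # w # l) = ?u (t # w # l)" if "w \<noteq> ?v" "t \<in> {aEnd, aInn, acA, aA, aI}" for t w l
        using nodeA_keep[OF ag' that(2)] that(1) by simp
      have "doneA u' (LA(?v := xs)) w" if w: "?v \<le> w" "w < ?N" for w
      proof (cases "w = ?v")
        case False
        then have "w > ?v" using w by simp
        have "doneA u' (LA(?v := xs)) w = doneA ?u LA w"
        proof (rule doneA_cong)
          show "u' [sm] = ?u [sm]" using agree_tag[OF ag', of sm] by (simp add: wr_nodeA)
          show "(LA(?v := xs)) w = LA w" "(LA(?v := xs)) (w + 1) = LA (w + 1)" "(LA(?v := xs)) (rt w) = LA (rt w)"
            using \<open>w > ?v\<close> by (auto simp: rt_def)
        qed (rule keep[OF False])
        then show ?thesis using LA[of w] \<open>w > ?v\<close> w vN dn by simp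
      qed (use xs in simp)
      moreover have "freshA u' ?v" using fr keep by (auto simp: freshA_def)
      moreover have "u' [sv] = ?v" using agree_tag[OF ag', of sv] by (simp add: wr_nodeA)
      ultimately show "u' [sv] = ?N - Suc j \<and> freshA u' (?N - Suc j) \<and>
        (\<exists>LA. \<forall>v. ?N - Suc j \<le> v \<and> v < ?N \<longrightarrow> doneA u' LA v)" by blast
    qed simp
    moreover have "(u([lv] := j))(sv # map (val (u([lv] := j))) [] := val (u([lv] := j)) (Sub (V sv) (N 1))) = ?u"
      using I vN by simp
    ultimately show "spec ?body (u([lv] := j)) (\<lambda>u'. u' [sv] = ?N - Suc j \<and> freshA u' (?N - Suc j) \<and>
      (\<exists>LA. \<forall>v. ?N - Suc j \<le> v \<and> v < ?N \<longrightarrow> doneA u' LA v)) (Suc costA)"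
      by (intro spec_AsgSeq) simp
  next
    fix u assume "u [sv] = ?N - ?N \<and> freshA u (?N - ?N) \<and> (\<exists>LA. \<forall>v. ?N - ?N \<le> v \<and> v < ?N \<longrightarrow> doneA u LA v)"
    then show "\<exists>LA. \<forall>v<sz T. doneA u LA v" by simp
  qed (use N in simp_all)
  then show "spec (For lv (V sN) ?body) (s(sv # map (val s) [] := val s (V sN))) (\<lambda>u. \<exists>LA. \<forall>v<sz T. doneA u LA v) (1 + ?N * (2 + costA))"
    using N by simp
qed simp_all

end

end

lemma eff_skip: "run_prog skip s = s"
  by simp

section \<open>Top-down pass for the help from outside\<close>

text \<open>On bits, \<open>Sub x (Sub (N 1) y)\<close> is conjunction, here with membership in the
  clauses of the child. The set of the parent is the first coordinate of the recorded position, the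
  set of the sibling the second.\<close>

definition genB :: "nat \<Rightarrow> nat \<Rightarrow> prog" where
  "genB ch ot = gen_table ch acB aB aJ (At acB [V sv]) (At acA [V ot])
     (Sub (bor (At aB [V sv, V l1, V lc]) (At aA [V ot, V l2, V lc])) (Sub (N 1) (At aInn [V ch, V lc])))"

definition innerB :: prog where
  "innerB = (Asg sl [] (Inc (V sv)) ;; Asg sr [] (At aEnd [V sl]) ;;
     Asg acB [V sl] (N 0) ;; Asg acB [V sr] (N 0) ;; genB sl sr ;; genB sr sl)"

text \<open>Increasing preorder numbers visit a parent before its children. The root receives only
  the empty help, which again is found in untouched memory.\<close>

definition treeB :: prog where
  "treeB = (Asg acB [N 0] (N 1) ;; For sv (V sN) (Ife (At aTag [V sv]) (N 2) skip innerB))"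

lemma wr_genB: "writes (genB ch ot) = {(24, None), (25, None), (50, Some ch), (10, None), (23, None), (11, None),
    (22, None), (48, Some ch), (47, Some ch), (22, None), (52, Some 22)}"
  unfolding genB_def by (simp add: wr_gen)

lemma fst_wr_treeB: "fst ` writes treeB = {47, 7, 11, 8, 9, 24, 25, 50, 10, 23, 22, 48, 52}"
  unfolding treeB_def innerB_def by (simp add: wr_genB insert_commute)

lemma genB_keep:
  assumes ag: "agree (writes (genB ch ot)) s u" and t: "t \<in> {47, 48, 50}" and w: "w \<noteq> s [ch]" and ch: "ch \<in> {8, 9}"
  shows "u (t # w # l) = s (t # w # l)"
proof (rule agree_index[OF ag])
  fix oo assume "(t, oo) \<in> writes (genB ch ot)"
  then have "oo = Some ch" using t by (auto simp: wr_genB)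
  then show "\<exists>v. oo = Some v \<and> v \<notin> fst ` writes (genB ch ot) \<and> w \<noteq> s [v]" using w ch by (auto simp: wr_genB)
qed

lemma genB_keep_tag:
  assumes ag: "agree (writes (genB ch ot)) s u" and t: "t \<in> {4, 5, 6, 7, 8, 9, 40, 41, 42, 43, 44, 45, 46, 49}"
  shows "u (t # l) = s (t # l)"
  by (rule agree_tag[OF ag]) (use t in \<open>auto simp: wr_genB\<close>)

lemma genB_correct:
  assumes co: "ch \<in> {8, 9}" "ot \<in> {8, 9}"
    and s: "s [sv] = v" "s [ch] = x" "s [ot] = y" "x \<noteq> v" "s [acB, x] = 0"
    and B: "islist s acB aB v B" and A: "islist s acA aA y A"
    and inn: "\<forall>c<s [sm]. s [aInn, x, c] = of_bool (c \<in> C)"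
    and k: "card ((\<lambda>(X, Y). (X \<union> Y) \<inter> C) ` (set B \<times> set A)) \<le> k"
    and len: "length B \<le> k" "length A \<le> k"
  shows "spec (genB ch ot) s (\<lambda>u. \<exists>xs. islist u acB aB x xs \<and> set xs = (\<lambda>(X, Y). (X \<union> Y) \<inter> C) ` (set B \<times> set A) \<and>
     table u aJ x (\<lambda>j i. (B ! j \<union> A ! i) \<inter> C) xs ({..<length B} \<times> {..<length A})) (gen_cost k k k (s [sm]))"
proof -
  let ?f = "\<lambda>j i. (B ! j \<union> A ! i) \<inter> C"
  have im: "case_prod ?f ` ({..<length B} \<times> {..<length A}) = (\<lambda>(X, Y). (X \<union> Y) \<inter> C) ` (set B \<times> set A)"
    by (rule image_nth_product)
  have "spec (genB ch ot) s (\<lambda>u. \<exists>xs. islist u acB aB x xs \<and> set xs = case_prod ?f ` ({..<length B} \<times> {..<length A}) \<and>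
     table u aJ x ?f xs ({..<length B} \<times> {..<length A})) (gen_cost (length B) (length A) k (s [sm]))"
    unfolding genB_def
  proof (rule gen_correct)
    show "distinct [ch, acB, aB, aJ, sm, sidx, sdiff, lc, li, l1, l2, aCand]" using co by auto
    show "val s (At acB [V sv]) = length B" using s B by (simp add: islist_def)
    show "card (case_prod ?f ` ({..<length B} \<times> {..<length A})) \<le> k" unfolding im by (rule k)
    show "s [ch] = x" "s [sm] = s [sm]" "s [acB, x] = 0" using s by auto
  next
    fix i1 i2 assume "i1 < length B" "i2 < length A"
    then have "B ! i1 \<subseteq> {..<s [sm]}" "A ! i2 \<subseteq> {..<s [sm]}" using A B unfolding islist_def by (metis Pow_iff nth_mem subsetD)+
    then show "?f i1 i2 \<subseteq> {..<s [sm]}" by blast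
  next
    fix u assume "agree (writes (gen_table ch acB aB aJ (At acB [V sv]) (At acA [V ot])
     (Sub (bor (At aB [V sv, V l1, V lc]) (At aA [V ot, V l2, V lc])) (Sub (N 1) (At aInn [V ch, V lc]))))) s u"
    then have ag: "agree (writes (genB ch ot)) s u" unfolding genB_def .
    have u: "u [ot] = y" "u [acA, y] = s [acA, y]" 
      using genB_keep_tag[OF ag] s co by auto
    then show "val u (At acA [V ot]) = length A" using A by (simp add: islist_def)
  next
    fix u i1 i2 c assume "agree (writes (gen_table ch acB aB aJ (At acB [V sv]) (At acA [V ot])
     (Sub (bor (At aB [V sv, V l1, V lc]) (At aA [V ot, V l2, V lc])) (Sub (N 1) (At aInn [V ch, V lc]))))) s u"
     and h: "i1 < length B" "i2 < length A" "c < s [sm]" "u [l1] = i1" "u [l2] = i2" "u [lc] = c"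
    then have ag: "agree (writes (genB ch ot)) s u" unfolding genB_def by simp
    have 1: "u [ot] = y" "u [ch] = x" "u [sv] = v" "u [aA, y, i2, c] = of_bool (c \<in> A ! i2)" "u [aInn, x, c] = of_bool (c \<in> C)"
      using genB_keep_tag[OF ag] s co h A inn by (auto simp: islist_def)
    have 2: "u [aB, v, i1, c] = of_bool (c \<in> B ! i1)"
      using genB_keep[OF ag, of aB v "[i1, c]"] s co h B by (auto simp: islist_def)
    have "val u (bor (At aB [V sv, V l1, V lc]) (At aA [V ot, V l2, V lc])) = of_bool (c \<in> B ! i1 \<or> c \<in> A ! i2)"
      using 1 2 h by (intro val_bor) auto
    then show "val u (Sub (bor (At aB [V sv, V l1, V lc]) (At aA [V ot, V l2, V lc])) (Sub (N 1) (At aInn [V ch, V lc])))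
       = of_bool (c \<in> ?f i1 i2)" using 1 h by simp
  qed
  then show ?thesis unfolding im
  proof (rule spec_mono)
    show "gen_cost (length B) (length A) k (s [sm]) \<le> gen_cost k k k (s [sm])"
      unfolding gen_cost_def using len by (intro add_mono mult_le_mono) auto
  qed simp
qed

context instance_data
begin

lemma static_cong:
  assumes "\<And>t l. t \<in> {4, 5, 6, 40, 41, 42} \<Longrightarrow> u (t # l) = s (t # l)"
  shows "static u = static s"
  unfolding static_def using assms by (simp add: tagged_cong[of u _ s])

definition okB :: "store \<Rightarrow> (nat \<Rightarrow> nat set list) \<Rightarrow> nat \<Rightarrow> bool" where
  "okB s LB v \<longleftrightarrow> islist s acB aB v (LB v) \<and> set (LB v) = psB (pre T ! v)"

text \<open>The claims about both children are attached to their parent, since that is the node at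
  which their lists are written.\<close>

fun okJ :: "store \<Rightarrow> (nat \<Rightarrow> nat set list) \<Rightarrow> (nat \<Rightarrow> nat set list) \<Rightarrow> nat \<Rightarrow> (nat + nat) btree \<Rightarrow> bool" where
  "okJ s LA LB v (Leaf y) \<longleftrightarrow> True"
| "okJ s LA LB v (Node a b) \<longleftrightarrow> okB s LB (v + 1) \<and> okB s LB (rt v) \<and>
    table s aJ (v + 1) (\<lambda>j i. (LB v ! j \<union> LA (rt v) ! i) \<inter> cls a) (LB (v + 1)) ({..<length (LB v)} \<times> {..<length (LA (rt v))}) \<and>
    table s aJ (rt v) (\<lambda>j i. (LB v ! j \<union> LA (v + 1) ! i) \<inter> cls b) (LB (rt v)) ({..<length (LB v)} \<times> {..<length (LA (v + 1))})"

lemma okB_cong: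
  assumes "\<And>t l. t \<in> {47, 48} \<Longrightarrow> u (t # v # l) = s (t # v # l)" "u [sm] = s [sm]" "LB' v = LB v"
  shows "okB u LB' v = okB s LB v"
  using assms unfolding okB_def by (simp add: islist_cong[of u acB v s aB])

lemma okJ_cong:
  assumes "\<And>t l. t \<in> {47, 48, 50} \<Longrightarrow> u (t # (v + 1) # l) = s (t # (v + 1) # l)"
    "\<And>t l. t \<in> {47, 48, 50} \<Longrightarrow> u (t # rt v # l) = s (t # rt v # l)" "u [sm] = s [sm]"
    "LB' v = LB v" "LB' (v + 1) = LB (v + 1)" "LB' (rt v) = LB (rt v)"
  shows "okJ u LA LB' v t = okJ s LA LB v t"
proof (cases t)
  case (Node a b)
  have "okB u LB' (v + 1) = okB s LB (v + 1)" by (rule okB_cong) (use assms in auto)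
  moreover have "okB u LB' (rt v) = okB s LB (rt v)" by (rule okB_cong) (use assms in auto)
  ultimately show ?thesis unfolding Node okJ.simps assms(4-6)
    using table_cong[of u aJ "v + 1" s] table_cong[of u aJ "rt v" s] assms by simp
qed simp

definition readyB :: "store \<Rightarrow> (nat \<Rightarrow> nat set list) \<Rightarrow> (nat \<Rightarrow> nat set list) \<Rightarrow> bool" where
  "readyB s LA LB \<longleftrightarrow> okB s LB 0 \<and> (\<forall>v<sz T. okJ s LA LB v (pre T ! v))"

text \<open>A node other than the root has a parent with a smaller number, and the claim attached to
  that parent includes the list of the node.\<close>

lemma okB_all:
  assumes "okB s LB 0" "\<And>w. w < v \<Longrightarrow> okJ s LA LB w (pre T ! w)" "v < sz T"
  shows "okB s LB v"
proof (cases "v = 0")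
  case False
  then obtain w where w: "child T w v" using child_exists assms(3) by blast
  then have "w < v" using child_bounds by blast
  obtain a b where ab: "pre T ! w = Node a b" "v = w + 1 \<or> v = w + 1 + sz a" "w < sz T" using w unfolding child_def by blast
  then have "v = w + 1 \<or> v = rt w" using rt_Node by auto
  then show ?thesis using assms(2)[OF \<open>w < v\<close>] ab by auto
qed (use assms in simp)

context
  fixes k :: nat
  assumes k: "\<And>t. t \<in> nodes T \<Longrightarrow> card (psA t) \<le> k" "\<And>t. t \<in> nodes T \<Longrightarrow> card (psB t) \<le> k"
begin

lemma innerB_correct:
  assumes v: "s [sv] = v" "v < sz T" "pre T ! v = Node a b" and st: "static s"
    and A: "\<And>w. w < sz T \<Longrightarrow> doneA s LA w"
    and B: "okB s LB v"
  shows "spec innerB s (\<lambda>u. \<exists>xs ys. okJ u LA (LB(v + 1 := xs, rt v := ys)) v (Node a b) \<and>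
     (\<forall>t w l. t \<in> {47, 48, 50} \<longrightarrow> w \<noteq> v + 1 \<longrightarrow> w \<noteq> rt v \<longrightarrow> u (t # w # l) = s (t # w # l))) (4 + 2 * gen_cost k k k m)"
proof -
  let ?l = "v + 1" and ?r = "rt v"
  have lr: "?r = v + 1 + sz a" "pre T ! ?l = a" "pre T ! ?r = b" "?l < sz T" "?r < sz T"
    using rt_Node[OF v(2,3)] by auto
  have vr: "v < ?r" "?l < ?r" using lr by (simp_all)
  have t: "Node a b \<in> nodes T" using pre_in_nodes[OF v(2)] v(3) by simp
  have ta: "a \<in> nodes T" "b \<in> nodes T" using pre_in_nodes lr by metis+
  have sm: "s [sm] = m" using st by (simp add: static_def)
  have dl: "doneA s LA ?l" and dr: "doneA s LA ?r" using A lr by auto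
  have lenA: "length (LA ?l) \<le> k" "length (LA ?r) \<le> k"
    using length_psA[OF dl] length_psA[OF dr] k(1) ta lr by auto
  have lenB: "length (LB v) \<le> k"
  proof -
    have "length (LB v) = card (psB (Node a b))"
      using B v(3) unfolding okB_def islist_def by (metis distinct_card)
    then show ?thesis using k(2)[OF t] by simp
  qed
  have sets: "set (LA ?l) = psA a" "set (LA ?r) = psA b" "set (LB v) = psB (Node a b)"
    using dl dr B lr v by (auto simp: doneA_def okB_def)
  let ?s = "s([sl] := ?l, [sr] := ?r, [acB, ?l] := 0, [acB, ?r] := 0)"
  have E: "s [aEnd, ?l] = ?r" using dl lr by (simp add: doneA_def)
  have "spec (genB sl sr ;; genB sr sl) ?s (\<lambda>u. \<exists>xs ys. okJ u LA (LB(?l := xs, ?r := ys)) v (Node a b) \<and>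
     (\<forall>t w l. t \<in> {47, 48, 50} \<longrightarrow> w \<noteq> ?l \<longrightarrow> w \<noteq> ?r \<longrightarrow> u (t # w # l) = s (t # w # l))) (gen_cost k k k m + gen_cost k k k m)"
  proof (rule spec_Seq)
    show "spec (genB sl sr) ?s (\<lambda>u. \<exists>xs. islist u acB aB ?l xs \<and> set xs = (\<lambda>(X, Y). (X \<union> Y) \<inter> cls a) ` (set (LB v) \<times> set (LA ?r)) \<and>
      table u aJ ?l (\<lambda>j i. (LB v ! j \<union> LA ?r ! i) \<inter> cls a) xs ({..<length (LB v)} \<times> {..<length (LA ?r)})) (gen_cost k k k m)"
    proof (rule spec_mono[OF genB_correct])
      have "islist ?s acB aB v (LB v) = islist s acB aB v (LB v)" by (rule islist_cong) (use vr in auto)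
      then show "islist ?s acB aB v (LB v)" using B by (simp add: okB_def)
      have "islist ?s acA aA ?r (LA ?r) = islist s acA aA ?r (LA ?r)" by (rule islist_cong) auto
      then show "islist ?s acA aA ?r (LA ?r)" using dr by (simp add: doneA_def)
      show "\<forall>c<?s [sm]. ?s [aInn, ?l, c] = of_bool (c \<in> cls a)" using dl lr sm by (simp add: doneA_def)
      show "card ((\<lambda>(X, Y). (X \<union> Y) \<inter> cls a) ` (set (LB v) \<times> set (LA ?r))) \<le> k"
        unfolding sets psB_child(1)[OF t, symmetric] by (rule k(2)[OF ta(1)])
    qed (use v vr lenA lenB sm in auto)
  next
    fix u assume "\<exists>xs. islist u acB aB ?l xs \<and> set xs = (\<lambda>(X, Y). (X \<union> Y) \<inter> cls a) ` (set (LB v) \<times> set (LA ?r)) \<and>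
      table u aJ ?l (\<lambda>j i. (LB v ! j \<union> LA ?r ! i) \<inter> cls a) xs ({..<length (LB v)} \<times> {..<length (LA ?r)})"
      and ag: "agree (writes (genB sl sr)) ?s u"
    then obtain xs where xs: "islist u acB aB ?l xs" "set xs = psB a"
      "table u aJ ?l (\<lambda>j i. (LB v ! j \<union> LA ?r ! i) \<inter> cls a) xs ({..<length (LB v)} \<times> {..<length (LA ?r)})"
      unfolding sets psB_child(1)[OF t, symmetric] by blast
    have keep: "u (t # w # l) = ?s (t # w # l)" if "t \<in> {47, 48, 50}" "w \<noteq> ?l" for t w l
      using genB_keep[OF ag that(1)] that(2) by simp
    note kt = genB_keep_tag[OF ag]
    have u: "u [sv] = v" "u [sl] = ?l" "u [sr] = ?r" "u [sm] = m" using kt sm v by auto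
    show "spec (genB sr sl) u (\<lambda>u. \<exists>xs ys. okJ u LA (LB(?l := xs, ?r := ys)) v (Node a b) \<and>
     (\<forall>t w l. t \<in> {47, 48, 50} \<longrightarrow> w \<noteq> ?l \<longrightarrow> w \<noteq> ?r \<longrightarrow> u (t # w # l) = s (t # w # l))) (gen_cost k k k m)"
    proof (rule spec_mono[OF genB_correct])
      have "islist u acB aB v (LB v) = islist s acB aB v (LB v)"
        by (rule islist_cong) (use keep vr u sm in auto)
      then show "islist u acB aB v (LB v)" using B by (simp add: okB_def)
      have "islist u acA aA ?l (LA ?l) = islist s acA aA ?l (LA ?l)"
        by (rule islist_cong) (use kt u sm in auto)
      then show "islist u acA aA ?l (LA ?l)" using dl by (simp add: doneA_def)
      show "\<forall>c<u [sm]. u [aInn, ?r, c] = of_bool (c \<in> cls b)" using dr lr u kt by (simp add: doneA_def)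
      show "card ((\<lambda>(X, Y). (X \<union> Y) \<inter> cls b) ` (set (LB v) \<times> set (LA ?l))) \<le> k"
        unfolding sets psB_child(2)[OF t, symmetric] by (rule k(2)[OF ta(2)])
      show "u [acB, ?r] = 0" using keep[of 47 ?r "[]"] vr by simp
    next
      fix u' assume "\<exists>ys. islist u' acB aB ?r ys \<and> set ys = (\<lambda>(X, Y). (X \<union> Y) \<inter> cls b) ` (set (LB v) \<times> set (LA ?l)) \<and>
        table u' aJ ?r (\<lambda>j i. (LB v ! j \<union> LA ?l ! i) \<inter> cls b) ys ({..<length (LB v)} \<times> {..<length (LA ?l)})"
        and ag': "agree (writes (genB sr sl)) u u'"
      then obtain ys where ys: "islist u' acB aB ?r ys" "set ys = psB b"
        "table u' aJ ?r (\<lambda>j i. (LB v ! j \<union> LA ?l ! i) \<inter> cls b) ys ({..<length (LB v)} \<times> {..<length (LA ?l)})"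
        unfolding sets psB_child(2)[OF t, symmetric] by blast
      have keep': "u' (t # w # l) = u (t # w # l)" if "t \<in> {47, 48, 50}" "w \<noteq> ?r" for t w l
        using genB_keep[OF ag' that(1)] that(2) u by simp
      have sm': "u' [sm] = u [sm]" by (rule genB_keep_tag[OF ag']) simp
      have "islist u' acB aB ?l xs"
        using xs(1) islist_cong[of u' acB ?l u aB] keep' vr sm' by simp
      moreover have "table u' aJ ?l (\<lambda>j i. (LB v ! j \<union> LA ?r ! i) \<inter> cls a) xs ({..<length (LB v)} \<times> {..<length (LA ?r)})"
        using xs(3) table_cong[of u' aJ ?l u] keep' vr by simp
      ultimately have "okJ u' LA (LB(?l := xs, ?r := ys)) v (Node a b)"
        using xs(2) ys lr vr by (simp add: okB_def)
      moreover have "\<forall>t w l. t \<in> {47, 48, 50} \<longrightarrow> w \<noteq> ?l \<longrightarrow> w \<noteq> ?r \<longrightarrow> u' (t # w # l) = s (t # w # l)"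
        using keep keep' by simp
      ultimately show "\<exists>xs ys. okJ u' LA (LB(?l := xs, ?r := ys)) v (Node a b) \<and>
        (\<forall>t w l. t \<in> {47, 48, 50} \<longrightarrow> w \<noteq> ?l \<longrightarrow> w \<noteq> ?r \<longrightarrow> u' (t # w # l) = s (t # w # l))" by blast
    qed (use v u vr lenA lenB sm in auto)
  qed simp
  then have "spec innerB s (\<lambda>u. \<exists>xs ys. okJ u LA (LB(?l := xs, ?r := ys)) v (Node a b) \<and>
     (\<forall>t w l. t \<in> {47, 48, 50} \<longrightarrow> w \<noteq> ?l \<longrightarrow> w \<noteq> ?r \<longrightarrow> u (t # w # l) = s (t # w # l)))
     (Suc (Suc (Suc (Suc (gen_cost k k k m + gen_cost k k k m)))))"
    unfolding innerB_def by (intro spec_AsgSeq) (use v E in simp)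
  then show ?thesis by (rule spec_mono) auto
qed

lemma treeB_correct:
  assumes st: "static s" and A: "\<And>w. w < sz T \<Longrightarrow> doneA s LA w" and z: "\<And>l. s (aB # 0 # l) = 0"
  shows "spec treeB s (\<lambda>u. \<exists>LB. readyB u LA LB) (2 + sz T * (6 + 2 * gen_cost k k k m))"
  unfolding treeB_def
proof (rule spec_mono[OF spec_AsgSeq])
  let ?N = "sz T"
  let ?s = "s([acB, 0] := 1)"
  have N: "s [sN] = ?N" and sm: "s [sm] = m" using st by (auto simp: static_def)
  let ?body = "Ife (At aTag [V sv]) (N 2) skip innerB"
  let ?I = "\<lambda>j u. \<exists>LB. okB u LB 0 \<and> (\<forall>v<j. okJ u LA LB v (pre T ! v))"
  have fstw: "fst ` writes (For sv (V sN) ?body) \<subseteq> {47, 7, 11, 8, 9, 24, 25, 50, 10, 23, 22, 48, 52}"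
    using fst_wr_treeB unfolding treeB_def by auto
  have "spec (For sv (V sN) ?body) ?s (\<lambda>u. \<exists>LB. readyB u LA LB) (1 + ?N * (6 + 2 * gen_cost k k k m))"
  proof (rule spec_For_const[where n="?N" and c="5 + 2 * gen_cost k k k m" and I="?I"])
    have "okB ?s (\<lambda>_. [{}]) 0" using z by (simp add: okB_def islist_def pre_0 psB_T)
    then show "?I 0 ?s" by auto
  next
    fix j u assume j: "j < ?N" and I: "?I j u" and ag: "agree (writes (For sv (V sN) ?body)) ?s u"
    then obtain LB where LB: "okB u LB 0" "\<And>v. v < j \<Longrightarrow> okJ u LA LB v (pre T ! v)" by blast
    let ?u = "u([sv] := j)"
    have "static ?s = static s" by (rule static_cong) auto
    then have "static ?s" using st by simp
    moreover have "static u = static ?s" by (rule static_agree[OF ag]) (use fstw in auto)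
    moreover have "static ?u = static u" by (rule static_cong) auto
    ultimately have stu: "static ?u" by simp
    have smu: "?u [sm] = m" using stu by (simp add: static_def)
    have Au: "doneA ?u LA w" if "w < ?N" for w
    proof -
      have "doneA ?s LA w = doneA s LA w" by (rule doneA_cong) auto
      moreover have "doneA u LA w = doneA ?s LA w" by (rule doneA_agree[OF ag]) (use fstw in auto)
      moreover have "doneA ?u LA w = doneA u LA w" by (rule doneA_cong) auto
      ultimately show ?thesis using A[OF that] by simp
    qed
    have B0: "okB ?u LB 0" using LB(1) okB_cong[of ?u 0 u LB LB] by simp
    have BJ: "okJ ?u LA LB v (pre T ! v)" if "v < j" for v
      using LB(2)[OF that] okJ_cong[of ?u v u LB LB LA] by simp
    have tag: "tagged ?u j (pre T ! j)" using stu j by (simp add: static_def)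
    show "spec ?body ?u (?I (Suc j)) (5 + 2 * gen_cost k k k m)"
    proof (cases "pre T ! j")
      case (Leaf y)
      have "?u [aTag, j] < 2" using tag Leaf by (cases y) auto
      moreover have "okJ ?u LA LB v (pre T ! v)" if "v < Suc j" for v
        using BJ[of v] that Leaf by (cases "v = j") auto
      then have "?I (Suc j) ?u" using B0 by blast
      then have "spec skip ?u (?I (Suc j)) 1" unfolding spec_def eff_skip by simp
      ultimately show ?thesis by (intro spec_Ife[where c=1]) auto
    next
      case (Node a b)
      let ?l = "j + 1" and ?r = "rt j"
      have ch: "child T j ?l" "child T j ?r"
        using j Node rt_Node[OF j Node] by (auto simp: child_def)
      have Bj: "okB ?u LB j" using okB_all[OF B0 BJ j] .
      have "spec innerB ?u (?I (Suc j)) (4 + 2 * gen_cost k k k m)"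
      proof (rule spec_mono[OF innerB_correct[OF _ j Node stu Au Bj]])
        fix u' assume "\<exists>xs ys. okJ u' LA (LB(?l := xs, ?r := ys)) j (Node a b) \<and>
           (\<forall>t w l. t \<in> {47, 48, 50} \<longrightarrow> w \<noteq> ?l \<longrightarrow> w \<noteq> ?r \<longrightarrow> u' (t # w # l) = ?u (t # w # l))"
          and ag': "agree (writes innerB) ?u u'"
        then obtain xs ys where J: "okJ u' LA (LB(?l := xs, ?r := ys)) j (Node a b)"
          and keep: "\<And>t w l. t \<in> {47, 48, 50} \<Longrightarrow> w \<noteq> ?l \<Longrightarrow> w \<noteq> ?r \<Longrightarrow> u' (t # w # l) = ?u (t # w # l)" by blast
        let ?LB = "LB(?l := xs, ?r := ys)"
        have sm': "u' [sm] = ?u [sm]"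
          by (rule agree_tag[OF ag']) (simp add: innerB_def wr_genB)
        have pos: "?l \<noteq> 0" "?r \<noteq> 0" using child_bounds ch by fastforce+
        have "okB u' ?LB 0 = okB ?u LB 0"
          by (rule okB_cong) (use keep pos sm' in auto)
        moreover have "okJ u' LA ?LB v (pre T ! v)" if "v < Suc j" for v
        proof (cases "v = j")
          case False
          then have vj: "v < j" using that by simp
          show ?thesis
          proof (cases "pre T ! v")
            case N': (Node a' b')
            have ch': "child T v (v + 1)" "child T v (rt v)"
              using vj j N' rt_Node[OF _ N'] by (auto simp: child_def)
            \<comment> \<open>A node has only one parent, so the children of \<open>v\<close> differ
              from those of \<open>j\<close>; and \<open>v\<close> itself is smaller than
              \<open>j\<close>, hence no child of \<open>j\<close>. What was established for
              \<open>v\<close> is therefore not disturbed.\<close>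
            have ne: "v + 1 \<noteq> ?l" "v + 1 \<noteq> ?r" "rt v \<noteq> ?l" "rt v \<noteq> ?r" "v \<noteq> ?l" "v \<noteq> ?r"
              using child_unique ch ch' vj child_bounds[OF ch(1)] child_bounds[OF ch(2)] by (blast | force)+
            have "okJ u' LA ?LB v (pre T ! v) = okJ ?u LA LB v (pre T ! v)"
              by (rule okJ_cong) (use keep ne sm' in auto)
            then show ?thesis using BJ[OF vj] by simp
          qed simp
        qed (use J Node in simp)
        ultimately show "?I (Suc j) u'" using B0 by blast
      qed simp_all
      then show ?thesis using tag Node by (intro spec_Ife[where c="4 + 2 * gen_cost k k k m"]) auto
    qed
  next
    fix u assume "?I ?N u" then show "\<exists>LB. readyB u LA LB" by (simp add: readyB_def)
  qed (use N in simp_all)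
  then show "spec (For sv (V sN) ?body) (s(acB # map (val s) [N 0] := val s (N 1))) (\<lambda>u. \<exists>LB. readyB u LA LB)
     (1 + ?N * (6 + 2 * gen_cost k k k m))" by simp
qed simp_all

end

end

section \<open>The table of the dynamic program\<close>

abbreviation (input) "lj \<equiv> 26 :: nat"
abbreviation (input) "si \<equiv> 19 :: nat"
abbreviation (input) "sja \<equiv> 20 :: nat"
abbreviation (input) "sjb \<equiv> 21 :: nat"

text \<open>Each triple of positions costs three lookups: \<open>si\<close> gives the row of the
  current node to be updated, and \<open>sja\<close>, \<open>sjb\<close> give the columns of the
  children to be read.\<close>

definition innerD :: "prog \<Rightarrow> prog" where
  "innerD COMB = (Asg sl [] (Inc (V sv)) ;; Asg sr [] (At aEnd [V sl]) ;;
     For lj (At acB [V sv]) (For l1 (At acA [V sl]) (For l2 (At acA [V sr]) (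
       Asg si [] (At aI [V sv, V l1, V l2]) ;; Asg sja [] (At aJ [V sl, V lj, V l2]) ;;
       Asg sjb [] (At aJ [V sr, V lj, V l1]) ;; COMB))))"

definition nodeD :: "prog \<Rightarrow> prog \<Rightarrow> prog \<Rightarrow> prog" where
  "nodeD CL VARL COMB =
     Ife (At aTag [V sv]) (N 1) (For lj (At acB [V sv]) CL)
      (Ife (At aTag [V sv]) (N 2) (For l1 (N 2) (Asg si [] (At aI [V sv, V l1, N 0]) ;; VARL))
        (innerD COMB))"

definition treeD :: "prog \<Rightarrow> prog \<Rightarrow> prog \<Rightarrow> prog" where
  "treeD CL VARL COMB =
     (Asg sv [] (V sN) ;; For lv (V sN) (Asg sv [] (Sub (V sv) (N 1)) ;; nodeD CL VARL COMB))"

text \<open>The interface of the exchangeable programs: scratch names may be used freely, but the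
  tables 54 and 55 only at the current node, whose number is the scalar 7.\<close>

definition localp :: "prog \<Rightarrow> bool" where
  "localp p \<longleftrightarrow> (\<forall>(t, oo)\<in>writes p. t \<in> {11, 12, 13, 14, 28, 29, 30, 56} \<or> t \<in> {54, 55} \<and> oo = Some 7)"

definition dpT :: "nat set" where
  "dpT = {7, 8, 9, 11, 12, 13, 14, 19, 20, 21, 24, 25, 26, 27, 28, 29, 30, 54, 55, 56}"

definition eqT :: "store \<Rightarrow> store \<Rightarrow> bool" where
  "eqT s u \<longleftrightarrow> (\<forall>t l. t \<notin> dpT \<longrightarrow> u (t # l) = s (t # l))"

definition only :: "store \<Rightarrow> store \<Rightarrow> nat \<Rightarrow> nat \<Rightarrow> nat \<Rightarrow> bool" where
  "only s u v i j \<longleftrightarrow> (\<forall>t\<in>{54, 55}. \<forall>i' j' l. (i', j') \<noteq> (i, j) \<longrightarrow> u (t # v # i' # j' # l) = s (t # v # i' # j' # l))"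

lemma tableD:
  "table s tJ v f xs Z \<Longrightarrow> (i1, i2) \<in> Z \<Longrightarrow> s [tJ, v, i1, i2] < length xs \<and> xs ! (s [tJ, v, i1, i2]) = f i1 i2"
  unfolding table_def by blast

lemma only_eq:
  "only s u v i j \<Longrightarrow> t \<in> {54, 55} \<Longrightarrow> (i', j') \<noteq> (i, j) \<Longrightarrow> u (t # v # i' # j' # l) = s (t # v # i' # j' # l)"
  unfolding only_def by blast

lemma eqT_refl [simp]: "eqT s s" by (simp add: eqT_def)

lemma eqT_trans: "eqT s u \<Longrightarrow> eqT u u' \<Longrightarrow> eqT s u'" by (simp add: eqT_def)

lemma eqT_update: "eqT s u \<Longrightarrow> t \<in> dpT \<Longrightarrow> eqT s (u(t # l := x))" by (auto simp: eqT_def)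

lemma eqT_agree: "agree w s u \<Longrightarrow> fst ` w \<subseteq> dpT \<Longrightarrow> eqT s u"
  unfolding eqT_def by (intro allI impI agree_tag) auto

lemma localp_dpT: "localp p \<Longrightarrow> fst ` writes p \<subseteq> dpT"
  unfolding localp_def dpT_def by fastforce

text \<open>
  \<open>repr s v i j Q\<close> says that the entry of node \<open>v\<close> for its \<open>i\<close>-th outside effect and its \<open>j\<close>-th help from
  outside is correct when only the assignments in \<open>Q\<close> are taken into account; counting and maximization
  are the two instances.
\<close>

locale dp = instance_data +
  fixes LA LB :: "nat \<Rightarrow> nat set list" and k :: nat
    and extra :: "store \<Rightarrow> bool"
    and repr :: "store \<Rightarrow> nat \<Rightarrow> nat \<Rightarrow> nat \<Rightarrow> nat set set \<Rightarrow> bool"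
    and CL VARL COMB :: prog and cC cV :: nat and cX :: "nat \<Rightarrow> nat"
  assumes k: "\<And>t. t \<in> nodes T \<Longrightarrow> card (psA t) \<le> k" "\<And>t. t \<in> nodes T \<Longrightarrow> card (psB t) \<le> k"
    and extra_eqT: "\<And>s u. extra s \<Longrightarrow> eqT s u \<Longrightarrow> extra u"
    and local: "localp CL" "localp VARL" "localp COMB"
    and repr_cong: "\<And>s u v i j Q. (\<And>t l. t \<in> {54, 55} \<Longrightarrow> u (t # v # i # j # l) = s (t # v # i # j # l)) \<Longrightarrow>
        repr u v i j Q = repr s v i j Q"
    and repr_init: "\<And>s v i j. (\<And>t l. t \<in> {54, 55} \<Longrightarrow> s (t # v # i # j # l) = 0) \<Longrightarrow> repr s v i j {}"
    and CL: "\<And>s v c j. static s \<Longrightarrow> (\<And>w. w < sz T \<Longrightarrow> doneA s LA w) \<Longrightarrow> okB s LB v \<Longrightarrow> extra s \<Longrightarrow> s [7] = v \<Longrightarrow>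
        v < sz T \<Longrightarrow> pre T ! v = Leaf (Inl c) \<Longrightarrow> s [lj] = j \<Longrightarrow> j < length (LB v) \<Longrightarrow>
        (\<And>t l. t \<in> {54, 55} \<Longrightarrow> s (t # v # 0 # j # l) = 0) \<Longrightarrow>
        spec CL s (\<lambda>u. repr u v 0 j {{}} \<and> only s u v 0 j) cC"
    and VARL: "\<And>s v x b i Q. static s \<Longrightarrow> (\<And>w. w < sz T \<Longrightarrow> doneA s LA w) \<Longrightarrow> okB s LB v \<Longrightarrow> extra s \<Longrightarrow> s [7] = v \<Longrightarrow>
        v < sz T \<Longrightarrow> pre T ! v = Leaf (Inr x) \<Longrightarrow> s [l1] = b \<Longrightarrow> b < 2 \<Longrightarrow> s [si] = i \<Longrightarrow> i < length (LA v) \<Longrightarrow>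
        repr s v i 0 Q \<Longrightarrow> Q \<subseteq> (if b = 0 then {} else {{}}) \<Longrightarrow>
        spec VARL s (\<lambda>u. repr u v i 0 (insert (if b = 1 then {x} else {}) Q) \<and> only s u v i 0) cV"
    and COMB: "\<And>s v a b i j i1 i2 ja jb Q. static s \<Longrightarrow> (\<And>w. w < sz T \<Longrightarrow> doneA s LA w) \<Longrightarrow> extra s \<Longrightarrow> s [7] = v \<Longrightarrow>
        v < sz T \<Longrightarrow> pre T ! v = Node a b \<Longrightarrow> s [sl] = v + 1 \<Longrightarrow> s [sr] = rt v \<Longrightarrow>
        s [l1] = i1 \<Longrightarrow> s [l2] = i2 \<Longrightarrow> s [lj] = j \<Longrightarrow> s [si] = i \<Longrightarrow> s [sja] = ja \<Longrightarrow> s [sjb] = jb \<Longrightarrow>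
        LB (v + 1) ! ja = (LB v ! j \<union> LA (rt v) ! i2) \<inter> cls a \<Longrightarrow>
        LB (rt v) ! jb = (LB v ! j \<union> LA (v + 1) ! i1) \<inter> cls b \<Longrightarrow>
        Q \<subseteq> sols (Node a b) (LA v ! i) \<Longrightarrow> joined a b (LA (v + 1) ! i1) (LA (rt v) ! i2) \<subseteq> sols (Node a b) (LA v ! i) \<Longrightarrow>
        Q \<inter> joined a b (LA (v + 1) ! i1) (LA (rt v) ! i2) = {} \<Longrightarrow>
        sols a (LA (v + 1) ! i1) \<noteq> {} \<Longrightarrow> sols b (LA (rt v) ! i2) \<noteq> {} \<Longrightarrow>
        repr s v i j Q \<Longrightarrow> repr s (v + 1) i1 ja (sols a (LA (v + 1) ! i1)) \<Longrightarrow>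
        repr s (rt v) i2 jb (sols b (LA (rt v) ! i2)) \<Longrightarrow>
        spec COMB s (\<lambda>u. repr u v i j (Q \<union> joined a b (LA (v + 1) ! i1) (LA (rt v) ! i2)) \<and> only s u v i j) (cX v)"
begin

text \<open>Everything that this phase reads without changing; it survives because all writes of the
  phase lie in \<open>dpT\<close>.\<close>

definition glob :: "store \<Rightarrow> bool" where
  "glob s \<longleftrightarrow> static s \<and> (\<forall>v<sz T. doneA s LA v) \<and> readyB s LA LB \<and> extra s"

definition full :: "store \<Rightarrow> nat \<Rightarrow> bool" where
  "full s v \<longleftrightarrow> (\<forall>i<length (LA v). \<forall>j<length (LB v). repr s v i j (sols (pre T ! v) (LA v ! i)))"

definition zero :: "store \<Rightarrow> nat \<Rightarrow> bool" where
  "zero s v \<longleftrightarrow> (\<forall>t\<in>{54, 55}. \<forall>l. s (t # v # l) = 0)"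

lemma glob_eqT: "glob s \<Longrightarrow> eqT s u \<Longrightarrow> glob u"
proof -
  assume g: "glob s" and e: "eqT s u"
  have tag: "u (t # l) = s (t # l)" if "t \<notin> dpT" for t l using e that by (simp add: eqT_def)
  have "static u = static s" by (rule static_cong) (auto simp: tag dpT_def)
  moreover have "doneA u LA v = doneA s LA v" for v by (rule doneA_cong) (auto simp: tag dpT_def)
  moreover have "okB u LB 0 = okB s LB 0" by (rule okB_cong) (auto simp: tag dpT_def)
  moreover have "okJ u LA LB v t = okJ s LA LB v t" for v t by (rule okJ_cong) (auto simp: tag dpT_def)
  ultimately show ?thesis using g extra_eqT[OF _ e] unfolding glob_def readyB_def by simp
qed

lemma globD:
  assumes "glob s" "v < sz T"
  shows "okB s LB v" "length (LA v) \<le> k" "length (LB v) \<le> k" "s [acA, v] = length (LA v)" "s [acB, v] = length (LB v)"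
proof -
  show B: "okB s LB v" using assms okB_all[of s LB v LA] unfolding glob_def readyB_def by auto
  have A: "doneA s LA v" using assms unfolding glob_def by blast
  show "length (LA v) \<le> k" using length_psA[OF A] k(1)[OF pre_in_nodes[OF assms(2)]] by simp
  have "length (LB v) = card (psB (pre T ! v))" using B unfolding okB_def islist_def by (metis distinct_card)
  then show "length (LB v) \<le> k" using k(2)[OF pre_in_nodes[OF assms(2)]] by simp
  show "s [acA, v] = length (LA v)" "s [acB, v] = length (LB v)" using A B by (auto simp: doneA_def okB_def islist_def)
qed

definition costD :: "nat \<Rightarrow> nat" where
  "costD v = 12 + k * (1 + cC) + 2 * cV + k * (2 + k * (2 + k * (4 + cX v)))"

lemma clause_leafD:
  assumes g: "glob s" and v: "s [7] = v" "v < sz T" "pre T ! v = Leaf (Inl c)" and z: "zero s v"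
  shows "spec (For lj (At acB [V sv]) CL) s (\<lambda>u. full u v) (1 + k * (1 + cC))"
proof (rule spec_For_const[where n="length (LB v)" and c=cC and I="\<lambda>j u. glob u \<and>
    (\<forall>j'<j. repr u v 0 j' {{}}) \<and> (\<forall>j'\<ge>j. \<forall>t\<in>{54, 55}. \<forall>l. u (t # v # 0 # j' # l) = 0)"])
  show "val s (At acB [V sv]) = length (LB v)" using globD[OF g v(2)] v by simp
next
  fix j u assume j: "j < length (LB v)" and I: "glob u \<and>
    (\<forall>j'<j. repr u v 0 j' {{}}) \<and> (\<forall>j'\<ge>j. \<forall>t\<in>{54, 55}. \<forall>l. u (t # v # 0 # j' # l) = 0)"
    and ag: "agree (writes (For lj (At acB [V sv]) CL)) s u"
  let ?u = "u([lj] := j)"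
  have gu: "glob ?u" by (rule glob_eqT[of u]) (use I in \<open>auto intro!: eqT_update simp: dpT_def\<close>)
  have u7: "?u [7] = v" using agree_tag[OF ag, of 7] local(1) v by (fastforce simp: localp_def)
  have "spec CL ?u (\<lambda>u'. repr u' v 0 j {{}} \<and> only ?u u' v 0 j) cC"
    by (rule CL) (use gu v u7 I j globD[OF gu v(2)] in \<open>auto simp: glob_def\<close>)
  then show "spec CL ?u (\<lambda>u. glob u \<and> (\<forall>j'<Suc j. repr u v 0 j' {{}}) \<and>
     (\<forall>j'\<ge>Suc j. \<forall>t\<in>{54, 55}. \<forall>l. u (t # v # 0 # j' # l) = 0)) cC"
  proof (rule spec_mono)
    fix u' assume u': "repr u' v 0 j {{}} \<and> only ?u u' v 0 j" and ag': "agree (writes CL) ?u u'"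
    have g': "glob u'" using glob_eqT[OF gu eqT_agree[OF ag' localp_dpT[OF local(1)]]] .
    have r': "repr u' v 0 j' {{}}" if "j' < Suc j" for j'
    proof (cases "j' = j")
      case False
      have "repr u' v 0 j' {{}} = repr u v 0 j' {{}}"
        by (rule repr_cong) (use u' False only_eq in \<open>fastforce\<close>)
      then show ?thesis using I that False by simp
    qed (use u' in simp)
    have z': "u' (t # v # 0 # j' # l) = 0" if "j' \<ge> Suc j" "t \<in> {54, 55}" for t j' l
    proof -
      have "u' (t # v # 0 # j' # l) = ?u (t # v # 0 # j' # l)" using only_eq[of ?u u' v 0 j t 0 j' l] u' that by simp
      then show ?thesis using I that by auto
    qed
    show "glob u' \<and> (\<forall>j'<Suc j. repr u' v 0 j' {{}}) \<and>
     (\<forall>j'\<ge>Suc j. \<forall>t\<in>{54, 55}. \<forall>l. u' (t # v # 0 # j' # l) = 0)"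
      by (intro conjI allI impI ballI g' r' z')
  qed simp
next
  fix u assume u: "glob u \<and> (\<forall>j'<length (LB v). repr u v 0 j' {{}}) \<and>
    (\<forall>j'\<ge>length (LB v). \<forall>t\<in>{54, 55}. \<forall>l. u (t # v # 0 # j' # l) = 0)"
  then have dA: "doneA u LA v" using v unfolding glob_def by blast
  then have "set (LA v) = {{}}" "distinct (LA v)" using v by (auto simp: doneA_def psA_leaf islist_def)
  then have LA: "LA v = [{}]" 
    by (metis (no_types, lifting) card.empty card_1_singleton_iff card_insert_disjoint distinct_card empty_iff finite.emptyI length_0_conv length_Suc_conv list.set_intros(1) singletonD)
  have "sols (pre T ! v) {} = {{}}" using v by (auto simp: sols_def satX_def)
  then show "full u v" using u LA by (simp add: full_def)
next
  show "Suc (length (LB v) * Suc cC) \<le> 1 + k * (1 + cC)"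
    using mult_le_mono1[OF globD(3)[OF g v(2)], of "Suc cC"] by simp
qed (use g z in \<open>auto simp: zero_def\<close>)

lemma var_leafD:
  assumes g: "glob s" and v: "s [7] = v" "v < sz T" "pre T ! v = Leaf (Inr x)" and z: "zero s v"
  shows "spec (For l1 (N 2) (Asg si [] (At aI [V sv, V l1, N 0]) ;; VARL)) s (\<lambda>u. full u v) (5 + 2 * cV)"
proof -
  let ?body = "Asg si [] (At aI [V sv, V l1, N 0]) ;; VARL"
  \<comment> \<open>The truth values below \<open>b\<close> whose effect is the \<open>i\<close>-th
    set. Both values may have the same effect and then fall into one entry.\<close>
  let ?Q = "\<lambda>b i. {\<tau>. \<exists>b'<b. \<tau> = (if b' = (1 :: nat) then {x} else {}) \<and> occs b' x = LA v ! i}"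
  have psB: "set (LB v) = {{}}" "distinct (LB v)"
    using globD(1)[OF g v(2)] v by (auto simp: okB_def psB_var islist_def)
  then have lenB: "length (LB v) = 1" by (metis distinct_card is_singletonI is_singleton_altdef)
  have dA0: "doneA s LA v" using g v unfolding glob_def by blast
  have dist: "distinct (LA v)" using dA0 by (simp add: doneA_def islist_def)
  show ?thesis
  proof (rule spec_For_const[where n=2 and c="Suc cV" and I="\<lambda>b u. glob u \<and> (\<forall>i<length (LA v). repr u v i 0 (?Q b i))"])
    have "repr s v i 0 {}" for i by (rule repr_init) (use z in \<open>auto simp: zero_def\<close>)
    then show "glob s \<and> (\<forall>i<length (LA v). repr s v i 0 (?Q 0 i))" using g by simp
  next
    fix b u assume b: "b < 2" and I: "glob u \<and> (\<forall>i<length (LA v). repr u v i 0 (?Q b i))"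
      and ag: "agree (writes (For l1 (N 2) ?body)) s u"
    let ?w = "u([l1] := b)"
    have u7: "u [7] = v" using agree_tag[OF ag, of 7] local(2) v by (fastforce simp: localp_def)
    have dA: "doneA u LA v" using I v unfolding glob_def by blast
    let ?i = "u [aI, v, b, 0]"
    have i: "?i < length (LA v)" "LA v ! ?i = occs b x"
      using dA b v by (auto simp: doneA_def table_def)
    let ?u = "u([l1] := b, [si] := ?i)"
    have gu: "glob ?u" by (rule glob_eqT[of u]) (use I in \<open>auto intro!: eqT_update simp: dpT_def\<close>)
    have "spec VARL ?u (\<lambda>u'. repr u' v ?i 0 (insert (if b = 1 then {x} else {}) (?Q b ?i)) \<and> only ?u u' v ?i 0) cV"
    proof (rule VARL)
      have "repr ?u v ?i 0 (?Q b ?i) = repr u v ?i 0 (?Q b ?i)" by (rule repr_cong) auto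
      moreover have "repr u v ?i 0 (?Q b ?i)" using I i(1) by blast
      ultimately show "repr ?u v ?i 0 (?Q b ?i)" by (simp only:)
      show "?Q b ?i \<subseteq> (if b = 0 then {} else {{}})" using b by auto
    next
      fix w assume "w < sz T" then show "doneA ?u LA w" using gu by (simp add: glob_def)
    qed (use gu v u7 i b globD[OF gu v(2)] in \<open>auto simp: glob_def\<close>)
    then have "spec VARL ?u (\<lambda>u. glob u \<and> (\<forall>i<length (LA v). repr u v i 0 (?Q (Suc b) i))) cV"
    proof (rule spec_mono)
      fix u' assume u': "repr u' v ?i 0 (insert (if b = 1 then {x} else {}) (?Q b ?i)) \<and> only ?u u' v ?i 0"
        and ag': "agree (writes VARL) ?u u'"
      have "glob u'" using glob_eqT[OF gu eqT_agree[OF ag' localp_dpT[OF local(2)]]] .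
      moreover have "repr u' v i' 0 (?Q (Suc b) i')" if i': "i' < length (LA v)" for i'
      proof (cases "i' = ?i")
        case True
        have "?Q (Suc b) ?i = insert (if b = 1 then {x} else {}) (?Q b ?i)"
          unfolding i(2) less_Suc_eq by blast
        then show ?thesis unfolding True using u' by simp
      next
        case False
        have "LA v ! i' \<noteq> occs b x" using False dist i' i by (metis nth_eq_iff_index_eq)
        then have "?Q (Suc b) i' = ?Q b i'" unfolding less_Suc_eq by blast
        moreover have "repr u' v i' 0 (?Q b i') = repr u v i' 0 (?Q b i')"
          by (rule repr_cong) (use u' False only_eq in \<open>fastforce\<close>)
        ultimately show ?thesis using I i' by simp
      qed
      ultimately show "glob u' \<and> (\<forall>i<length (LA v). repr u' v i 0 (?Q (Suc b) i))" by blast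
    qed simp
    then show "spec ?body ?w (\<lambda>u. glob u \<and> (\<forall>i<length (LA v). repr u v i 0 (?Q (Suc b) i))) (Suc cV)"
      by (intro spec_AsgSeq) (use u7 in simp)
  next
    fix u assume u: "glob u \<and> (\<forall>i<length (LA v). repr u v i 0 (?Q 2 i))"
    have "?Q 2 i = sols (pre T ! v) (LA v ! i)" for i
    proof -
      have ex: "(\<exists>b'<2. R b') = (R 0 \<or> R (1 :: nat))" for R by (auto simp: less_2_cases_iff)
      have sat: "satX {x} {} = occs 0 x" "satX {x} {x} = occs 1 x" by (auto simp: satX_def occs_def)
      have q: "\<tau> \<in> ?Q 2 i \<longleftrightarrow> (\<tau> = {} \<and> occs 0 x = LA v ! i) \<or> (\<tau> = {x} \<and> occs 1 x = LA v ! i)" for \<tau>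
        unfolding mem_Collect_eq ex by simp
      have q': "\<tau> \<in> sols (pre T ! v) (LA v ! i) \<longleftrightarrow>
        (\<tau> = {} \<and> satX {x} {} = LA v ! i) \<or> (\<tau> = {x} \<and> satX {x} {x} = LA v ! i)" for \<tau>
        unfolding v(3) sols_def mem_Collect_eq vrs_simps cls_simps Diff_empty subset_singleton_iff by blast
      show ?thesis by (rule set_eqI) (simp only: q q' sat)
    qed
    then show "full u v" using u lenB by (simp add: full_def)
  qed simp_all
qed

lemma innerD_correct:
  assumes g: "glob s" and v: "s [7] = v" "v < sz T" "pre T ! v = Node a b" and z: "zero s v"
    and fl: "full s (v + 1)" and fr: "full s (rt v)"
  shows "spec (innerD COMB) s (\<lambda>u. full u v) (3 + k * (2 + k * (2 + k * (4 + cX v))))"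
proof -
  let ?l = "v + 1" and ?r = "rt v"
  have lr: "?r = v + 1 + sz a" "pre T ! ?l = a" "pre T ! ?r = b" "?l < sz T" "?r < sz T"
    using rt_Node[OF v(2,3)] by auto
  have vr: "v < ?r" "?l < ?r" using lr by (simp_all)
  have t: "Node a b \<in> nodes T" using pre_in_nodes[OF v(2)] v(3) by simp
  let ?nl = "length (LA ?l)" and ?nr = "length (LA ?r)" and ?nB = "length (LB v)"
  let ?A = "\<lambda>i1 i2. (LA ?l ! i1 \<union> LA ?r ! i2) - cls (Node a b)"
  let ?U = "{..<?nB} \<times> {..<?nl} \<times> {..<?nr}"
  let ?J = "\<lambda>i1 i2. joined a b (LA ?l ! i1) (LA ?r ! i2)"
  \<comment> \<open>The assignments that entry \<open>(i, j)\<close> has taken into account once the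
    triples in \<open>Z\<close> have been processed.\<close>
  define Q where "Q Z i j = (\<Union>(i1, i2)\<in>{(i1, i2). (j, i1, i2) \<in> Z \<and> ?A i1 i2 = LA v ! i}. ?J i1 i2)"
    for Z :: "(nat \<times> nat \<times> nat) set" and i j :: nat
  define P where "P Z u \<longleftrightarrow> (\<forall>i<length (LA v). \<forall>j<?nB. repr u v i j (Q Z i j))" for Z and u :: store
  let ?s = "s([sl] := ?l, [sr] := ?r)"
  let ?body = "Asg si [] (At aI [V sv, V l1, V l2]) ;; Asg sja [] (At aJ [V sl, V lj, V l2]) ;;
       Asg sjb [] (At aJ [V sr, V lj, V l1]) ;; COMB"
  let ?w = "writes (For lj (At acB [V sv]) (For l1 (At acA [V sl]) (For l2 (At acA [V sr]) ?body)))"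
  have dA: "\<And>w. w < sz T \<Longrightarrow> doneA s LA w" using g by (simp add: glob_def)
  have sets: "set (LA ?l) = psA a" "set (LA ?r) = psA b" "set (LA v) = psA (Node a b)"
    and dist: "distinct (LA v)" "distinct (LA ?l)" "distinct (LA ?r)"
    using dA[of ?l] dA[of ?r] dA[of v] lr v by (auto simp: doneA_def islist_def)
  have wT: "fst ` ?w \<subseteq> dpT" using localp_dpT[OF local(3)] by (auto simp: dpT_def)
  have cells: "u [7] = v" "u [sl] = ?l" "u [sr] = ?r" "glob u"
    "\<And>t w l. t \<in> {54, 55} \<Longrightarrow> w \<noteq> v \<Longrightarrow> u (t # w # l) = s (t # w # l)" if ag: "agree ?w ?s u" for u
  proof -
    have n: "t \<notin> fst ` writes COMB" if "t \<in> {7, 8, 9}" for t using local(3) that by (fastforce simp: localp_def)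
    have x: "t \<notin> fst ` ?w" if "t \<in> {7, 8, 9}" for t using n[OF that] that by auto
    show 1: "u [7] = v" "u [sl] = ?l" "u [sr] = ?r" using agree_tag[OF ag x] v by auto
    have "eqT ?s u" by (rule eqT_agree[OF ag wT])
    moreover have "eqT s ?s" by (auto intro!: eqT_update simp: dpT_def)
    ultimately show "glob u" using glob_eqT[OF g] eqT_trans by blast
    fix t w l assume tw: "t \<in> {54, 55 :: nat}" "w \<noteq> v"
    have "u (t # w # l) = ?s (t # w # l)"
    proof (rule agree_index[OF ag])
      fix oo assume "(t, oo) \<in> ?w"
      then have "(t, oo) \<in> writes COMB" using tw by auto
      then have "oo = Some 7" using tw local(3) unfolding localp_def by fastforce
      then show "\<exists>v. oo = Some v \<and> v \<notin> fst ` ?w \<and> w \<noteq> ?s [v]" using x[of 7] tw v by auto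
    qed
    then show "u (t # w # l) = s (t # w # l)" using tw by auto
  qed
  have body: "spec ?body u (P (insert (j, i1, i2) Z)) (3 + cX v)"
    if ag: "agree ?w ?s u" and ij: "j < ?nB" "i1 < ?nl" "i2 < ?nr" "u [lj] = j" "u [l1] = i1" "u [l2] = i2"
      and P: "P Z u" and Z: "(j, i1, i2) \<notin> Z" "Z \<subseteq> ?U" for u j i1 i2 Z
  proof -
    note c = cells[OF ag]
    have J: "okJ u LA LB v (Node a b)" and dv: "doneA u LA v" using c(4) v unfolding glob_def readyB_def by auto
    define i where "i = u [aI, v, i1, i2]"
    define ja where "ja = u [aJ, ?l, j, i2]"
    define jb where "jb = u [aJ, ?r, j, i1]"
    have tI: "table u aI v ?A (LA v) ({..<?nl} \<times> {..<?nr})"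
      using dv unfolding doneA_def v(3) tableA.simps by blast
    have tJ: "table u aJ ?l (\<lambda>j i. (LB v ! j \<union> LA ?r ! i) \<inter> cls a) (LB ?l) ({..<?nB} \<times> {..<?nr})"
      "table u aJ ?r (\<lambda>j i. (LB v ! j \<union> LA ?l ! i) \<inter> cls b) (LB ?r) ({..<?nB} \<times> {..<?nl})"
      using J unfolding okJ.simps by blast+
    have i: "i < length (LA v)" "LA v ! i = ?A i1 i2"
      using tableD[OF tI, of i1 i2] ij unfolding i_def by auto
    have ja: "ja < length (LB ?l)" "LB ?l ! ja = (LB v ! j \<union> LA ?r ! i2) \<inter> cls a"
      using tableD[OF tJ(1), of j i2] ij unfolding ja_def by auto
    have jb: "jb < length (LB ?r)" "LB ?r ! jb = (LB v ! j \<union> LA ?l ! i1) \<inter> cls b"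
      using tableD[OF tJ(2), of j i1] ij unfolding jb_def by auto
    let ?u = "u([si] := i, [sja] := ja, [sjb] := jb)"
    have gu: "glob ?u" by (rule glob_eqT[OF c(4)]) (auto intro!: eqT_update simp: dpT_def)
    have ru: "repr ?u w i' j' X = repr u w i' j' X" for w i' j' X by (rule repr_cong) auto
    have A12: "LA ?l ! i1 \<in> psA a" "LA ?r ! i2 \<in> psA b" using ij sets by (metis nth_mem)+
    have Qsub: "Q Z i' j' \<subseteq> sols (Node a b) (LA v ! i')" if "j' < ?nB" for i' j'
    proof
      fix \<tau> assume "\<tau> \<in> Q Z i' j'"
      then obtain x y where "(j', x, y) \<in> Z" "?A x y = LA v ! i'" "\<tau> \<in> ?J x y" unfolding Q_def by auto
      moreover from this(1) Z(2) have "LA ?l ! x \<in> psA a" "LA ?r ! y \<in> psA b" using sets by (auto simp flip: sets)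
      ultimately show "\<tau> \<in> sols (Node a b) (LA v ! i')" unfolding sols_Node[OF t] by blast
    qed
    have spC: "spec COMB ?u (\<lambda>u'. repr u' v i j (Q Z i j \<union> ?J i1 i2) \<and> only ?u u' v i j) (cX v)"
    proof (rule COMB)
      show "static ?u" "extra ?u" using gu by (auto simp: glob_def)
      show "?J i1 i2 \<subseteq> sols (Node a b) (LA v ! i)" unfolding sols_Node[OF t] using A12 i(2) by blast
      \<comment> \<open>The lists of the children have no repetitions, so different positions mean
        different pairs of effects, to which \<open>joined_disjoint\<close> applies.\<close>
      show "Q Z i j \<inter> ?J i1 i2 = {}"
      proof -
        have "?J x y \<inter> ?J i1 i2 = {}" if "(j, x, y) \<in> Z" for x y
        proof (rule joined_disjoint[OF t])
          have "x < ?nl" "y < ?nr" "(x, y) \<noteq> (i1, i2)" using that Z by auto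
          then show "(LA ?l ! x, LA ?r ! y) \<noteq> (LA ?l ! i1, LA ?r ! i2)"
            using dist ij by (auto simp: nth_eq_iff_index_eq)
        qed
        then show ?thesis unfolding Q_def by blast
      qed
      show "sols a (LA ?l ! i1) \<noteq> {}" "sols b (LA ?r ! i2) \<noteq> {}" using A12 unfolding psA_def sols_def by blast+
      have "repr u ?l i1 ja (sols a (LA ?l ! i1)) = repr s ?l i1 ja (sols a (LA ?l ! i1))"
        by (rule repr_cong) (rule c(5), auto)
      then show "repr ?u ?l i1 ja (sols a (LA ?l ! i1))"
        unfolding ru using fl ij ja lr by (simp add: full_def)
      have "repr u ?r i2 jb (sols b (LA ?r ! i2)) = repr s ?r i2 jb (sols b (LA ?r ! i2))"
        by (rule repr_cong) (rule c(5), use vr in auto)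
      then show "repr ?u ?r i2 jb (sols b (LA ?r ! i2))"
        unfolding ru using fr ij jb lr by (simp add: full_def)
      show "repr ?u v i j (Q Z i j)" unfolding ru using P i ij by (simp add: P_def)
      show "Q Z i j \<subseteq> sols (Node a b) (LA v ! i)" by (rule Qsub[OF ij(1)])
    next
      fix w assume "w < sz T" then show "doneA ?u LA w" using gu by (simp add: glob_def)
    qed (use v c ij i ja jb in auto)
    have "spec COMB ?u (P (insert (j, i1, i2) Z)) (cX v)"
    proof (rule spec_mono[OF spC])
      fix u' assume u': "repr u' v i j (Q Z i j \<union> ?J i1 i2) \<and> only ?u u' v i j"
      show "P (insert (j, i1, i2) Z) u'" unfolding P_def
      proof (intro allI impI)
        fix i' j' assume ij': "i' < length (LA v)" "j' < ?nB"
        show "repr u' v i' j' (Q (insert (j, i1, i2) Z) i' j')"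
        proof (cases "(i', j') = (i, j)")
          case True
          have "Q (insert (j, i1, i2) Z) i j = Q Z i j \<union> ?J i1 i2" unfolding Q_def using i(2) by blast
          then show ?thesis using u' True by simp
        next
          case False
          \<comment> \<open>Since \<open>LA v\<close> has no repetitions, a triple contributes to
            one entry only.\<close>
          have "?A i1 i2 \<noteq> LA v ! i'" if "j' = j"
            using False that dist(1) i ij' by (metis nth_eq_iff_index_eq)
          then have "Q (insert (j, i1, i2) Z) i' j' = Q Z i' j'" unfolding Q_def by blast
          moreover have "repr u' v i' j' (Q Z i' j') = repr ?u v i' j' (Q Z i' j')"
            by (rule repr_cong) (rule only_eq[of ?u u' v i j], use u' False in auto)
          ultimately show ?thesis using P ij' unfolding ru P_def by simp
        qed
      qed
    qed simp
    then have "spec ?body u (P (insert (j, i1, i2) Z)) (Suc (Suc (Suc (cX v))))"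
      by (intro spec_AsgSeq) (use c ij in \<open>simp add: i_def ja_def jb_def\<close>)
    then show ?thesis by (rule spec_mono) auto
  qed
  have Pupd: "P Z (u([x] := y)) = P Z u" for Z u x y
    unfolding P_def by (simp add: repr_cong[of "u([x] := y)" v _ _ u])
  have len: "?nl \<le> k" "?nr \<le> k" "?nB \<le> k" using globD[OF g] v lr by auto
  have upd: "agree ?w ?s (u([x] := y))" if "agree ?w ?s u" "x \<in> {24, 25, 26}" for u x y
    using that by (auto intro!: agree_update[where oo=None])
  let ?L2 = "For l2 (At acA [V sr]) ?body" let ?L1 = "For l1 (At acA [V sl]) ?L2"
  have loop2: "spec ?L2 u (P (Z \<union> {j} \<times> {i1} \<times> {..<?nr})) (1 + k * (4 + cX v))"
    if ag: "agree ?w ?s u" and ij: "j < ?nB" "i1 < ?nl" "u [lj] = j" "u [l1] = i1"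
      and P: "P Z u" and Z: "\<And>i2. (j, i1, i2) \<notin> Z" "Z \<subseteq> ?U" for u j i1 Z
  proof (rule spec_For_const[where n="?nr" and c="3 + cX v" and I="\<lambda>i2. P (Z \<union> {j} \<times> {i1} \<times> {..<i2})"])
    show "val u (At acA [V sr]) = ?nr" using cells[OF ag] globD(4)[OF _ lr(5), of u] by simp
  next
    fix i2 u' assume i2: "i2 < ?nr" and I: "P (Z \<union> {j} \<times> {i1} \<times> {..<i2}) u'" and ag': "agree (writes ?L2) u u'"
    have ag2: "agree ?w ?s u'" by (rule agree_trans[OF ag agree_mono[OF ag']]) auto
    have eq: "Z \<union> {j} \<times> {i1} \<times> {..<Suc i2} = insert (j, i1, i2) (Z \<union> {j} \<times> {i1} \<times> {..<i2})" by auto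
    have x: "t \<notin> fst ` writes ?L2" if "t \<in> {24, 26}" for t using local(3) that by (fastforce simp: localp_def)
    show "spec ?body (u'([l2] := i2)) (P (Z \<union> {j} \<times> {i1} \<times> {..<Suc i2})) (3 + cX v)"
      unfolding eq
    proof (rule body[OF upd[OF ag2]])
      show "(u'([l2] := i2)) [lj] = j" "(u'([l2] := i2)) [l1] = i1"
        using agree_tag[OF ag' x] ij by auto
      show "P (Z \<union> {j} \<times> {i1} \<times> {..<i2}) (u'([l2] := i2))" unfolding Pupd by (rule I)
    qed (use ij i2 Z in auto)
  next
    show "Suc (?nr * Suc (3 + cX v)) \<le> 1 + k * (4 + cX v)" using mult_le_mono1[OF len(2), of "4 + cX v"] by simp
  qed (use P in simp_all)
  have loop1: "spec ?L1 u (P (Z \<union> {j} \<times> {..<?nl} \<times> {..<?nr})) (1 + k * (2 + k * (4 + cX v)))"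
    if ag: "agree ?w ?s u" and ij: "j < ?nB" "u [lj] = j"
      and P: "P Z u" and Z: "\<And>i1 i2. (j, i1, i2) \<notin> Z" "Z \<subseteq> ?U" for u j Z
  proof (rule spec_For_const[where n="?nl" and c="1 + k * (4 + cX v)" and I="\<lambda>i1. P (Z \<union> {j} \<times> {..<i1} \<times> {..<?nr})"])
    show "val u (At acA [V sl]) = ?nl" using cells[OF ag] globD(4)[OF _ lr(4), of u] by simp
  next
    fix i1 u' assume i1: "i1 < ?nl" and I: "P (Z \<union> {j} \<times> {..<i1} \<times> {..<?nr}) u'" and ag': "agree (writes ?L1) u u'"
    have ag2: "agree ?w ?s u'" by (rule agree_trans[OF ag agree_mono[OF ag']]) auto
    have eq: "Z \<union> {j} \<times> {..<Suc i1} \<times> {..<?nr} = (Z \<union> {j} \<times> {..<i1} \<times> {..<?nr}) \<union> {j} \<times> {i1} \<times> {..<?nr}" by auto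
    have x: "t \<notin> fst ` writes ?L1" if "t = 26" for t using local(3) that by (fastforce simp: localp_def)
    show "spec ?L2 (u'([l1] := i1)) (P (Z \<union> {j} \<times> {..<Suc i1} \<times> {..<?nr})) (1 + k * (4 + cX v))"
      unfolding eq
    proof (rule loop2[OF upd[OF ag2]])
      show "(u'([l1] := i1)) [lj] = j" using agree_tag[OF ag' x] ij by auto
      show "P (Z \<union> {j} \<times> {..<i1} \<times> {..<?nr}) (u'([l1] := i1))" unfolding Pupd by (rule I)
    qed (use ij i1 Z in auto)
  next
    show "Suc (?nl * Suc (1 + k * (4 + cX v))) \<le> 1 + k * (2 + k * (4 + cX v))"
      using mult_le_mono1[OF len(1), of "2 + k * (4 + cX v)"] by simp
  qed (use P in simp_all)
  have "spec (For lj (At acB [V sv]) ?L1) ?s (P ({..<?nB} \<times> {..<?nl} \<times> {..<?nr})) (1 + k * (2 + k * (2 + k * (4 + cX v))))"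
  proof (rule spec_For_const[where n="?nB" and c="1 + k * (2 + k * (4 + cX v))" and I="\<lambda>j. P ({..<j} \<times> {..<?nl} \<times> {..<?nr})"])
    show "val ?s (At acB [V sv]) = ?nB" using v globD(5)[OF g v(2)] by simp
    have "repr ?s v i j {}" for i j by (rule repr_init) (use z in \<open>auto simp: zero_def\<close>)
    then show "P ({..<0} \<times> {..<?nl} \<times> {..<?nr}) ?s" by (simp add: P_def Q_def)
  next
    fix j u assume j: "j < ?nB" and I: "P ({..<j} \<times> {..<?nl} \<times> {..<?nr}) u"
      and ag: "agree ?w ?s u"
    have eq: "{..<Suc j} \<times> {..<?nl} \<times> {..<?nr} = ({..<j} \<times> {..<?nl} \<times> {..<?nr}) \<union> {j} \<times> {..<?nl} \<times> {..<?nr}" by auto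
    show "spec ?L1 (u([lj] := j)) (P ({..<Suc j} \<times> {..<?nl} \<times> {..<?nr})) (1 + k * (2 + k * (4 + cX v)))"
      unfolding eq
    proof (rule loop1[OF upd[OF ag]])
      show "P ({..<j} \<times> {..<?nl} \<times> {..<?nr}) (u([lj] := j))" unfolding Pupd by (rule I)
    qed (use j in auto)
  next
    show "Suc (?nB * Suc (1 + k * (2 + k * (4 + cX v)))) \<le> 1 + k * (2 + k * (2 + k * (4 + cX v)))"
      using mult_le_mono1[OF len(3), of "2 + k * (2 + k * (4 + cX v))"] by simp
  qed simp
  then have "spec (For lj (At acB [V sv]) ?L1) ?s (\<lambda>u. full u v) (1 + k * (2 + k * (2 + k * (4 + cX v))))"
  proof (rule spec_mono)
    fix u assume P: "P ?U u"
    \<comment> \<open>The positions run through all pairs of child effects, so the contributions are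
      precisely those in \<open>sols_Node\<close>.\<close>
    have "Q ?U i j = sols (pre T ! v) (LA v ! i)" if "i < length (LA v)" "j < ?nB" for i j
    proof -
      have "{(A1, A2). A1 \<in> psA a \<and> A2 \<in> psA b \<and> (A1 \<union> A2) - cls (Node a b) = LA v ! i}
        = (\<lambda>(i1, i2). (LA ?l ! i1, LA ?r ! i2)) ` {(i1, i2). (j, i1, i2) \<in> ?U \<and> ?A i1 i2 = LA v ! i}"
        unfolding sets(1,2)[symmetric] using that(2) by (auto simp: in_set_conv_nth image_iff)
      then show ?thesis unfolding v(3) sols_Node[OF t] Q_def by (simp add: case_prod_unfold)
    qed
    then show "full u v" using P unfolding P_def full_def by simp
  qed simp
  then have "spec (innerD COMB) s (\<lambda>u. full u v) (Suc (Suc (1 + k * (2 + k * (2 + k * (4 + cX v))))))"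
    unfolding innerD_def
    by (intro spec_AsgSeq) (use v dA[of ?l] lr in \<open>simp add: doneA_def\<close>)
  then show ?thesis by (rule spec_mono) auto
qed

lemma nodeD_correct:
  assumes g: "glob s" and v: "s [7] = v" "v < sz T" and z: "zero s v"
    and later: "\<And>w. v < w \<Longrightarrow> w < sz T \<Longrightarrow> full s w"
  shows "spec (nodeD CL VARL COMB) s (\<lambda>u. full u v) (costD v)"
proof -
  have tag: "tagged s v (pre T ! v)" using g v by (simp add: glob_def static_def)
  show ?thesis
  proof (cases "pre T ! v")
    case (Leaf y)
    show ?thesis
    proof (cases y)
      case (Inl c)
      show ?thesis unfolding nodeD_def
        using clause_leafD[OF g v] z tag Leaf Inl v
        by (intro spec_Ife[where c="1 + k * (1 + cC)"]) (auto simp: costD_def)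
    next
      case (Inr x)
      show ?thesis unfolding nodeD_def
        using var_leafD[OF g v] z tag Leaf Inr v
        by (intro spec_Ife[where c="6 + 2 * cV"] spec_Ife[where c="5 + 2 * cV"]) (auto simp: costD_def)
    qed
  next
    case (Node a b)
    have r: "v < rt v" "rt v < sz T" "v + 1 < sz T" using rt_Node[OF v(2) Node] by auto
    show ?thesis unfolding nodeD_def
      using innerD_correct[OF g v Node z later later] tag Node v r
      by (intro spec_Ife[where c="4 + k * (2 + k * (2 + k * (4 + cX v)))"] spec_Ife[where c="3 + k * (2 + k * (2 + k * (4 + cX v)))"])
        (auto simp: costD_def)
  qed
qed

lemma wr_nodeD: "fst ` writes (nodeD CL VARL COMB) \<subseteq> dpT - {7}"
proof -
  have "fst ` writes p \<subseteq> dpT - {7}" if "localp p" for p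
    using localp_dpT[OF that] that unfolding localp_def by fastforce
  then show ?thesis using local unfolding nodeD_def innerD_def by (auto simp: dpT_def)
qed

lemma nodeD_table:
  assumes "agree (writes (nodeD CL VARL COMB)) s u" "t \<in> {54, 55}" "w \<noteq> s [7]"
  shows "u (t # w # l) = s (t # w # l)"
proof (rule agree_index[OF assms(1)])
  fix oo assume "(t, oo) \<in> writes (nodeD CL VARL COMB)"
  then have "(t, oo) \<in> writes CL \<union> writes VARL \<union> writes COMB"
    using assms(2) unfolding nodeD_def innerD_def by auto
  then have "oo = Some 7" using assms(2) local unfolding localp_def by fastforce
  then show "\<exists>v. oo = Some v \<and> v \<notin> fst ` writes (nodeD CL VARL COMB) \<and> w \<noteq> s [v]"
    using assms(3) wr_nodeD by blast
qed

text \<open>The root has a single outside effect and a single help, both empty, so its only entry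
  accounts for all assignments.\<close>

theorem treeD_correct:
  assumes g: "glob s" and z: "\<And>v. v < sz T \<Longrightarrow> zero s v"
  shows "spec (treeD CL VARL COMB) s (\<lambda>u. repr u 0 0 0 (Pow {..<n})) (2 + (\<Sum>v<sz T. 2 + costD v))"
  unfolding treeD_def
proof (rule spec_mono[OF spec_AsgSeq])
  let ?N = "sz T"
  have N: "s [sN] = ?N" using g by (simp add: glob_def static_def)
  let ?s = "s([sv] := ?N)"
  let ?body = "Asg sv [] (Sub (V sv) (N 1)) ;; nodeD CL VARL COMB"
  let ?I = "\<lambda>j u. u [sv] = ?N - j \<and> glob u \<and> (\<forall>v<?N - j. zero u v) \<and> (\<forall>v. ?N - j \<le> v \<and> v < ?N \<longrightarrow> full u v)"
  have "spec (For lv (V sN) ?body) ?s (\<lambda>u. repr u 0 0 0 (Pow {..<n})) (1 + (\<Sum>v<?N. 2 + costD v))"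
  proof (rule spec_For[where n="?N" and c="\<lambda>j. Suc (costD (?N - Suc j))" and I="?I"])
    have "glob ?s" by (rule glob_eqT[OF g]) (auto intro!: eqT_update simp: dpT_def)
    then show "?I 0 ?s" using z by (auto simp: zero_def)
  next
    fix j u assume j: "j < ?N" and I: "?I j u"
    let ?v = "?N - Suc j"
    let ?u = "u([lv] := j, [sv] := ?v)"
    have vN: "?N - j = Suc ?v" using j by simp
    have gu: "glob ?u" by (rule glob_eqT[of u]) (use I in \<open>auto intro!: eqT_update simp: dpT_def\<close>)
    have fu: "full ?u w = full u w" for w
    proof -
      have "repr ?u w i j' X = repr u w i j' X" for i j' X by (rule repr_cong) auto
      then show ?thesis by (simp add: full_def)
    qed
    have zu: "zero ?u w = zero u w" for w by (auto simp: zero_def)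
    have "spec (nodeD CL VARL COMB) ?u (?I (Suc j)) (costD ?v)"
    proof (rule spec_mono[OF nodeD_correct[OF gu]])
      show "?u [7] = ?v" "?v < ?N" using j by auto
      show "zero ?u ?v" unfolding zu using I vN by simp
    next
      fix w assume "?v < w" "w < ?N" then show "full ?u w" unfolding fu using I vN by simp
    next
      fix u' assume f: "full u' ?v" and ag': "agree (writes (nodeD CL VARL COMB)) ?u u'"
      have keep: "u' (t # w # l) = ?u (t # w # l)" if "w \<noteq> ?v" "t \<in> {54, 55}" for t w l
        using nodeD_table[OF ag' that(2)] that(1) by simp
      have "7 \<notin> fst ` writes (nodeD CL VARL COMB)" using wr_nodeD by blast
      from agree_tag[OF ag' this, of "[]"] have 1: "u' [sv] = ?v" by simp
      have 2: "glob u'" by (rule glob_eqT[OF gu eqT_agree[OF ag']]) (use wr_nodeD in blast)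
      have 3: "zero u' w" if "w < ?v" for w
      proof -
        have "zero ?u w" unfolding zu using I vN that by simp
        then show ?thesis using keep[of w] that unfolding zero_def by simp
      qed
      have 4: "full u' w" if "?v \<le> w" "w < ?N" for w
      proof (cases "w = ?v")
        case False
        have "repr u' w i j' X = repr ?u w i j' X" for i j' X by (rule repr_cong) (rule keep[OF False])
        then have "full u' w = full ?u w" by (simp add: full_def)
        then show ?thesis unfolding fu using I vN that False by simp
      qed (use f in simp)
      show "?I (Suc j) u'" using 1 2 3 4 by blast
    qed simp
    moreover have "(u([lv] := j))(sv # map (val (u([lv] := j))) [] := val (u([lv] := j)) (Sub (V sv) (N 1))) = ?u"
      using I vN by simp
    ultimately show "spec ?body (u([lv] := j)) (?I (Suc j)) (Suc (costD (?N - Suc j)))"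
      by (intro spec_AsgSeq) simp
  next
    fix u assume "?I ?N u"
    then have f: "full u 0" and gl: "glob u" by auto
    have dA: "doneA u LA 0" and B: "okB u LB 0" using gl unfolding glob_def readyB_def by auto
    then have 1: "set (LA 0) = {{}}" "set (LB 0) = {{}}" by (auto simp: doneA_def okB_def pre_0 psA_T psB_T)
    then have l: "0 < length (LA 0)" "0 < length (LB 0)" by (metis empty_not_insert length_greater_0_conv list.set(1))+
    have h: "LA 0 ! 0 = {}" using l(1) 1(1) by (metis nth_mem singletonD)
    have S: "sols T {} = Pow {..<n}" by (auto simp: sols_def vrs_T cls_T satX_def)
    have "repr u 0 0 0 (sols (pre T ! 0) (LA 0 ! 0))" using f l unfolding full_def by blast
    then show "repr u 0 0 0 (Pow {..<n})" by (simp only: pre_0 h S)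
  next
    \<comment> \<open>Iteration \<open>j\<close> treats node \<open>?N - Suc j\<close>; reversing
      the order of summation gives the sum over the nodes.\<close>
    have "(\<Sum>j<?N. Suc (Suc (costD (?N - Suc j)))) = (\<Sum>v<?N. Suc (Suc (costD v)))"
      by (rule sum.nat_diff_reindex)
    then show "Suc (\<Sum>j<?N. Suc (Suc (costD (?N - Suc j)))) \<le> 1 + (\<Sum>v<?N. 2 + costD v)" by simp
  qed (use N in simp_all)
  then show "spec (For lv (V sN) ?body) (s(sv # map (val s) [] := val s (V sN))) (\<lambda>u. repr u 0 0 0 (Pow {..<n}))
     (1 + (\<Sum>v<?N. 2 + costD v))" using N by simp
qed simp_all

end

section \<open>Counting\<close>

abbreviation (input) "su \<equiv> 12 :: nat"
abbreviation (input) "scar \<equiv> 13 :: nat"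
abbreviation (input) "sq \<equiv> 14 :: nat"
abbreviation (input) "lt \<equiv> 28 :: nat"
abbreviation (input) "l3 \<equiv> 29 :: nat"
abbreviation (input) "aNum \<equiv> 54 :: nat"
abbreviation (input) "aBuf \<equiv> 56 :: nat"

section \<open>Bit arrays as numbers\<close>

definition num :: "(nat \<Rightarrow> nat) \<Rightarrow> nat \<Rightarrow> nat" where
  "num f len = (\<Sum>t<len. f t * 2 ^ t)"

lemma num_0 [simp]: "num f 0 = 0" and num_Suc [simp]: "num f (Suc t) = num f t + f t * 2 ^ t"
  by (simp_all add: num_def)

lemma num_less: "(\<And>t. t < len \<Longrightarrow> f t \<le> 1) \<Longrightarrow> num f len < 2 ^ len"
proof (induction len)
  case (Suc len)
  have "f len * 2 ^ len \<le> 1 * 2 ^ len" using Suc.prems[of len] by (intro mult_le_mono1) simp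
  moreover have "num f len < 2 ^ len" using Suc by simp
  ultimately show ?case unfolding num_Suc power_Suc by linarith
qed simp

lemma num_cong: "(\<And>t. t < len \<Longrightarrow> f t = g t) \<Longrightarrow> num f len = num g len"
  unfolding num_def by (intro sum.cong) auto

lemma num_zero: "(\<And>t. t < len \<Longrightarrow> f t = 0) \<Longrightarrow> num f len = 0"
  unfolding num_def by (intro sum.neutral) auto

lemma num_extend:
  assumes "a \<le> len" "\<And>t. a \<le> t \<Longrightarrow> t < len \<Longrightarrow> f t = 0"
  shows "num f len = num f a"
  using assms by (induction len rule: dec_induct) auto

lemma num_add: "num f (a + w) = num f a + 2 ^ a * num (\<lambda>t. f (a + t)) w"
  by (induction w) (auto simp: algebra_simps power_add)

text \<open>Changing digits only in the window from \<open>a\<close> to \<open>a + w\<close> changes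
  the number by \<open>2 ^ a\<close> times the change of the window; the additive form avoids
  truncated subtraction.\<close>

lemma num_window:
  assumes "a + w \<le> len" "\<And>t. t < len \<Longrightarrow> t < a \<or> a + w \<le> t \<Longrightarrow> g t = f t"
  shows "num g len + 2 ^ a * num (\<lambda>t. f (a + t)) w = num f len + 2 ^ a * num (\<lambda>t. g (a + t)) w"
proof -
  define r where "r = len - (a + w)"
  have len: "len = a + w + r" using assms(1) by (simp add: r_def)
  have "num g a = num f a" using assms by (intro num_cong) auto
  moreover have "num (\<lambda>t. g (a + w + t)) r = num (\<lambda>t. f (a + w + t)) r"
    using assms(2) len by (intro num_cong) auto
  ultimately show ?thesis unfolding len num_add by simp
qed

text \<open>The position \<open>su\<close> in the destination advances independently of the source
  index \<open>lt\<close>, so the same loop also adds a shifted number. The scalar \<open>sq\<close>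
  collects two bits and the carry, at most 3.\<close>

definition addloop :: "nat \<Rightarrow> exp list \<Rightarrow> exp \<Rightarrow> exp \<Rightarrow> prog" where
  "addloop dt des src len =
    Asg scar [] (N 0) ;;
    For lt len (
      Asg sq [] (At dt (des @ [V su])) ;;
      Ife (N 0) src (Asg sq [] (Inc (V sq))) skip ;;
      Ife (N 0) (V scar) (Asg sq [] (Inc (V sq))) skip ;;
      Ife (N 1) (V sq)
        (Asg dt (des @ [V su]) (Sub (V sq) (N 2)) ;; Asg scar [] (N 1))
        (Asg dt (des @ [V su]) (V sq) ;; Asg scar [] (N 0)) ;;
      Asg su [] (Inc (V su)))"

text \<open>Finer than \<open>agree\<close>, which would allow changes in all entries of the current
  node: here only the row with index \<open>dv\<close> and scratch names may change.\<close>

definition upto_cells :: "store \<Rightarrow> store \<Rightarrow> nat \<Rightarrow> nat list \<Rightarrow> bool" where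
  "upto_cells s u dt dv \<longleftrightarrow>
    (\<forall>t l. t \<notin> {11, 12, 13, 14, 28} \<longrightarrow> \<not> (t = dt \<and> (\<exists>x. l = dv @ [x])) \<longrightarrow> u (t # l) = s (t # l))"

lemma addloop_correct:
  assumes dt: "dt \<notin> {11, 12, 13, 14, 28}"
    and src: "\<And>u t. t < n \<Longrightarrow> u [lt] = t \<Longrightarrow> upto_cells s u dt dv \<Longrightarrow> val u src = S t"
    and des: "\<And>u. upto_cells s u dt dv \<Longrightarrow> map (val u) des = dv"
    and len: "val (s([scar] := 0)) len = n" and su: "s [su] = u0"
    and bits: "\<And>t. t < n \<Longrightarrow> S t \<le> 1" "\<And>t. t < n \<Longrightarrow> s (dt # dv @ [u0 + t]) \<le> 1"
    and fits: "num (\<lambda>t. s (dt # dv @ [u0 + t])) n + num S n < 2 ^ n"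
  shows "spec (addloop dt des src len) s (\<lambda>u. upto_cells s u dt dv \<and>
      (\<forall>x. x < u0 \<or> u0 + n \<le> x \<longrightarrow> u (dt # dv @ [x]) = s (dt # dv @ [x])) \<and>
      (\<forall>t<n. u (dt # dv @ [u0 + t]) \<le> 1) \<and>
      num (\<lambda>t. u (dt # dv @ [u0 + t])) n = num (\<lambda>t. s (dt # dv @ [u0 + t])) n + num S n) (2 + 10 * n)"
proof -
  let ?D = "\<lambda>u x. u (dt # dv @ [x])"
  \<comment> \<open>The pending carry has weight \<open>2 ^ t\<close>; with it, the \<open>t\<close>
    digits written so far equal the sum of the low parts of both numbers.\<close>
  let ?I = "\<lambda>t u. upto_cells s u dt dv \<and> u [su] = u0 + t \<and> u [scar] \<le> 1 \<and>
      (\<forall>x. x < u0 \<or> u0 + t \<le> x \<longrightarrow> ?D u x = ?D s x) \<and> (\<forall>t'<t. ?D u (u0 + t') \<le> 1) \<and>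
      num (\<lambda>t. ?D u (u0 + t)) t + u [scar] * 2 ^ t = num (\<lambda>t. ?D s (u0 + t)) t + num S t"
  let ?s = "s([scar] := 0)"
  let ?body = "Asg sq [] (At dt (des @ [V su])) ;;
      Ife (N 0) src (Asg sq [] (Inc (V sq))) skip ;;
      Ife (N 0) (V scar) (Asg sq [] (Inc (V sq))) skip ;;
      Ife (N 1) (V sq)
        (Asg dt (des @ [V su]) (Sub (V sq) (N 2)) ;; Asg scar [] (N 1))
        (Asg dt (des @ [V su]) (V sq) ;; Asg scar [] (N 0)) ;;
      Asg su [] (Inc (V su))"
  have upd: "upto_cells s (u(t # l := x)) dt dv" if "upto_cells s u dt dv" "t \<in> {11, 12, 13, 14, 28}" for u t l x
    using that unfolding upto_cells_def by auto
  have "spec (For lt len ?body) ?s (\<lambda>u. upto_cells s u dt dv \<and>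
      (\<forall>x. x < u0 \<or> u0 + n \<le> x \<longrightarrow> ?D u x = ?D s x) \<and>
      (\<forall>t<n. ?D u (u0 + t) \<le> 1) \<and>
      num (\<lambda>t. ?D u (u0 + t)) n = num (\<lambda>t. ?D s (u0 + t)) n + num S n) (1 + 10 * n)"
  proof (rule spec_For_const[where n=n and c=9 and I="?I"])
    have "upto_cells s ?s dt dv" by (rule upd) (auto simp: upto_cells_def)
    then show "?I 0 ?s" using su dt by auto
  next
    fix t u assume t: "t < n" and I: "?I t u"
    let ?v = "u([lt] := t)"
    define y where "y = ?D s (u0 + t)"
    define q where "q = y + S t + u [scar]"
    have y: "?D u (u0 + t) = y" "y \<le> 1" using I bits(2)[OF t] by (auto simp: y_def)
    have S1: "S t \<le> 1" using bits(1)[OF t] .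
    have up: "upto_cells s ?v dt dv" using upd I by simp
    have D': "?D (w(r # l := x)) z = ?D w z" if "r \<in> {11, 12, 13, 14, 28}" for w :: store and r l x z
      using that dt by auto
    let ?w1 = "?v([sq] := y)"
    have s1: "run_prog (Asg sq [] (At dt (des @ [V su]))) ?v = ?w1"
      using des[OF up] I y dt by simp
    let ?w2 = "?w1([sq] := y + S t)"
    have upw1: "upto_cells s ?w1 dt dv" by (rule upd[OF up]) simp
    have v1: "val ?w1 src = S t" by (rule src[OF t _ upw1]) simp
    have s2: "run_prog (Ife (N 0) src (Asg sq [] (Inc (V sq))) skip) ?w1 = ?w2([sdiff] := ?w2 [sdiff])
       \<or> run_prog (Ife (N 0) src (Asg sq [] (Inc (V sq))) skip) ?w1 = ?w2"
      using v1 S1 by (cases "S t") auto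
    then have s2: "run_prog (Ife (N 0) src (Asg sq [] (Inc (V sq))) skip) ?w1 = ?w2"
      by (auto simp only: fun_upd_triv)
    let ?w3 = "?w2([sq] := q)"
    have s3: "run_prog (Ife (N 0) (V scar) (Asg sq [] (Inc (V sq))) skip) ?w2 = ?w3"
    proof (cases "u [scar]")
      case 0
      then have "?w3 = ?w2" by (auto simp: q_def)
      moreover have "run_prog (Ife (N 0) (V scar) (Asg sq [] (Inc (V sq))) skip) ?w2 = ?w2"
        using 0 by (auto simp: fun_eq_iff)
      ultimately show ?thesis by simp
    next
      case (Suc c)
      then have "u [scar] = 1" using I by simp
      then show ?thesis by (auto simp: q_def)
    qed
    have upw3: "upto_cells s ?w3 dt dv" by (rule upd[OF upd[OF upw1]]) simp_all
    have d3: "map (val ?w3) des = dv" by (rule des[OF upw3])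
    let ?c = "of_bool (1 < q) :: nat" let ?d = "if 1 < q then q - 2 else q"
    let ?w4 = "?w3(dt # dv @ [u0 + t] := ?d, [scar] := ?c)"
    have s4: "run_prog (Ife (N 1) (V sq)
        (Asg dt (des @ [V su]) (Sub (V sq) (N 2)) ;; Asg scar [] (N 1))
        (Asg dt (des @ [V su]) (V sq) ;; Asg scar [] (N 0))) ?w3 = ?w4"
      using d3 I by auto
    let ?w5 = "?w4([su] := Suc (u0 + t))"
    have "?w4 [su] = u0 + t" using I dt by auto
    then have s5: "run_prog (Asg su [] (Inc (V su))) ?w4 = ?w5" by simp
    have run_prog: "run_prog ?body ?v = ?w5"
      unfolding run_prog.simps(2) s1 s2 s3 s4 s5 ..
    have q3: "q \<le> 3" using y S1 I unfolding q_def by linarith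
    have d1: "?d \<le> 1" and qd: "?d + 2 * ?c = q" using q3 by auto
    have D5: "?D ?w5 x = (if x = u0 + t then ?d else ?D u x)" for x using dt by auto
    have "?I (Suc t) ?w5"
    proof (intro conjI)
      have "upto_cells s (?w3(dt # dv @ [u0 + t] := ?d)) dt dv" using upw3 unfolding upto_cells_def by auto
      then show "upto_cells s ?w5 dt dv" using upd by simp
      show "?w5 [su] = u0 + Suc t" "?w5 [scar] \<le> 1" using dt by auto
      show "\<forall>x. x < u0 \<or> u0 + Suc t \<le> x \<longrightarrow> ?D ?w5 x = ?D s x" unfolding D5 using I by simp
      show "\<forall>t'<Suc t. ?D ?w5 (u0 + t') \<le> 1" unfolding D5 using I d1 by (simp add: less_Suc_eq)
      have n1: "num (\<lambda>t. ?D ?w5 (u0 + t)) t = num (\<lambda>t. ?D u (u0 + t)) t"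
        unfolding D5 by (rule num_cong) simp
      have n2: "?w5 [scar] = ?c" by simp
      have n3: "?D ?w5 (u0 + t) = ?d" unfolding D5 by simp
      have "D + 2 * C = q \<Longrightarrow> D * 2 ^ t + C * 2 ^ Suc t = q * 2 ^ t" for C D :: nat
        by (auto simp: algebra_simps)
      from this[OF qd] have A: "?d * 2 ^ t + ?c * 2 ^ Suc t = q * 2 ^ t" .
      have B: "q * 2 ^ t = ?D s (u0 + t) * 2 ^ t + S t * 2 ^ t + u [scar] * 2 ^ t"
        unfolding q_def y_def by (simp add: algebra_simps)
      have C: "num (\<lambda>t. ?D u (u0 + t)) t + u [scar] * 2 ^ t = num (\<lambda>t. ?D s (u0 + t)) t + num S t" using I by simp
      have "num (\<lambda>t. ?D u (u0 + t)) t + ?d * 2 ^ t + ?c * 2 ^ Suc t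
         = num (\<lambda>t. ?D s (u0 + t)) t + ?D s (u0 + t) * 2 ^ t + (num S t + S t * 2 ^ t)"
        using A B C by linarith
      then show "num (\<lambda>t. ?D ?w5 (u0 + t)) (Suc t) + ?w5 [scar] * 2 ^ Suc t
         = num (\<lambda>t. ?D s (u0 + t)) (Suc t) + num S (Suc t)"
        by (simp only: num_Suc n1 n2 n3)
    qed
    then show "spec ?body ?v (?I (Suc t)) 9" unfolding spec_def run_prog by simp
  next
    fix u assume I: "?I n u"
    \<comment> \<open>A final carry would make the sum at least \<open>2 ^ n\<close>, against the
      premise \<open>fits\<close>.\<close>
    have "u [scar] = 0"
    proof (rule ccontr)
      assume "u [scar] \<noteq> 0"
      then have "u [scar] = 1" using I by simp
      then show False using I fits by simp
    qed
    then show "upto_cells s u dt dv \<and>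
      (\<forall>x. x < u0 \<or> u0 + n \<le> x \<longrightarrow> ?D u x = ?D s x) \<and> (\<forall>t<n. ?D u (u0 + t) \<le> 1) \<and>
      num (\<lambda>t. ?D u (u0 + t)) n = num (\<lambda>t. ?D s (u0 + t)) n + num S n" using I by simp
  qed (use len in simp_all)
  then have "spec (addloop dt des src len) s (\<lambda>u. upto_cells s u dt dv \<and>
      (\<forall>x. x < u0 \<or> u0 + n \<le> x \<longrightarrow> ?D u x = ?D s x) \<and>
      (\<forall>t<n. ?D u (u0 + t) \<le> 1) \<and>
      num (\<lambda>t. ?D u (u0 + t)) n = num (\<lambda>t. ?D s (u0 + t)) n + num S n) (Suc (1 + 10 * n))"
    unfolding addloop_def by (intro spec_AsgSeq) simp
  then show ?thesis by simp
qed

section \<open>Table entries as counts\<close>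

text \<open>The bit width is the size of the subtree plus one. It suffices because there are at most
  as many variables as nodes, and the widths of two children add up exactly to the width of their
  parent.\<close>

definition lenE :: "nat \<Rightarrow> exp" where
  "lenE x = Inc (Sub (At aEnd [V x]) (V x))"

text \<open>The empty assignment is the only one at a clause leaf, and it counts exactly if the help
  contains the clause; so the count is a copied bit.\<close>

definition count_clause :: prog where
  "count_clause = Asg aNum [V sv, N 0, V lj, N 0] (At aB [V sv, V lj, At aArg [V sv]])"

text \<open>An entry is incremented once for each truth value with its effect, hence from 0 to 1 and
  possibly on to 2.\<close>

definition count_var :: prog where
  "count_var = Ife (N 0) (At aNum [V sv, V si, N 0, N 0])
     (Asg aNum [V sv, V si, N 0, N 0] (N 0) ;; Asg aNum [V sv, V si, N 0, N 1] (N 1))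
     (Asg aNum [V sv, V si, N 0, N 0] (N 1))"

text \<open>One row of schoolbook multiplication: for a set bit at \<open>l3\<close> the right
  factor is added with shift \<open>l3\<close>. The addition extends one place beyond the right
  factor to take up the carry.\<close>

definition mulrow :: prog where
  "mulrow = Ife (N 0) (At aNum [V sl, V l1, V sja, V l3])
      (Asg su [] (V l3) ;; addloop aBuf [] (At aNum [V sr, V l2, V sjb, V lt]) (Inc (lenE sr)))
      skip"

definition count_combine :: prog where
  "count_combine = For lt (lenE sv) (Asg aBuf [V lt] (N 0)) ;;
     For l3 (lenE sl) mulrow ;;
     Asg su [] (N 0) ;; addloop aNum [V sv, V si, V lj] (At aBuf [V lt]) (lenE sv)"

lemma wr_addloop: "writes (addloop dt (V x # des) src len) = {(13, None), (28, None), (14, None), (11, None), (dt, Some x), (12, None)}"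
   "writes (addloop dt [] src len) = {(13, None), (28, None), (14, None), (11, None), (dt, Some 12), (12, None)}"
  by (auto simp: addloop_def)

lemma localp_count: "localp count_clause" "localp count_var" "localp count_combine"
  by (auto simp: localp_def count_clause_def count_var_def count_combine_def mulrow_def wr_addloop)

context instance_data
begin

definition count_repr :: "(nat \<Rightarrow> nat set list) \<Rightarrow> store \<Rightarrow> nat \<Rightarrow> nat \<Rightarrow> nat \<Rightarrow> nat set set \<Rightarrow> bool" where
  "count_repr LB s v i j Q \<longleftrightarrow> (\<forall>t. s [54, v, i, j, t] \<le> 1) \<and> (\<forall>t>sz (pre T ! v). s [54, v, i, j, t] = 0) \<and>
     num (\<lambda>t. s [54, v, i, j, t]) (Suc (sz (pre T ! v))) =
       card {\<tau>\<in>Q. covered (pre T ! v) (LB v ! j) \<tau> = cls (pre T ! v)}"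

lemma card_vrs: "distinct (leaves t) \<Longrightarrow> card (vrs t) \<le> sz t"
proof -
  assume d: "distinct (leaves t)"
  have "card (vrs t) = card (Inr ` vrs t :: (nat + nat) set)" by (simp add: card_image)
  also have "\<dots> \<le> card (set (leaves t))" by (intro card_mono) (auto simp: vrs_def)
  also have "\<dots> = length (leaves t)" using d by (rule distinct_card)
  also have "\<dots> \<le> sz t" using sz_leaves[of t] leaves_not_Nil[of t] by (cases "leaves t") auto
  finally show ?thesis .
qed

text \<open>After \<open>a\<close> rows no bit from position \<open>a + nr\<close> on is set. In the
  window of the next row both summands are therefore below \<open>2 ^ nr\<close>, and one extra
  place holds their sum.\<close>

lemma mulrow_loop:
  assumes s: "s [sl] = l" "s [sr] = r" "s [l1] = i1" "s [l2] = i2" "s [sja] = ja" "s [sjb] = jb"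
    and len: "s [aEnd, l] - l + 1 = nl" "s [aEnd, r] - r + 1 = nr"
    and x: "\<And>t. s [54, l, i1, ja, t] \<le> 1" and y: "\<And>t. s [54, r, i2, jb, t] \<le> 1" "\<And>t. nr \<le> t \<Longrightarrow> s [54, r, i2, jb, t] = 0"
    and z: "\<And>t. t < nl + nr \<Longrightarrow> s [56, t] = 0"
  shows "spec (For l3 (lenE sl) mulrow) s (\<lambda>u. (\<forall>t<nl + nr. u [56, t] \<le> 1) \<and>
     num (\<lambda>t. u [56, t]) (nl + nr) = num (\<lambda>t. s [54, l, i1, ja, t]) nl * num (\<lambda>t. s [54, r, i2, jb, t]) nr)
     (1 + nl * (15 + 10 * nr))"
proof (rule spec_For_const[where n=nl and c="14 + 10 * nr" and I="\<lambda>a u. (\<forall>t<nl + nr. u [56, t] \<le> 1) \<and>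
     (\<forall>t. a + nr \<le> t \<and> t < nl + nr \<longrightarrow> u [56, t] = 0) \<and>
     num (\<lambda>t. u [56, t]) (nl + nr) = num (\<lambda>t. s [54, l, i1, ja, t]) a * num (\<lambda>t. s [54, r, i2, jb, t]) nr"])
  let ?Y = "num (\<lambda>t. s [54, r, i2, jb, t]) nr"
  show "(\<forall>t<nl + nr. s [56, t] \<le> 1) \<and> (\<forall>t. 0 + nr \<le> t \<and> t < nl + nr \<longrightarrow> s [56, t] = 0) \<and>
     num (\<lambda>t. s [56, t]) (nl + nr) = num (\<lambda>t. s [54, l, i1, ja, t]) 0 * ?Y"
    using z by (auto intro!: num_zero)
  show "val s (lenE sl) = nl" using s len by (simp add: lenE_def)
next
  let ?Y = "num (\<lambda>t. s [54, r, i2, jb, t]) nr"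
  fix a u assume a: "a < nl" and I: "(\<forall>t<nl + nr. u [56, t] \<le> 1) \<and> (\<forall>t. a + nr \<le> t \<and> t < nl + nr \<longrightarrow> u [56, t] = 0) \<and>
     num (\<lambda>t. u [56, t]) (nl + nr) = num (\<lambda>t. s [54, l, i1, ja, t]) a * ?Y"
    and ag: "agree (writes (For l3 (lenE sl) mulrow)) s u"
  let ?J = "\<lambda>u. (\<forall>t<nl + nr. u [56, t] \<le> 1) \<and> (\<forall>t. Suc a + nr \<le> t \<and> t < nl + nr \<longrightarrow> u [56, t] = 0) \<and>
     num (\<lambda>t. u [56, t]) (nl + nr) = num (\<lambda>t. s [54, l, i1, ja, t]) (Suc a) * ?Y"
  have tag: "u (t # q) = s (t # q)" if "t \<in> {8, 9, 20, 21, 24, 25, 43, 54}" for t q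
    by (rule agree_tag[OF ag]) (use that in \<open>auto simp: mulrow_def wr_addloop\<close>)
  let ?u = "u([l3] := a)"
  have xa: "val ?u (At aNum [V sl, V l1, V sja, V l3]) = s [54, l, i1, ja, a]" using tag s by simp
  show "spec mulrow ?u ?J (14 + 10 * nr)"
    unfolding mulrow_def
  proof (rule spec_Ife)
    assume "val ?u (N 0) < val ?u (At aNum [V sl, V l1, V sja, V l3])"
    then have x1: "s [54, l, i1, ja, a] = 1" unfolding xa using x[of a] by simp
    let ?w = "?u([su] := a)"
    have "spec (addloop aBuf [] (At aNum [V sr, V l2, V sjb, V lt]) (Inc (lenE sr))) ?w
      (\<lambda>u'. upto_cells ?w u' 56 [] \<and>
      (\<forall>x. x < a \<or> a + Suc nr \<le> x \<longrightarrow> u' (56 # [] @ [x]) = ?w (56 # [] @ [x])) \<and>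
      (\<forall>t<Suc nr. u' (56 # [] @ [a + t]) \<le> 1) \<and>
      num (\<lambda>t. u' (56 # [] @ [a + t])) (Suc nr) = num (\<lambda>t. ?w (56 # [] @ [a + t])) (Suc nr) + num (\<lambda>t. s [54, r, i2, jb, t]) (Suc nr))
      (2 + 10 * Suc nr)"
    proof (rule addloop_correct)
      fix u' t assume "u' [lt] = t" and up: "upto_cells ?w u' 56 []"
      moreover have "u' (q # z) = ?w (q # z)" if "q \<in> {9, 21, 25, 54}" for q z
        using up that unfolding upto_cells_def by auto
      ultimately show "val u' (At aNum [V sr, V l2, V sjb, V lt]) = s [54, r, i2, jb, t]"
        using tag s by simp
    next
      show "val (?w([scar] := 0)) (Inc (lenE sr)) = Suc nr" using tag s len by (simp add: lenE_def)
      have b: "u [56, a + t] \<le> 1" if "t < Suc nr" for t using I a that by simp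
      show "?w (56 # [] @ [a + t]) \<le> 1" if "t < Suc nr" for t using b[OF that] by simp
      have "num (\<lambda>t. u [56, a + t]) nr < 2 ^ nr" "?Y < 2 ^ nr" using b y by (auto intro!: num_less)
      moreover have "u [56, a + nr] = 0" using I a by simp
      ultimately show "num (\<lambda>t. ?w (56 # [] @ [a + t])) (Suc nr) + num (\<lambda>t. s [54, r, i2, jb, t]) (Suc nr) < 2 ^ Suc nr"
        using y(2)[of nr] by simp
    qed (use y in auto)
    then have "spec (addloop aBuf [] (At aNum [V sr, V l2, V sjb, V lt]) (Inc (lenE sr))) ?w ?J (2 + 10 * Suc nr)"
    proof (rule spec_mono)
      fix u' assume "upto_cells ?w u' 56 [] \<and>
      (\<forall>x. x < a \<or> a + Suc nr \<le> x \<longrightarrow> u' (56 # [] @ [x]) = ?w (56 # [] @ [x])) \<and>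
      (\<forall>t<Suc nr. u' (56 # [] @ [a + t]) \<le> 1) \<and>
      num (\<lambda>t. u' (56 # [] @ [a + t])) (Suc nr) = num (\<lambda>t. ?w (56 # [] @ [a + t])) (Suc nr) + num (\<lambda>t. s [54, r, i2, jb, t]) (Suc nr)"
      then have out: "\<And>x. x < a \<or> a + Suc nr \<le> x \<Longrightarrow> u' [56, x] = u [56, x]"
        and bit: "\<And>t. t < Suc nr \<Longrightarrow> u' [56, a + t] \<le> 1"
        and nm: "num (\<lambda>t. u' [56, a + t]) (Suc nr) = num (\<lambda>t. u [56, a + t]) (Suc nr) + ?Y"
        using y(2)[of nr] by auto
      have "u' [56, t] \<le> 1" if "t < nl + nr" for t
      proof (cases "t < a \<or> a + Suc nr \<le> t")
        case True then show ?thesis using out I that by simp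
      next
        case False
        then have "t - a < Suc nr" "a + (t - a) = t" by linarith+
        then show ?thesis using bit[of "t - a"] by (simp only:)
      qed
      moreover have "u' [56, t] = 0" if "Suc a + nr \<le> t" "t < nl + nr" for t
        using out[of t] I that by simp
      moreover have "num (\<lambda>t. u' [56, t]) (nl + nr) = num (\<lambda>t. s [54, l, i1, ja, t]) (Suc a) * ?Y"
      proof -
        have "num (\<lambda>t. u' [56, t]) (nl + nr) + 2 ^ a * num (\<lambda>t. u [56, a + t]) (Suc nr)
          = num (\<lambda>t. u [56, t]) (nl + nr) + 2 ^ a * num (\<lambda>t. u' [56, a + t]) (Suc nr)"
          by (rule num_window) (use a out in auto)
        then have "num (\<lambda>t. u' [56, t]) (nl + nr) = num (\<lambda>t. u [56, t]) (nl + nr) + 2 ^ a * ?Y"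
          unfolding nm by (simp only: distrib_left)
        then show ?thesis using I x1 by (simp add: algebra_simps)
      qed
      ultimately show "?J u'" by blast
    qed simp
    then show "spec (Asg su [] (V l3) ;; addloop aBuf [] (At aNum [V sr, V l2, V sjb, V lt]) (Inc (lenE sr))) ?u ?J (Suc (2 + 10 * Suc nr))"
      by (intro spec_AsgSeq) simp
  next
    assume "\<not> val ?u (N 0) < val ?u (At aNum [V sl, V l1, V sja, V l3])"
    then have x0: "s [54, l, i1, ja, a] = 0" unfolding xa by simp
    have "?J ?u" using I x0 by auto
    then show "spec skip ?u ?J (Suc (2 + 10 * Suc nr))" unfolding spec_def eff_skip by simp
  qed simp
qed simp_all

text \<open>Both sizes are at least 1, so the lower terms are absorbed by the product; the constants
  4 and 70 are the left-hand sides at \<open>x = y = 1\<close>.\<close>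

lemma merge_bounds:
  fixes x y :: nat
  assumes "0 < x" "0 < y"
  shows "x + y + 2 \<le> 4 * (x * y)" "(x + 1) * (15 + 10 * (y + 1)) \<le> 70 * (x * y)"
proof -
  obtain p q where [simp]: "x = Suc p" "y = Suc q" using assms by (metis gr0_implies_Suc)
  show "x + y + 2 \<le> 4 * (x * y)" "(x + 1) * (15 + 10 * (y + 1)) \<le> 70 * (x * y)"
    by (simp_all add: algebra_simps)
qed

text \<open>The clauses of the node are the disjoint union of those of its children, so being fully
  covered splits into two independent conditions. With injectivity of the union the count is a
  product.\<close>

lemma count_joined:
  assumes t: "Node a b \<in> nodes T"
    and Ba: "Ba = (B \<union> A2) \<inter> cls a" and Bb: "Bb = (B \<union> A1) \<inter> cls b"
  shows "card {\<tau>\<in>joined a b A1 A2. covered (Node a b) B \<tau> = cls (Node a b)}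
    = card {\<tau>\<in>sols a A1. covered a Ba \<tau> = cls a} * card {\<tau>\<in>sols b A2. covered b Bb \<tau> = cls b}"
proof -
  let ?Ga = "{\<tau>\<in>sols a A1. covered a Ba \<tau> = cls a}" and ?Gb = "{\<tau>\<in>sols b A2. covered b Bb \<tau> = cls b}"
  have iff: "covered (Node a b) B (\<tau> \<union> \<sigma>) = cls (Node a b) \<longleftrightarrow> covered a Ba \<tau> = cls a \<and> covered b Bb \<sigma> = cls b"
    if "\<tau> \<in> sols a A1" "\<sigma> \<in> sols b A2" for \<tau> \<sigma>
  proof -
    have "covered a Ba \<tau> \<subseteq> cls a" "covered b Bb \<sigma> \<subseteq> cls b" by (auto simp: covered_def)
    then show ?thesis unfolding covered_Node[OF t that] Ba[symmetric] Bb[symmetric] cls_simps using disj(1)[OF t] by blast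
  qed
  have "{\<tau>\<in>joined a b A1 A2. covered (Node a b) B \<tau> = cls (Node a b)} = (\<lambda>(\<tau>, \<sigma>). \<tau> \<union> \<sigma>) ` (?Ga \<times> ?Gb)"
  proof (intro equalityI subsetI)
    fix \<rho> assume "\<rho> \<in> {\<tau>\<in>joined a b A1 A2. covered (Node a b) B \<tau> = cls (Node a b)}"
    then obtain \<tau> \<sigma> where 1: "\<tau> \<in> sols a A1" "\<sigma> \<in> sols b A2" "\<rho> = \<tau> \<union> \<sigma>" "covered (Node a b) B (\<tau> \<union> \<sigma>) = cls (Node a b)"
      by (auto simp: joined_def[OF t])
    then have "(\<tau>, \<sigma>) \<in> ?Ga \<times> ?Gb" using iff by simp
    then show "\<rho> \<in> (\<lambda>(\<tau>, \<sigma>). \<tau> \<union> \<sigma>) ` (?Ga \<times> ?Gb)" using 1(3) by (intro image_eqI[of _ _ "(\<tau>, \<sigma>)"]) auto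
  next
    fix \<rho> assume "\<rho> \<in> (\<lambda>(\<tau>, \<sigma>). \<tau> \<union> \<sigma>) ` (?Ga \<times> ?Gb)"
    then obtain \<tau> \<sigma> where 1: "\<tau> \<in> ?Ga" "\<sigma> \<in> ?Gb" "\<rho> = \<tau> \<union> \<sigma>" by auto
    then have "\<rho> \<in> joined a b A1 A2" unfolding joined_def[OF t] by (intro image_eqI[of _ _ "(\<tau>, \<sigma>)"]) auto
    then show "\<rho> \<in> {\<tau>\<in>joined a b A1 A2. covered (Node a b) B \<tau> = cls (Node a b)}" using iff 1 by simp
  qed
  moreover have "inj_on (\<lambda>(\<tau>, \<sigma>). \<tau> \<union> \<sigma>) (?Ga \<times> ?Gb)"
    by (rule inj_on_subset[OF joined_inj[OF t, of A1 A2]]) auto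
  ultimately show ?thesis by (simp add: card_image card_cartesian_product)
qed

lemma COMBc_correct:
  assumes dA: "\<And>w. w < sz T \<Longrightarrow> doneA s LA w" and v: "s [7] = v" "v < sz T" "pre T ! v = Node a b"
    and s: "s [sl] = v + 1" "s [sr] = rt v" "s [l1] = i1" "s [l2] = i2" "s [lj] = j" "s [si] = i" "s [sja] = ja" "s [sjb] = jb"
    and ja: "LB (v + 1) ! ja = (LB v ! j \<union> LA (rt v) ! i2) \<inter> cls a"
    and jb: "LB (rt v) ! jb = (LB v ! j \<union> LA (v + 1) ! i1) \<inter> cls b"
    and Q: "Q \<subseteq> sols (Node a b) (LA v ! i)" "joined a b (LA (v + 1) ! i1) (LA (rt v) ! i2) \<subseteq> sols (Node a b) (LA v ! i)"
      "Q \<inter> joined a b (LA (v + 1) ! i1) (LA (rt v) ! i2) = {}"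
    and R: "count_repr LB s v i j Q" "count_repr LB s (v + 1) i1 ja (sols a (LA (v + 1) ! i1))"
      "count_repr LB s (rt v) i2 jb (sols b (LA (rt v) ! i2))"
  shows "spec count_combine s (\<lambda>u. count_repr LB u v i j (Q \<union> joined a b (LA (v + 1) ! i1) (LA (rt v) ! i2)) \<and> only s u v i j)
    (123 * merge_cost (pre T ! v))"
proof -
  let ?l = "v + 1" and ?r = "rt v" and ?t = "Node a b"
  have lr: "?r = v + 1 + sz a" "pre T ! ?l = a" "pre T ! ?r = b" "?l < sz T" "?r < sz T"
    using rt_Node[OF v(2,3)] by auto
  have t: "?t \<in> nodes T" using pre_in_nodes[OF v(2)] v(3) by simp
  let ?nl = "Suc (sz a)" and ?nr = "Suc (sz b)"
  let ?nv = "Suc (sz ?t)"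
  have nv: "?nv = ?nl + ?nr" by simp
  have ends: "s [aEnd, v] = v + sz ?t" "s [aEnd, ?l] = ?l + sz a" "s [aEnd, ?r] = ?r + sz b"
    using dA[OF v(2)] dA[OF lr(4)] dA[OF lr(5)] v lr by (auto simp: doneA_def)
  let ?J = "joined a b (LA ?l ! i1) (LA ?r ! i2)"
  let ?good = "\<lambda>S. card {\<tau>\<in>S. covered ?t (LB v ! j) \<tau> = cls ?t}"
  let ?X = "num (\<lambda>t. s [54, ?l, i1, ja, t]) ?nl" and ?Y = "num (\<lambda>t. s [54, ?r, i2, jb, t]) ?nr"
  have XY: "?X * ?Y = ?good ?J"
    using R(2,3) count_joined[OF t ja jb] unfolding count_repr_def lr(2,3) by simp
  have tot: "?good (Q \<union> ?J) = ?good Q + ?good ?J"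
  proof -
    have fin: "finite (sols ?t (LA v ! i))" by simp
    have "{\<tau>\<in>Q \<union> ?J. covered ?t (LB v ! j) \<tau> = cls ?t}
       = {\<tau>\<in>Q. covered ?t (LB v ! j) \<tau> = cls ?t} \<union> {\<tau>\<in>?J. covered ?t (LB v ! j) \<tau> = cls ?t}" by blast
    moreover have "finite {\<tau>\<in>Q. covered ?t (LB v ! j) \<tau> = cls ?t}" "finite {\<tau>\<in>?J. covered ?t (LB v ! j) \<tau> = cls ?t}"
      using Q finite_subset[OF _ fin] by (auto intro: finite_subset)
    ultimately show ?thesis using Q(3) by (simp add: card_Un_disjoint disjoint_iff)
  qed
  \<comment> \<open>All counted assignments are subsets of the variables below the node, of which
    there are at most \<open>sz ?t\<close>.\<close>
  have fits: "?good (Q \<union> ?J) < 2 ^ ?nv"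
  proof -
    have "?good (Q \<union> ?J) \<le> card (Pow (vrs ?t))"
      using Q by (intro card_mono) (auto simp: sols_def)
    also have "\<dots> = 2 ^ card (vrs ?t)" by (simp add: card_Pow)
    also have "\<dots> \<le> 2 ^ sz ?t" using card_vrs[OF node_facts(3)[OF t]] by (intro power_increasing) auto
    also have "\<dots> < 2 ^ ?nv" by simp
    finally show ?thesis .
  qed
  let ?clear = "For lt (lenE sv) (Asg aBuf [V lt] (N 0))"
  let ?mul = "For l3 (lenE sl) mulrow"
  let ?add = "addloop aNum [V sv, V si, V lj] (At aBuf [V lt]) (lenE sv)"
  let ?P = "\<lambda>u. count_repr LB u v i j (Q \<union> ?J) \<and> only s u v i j"
  have "spec count_combine s ?P ((1 + 2 * ?nv) + ((1 + ?nl * (15 + 10 * ?nr)) + Suc (2 + 10 * ?nv)))"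
    unfolding count_combine_def
  proof (rule spec_Seq[OF _ _ order_refl])
    show "spec ?clear s (\<lambda>u. \<forall>t<?nv. u [56, t] = 0) (1 + 2 * ?nv)"
    proof (rule spec_For_const[where n="?nv" and c=1 and I="\<lambda>x u. \<forall>t<x. u [56, t] = 0"])
      show "val s (lenE sv) = ?nv" using v ends by (simp add: lenE_def)
    qed (auto simp: spec_def less_Suc_eq)
  next
    fix u assume z: "\<forall>t<?nv. u [56, t] = 0" and ag: "agree (writes ?clear) s u"
    have ut: "u (t # q) = s (t # q)" if "t \<notin> {28, 56}" for t q
      by (rule agree_tag[OF ag]) (use that in auto)
    show "spec (?mul ;; Asg su [] (N 0) ;; ?add) u ?P ((1 + ?nl * (15 + 10 * ?nr)) + Suc (2 + 10 * ?nv))"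
    proof (rule spec_Seq[OF mulrow_loop _ order_refl])
      show "u [aEnd, ?l] - ?l + 1 = ?nl" "u [aEnd, ?r] - ?r + 1 = ?nr" using ut ends by auto
      show "u [54, ?l, i1, ja, t] \<le> 1" "u [54, ?r, i2, jb, t] \<le> 1" for t
        using ut R by (auto simp: count_repr_def)
      show "u [54, ?r, i2, jb, t] = 0" if "?nr \<le> t" for t
        using ut R(3) that lr(3) by (auto simp: count_repr_def)
      show "u [56, t] = 0" if "t < ?nl + ?nr" for t using z that nv by simp
    next
      fix u2 assume m: "(\<forall>t<?nl + ?nr. u2 [56, t] \<le> 1) \<and> num (\<lambda>t. u2 [56, t]) (?nl + ?nr) =
          num (\<lambda>t. u [54, ?l, i1, ja, t]) ?nl * num (\<lambda>t. u [54, ?r, i2, jb, t]) ?nr"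
        and ag2: "agree (writes ?mul) u u2"
      have u2t: "u2 (t # q) = s (t # q)" if "t \<notin> {11, 12, 13, 14, 28, 29, 56}" for t q
      proof -
        have "u2 (t # q) = u (t # q)" by (rule agree_tag[OF ag2]) (use that in \<open>auto simp: mulrow_def wr_addloop\<close>)
        then show ?thesis using ut[of t] that by simp
      qed
      let ?w = "u2([su] := 0)"
      have prod: "num (\<lambda>t. u2 [56, t]) ?nv = ?good ?J"
        using m ut unfolding nv XY[symmetric] by simp
      have q: "num (\<lambda>t. u2 [54, v, i, j, t]) ?nv = ?good Q"
        using R(1) u2t unfolding count_repr_def v(3) by simp
      have "spec ?add ?w (\<lambda>u. upto_cells ?w u aNum [v, i, j] \<and>
        (\<forall>x. x < 0 \<or> 0 + ?nv \<le> x \<longrightarrow> u (aNum # [v, i, j] @ [x]) = ?w (aNum # [v, i, j] @ [x])) \<and>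
        (\<forall>t<?nv. u (aNum # [v, i, j] @ [0 + t]) \<le> 1) \<and>
        num (\<lambda>t. u (aNum # [v, i, j] @ [0 + t])) ?nv = num (\<lambda>t. ?w (aNum # [v, i, j] @ [0 + t])) ?nv + num (\<lambda>t. u2 [56, t]) ?nv)
        (2 + 10 * ?nv)"
      proof (rule addloop_correct)
        fix u' t assume "u' [lt] = t" "upto_cells ?w u' aNum [v, i, j]"
        then show "val u' (At aBuf [V lt]) = u2 [56, t]" by (simp add: upto_cells_def)
      next
        fix u' assume up: "upto_cells ?w u' aNum [v, i, j]"
        have "u' [7] = u2 [7]" "u' [19] = u2 [19]" "u' [26] = u2 [26]"
          using up by (simp_all add: upto_cells_def)
        then show "map (val u') [V sv, V si, V lj] = [v, i, j]" using u2t v s by simp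
      next
        show "val (?w([scar] := 0)) (lenE sv) = ?nv" using u2t v ends by (simp add: lenE_def)
        show "u2 [56, t] \<le> 1" if "t < ?nv" for t using m that nv by simp
        show "?w (aNum # [v, i, j] @ [0 + t]) \<le> 1" for t using u2t R(1) by (simp add: count_repr_def)
        have "num (\<lambda>t. ?w (aNum # [v, i, j] @ [0 + t])) ?nv = num (\<lambda>t. u2 [54, v, i, j, t]) ?nv" by simp
        then show "num (\<lambda>t. ?w (aNum # [v, i, j] @ [0 + t])) ?nv + num (\<lambda>t. u2 [56, t]) ?nv < 2 ^ ?nv"
          using q prod tot fits by linarith
      qed auto
      then have "spec ?add ?w ?P (2 + 10 * ?nv)"
      proof (rule spec_mono)
        fix u' assume u': "upto_cells ?w u' aNum [v, i, j] \<and>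
        (\<forall>x. x < 0 \<or> 0 + ?nv \<le> x \<longrightarrow> u' (aNum # [v, i, j] @ [x]) = ?w (aNum # [v, i, j] @ [x])) \<and>
        (\<forall>t<?nv. u' (aNum # [v, i, j] @ [0 + t]) \<le> 1) \<and>
        num (\<lambda>t. u' (aNum # [v, i, j] @ [0 + t])) ?nv = num (\<lambda>t. ?w (aNum # [v, i, j] @ [0 + t])) ?nv + num (\<lambda>t. u2 [56, t]) ?nv"
        then have a: "upto_cells ?w u' aNum [v, i, j]" "\<And>x. ?nv \<le> x \<Longrightarrow> u' [54, v, i, j, x] = u2 [54, v, i, j, x]"
          "\<And>t. t < ?nv \<Longrightarrow> u' [54, v, i, j, t] \<le> 1"
          "num (\<lambda>t. u' [54, v, i, j, t]) ?nv = num (\<lambda>t. u2 [54, v, i, j, t]) ?nv + num (\<lambda>t. u2 [56, t]) ?nv"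
          by simp_all
        have z': "u' [54, v, i, j, x] = 0" if "?nv \<le> x" for x
          using a(2)[OF that] u2t R(1) that v(3) by (simp add: count_repr_def)
        have "u' [54, v, i, j, x] \<le> 1" for x using a(3)[of x] z'[of x] by (cases "x < ?nv") auto
        moreover have "num (\<lambda>t. u' [54, v, i, j, t]) ?nv = ?good (Q \<union> ?J)" unfolding a(4) q prod tot ..
        ultimately have "count_repr LB u' v i j (Q \<union> ?J)" unfolding count_repr_def v(3) using z' by (simp add: Suc_le_eq)
        moreover have "only s u' v i j" unfolding only_def
        proof (intro ballI allI impI)
          fix t i' j' q assume "t \<in> {54, 55 :: nat}" "(i', j') \<noteq> (i, j)"
          then have "u' (t # v # i' # j' # q) = ?w (t # v # i' # j' # q)" using a(1) unfolding upto_cells_def by auto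
          then show "u' (t # v # i' # j' # q) = s (t # v # i' # j' # q)" using \<open>t \<in> {54, 55}\<close> u2t by auto
        qed
        ultimately show "?P u'" by blast
      qed simp
      then show "spec (Asg su [] (N 0) ;; ?add) u2 ?P (Suc (2 + 10 * ?nv))" by (intro spec_AsgSeq) simp
    qed (use ut s v in auto)
  qed
  then show ?thesis
  proof (rule spec_mono)
    \<comment> \<open>The left-hand sum is \<open>5 + 12 * N + X\<close>, and 5 + 12 * 4 + 70 =
      123.\<close>
    have lin: "X \<le> 70 * P \<Longrightarrow> N \<le> 4 * P \<Longrightarrow> 1 \<le> P \<Longrightarrow> 1 + 2 * N + (1 + X + Suc (2 + 10 * N)) \<le> 123 * P"
      for X N P :: nat by linarith
    have "?nl * (15 + 10 * ?nr) \<le> 70 * (sz a * sz b)" using merge_bounds(2)[of "sz a" "sz b"] by simp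
    moreover have "?nv \<le> 4 * (sz a * sz b)" using merge_bounds(1)[of "sz a" "sz b"] nv by simp
    moreover have "1 \<le> sz a * sz b" by (simp add: Suc_le_eq)
    ultimately show "(1 + 2 * ?nv) + ((1 + ?nl * (15 + 10 * ?nr)) + Suc (2 + 10 * ?nv)) \<le> 123 * merge_cost (pre T ! v)"
      unfolding v(3) merge_cost.simps by (rule lin)
  qed simp
qed

lemma count_dp:
  assumes "\<And>t. t \<in> nodes T \<Longrightarrow> card (psA t) \<le> k" "\<And>t. t \<in> nodes T \<Longrightarrow> card (psB t) \<le> k"
  shows "dp m n occ T LA LB k (\<lambda>_. True) (count_repr LB) count_clause count_var count_combine 1 3 (\<lambda>v. 123 * merge_cost (pre T ! v))"
proof unfold_locales
  fix s v c j assume st: "static s" and B: "okB s LB v" and v: "s [7] = v" "v < sz T" "pre T ! v = Leaf (Inl c)"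
    and j: "s [lj] = j" "j < length (LB v)" and z: "\<And>t l. t \<in> {54, 55} \<Longrightarrow> s (t # v # 0 # j # l) = 0"
  have c: "s [aArg, v] = c" "c < m" using st v node_facts(1)[OF pre_in_nodes[OF v(2)]] by (auto simp: static_def)
  have b: "s [aB, v, j, c] = of_bool (c \<in> LB v ! j)" using B j c st by (auto simp: okB_def islist_def static_def)
  have "{\<tau> \<in> {{}}. covered (Leaf (Inl c)) (LB v ! j) \<tau> = cls (Leaf (Inl c))} = (if c \<in> LB v ! j then {{}} else {})"
    by (auto simp: covered_def satX_def)
  then show "spec count_clause s (\<lambda>u. count_repr LB u v 0 j {{}} \<and> only s u v 0 j) 1"
    unfolding spec_def count_clause_def using v j c b z by (auto simp: count_repr_def only_def numeral_2_eq_2)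
next
  fix s v x b i Q
  assume v: "s [7] = v" "v < sz T" "pre T ! v = Leaf (Inr x)" and b: "b < (2 :: nat)" and i: "s [si] = i"
    and R: "count_repr LB s v i 0 Q" and Q: "Q \<subseteq> (if b = 0 then {} else {{}})"
  let ?n = "\<lambda>t. s [54, v, i, 0, t]"
  have cov: "{\<tau>\<in>S. covered (Leaf (Inr x)) B \<tau> = cls (Leaf (Inr x))} = S" for S B by (auto simp: covered_def)
  have bits: "\<And>t. ?n t \<le> 1" and z: "\<And>t. t \<ge> 2 \<Longrightarrow> ?n t = 0" and nm: "?n 0 + ?n 1 * 2 = card Q"
    using R unfolding count_repr_def v(3) cov by (auto simp: numeral_2_eq_2)
  have fin: "finite Q" "card Q \<le> 1" using Q by (auto split: if_splits simp: subset_singleton_iff)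
  have new: "(if b = 1 then {x} else {}) \<notin> Q"
    using Q b by (cases "b = 0") (auto simp: less_2_cases_iff)
  have card: "card (insert (if b = 1 then {x} else {}) Q) = Suc (card Q)" using fin new by simp
  have n1: "?n 1 = 0" using nm fin bits[of 0] bits[of 1] by linarith
  then have n0: "?n 0 = card Q" using nm by simp
  show "spec count_var s (\<lambda>u. count_repr LB u v i 0 (insert (if b = 1 then {x} else {}) Q) \<and> only s u v i 0) 3"
  proof (cases "?n 0 = 0")
    case True
    let ?u = "s([54, v, i, 0, 0] := 1)"
    have "count_repr LB ?u v i 0 (insert (if b = 1 then {x} else {}) Q)"
      unfolding count_repr_def v(3) cov card using bits z n1 n0 True by (auto simp: numeral_2_eq_2)
    moreover have "only s ?u v i 0" by (auto simp: only_def)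
    moreover have "run_prog count_var s = ?u" "cost count_var s \<le> 3" using True v i by (auto simp: count_var_def)
    ultimately show ?thesis unfolding spec_def by simp
  next
    case False
    let ?u = "s([54, v, i, 0, 0] := 0, [54, v, i, 0, 1] := 1)"
    have "card Q = 1" using n0 False fin(2) by linarith
    then have "count_repr LB ?u v i 0 (insert (if b = 1 then {x} else {}) Q)"
      unfolding count_repr_def v(3) cov card using bits z n1 n0 by (auto simp: numeral_2_eq_2)
    moreover have "only s ?u v i 0" by (auto simp: only_def)
    moreover have "run_prog count_var s = ?u" "cost count_var s \<le> 3" using False v i by (auto simp: count_var_def)
    ultimately show ?thesis unfolding spec_def by simp
  qed
next
  show "localp count_clause" "localp count_var" "localp count_combine" by (rule localp_count)+
next
  fix s u v i j Q assume e: "\<And>t l. t \<in> {54, 55} \<Longrightarrow> u (t # v # i # j # l) = (s :: store) (t # v # i # j # l)"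
  show "count_repr LB u v i j Q = count_repr LB s v i j Q" unfolding count_repr_def using e by simp
next
  fix s v i j assume "\<And>t l. t \<in> {54, 55} \<Longrightarrow> (s :: store) (t # v # i # j # l) = 0"
  then show "count_repr LB s v i j {}" unfolding count_repr_def by (auto intro!: num_zero)
next
  fix s v a b i j i1 i2 ja jb Q
  assume "\<And>w. w < sz T \<Longrightarrow> doneA s LA w" "s [7] = v" "v < sz T" "pre T ! v = Node a b"
    "s [sl] = v + 1" "s [sr] = rt v" "s [l1] = i1" "s [l2] = i2" "s [lj] = j" "s [si] = i" "s [sja] = ja" "s [sjb] = jb"
    "LB (v + 1) ! ja = (LB v ! j \<union> LA (rt v) ! i2) \<inter> cls a"
    "LB (rt v) ! jb = (LB v ! j \<union> LA (v + 1) ! i1) \<inter> cls b"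
    "Q \<subseteq> sols (Node a b) (LA v ! i)" "joined a b (LA (v + 1) ! i1) (LA (rt v) ! i2) \<subseteq> sols (Node a b) (LA v ! i)"
      "Q \<inter> joined a b (LA (v + 1) ! i1) (LA (rt v) ! i2) = {}"
    "count_repr LB s v i j Q" "count_repr LB s (v + 1) i1 ja (sols a (LA (v + 1) ! i1))"
      "count_repr LB s (rt v) i2 jb (sols b (LA (rt v) ! i2))"
  then show "spec count_combine s (\<lambda>u. count_repr LB u v i j (Q \<union> joined a b (LA (v + 1) ! i1) (LA (rt v) ! i2)) \<and> only s u v i j)
    (123 * merge_cost (pre T ! v))" by (rule COMBc_correct)
qed (use assms in auto)

end

section \<open>Maximization\<close>

text \<open>
  An entry for no assignment has weight \<open>0\<close>; it is overwritten by the first candidate because ties are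
  replaced. The comparison scans from the low bits, so the last difference decides.
\<close>

abbreviation (input) "sL \<equiv> 15 :: nat"
abbreviation (input) "lx \<equiv> 30 :: nat"
abbreviation (input) "aW \<equiv> 53 :: nat"
abbreviation (input) "aSg \<equiv> 55 :: nat"

definition max_clause :: prog where
  "max_clause = Ife (N 0) (At aB [V sv, V lj, At aArg [V sv]])
     (For lt (V sL) (Asg aNum [V sv, N 0, V lj, V lt] (At aW [At aArg [V sv], V lt]))) skip"

text \<open>A variable leaf has no clauses, so all its assignments have weight 0 and the last one
  tried may be kept.\<close>

definition max_var :: prog where
  "max_var = Asg aSg [V sv, V si, N 0, At aArg [V sv]] (V l1)"

definition cmploop :: prog where
  "cmploop = For lt (V sL) (
      Ife (At aBuf [V lt]) (At aNum [V sv, V si, V lj, V lt]) (Asg sq [] (N 1)) skip ;;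
      Ife (At aNum [V sv, V si, V lj, V lt]) (At aBuf [V lt]) (Asg sq [] (N 0)) skip)"

definition copybest :: prog where
  "copybest = (For lt (V sL) (Asg aNum [V sv, V si, V lj, V lt] (At aBuf [V lt])) ;;
      For lx (V sn) (Asg aSg [V sv, V si, V lj, V lx]
        (bor (At aSg [V sl, V l1, V sja, V lx]) (At aSg [V sr, V l2, V sjb, V lx]))))"

definition max_combine :: prog where
  "max_combine = For lt (V sL) (Asg aBuf [V lt] (At aNum [V sl, V l1, V sja, V lt])) ;;
     Asg su [] (N 0) ;; addloop aBuf [] (At aNum [V sr, V l2, V sjb, V lt]) (V sL) ;;
     Asg sq [] (N 0) ;; cmploop ;;
     Ife (V sq) (N 1) copybest skip"

lemma localp_max: "localp max_clause" "localp max_var" "localp max_combine"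
  by (auto simp: localp_def max_clause_def max_var_def max_combine_def cmploop_def copybest_def wr_addloop)

text \<open>The digits below position \<open>j\<close> stay below \<open>2 ^ j\<close> together, so
  they decide only if the digits at \<open>j\<close> agree.\<close>

lemma num_cmp_Suc:
  assumes "\<And>t. t < Suc j \<Longrightarrow> f t \<le> 1" "\<And>t. t < Suc j \<Longrightarrow> g t \<le> 1"
  shows "num f (Suc j) < num g (Suc j) \<longleftrightarrow> f j < g j \<or> f j = g j \<and> num f j < num g j"
proof -
  have b: "num f j < 2 ^ j" "num g j < 2 ^ j" using assms by (auto intro: num_less)
  have "f j = 0 \<or> f j = 1" "g j = 0 \<or> g j = 1" using assms[of j] by auto
  then show ?thesis using b by auto
qed

context instance_data
begin

definition wt :: "(nat \<Rightarrow> nat) \<Rightarrow> (nat \<Rightarrow> nat set list) \<Rightarrow> nat \<Rightarrow> nat \<Rightarrow> nat set \<Rightarrow> nat" where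
  "wt w LB v j \<tau> = (\<Sum>c\<in>covered (pre T ! v) (LB v ! j) \<tau>. w c)"

text \<open>For no assignment the entry is pinned to zeros, the content of untouched memory, so that
  empty entries are recognized without a flag.\<close>

definition max_repr :: "(nat \<Rightarrow> nat) \<Rightarrow> nat \<Rightarrow> (nat \<Rightarrow> nat set list) \<Rightarrow> store \<Rightarrow> nat \<Rightarrow> nat \<Rightarrow> nat \<Rightarrow> nat set set \<Rightarrow> bool" where
  "max_repr w L LB s v i j Q \<longleftrightarrow> (\<forall>t. s [54, v, i, j, t] \<le> 1) \<and>
     (if Q = {} then num (\<lambda>t. s [54, v, i, j, t]) L = 0 \<and> (\<forall>x. s [55, v, i, j, x] = 0)
      else \<exists>\<tau>\<in>Q. num (\<lambda>t. s [54, v, i, j, t]) L = wt w LB v j \<tau> \<and> (\<forall>\<sigma>\<in>Q. wt w LB v j \<sigma> \<le> wt w LB v j \<tau>) \<and>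
        (\<forall>x<n. s [55, v, i, j, x] = of_bool (x \<in> \<tau>)))"

definition weights :: "(nat \<Rightarrow> nat) \<Rightarrow> nat \<Rightarrow> store \<Rightarrow> bool" where
  "weights w L s \<longleftrightarrow> s [15] = L \<and> (\<forall>c<m. \<forall>t. s [53, c, t] \<le> 1) \<and> (\<forall>c<m. num (\<lambda>t. s [53, c, t]) L = w c)"

lemma cmploop_correct:
  assumes L: "s [15] = L" and q: "s [14] = 0" and c: "s [7] = v" "s [19] = i" "s [26] = j"
    and bits: "\<And>t. t < L \<Longrightarrow> s [56, t] \<le> 1" "\<And>t. t < L \<Longrightarrow> s [54, v, i, j, t] \<le> 1"
  shows "spec cmploop s (\<lambda>u. u [14] = of_bool (num (\<lambda>t. s [56, t]) L < num (\<lambda>t. s [54, v, i, j, t]) L)) (1 + 5 * L)"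
  unfolding cmploop_def
proof (rule spec_For_const[where n=L and c=4 and I="\<lambda>x u. u [14] = of_bool (num (\<lambda>t. s [56, t]) x < num (\<lambda>t. s [54, v, i, j, t]) x)"])
  let ?body = "Ife (At aBuf [V lt]) (At aNum [V sv, V si, V lj, V lt]) (Asg sq [] (N 1)) skip ;;
      Ife (At aNum [V sv, V si, V lj, V lt]) (At aBuf [V lt]) (Asg sq [] (N 0)) skip"
  fix x u assume x: "x < L" and I: "u [14] = of_bool (num (\<lambda>t. s [56, t]) x < num (\<lambda>t. s [54, v, i, j, t]) x)"
    and ag: "agree (writes (For lt (V sL) ?body)) s u"
  have ut: "u (t # z) = s (t # z)" if "t \<in> {7, 19, 26, 54, 56}" for t z
    by (rule agree_tag[OF ag]) (use that in auto)
  have iff: "num (\<lambda>t. s [56, t]) (Suc x) < num (\<lambda>t. s [54, v, i, j, t]) (Suc x) \<longleftrightarrow>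
     s [56, x] < s [54, v, i, j, x] \<or> s [56, x] = s [54, v, i, j, x] \<and> num (\<lambda>t. s [56, t]) x < num (\<lambda>t. s [54, v, i, j, t]) x"
    by (rule num_cmp_Suc) (use bits x in auto)
  show "spec ?body (u([lt] := x)) (\<lambda>u. u [14] = of_bool (num (\<lambda>t. s [56, t]) (Suc x) < num (\<lambda>t. s [54, v, i, j, t]) (Suc x))) 4"
    unfolding iff spec_def using ut c I by auto
qed (use L q in simp_all)

lemma copybest_correct:
  assumes L: "s [15] = L" and n: "s [sn] = n" and c: "s [7] = v" "s [19] = i" "s [26] = j"
    and lr: "s [sl] = l" "s [sr] = r" "s [l1] = i1" "s [l2] = i2" "s [sja] = ja" "s [sjb] = jb" "l \<noteq> v" "r \<noteq> v"
    and a: "\<And>x. x < n \<Longrightarrow> s [55, l, i1, ja, x] = of_bool (x \<in> \<tau>)" "\<And>x. x < n \<Longrightarrow> s [55, r, i2, jb, x] = of_bool (x \<in> \<sigma>)"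
  shows "spec copybest s (\<lambda>u. (\<forall>t<L. u [54, v, i, j, t] = s [56, t]) \<and> (\<forall>t\<ge>L. u [54, v, i, j, t] = s [54, v, i, j, t]) \<and>
     (\<forall>x<n. u [55, v, i, j, x] = of_bool (x \<in> \<tau> \<union> \<sigma>)) \<and> only s u v i j) (2 + 2 * L + 2 * n)"
  unfolding copybest_def
proof (rule spec_Seq)
  let ?f = "For lt (V sL) (Asg aNum [V sv, V si, V lj, V lt] (At aBuf [V lt]))"
  show "spec ?f s (\<lambda>u. (\<forall>t<L. u [54, v, i, j, t] = s [56, t]) \<and> (\<forall>t\<ge>L. u [54, v, i, j, t] = s [54, v, i, j, t]) \<and> only s u v i j) (1 + 2 * L)"
  proof (rule spec_For_const[where n=L and c=1 and I="\<lambda>x u. (\<forall>t<x. u [54, v, i, j, t] = s [56, t]) \<and> (\<forall>t\<ge>x. u [54, v, i, j, t] = s [54, v, i, j, t]) \<and> only s u v i j"])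
    fix x u assume "x < L" and I: "(\<forall>t<x. u [54, v, i, j, t] = s [56, t]) \<and> (\<forall>t\<ge>x. u [54, v, i, j, t] = s [54, v, i, j, t]) \<and> only s u v i j"
      and ag: "agree (writes ?f) s u"
    have ut: "u (t # z) = s (t # z)" if "t \<in> {7, 19, 26, 56}" for t z
      by (rule agree_tag[OF ag]) (use that in auto)
    let ?u = "u([lt] := x, [54, v, i, j, x] := s [56, x])"
    have e: "run_prog (Asg aNum [V sv, V si, V lj, V lt] (At aBuf [V lt])) (u([lt] := x)) = ?u"
      using ut c by simp
    have "only s ?u v i j" using I unfolding only_def by auto
    then show "spec (Asg aNum [V sv, V si, V lj, V lt] (At aBuf [V lt])) (u([lt] := x))
      (\<lambda>u. (\<forall>t<Suc x. u [54, v, i, j, t] = s [56, t]) \<and> (\<forall>t\<ge>Suc x. u [54, v, i, j, t] = s [54, v, i, j, t]) \<and> only s u v i j) 1"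
      unfolding spec_def e using I by (simp add: less_Suc_eq)
  qed (use L in \<open>auto simp: only_def\<close>)
next
  let ?f = "For lt (V sL) (Asg aNum [V sv, V si, V lj, V lt] (At aBuf [V lt]))"
  let ?asg = "Asg aSg [V sv, V si, V lj, V lx] (bor (At aSg [V sl, V l1, V sja, V lx]) (At aSg [V sr, V l2, V sjb, V lx]))"
  let ?g = "For lx (V sn) ?asg"
  fix u1 assume u1: "(\<forall>t<L. u1 [54, v, i, j, t] = s [56, t]) \<and> (\<forall>t\<ge>L. u1 [54, v, i, j, t] = s [54, v, i, j, t]) \<and> only s u1 v i j"
    and ag1: "agree (writes ?f) s u1"
  have u1t: "u1 (t # z) = s (t # z)" if "t \<notin> {28, 54}" for t z
    by (rule agree_tag[OF ag1]) (use that in auto)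
  show "spec ?g u1 (\<lambda>u. (\<forall>t<L. u [54, v, i, j, t] = s [56, t]) \<and> (\<forall>t\<ge>L. u [54, v, i, j, t] = s [54, v, i, j, t]) \<and>
     (\<forall>x<n. u [55, v, i, j, x] = of_bool (x \<in> \<tau> \<union> \<sigma>)) \<and> only s u v i j) (1 + 2 * n)"
  proof (rule spec_For_const[where n=n and c=1 and I="\<lambda>x u. (\<forall>y<x. u [55, v, i, j, y] = of_bool (y \<in> \<tau> \<union> \<sigma>)) \<and> only s u v i j"])
    fix x u assume x: "x < n" and I: "(\<forall>y<x. u [55, v, i, j, y] = of_bool (y \<in> \<tau> \<union> \<sigma>)) \<and> only s u v i j"
      and ag: "agree (writes ?g) u1 u"
    have ut: "u (t # z) = s (t # z)" if "t \<notin> {28, 30, 54, 55}" for t z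
    proof -
      have "u (t # z) = u1 (t # z)" by (rule agree_tag[OF ag]) (use that in auto)
      then show ?thesis using u1t that by simp
    qed
    have u55: "u (55 # w # z) = s (55 # w # z)" if "w \<noteq> v" for w z
    proof -
      have "u (55 # w # z) = u1 (55 # w # z)" by (rule agree_index[OF ag]) (use that u1t c in auto)
      then show ?thesis using u1t by simp
    qed
    let ?u = "u([lx] := x, [55, v, i, j, x] := of_bool (x \<in> \<tau> \<union> \<sigma>))"
    have "val (u([lx] := x)) (bor (At aSg [V sl, V l1, V sja, V lx]) (At aSg [V sr, V l2, V sjb, V lx])) = of_bool (x \<in> \<tau> \<or> x \<in> \<sigma>)"
      by (rule val_bor) (use ut u55 lr a x in auto)
    then have e: "run_prog ?asg (u([lx] := x)) = ?u" using ut c by simp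
    have "only s ?u v i j" using I unfolding only_def by auto
    then show "spec ?asg (u([lx] := x)) (\<lambda>u. (\<forall>y<Suc x. u [55, v, i, j, y] = of_bool (y \<in> \<tau> \<union> \<sigma>)) \<and> only s u v i j) 1"
      unfolding spec_def e using I by (auto simp: less_Suc_eq)
  next
    fix u assume I: "(\<forall>y<n. u [55, v, i, j, y] = of_bool (y \<in> \<tau> \<union> \<sigma>)) \<and> only s u v i j"
      and ag: "agree (writes ?g) u1 u"
    have "u (54 # z) = u1 (54 # z)" for z by (rule agree_tag[OF ag]) auto
    then show "(\<forall>t<L. u [54, v, i, j, t] = s [56, t]) \<and> (\<forall>t\<ge>L. u [54, v, i, j, t] = s [54, v, i, j, t]) \<and>
     (\<forall>x<n. u [55, v, i, j, x] = of_bool (x \<in> \<tau> \<union> \<sigma>)) \<and> only s u v i j" using u1 I by simp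
  qed (use u1 u1t n in simp_all)
qed simp

text \<open>The weights covered in the two children add up and the children can be chosen
  independently, so the best union has the sum of the two best weights.\<close>

lemma COMBm_correct:
  assumes st: "static s" and W: "weights w L s" and v: "s [7] = v" "v < sz T" "pre T ! v = Node a b"
    and s: "s [sl] = v + 1" "s [sr] = rt v" "s [l1] = i1" "s [l2] = i2" "s [lj] = j" "s [si] = i" "s [sja] = ja" "s [sjb] = jb"
    and ja: "LB (v + 1) ! ja = (LB v ! j \<union> LA (rt v) ! i2) \<inter> cls a"
    and jb: "LB (rt v) ! jb = (LB v ! j \<union> LA (v + 1) ! i1) \<inter> cls b"
    and ne: "sols a (LA (v + 1) ! i1) \<noteq> {}" "sols b (LA (rt v) ! i2) \<noteq> {}"
    and R: "max_repr w L LB s v i j Q" "max_repr w L LB s (v + 1) i1 ja (sols a (LA (v + 1) ! i1))"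
      "max_repr w L LB s (rt v) i2 jb (sols b (LA (rt v) ! i2))"
    and tot: "(\<Sum>c<m. w c) < 2 ^ L"
  shows "spec max_combine s (\<lambda>u. max_repr w L LB u v i j (Q \<union> joined a b (LA (v + 1) ! i1) (LA (rt v) ! i2)) \<and> only s u v i j)
    (10 + 19 * L + 2 * n)"
proof -
  let ?l = "v + 1" and ?r = "rt v" and ?t = "Node a b"
  have lr: "?r = v + 1 + sz a" "pre T ! ?l = a" "pre T ! ?r = b" "?l < sz T" "?r < sz T"
    using rt_Node[OF v(2,3)] by auto
  have vr: "v \<noteq> ?r" using lr by simp
  have t: "?t \<in> nodes T" using pre_in_nodes[OF v(2)] v(3) by simp
  have L: "s [15] = L" using W by (simp add: weights_def)
  let ?J = "joined a b (LA ?l ! i1) (LA ?r ! i2)"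
  let ?X = "num (\<lambda>t. s [54, ?l, i1, ja, t]) L" and ?Y = "num (\<lambda>t. s [54, ?r, i2, jb, t]) L"
  let ?Z = "num (\<lambda>t. s [54, v, i, j, t]) L"
  obtain \<tau> where \<tau>: "\<tau> \<in> sols a (LA ?l ! i1)" "?X = wt w LB ?l ja \<tau>"
      "\<And>\<sigma>. \<sigma> \<in> sols a (LA ?l ! i1) \<Longrightarrow> wt w LB ?l ja \<sigma> \<le> wt w LB ?l ja \<tau>"
      "\<And>x. x < n \<Longrightarrow> s [55, ?l, i1, ja, x] = of_bool (x \<in> \<tau>)"
    using R(2) ne(1) unfolding max_repr_def by (auto split: if_splits)
  obtain \<sigma> where \<sigma>: "\<sigma> \<in> sols b (LA ?r ! i2)" "?Y = wt w LB ?r jb \<sigma>"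
      "\<And>\<rho>. \<rho> \<in> sols b (LA ?r ! i2) \<Longrightarrow> wt w LB ?r jb \<rho> \<le> wt w LB ?r jb \<sigma>"
      "\<And>x. x < n \<Longrightarrow> s [55, ?r, i2, jb, x] = of_bool (x \<in> \<sigma>)"
    using R(3) ne(2) unfolding max_repr_def by (auto split: if_splits)
  \<comment> \<open>The covered clauses of the two children are disjoint, so no weight is counted
    twice.\<close>
  have wadd: "wt w LB v j (\<tau>' \<union> \<sigma>') = wt w LB ?l ja \<tau>' + wt w LB ?r jb \<sigma>'"
    if "\<tau>' \<in> sols a (LA ?l ! i1)" "\<sigma>' \<in> sols b (LA ?r ! i2)" for \<tau>' \<sigma>'
  proof -
    have "finite (covered a B \<rho>)" "finite (covered b B \<rho>)" for B \<rho> by (auto simp: covered_def)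
    then show ?thesis
      unfolding wt_def v(3) lr(2,3) covered_Node[OF t that] ja jb
      using covered_disj[OF t] by (intro sum.union_disjoint) auto
  qed
  have best: "\<And>\<rho>. \<rho> \<in> ?J \<Longrightarrow> wt w LB v j \<rho> \<le> ?X + ?Y" and mem: "\<tau> \<union> \<sigma> \<in> ?J" and eqw: "wt w LB v j (\<tau> \<union> \<sigma>) = ?X + ?Y"
  proof -
    show "\<tau> \<union> \<sigma> \<in> ?J" unfolding joined_def[OF t] using \<tau>(1) \<sigma>(1) by (intro image_eqI[of _ _ "(\<tau>, \<sigma>)"]) auto
    show "wt w LB v j (\<tau> \<union> \<sigma>) = ?X + ?Y" using wadd \<tau> \<sigma> by simp
    fix \<rho> assume "\<rho> \<in> ?J"
    then obtain \<tau>' \<sigma>' where 1: "\<tau>' \<in> sols a (LA ?l ! i1)" "\<sigma>' \<in> sols b (LA ?r ! i2)" "\<rho> = \<tau>' \<union> \<sigma>'"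
      unfolding joined_def[OF t] by auto
    then show "wt w LB v j \<rho> \<le> ?X + ?Y" using wadd[OF 1(1,2)] \<tau>(3)[OF 1(1)] \<sigma>(3)[OF 1(2)] \<tau>(2) \<sigma>(2) by simp
  qed
  \<comment> \<open>The weight of covered clauses never exceeds the total weight, so
    \<open>L\<close> bits suffice at every node.\<close>
  have fits: "?X + ?Y < 2 ^ L"
  proof -
    have "covered ?t (LB v ! j) (\<tau> \<union> \<sigma>) \<subseteq> {..<m}" using node_facts(1)[OF t] by (auto simp: covered_def)
    then have "wt w LB v j (\<tau> \<union> \<sigma>) \<le> (\<Sum>c<m. w c)" unfolding wt_def v(3) by (intro sum_mono2) auto
    then show ?thesis using eqw tot by simp
  qed
  let ?load = "For lt (V sL) (Asg aBuf [V lt] (At aNum [V sl, V l1, V sja, V lt]))"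
  let ?add = "addloop aBuf [] (At aNum [V sr, V l2, V sjb, V lt]) (V sL)"
  let ?P = "\<lambda>u. max_repr w L LB u v i j (Q \<union> ?J) \<and> only s u v i j"
  have "spec max_combine s ?P ((1 + 2 * L) + Suc ((2 + 10 * L) + Suc ((1 + 5 * L) + Suc (2 + 2 * L + 2 * n))))"
    unfolding max_combine_def
  proof (rule spec_Seq[OF _ _ order_refl])
    show "spec ?load s (\<lambda>u. \<forall>t<L. u [56, t] = s [54, ?l, i1, ja, t]) (1 + 2 * L)"
    proof (rule spec_For_const[where n=L and c=1 and I="\<lambda>x u. \<forall>t<x. u [56, t] = s [54, ?l, i1, ja, t]"])
      fix x u assume I: "\<forall>t<x. u [56, t] = s [54, ?l, i1, ja, t]" and ag: "agree (writes ?load) s u"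
      have ut: "u (t # q) = s (t # q)" if "t \<in> {8, 24, 20, 54}" for t q
        by (rule agree_tag[OF ag]) (use that in auto)
      show "spec (Asg aBuf [V lt] (At aNum [V sl, V l1, V sja, V lt])) (u([lt] := x)) (\<lambda>u. \<forall>t<Suc x. u [56, t] = s [54, ?l, i1, ja, t]) 1"
        unfolding spec_def using I ut s by (auto simp: less_Suc_eq)
    qed (use L in simp_all)
  next
    fix u assume ld: "\<forall>t<L. u [56, t] = s [54, ?l, i1, ja, t]" and ag: "agree (writes ?load) s u"
    have ut: "u (t # q) = s (t # q)" if "t \<notin> {28, 56}" for t q
      by (rule agree_tag[OF ag]) (use that in auto)
    let ?w = "u([su] := 0)"
    have "spec (?add ;; Asg sq [] (N 0) ;; cmploop ;; Ife (V sq) (N 1) copybest skip) ?w ?P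
       ((2 + 10 * L) + Suc ((1 + 5 * L) + Suc (2 + 2 * L + 2 * n)))"
    proof (rule spec_Seq[OF _ _ order_refl])
      show "spec ?add ?w (\<lambda>u'. upto_cells ?w u' 56 [] \<and>
      (\<forall>x. x < 0 \<or> 0 + L \<le> x \<longrightarrow> u' (56 # [] @ [x]) = ?w (56 # [] @ [x])) \<and>
      (\<forall>t<L. u' (56 # [] @ [0 + t]) \<le> 1) \<and>
      num (\<lambda>t. u' (56 # [] @ [0 + t])) L = num (\<lambda>t. ?w (56 # [] @ [0 + t])) L + ?Y) (2 + 10 * L)"
      proof (rule addloop_correct)
        fix u' t assume "u' [lt] = t" and up: "upto_cells ?w u' 56 []"
        moreover have "u' (q # z) = s (q # z)" if "q \<in> {9, 21, 25, 54}" for q z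
        proof -
          have "u' (q # z) = ?w (q # z)" using up that unfolding upto_cells_def by auto
          then show ?thesis using ut that by auto
        qed
        ultimately show "val u' (At aNum [V sr, V l2, V sjb, V lt]) = s [54, ?r, i2, jb, t]" using s by simp
      next
        show "val (?w([scar] := 0)) (V sL) = L" using ut L by simp
        show "s [54, ?r, i2, jb, t] \<le> 1" for t using R(3) by (simp add: max_repr_def)
        show "?w (56 # [] @ [0 + t]) \<le> 1" if "t < L" for t using ld that R(2) by (simp add: max_repr_def)
        have "num (\<lambda>t. ?w (56 # [] @ [0 + t])) L = ?X" by (rule num_cong) (use ld in simp)
        then show "num (\<lambda>t. ?w (56 # [] @ [0 + t])) L + ?Y < 2 ^ L" using fits by simp
      qed auto
    next
      fix u2 assume u2: "upto_cells ?w u2 56 [] \<and>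
      (\<forall>x. x < 0 \<or> 0 + L \<le> x \<longrightarrow> u2 (56 # [] @ [x]) = ?w (56 # [] @ [x])) \<and>
      (\<forall>t<L. u2 (56 # [] @ [0 + t]) \<le> 1) \<and>
      num (\<lambda>t. u2 (56 # [] @ [0 + t])) L = num (\<lambda>t. ?w (56 # [] @ [0 + t])) L + ?Y"
      have "num (\<lambda>t. u [56, t]) L = ?X" by (rule num_cong) (use ld in simp)
      then have nb: "num (\<lambda>t. u2 [56, t]) L = ?X + ?Y" and bits: "\<And>t. t < L \<Longrightarrow> u2 [56, t] \<le> 1" using u2 by simp_all
      have u2t: "u2 (t # q) = s (t # q)" if "t \<notin> {11, 12, 13, 14, 28, 56}" for t q
      proof -
        have "u2 (t # q) = ?w (t # q)" using u2 that unfolding upto_cells_def by blast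
        then show ?thesis using ut[of t q] that by auto
      qed
      let ?w2 = "u2([sq] := 0)"
      have "spec (cmploop ;; Ife (V sq) (N 1) copybest skip) ?w2 ?P ((1 + 5 * L) + Suc (2 + 2 * L + 2 * n))"
      proof (rule spec_Seq[OF cmploop_correct _ order_refl])
        show "?w2 [15] = L" "?w2 [7] = v" "?w2 [19] = i" "?w2 [26] = j" using u2t L v s by simp_all
        show "?w2 [56, t] \<le> 1" if "t < L" for t using bits that by simp
        show "?w2 [54, v, i, j, t] \<le> 1" for t using u2t R(1) by (simp add: max_repr_def)
      next
        fix u3 assume "u3 [14] = of_bool (num (\<lambda>t. ?w2 [56, t]) L < num (\<lambda>t. ?w2 [54, v, i, j, t]) L)"
          and ag3: "agree (writes cmploop) ?w2 u3"
        then have cmp: "u3 [14] = of_bool (?X + ?Y < ?Z)" using nb u2t by simp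
        have u3t: "u3 (t # q) = s (t # q)" if "t \<notin> {11, 12, 13, 14, 28, 56}" for t q
        proof -
          have "u3 (t # q) = ?w2 (t # q)" by (rule agree_tag[OF ag3]) (use that in \<open>auto simp: cmploop_def\<close>)
          then show ?thesis using u2t[of t q] that by auto
        qed
        have buf3: "u3 [56, t] = u2 [56, t]" for t
          using agree_tag[OF ag3, of 56] by (simp add: cmploop_def)
        show "spec (Ife (V sq) (N 1) copybest skip) u3 ?P (Suc (2 + 2 * L + 2 * n))"
        proof (rule spec_Ife)
          assume "val u3 (V sq) < val u3 (N 1)"
          then have ge: "?Z \<le> ?X + ?Y" using cmp by (auto split: if_splits)
          show "spec copybest u3 ?P (2 + 2 * L + 2 * n)"
          proof (rule spec_mono[OF copybest_correct])
            fix u4 assume u4: "(\<forall>t<L. u4 [54, v, i, j, t] = u3 [56, t]) \<and> (\<forall>t\<ge>L. u4 [54, v, i, j, t] = u3 [54, v, i, j, t]) \<and>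
              (\<forall>x<n. u4 [55, v, i, j, x] = of_bool (x \<in> \<tau> \<union> \<sigma>)) \<and> only u3 u4 v i j"
            have n4: "num (\<lambda>t. u4 [54, v, i, j, t]) L = wt w LB v j (\<tau> \<union> \<sigma>)"
              unfolding eqw nb[symmetric] by (rule num_cong) (use u4 buf3 in simp)
            have b4: "u4 [54, v, i, j, t] \<le> 1" for t
            proof (cases "t < L")
              case True then show ?thesis using u4 buf3 bits by simp
            next
              case False then show ?thesis using u4 u3t R(1) by (simp add: max_repr_def)
            qed
            have up: "wt w LB v j \<rho> \<le> wt w LB v j (\<tau> \<union> \<sigma>)" if "\<rho> \<in> Q \<union> ?J" for \<rho>
            proof (cases "\<rho> \<in> ?J")
              case True then show ?thesis using best eqw by simp
            next
              case False
              then have "\<rho> \<in> Q" using that by simp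
              then have "wt w LB v j \<rho> \<le> ?Z" using R(1) unfolding max_repr_def by (auto split: if_splits)
              then show ?thesis using ge eqw by simp
            qed
            have "max_repr w L LB u4 v i j (Q \<union> ?J)"
            proof -
              have "Q \<union> ?J \<noteq> {}" "\<tau> \<union> \<sigma> \<in> Q \<union> ?J" using mem by auto
              then show ?thesis unfolding max_repr_def using b4 n4 up u4 by (simp only: if_False) blast
            qed
            moreover have "only s u4 v i j" unfolding only_def
            proof (intro ballI allI impI)
              fix t i' j' q assume h: "t \<in> {54, 55 :: nat}" "(i', j') \<noteq> (i, j)"
              have "u4 (t # v # i' # j' # q) = u3 (t # v # i' # j' # q)" by (rule only_eq[OF _ h]) (use u4 in simp)
              then show "u4 (t # v # i' # j' # q) = s (t # v # i' # j' # q)" using h u3t by auto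
            qed
            ultimately show "?P u4" by blast
          next
            show "u3 [sn] = n" using u3t st by (simp add: static_def)
            show "u3 [55, ?l, i1, ja, x] = of_bool (x \<in> \<tau>)" if "x < n" for x using u3t \<tau>(4) that by simp
            show "u3 [55, ?r, i2, jb, x] = of_bool (x \<in> \<sigma>)" if "x < n" for x using u3t \<sigma>(4) that by simp
          qed (use u3t L v s vr in auto)
        next
          assume "\<not> val u3 (V sq) < val u3 (N 1)"
          then have lt: "?X + ?Y < ?Z" using cmp by (auto split: if_splits)
          \<comment> \<open>The stored weight is strictly larger than a natural number, hence
            positive, and an entry for no assignment has weight 0.\<close>
          then have Q: "Q \<noteq> {}" using R(1) unfolding max_repr_def by (auto split: if_splits)
          then obtain \<rho> where r: "\<rho> \<in> Q" "?Z = wt w LB v j \<rho>" "\<And>\<sigma>. \<sigma> \<in> Q \<Longrightarrow> wt w LB v j \<sigma> \<le> wt w LB v j \<rho>"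
            "\<And>x. x < n \<Longrightarrow> s [55, v, i, j, x] = of_bool (x \<in> \<rho>)"
            using R(1) unfolding max_repr_def by auto
          have bits3: "\<And>t. u3 [54, v, i, j, t] \<le> 1" using u3t R(1) by (simp add: max_repr_def)
          have n3: "num (\<lambda>t. u3 [54, v, i, j, t]) L = wt w LB v j \<rho>" using u3t r(2) by simp
          have up: "wt w LB v j \<sigma>' \<le> wt w LB v j \<rho>" if "\<sigma>' \<in> Q \<union> ?J" for \<sigma>'
            using that best[of \<sigma>'] r(2,3) lt by fastforce
          have a3: "u3 [55, v, i, j, x] = of_bool (x \<in> \<rho>)" if "x < n" for x using u3t r(4) that by simp
          have "max_repr w L LB u3 v i j (Q \<union> ?J)"
          proof -
            have "Q \<union> ?J \<noteq> {}" "\<rho> \<in> Q \<union> ?J" using mem r by auto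
            then show ?thesis unfolding max_repr_def using bits3 n3 up a3 by (simp only: if_False) blast
          qed
          moreover have "only s u3 v i j" unfolding only_def using u3t by auto
          ultimately show "spec skip u3 ?P (2 + 2 * L + 2 * n)" unfolding spec_def eff_skip by simp
        qed simp
      qed simp
      then show "spec (Asg sq [] (N 0) ;; cmploop ;; Ife (V sq) (N 1) copybest skip) u2 ?P (Suc ((1 + 5 * L) + Suc (2 + 2 * L + 2 * n)))"
        by (intro spec_AsgSeq) simp
    qed
    then show "spec (Asg su [] (N 0) ;; ?add ;; Asg sq [] (N 0) ;; cmploop ;; Ife (V sq) (N 1) copybest skip) u ?P
       (Suc ((2 + 10 * L) + Suc ((1 + 5 * L) + Suc (2 + 2 * L + 2 * n))))"
      by (intro spec_AsgSeq) simp
  qed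
  then show ?thesis by (rule spec_mono) auto
qed

lemma max_dp:
  assumes k: "\<And>t. t \<in> nodes T \<Longrightarrow> card (psA t) \<le> k" "\<And>t. t \<in> nodes T \<Longrightarrow> card (psB t) \<le> k"
    and tot: "(\<Sum>c<m. w c) < 2 ^ L"
  shows "dp m n occ T LA LB k (weights w L) (max_repr w L LB) max_clause max_var max_combine (2 + 2 * L) 1 (\<lambda>v. 10 + 19 * L + 2 * n)"
proof unfold_locales
  fix s u assume w: "weights w L s" and e: "eqT s u"
  have "u [15] = s [15]" "\<And>c t. u [53, c, t] = s [53, c, t]" using e by (auto simp: eqT_def dpT_def)
  then show "weights w L u" using w by (simp add: weights_def)
next
  fix s v c j assume st: "static s" and B: "okB s LB v" and W: "weights w L s" and v: "s [7] = v" "v < sz T" "pre T ! v = Leaf (Inl c)"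
    and j: "s [lj] = j" "j < length (LB v)" and z: "\<And>t l. t \<in> {54, 55} \<Longrightarrow> s (t # v # 0 # j # l) = 0"
  have c: "s [aArg, v] = c" "c < m" using st v node_facts(1)[OF pre_in_nodes[OF v(2)]] by (auto simp: static_def)
  have b: "s [aB, v, j, c] = of_bool (c \<in> LB v ! j)" using B j c st by (auto simp: okB_def islist_def static_def)
  have cov: "wt w LB v j {} = (if c \<in> LB v ! j then w c else 0)"
    unfolding wt_def v(3) by (auto simp: covered_def satX_def)
  have zz: "s [54, v, 0, j, t] = 0" "s [55, v, 0, j, t] = 0" for t using z by auto
  let ?P = "\<lambda>u. max_repr w L LB u v 0 j {{}} \<and> only s u v 0 j"
  show "spec max_clause s ?P (2 + 2 * L)"
    unfolding max_clause_def
  proof (rule spec_Ife)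
    let ?f = "For lt (V sL) (Asg aNum [V sv, N 0, V lj, V lt] (At aW [At aArg [V sv], V lt]))"
    assume "val s (N 0) < val s (At aB [V sv, V lj, At aArg [V sv]])"
    then have cB: "c \<in> LB v ! j" using b v j c by (auto split: if_splits)
    show "spec ?f s ?P (1 + 2 * L)"
    proof (rule spec_For_const[where n=L and c=1 and I="\<lambda>x u. (\<forall>t<x. u [54, v, 0, j, t] = s [53, c, t]) \<and> (\<forall>t\<ge>x. u [54, v, 0, j, t] = 0) \<and> only s u v 0 j"])
      fix x u assume I: "(\<forall>t<x. u [54, v, 0, j, t] = s [53, c, t]) \<and> (\<forall>t\<ge>x. u [54, v, 0, j, t] = 0) \<and> only s u v 0 j"
        and ag: "agree (writes ?f) s u"
      have ut: "u (t # q) = s (t # q)" if "t \<in> {7, 26, 42, 53}" for t q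
        by (rule agree_tag[OF ag]) (use that in auto)
      let ?u = "u([lt] := x, [54, v, 0, j, x] := s [53, c, x])"
      have e: "run_prog (Asg aNum [V sv, N 0, V lj, V lt] (At aW [At aArg [V sv], V lt])) (u([lt] := x)) = ?u"
        using ut v j c by simp
      have "only s ?u v 0 j" using I unfolding only_def by auto
      then show "spec (Asg aNum [V sv, N 0, V lj, V lt] (At aW [At aArg [V sv], V lt])) (u([lt] := x))
        (\<lambda>u. (\<forall>t<Suc x. u [54, v, 0, j, t] = s [53, c, t]) \<and> (\<forall>t\<ge>Suc x. u [54, v, 0, j, t] = 0) \<and> only s u v 0 j) 1"
        unfolding spec_def e using I by (simp add: less_Suc_eq)
    next
      fix u assume I: "(\<forall>t<L. u [54, v, 0, j, t] = s [53, c, t]) \<and> (\<forall>t\<ge>L. u [54, v, 0, j, t] = 0) \<and> only s u v 0 j"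
        and ag: "agree (writes ?f) s u"
      have "u [55, v, 0, j, x] = 0" for x using agree_tag[OF ag, of 55] zz by simp
      moreover have "num (\<lambda>t. u [54, v, 0, j, t]) L = num (\<lambda>t. s [53, c, t]) L" by (rule num_cong) (use I in simp)
      moreover have "u [54, v, 0, j, t] \<le> 1" for t using I W c by (cases "t < L") (auto simp: weights_def)
      ultimately show "?P u" using I W c cov cB by (simp add: max_repr_def weights_def)
    qed (use W zz in \<open>auto simp: weights_def only_def\<close>)
  next
    assume "\<not> val s (N 0) < val s (At aB [V sv, V lj, At aArg [V sv]])"
    then have cB: "c \<notin> LB v ! j" using b v j c by (auto split: if_splits)
    have "?P s" using cov cB zz by (auto simp: max_repr_def only_def intro!: num_zero)
    then show "spec skip s ?P (1 + 2 * L)" unfolding spec_def eff_skip by simp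
  qed simp
next
  fix s v x b i Q
  assume st: "static s" and v: "s [7] = v" "v < sz T" "pre T ! v = Leaf (Inr x)" and b: "s [l1] = b" "b < (2 :: nat)" and i: "s [si] = i"
    and R: "max_repr w L LB s v i 0 Q" and Q: "Q \<subseteq> (if b = 0 then {} else {{}})"
  have x: "s [aArg, v] = x" "x < n" using st v node_facts(2)[OF pre_in_nodes[OF v(2)]] by (auto simp: static_def)
  have w0: "wt w LB v 0 \<tau> = 0" for \<tau> unfolding wt_def v(3) by (simp add: covered_def)
  let ?\<tau> = "if b = 1 then {x} else {}"
  let ?u = "s([55, v, i, 0, x] := b)"
  have z: "s [55, v, i, 0, y] = 0" if "y < n" for y
  proof (cases "Q = {}")
    case True then show ?thesis using R by (simp add: max_repr_def)
  next
    case False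
    then have "Q = {{}}" using Q by (auto split: if_splits)
    then show ?thesis using R that by (simp add: max_repr_def)
  qed
  have "num (\<lambda>t. s [54, v, i, 0, t]) L = 0" using R w0 by (auto simp: max_repr_def split: if_splits)
  moreover have "?u [55, v, i, 0, y] = of_bool (y \<in> ?\<tau>)" if "y < n" for y using z[OF that] b by auto
  ultimately have "max_repr w L LB ?u v i 0 (insert ?\<tau> Q)"
    using R w0 by (auto simp: max_repr_def)
  moreover have "only s ?u v i 0" by (auto simp: only_def)
  ultimately show "spec max_var s (\<lambda>u. max_repr w L LB u v i 0 (insert ?\<tau> Q) \<and> only s u v i 0) 1"
    unfolding spec_def max_var_def using v b i x by simp
next
  show "localp max_clause" "localp max_var" "localp max_combine" by (rule localp_max)+
next
  fix s u v i j Q assume e: "\<And>t l. t \<in> {54, 55} \<Longrightarrow> u (t # v # i # j # l) = (s :: store) (t # v # i # j # l)"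
  show "max_repr w L LB u v i j Q = max_repr w L LB s v i j Q" unfolding max_repr_def using e by simp
next
  fix s v i j assume "\<And>t l. t \<in> {54, 55} \<Longrightarrow> (s :: store) (t # v # i # j # l) = 0"
  then show "max_repr w L LB s v i j {}" unfolding max_repr_def by (auto intro!: num_zero)
next
  fix s v a b i j i1 i2 ja jb Q
  assume "static s" "weights w L s" "s [7] = v" "v < sz T" "pre T ! v = Node a b"
    "s [sl] = v + 1" "s [sr] = rt v" "s [l1] = i1" "s [l2] = i2" "s [lj] = j" "s [si] = i" "s [sja] = ja" "s [sjb] = jb"
    "LB (v + 1) ! ja = (LB v ! j \<union> LA (rt v) ! i2) \<inter> cls a"
    "LB (rt v) ! jb = (LB v ! j \<union> LA (v + 1) ! i1) \<inter> cls b"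
    "sols a (LA (v + 1) ! i1) \<noteq> {}" "sols b (LA (rt v) ! i2) \<noteq> {}"
    "max_repr w L LB s v i j Q" "max_repr w L LB s (v + 1) i1 ja (sols a (LA (v + 1) ! i1))"
      "max_repr w L LB s (rt v) i2 jb (sols b (LA (rt v) ! i2))"
  then show "spec max_combine s (\<lambda>u. max_repr w L LB u v i j (Q \<union> joined a b (LA (v + 1) ! i1) (LA (rt v) ! i2)) \<and> only s u v i j)
    (10 + 19 * L + 2 * n)" using tot by (rule COMBm_correct)
qed (use assms in auto)

end

section \<open>Input and output\<close>

definition stream :: "store \<Rightarrow> nat list \<Rightarrow> bool" where
  "stream s xs \<longleftrightarrow> (\<forall>i<length xs. s [0, s [3] + i] = xs ! i)"

lemma stream_hd: "stream s (x # xs) \<Longrightarrow> s [0, s [3]] = x"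
  unfolding stream_def by (metis add.right_neutral length_greater_0_conv list.distinct(1) nth_Cons_0)

lemma stream_tl:
  assumes "stream s (x # xs)" "u [3] = Suc (s [3])" "\<And>l. u (0 # l) = s (0 # l)"
  shows "stream u xs"
  unfolding stream_def
proof (intro allI impI)
  fix i assume "i < length xs"
  then have "s [0, s [3] + Suc i] = (x # xs) ! Suc i" using assms(1) unfolding stream_def by (metis Suc_less_eq length_Cons)
  then show "u [0, u [3] + i] = xs ! i" using assms(2,3) by simp
qed

lemma stream_cong:
  assumes "u [3] = s [3]" "\<And>l. u (0 # l) = s (0 # l)"
  shows "stream u xs = stream s xs"
  unfolding stream_def using assms by simp

definition next_in :: prog where
  "next_in = Asg 3 [] (Inc (V 3))"

definition parse_clauses :: prog where
  "parse_clauses = For 31 (V sm) (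
     Asg 16 [] (At 0 [V 3]) ;; next_in ;;
     For 32 (V 16) (
       Asg 17 [] (At 0 [V 3]) ;; next_in ;;
       Asg 18 [] (At 0 [V 3]) ;; next_in ;;
       Asg aOcc [V 18, V 17, V 31] (N 1)))"

text \<open>The number of nodes is \<open>2 * (m + n) - 1\<close>. The language offers neither
  addition nor multiplication, so the value is reached by increments.\<close>

definition count_nodes :: prog where
  "count_nodes = Asg sN [] (N 0) ;; For 32 (V sm) (Asg sN [] (Inc (Inc (V sN)))) ;;
     For 32 (V sn) (Asg sN [] (Inc (Inc (V sN)))) ;; Asg sN [] (Sub (V sN) (N 1))"

text \<open>The encoding lists the nodes in preorder, so node numbers are assigned in reading order
  and the shape of the tree is recovered later through \<open>aEnd\<close>.\<close>

definition parse_tree :: prog where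
  "parse_tree = For 32 (V sN) (
     Asg aTag [V 32] (At 0 [V 3]) ;; next_in ;;
     Ife (At aTag [V 32]) (N 2) (Asg aArg [V 32] (At 0 [V 3]) ;; next_in) skip)"

definition parse :: prog where
  "parse = Asg sm [] (At 0 [N 0]) ;; Asg sn [] (At 0 [N 1]) ;; Asg 3 [] (N 2) ;;
     parse_clauses ;; count_nodes ;; parse_tree"

definition enc_pairs :: "(nat \<times> bool) list \<Rightarrow> nat list" where
  "enc_pairs D = concat (map (\<lambda>(x, b). [x, of_bool b]) D)"

definition enc_clauses :: "(nat \<Rightarrow> (nat \<times> bool) list) \<Rightarrow> nat list \<Rightarrow> nat list" where
  "enc_clauses cl cs = concat (map (\<lambda>c. length (cl c) # enc_pairs (cl c)) cs)"

fun token :: "(nat + nat) btree \<Rightarrow> nat list" where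
  "token (Leaf (Inl c)) = [0, c]"
| "token (Leaf (Inr x)) = [1, x]"
| "token (Node a b) = [2]"

definition tokens :: "(nat + nat) btree \<Rightarrow> nat list" where
  "tokens t = concat (map token (pre t))"

lemma fst_wr_parse: "fst ` writes parse = {4, 5, 3, 31, 16, 32, 17, 18, 40, 6, 41, 11, 42}"
  unfolding parse_def parse_clauses_def count_nodes_def parse_tree_def next_in_def by (simp add: insert_commute)

lemma parse_pairs_correct:
  assumes str: "stream s (enc_pairs D @ rest)" and len: "s [16] = length D" and c: "s [31] = c"
    and z: "\<And>b x c'. b < 2 \<Longrightarrow> s [40, b, x, c'] = of_bool (oc b x c')"
    and nc: "\<And>b x. \<not> oc b x c"
  shows "spec (For 32 (V 16) (
       Asg 17 [] (At 0 [V 3]) ;; next_in ;; Asg 18 [] (At 0 [V 3]) ;; next_in ;;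
       Asg aOcc [V 18, V 17, V 31] (N 1))) s
     (\<lambda>u. stream u rest \<and> (\<forall>b<2. \<forall>x c'. u [40, b, x, c'] = of_bool (oc b x c' \<or> c' = c \<and> (x, b = 1) \<in> set D)))
     (1 + 6 * length D)"
proof (rule spec_For_const[where n="length D" and c=5 and I="\<lambda>j u. stream u (enc_pairs (drop j D) @ rest) \<and>
    (\<forall>b<2. \<forall>x c'. u [40, b, x, c'] = of_bool (oc b x c' \<or> c' = c \<and> (x, b = 1) \<in> set (take j D)))"])
  let ?body = "Asg 17 [] (At 0 [V 3]) ;; next_in ;; Asg 18 [] (At 0 [V 3]) ;; next_in ;;
       Asg aOcc [V 18, V 17, V 31] (N 1)"
  fix j u assume j: "j < length D" and I: "stream u (enc_pairs (drop j D) @ rest) \<and>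
    (\<forall>b<2. \<forall>x c'. u [40, b, x, c'] = of_bool (oc b x c' \<or> c' = c \<and> (x, b = 1) \<in> set (take j D)))"
    and ag: "agree (writes (For 32 (V 16) ?body)) s u"
  have u31: "u [31] = c" using agree_tag[OF ag, of 31] c by (simp add: next_in_def)
  obtain y d where yd: "D ! j = (y, d)" by fastforce
  have dr: "drop j D = (y, d) # drop (Suc j) D" using j yd by (metis Cons_nth_drop_Suc)
  have str0: "stream u (y # of_bool d # enc_pairs (drop (Suc j) D) @ rest)"
    using I unfolding dr enc_pairs_def by simp
  let ?u1 = "u([3] := Suc (u [3]))"
  have str1: "stream ?u1 (of_bool d # enc_pairs (drop (Suc j) D) @ rest)"
    by (rule stream_tl[OF str0]) auto
  have rd: "u [0, u [3]] = y" "u [0, Suc (u [3])] = of_bool d" using stream_hd[OF str0] stream_hd[OF str1] by auto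
  let ?v = "u([32] := j, [17] := y, [3] := Suc (u [3]), [18] := of_bool d, [3] := Suc (Suc (u [3])), [40, of_bool d, y, c] := 1)"
  have e: "run_prog ?body (u([32] := j)) = ?v" using rd u31 by (simp add: next_in_def)
  have "stream ?v (enc_pairs (drop (Suc j) D) @ rest)" by (rule stream_tl[OF str1]) auto
  moreover have "?v [40, b, x, c'] = of_bool (oc b x c' \<or> c' = c \<and> (x, b = 1) \<in> set (take (Suc j) D))" if "b < 2" for b x c'
  proof -
    have tk: "set (take (Suc j) D) = insert (y, d) (set (take j D))" using j yd by (simp add: take_Suc_conv_app_nth)
    have "?v [40, b, x, c'] = (if b = of_bool d \<and> x = y \<and> c' = c then 1 else u [40, b, x, c'])" by auto
    moreover have "u [40, b, x, c'] = of_bool (oc b x c' \<or> c' = c \<and> (x, b = 1) \<in> set (take j D))" using I that by blast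
    moreover have "b = of_bool d \<longleftrightarrow> (b = 1) = d" using that by auto
    ultimately show ?thesis unfolding tk by auto
  qed
  ultimately show "spec ?body (u([32] := j)) (\<lambda>u. stream u (enc_pairs (drop (Suc j) D) @ rest) \<and>
    (\<forall>b<2. \<forall>x c'. u [40, b, x, c'] = of_bool (oc b x c' \<or> c' = c \<and> (x, b = 1) \<in> set (take (Suc j) D)))) 5"
    unfolding spec_def e by (simp add: next_in_def)
qed (use str len z in \<open>auto simp: enc_pairs_def\<close>)

context instance_data
begin

lemma parse_clauses_correct:
  assumes str: "stream s (enc_clauses cl [0..<m] @ rest)" and sm: "s [sm] = m"
    and z: "\<And>l. s (40 # l) = 0"
  shows "spec parse_clauses s (\<lambda>u. stream u rest \<and> (\<forall>b<2. \<forall>x c. u [40, b, x, c] = of_bool (c < m \<and> (x, b = 1) \<in> set (cl c))))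
     (1 + (\<Sum>c<m. 4 + 6 * length (cl c)))"
  unfolding parse_clauses_def
proof (rule spec_For[where n=m and c="\<lambda>c. 3 + 6 * length (cl c)" and I="\<lambda>j u. stream u (enc_clauses cl [j..<m] @ rest) \<and>
    (\<forall>b<2. \<forall>x c. u [40, b, x, c] = of_bool (c < j \<and> (x, b = 1) \<in> set (cl c)))"])
  let ?inner = "For 32 (V 16) (
       Asg 17 [] (At 0 [V 3]) ;; next_in ;; Asg 18 [] (At 0 [V 3]) ;; next_in ;;
       Asg aOcc [V 18, V 17, V 31] (N 1))"
  fix j u assume j: "j < m" and I: "stream u (enc_clauses cl [j..<m] @ rest) \<and>
    (\<forall>b<2. \<forall>x c. u [40, b, x, c] = of_bool (c < j \<and> (x, b = 1) \<in> set (cl c)))"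
  have str0: "stream u (length (cl j) # (enc_pairs (cl j) @ enc_clauses cl [Suc j..<m] @ rest))"
    using I j unfolding enc_clauses_def by (simp add: upt_conv_Cons)
  let ?u = "u([31] := j, [16] := length (cl j), [3] := Suc (u [3]))"
  have "spec ?inner ?u (\<lambda>u. stream u (enc_clauses cl [Suc j..<m] @ rest) \<and>
    (\<forall>b<2. \<forall>x c'. u [40, b, x, c'] = of_bool ((c' < j \<and> (x, b = 1) \<in> set (cl c')) \<or> c' = j \<and> (x, b = 1) \<in> set (cl j))))
     (1 + 6 * length (cl j))"
  proof (rule parse_pairs_correct)
    show "stream ?u (enc_pairs (cl j) @ enc_clauses cl [Suc j..<m] @ rest)" by (rule stream_tl[OF str0]) auto
  qed (use I in auto)
  then have sp: "spec ?inner ?u (\<lambda>u. stream u (enc_clauses cl [Suc j..<m] @ rest) \<and>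
    (\<forall>b<2. \<forall>x c'. u [40, b, x, c'] = of_bool (c' < Suc j \<and> (x, b = 1) \<in> set (cl c')))) (1 + 6 * length (cl j))"
  proof (rule spec_mono)
    fix u' assume u': "stream u' (enc_clauses cl [Suc j..<m] @ rest) \<and>
    (\<forall>b<2. \<forall>x c'. u' [40, b, x, c'] = of_bool ((c' < j \<and> (x, b = 1) \<in> set (cl c')) \<or> c' = j \<and> (x, b = 1) \<in> set (cl j)))"
    have eq: "(c' < j \<and> (x, b = (1::nat)) \<in> set (cl c') \<or> c' = j \<and> (x, b = 1) \<in> set (cl j)) = (c' < Suc j \<and> (x, b = 1) \<in> set (cl c'))" for x b c'
      by (auto simp: less_Suc_eq)
    show "stream u' (enc_clauses cl [Suc j..<m] @ rest) \<and>
      (\<forall>b<2. \<forall>x c'. u' [40, b, x, c'] = of_bool (c' < Suc j \<and> (x, b = 1) \<in> set (cl c')))" using u' unfolding eq .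
  qed simp
  have e: "run_prog (Asg 16 [] (At 0 [V 3])) (u([31] := j)) = u([31] := j, [16] := length (cl j))"
     "run_prog next_in (u([31] := j, [16] := length (cl j))) = ?u"
    using stream_hd[OF str0] by (simp_all add: next_in_def)
  show "spec (Asg 16 [] (At 0 [V 3]) ;; next_in ;; ?inner) (u([31] := j)) (\<lambda>u. stream u (enc_clauses cl [Suc j..<m] @ rest) \<and>
    (\<forall>b<2. \<forall>x c'. u [40, b, x, c'] = of_bool (c' < Suc j \<and> (x, b = 1) \<in> set (cl c')))) (3 + 6 * length (cl j))"
    using sp unfolding spec_def run_prog.simps(2) cost.simps(2) e by (simp add: next_in_def)
qed (use str sm z in \<open>auto simp: enc_clauses_def\<close>)

lemma count_nodes_correct:
  assumes "s [sm] = m" "s [sn] = n"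
  shows "spec count_nodes s (\<lambda>u. u [sN] = sz T) (4 + 2 * m + 2 * n)"
  unfolding count_nodes_def
proof (rule spec_mono[OF spec_AsgSeq])
  let ?f = "For 32 (V sm) (Asg sN [] (Inc (Inc (V sN))))" and ?g = "For 32 (V sn) (Asg sN [] (Inc (Inc (V sN))))"
  have "spec (?f ;; ?g ;; Asg sN [] (Sub (V sN) (N 1))) (s([6] := 0)) (\<lambda>u. u [sN] = sz T) ((1 + 2 * m) + ((1 + 2 * n) + 1))"
  proof (rule spec_Seq[OF _ _ order_refl])
    show "spec ?f (s([6] := 0)) (\<lambda>u. u [sN] = 2 * m) (1 + 2 * m)"
      by (rule spec_For_const[where n=m and c=1 and I="\<lambda>j u. u [sN] = 2 * j"]) (use assms in \<open>auto simp: spec_def\<close>)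
  next
    fix u assume u: "u [sN] = 2 * m" and ag: "agree (writes ?f) (s([6] := 0)) u"
    have un: "u [sn] = n" using agree_tag[OF ag, of sn] assms by simp
    show "spec (?g ;; Asg sN [] (Sub (V sN) (N 1))) u (\<lambda>u. u [sN] = sz T) ((1 + 2 * n) + 1)"
    proof (rule spec_Seq[OF _ _ order_refl])
      show "spec ?g u (\<lambda>u. u [sN] = 2 * m + 2 * n) (1 + 2 * n)"
        by (rule spec_For_const[where n=n and c=1 and I="\<lambda>j u. u [sN] = 2 * m + 2 * j"]) (use u un in \<open>auto simp: spec_def\<close>)
    next
      fix u assume "u [sN] = 2 * m + 2 * n"
      then show "spec (Asg sN [] (Sub (V sN) (N 1))) u (\<lambda>u. u [sN] = sz T) 1"
        unfolding spec_def using sz_T by simp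
    qed
  qed
  then show "spec (?f ;; ?g ;; Asg sN [] (Sub (V sN) (N 1))) (s(sN # map (val s) [] := val s (N 0))) (\<lambda>u. u [sN] = sz T)
     ((1 + 2 * m) + ((1 + 2 * n) + 1))" by simp
qed auto

lemma parse_tree_correct:
  assumes str: "stream s (tokens T @ rest)" and sN: "s [sN] = sz T"
  shows "spec parse_tree s (\<lambda>u. stream u rest \<and> (\<forall>v<sz T. tagged u v (pre T ! v))) (1 + 6 * sz T)"
  unfolding parse_tree_def
proof (rule spec_For_const[where n="sz T" and c=5 and I="\<lambda>j u. stream u (concat (map token (drop j (pre T))) @ rest) \<and>
    (\<forall>v<j. tagged u v (pre T ! v))"])
  let ?body = "Asg aTag [V 32] (At 0 [V 3]) ;; next_in ;;
     Ife (At aTag [V 32]) (N 2) (Asg aArg [V 32] (At 0 [V 3]) ;; next_in) skip"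
  fix j u assume j: "j < sz T" and I: "stream u (concat (map token (drop j (pre T))) @ rest) \<and> (\<forall>v<j. tagged u v (pre T ! v))"
  let ?rest = "concat (map token (drop (Suc j) (pre T))) @ rest"
  have str0: "stream u (token (pre T ! j) @ ?rest)"
    using I Cons_nth_drop_Suc[OF j, symmetric] by simp
  let ?Q = "\<lambda>u. stream u ?rest \<and> (\<forall>v<Suc j. tagged u v (pre T ! v))"
  show "spec ?body (u([32] := j)) ?Q 5"
  proof (cases "pre T ! j")
    case (Leaf y)
    obtain d x where tok: "token (pre T ! j) = [d, x]" "d < 2" and tg: "\<And>u. tagged u j (pre T ! j) \<longleftrightarrow> u [aTag, j] = d \<and> u [aArg, j] = x"
      unfolding Leaf by (cases y) auto
    let ?u1 = "u([3] := Suc (u [3]))"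
    have s0: "stream u (d # x # ?rest)" using str0 tok by simp
    have s1: "stream ?u1 (x # ?rest)" by (rule stream_tl[OF s0]) auto
    have rd: "u [0, u [3]] = d" "u [0, Suc (u [3])] = x" using stream_hd[OF s0] stream_hd[OF s1] by auto
    let ?v = "u([32] := j, [41, j] := d, [3] := Suc (u [3]), [42, j] := x, [3] := Suc (Suc (u [3])))"
    have e: "run_prog ?body (u([32] := j)) = ?v" "cost ?body (u([32] := j)) \<le> 5" using rd tok by (simp_all add: next_in_def)
    have "stream ?v ?rest" by (rule stream_tl[OF s1]) auto
    moreover have "tagged ?v v (pre T ! v)" if "v < Suc j" for v
    proof (cases "v = j")
      case True then show ?thesis by (simp add: tg)
    next
      case False
      then have "tagged ?v v (pre T ! v) = tagged u v (pre T ! v)" by (intro tagged_cong) auto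
      then show ?thesis using I that False by simp
    qed
    ultimately show ?thesis unfolding spec_def using e by simp
  next
    case (Node a b)
    have s0: "stream u (2 # ?rest)" using str0 Node by simp
    have rd: "u [0, u [3]] = 2" using stream_hd[OF s0] by auto
    let ?v = "u([32] := j, [41, j] := 2, [3] := Suc (u [3]))"
    have "run_prog ?body (u([32] := j)) = ?v([11] := ?v [11])" "cost ?body (u([32] := j)) \<le> 5" using rd by (simp_all add: next_in_def)
    then have e: "run_prog ?body (u([32] := j)) = ?v" "cost ?body (u([32] := j)) \<le> 5" by (simp_all only: fun_upd_triv)
    have "stream ?v ?rest" by (rule stream_tl[OF s0]) auto
    moreover have "tagged ?v v (pre T ! v)" if "v < Suc j" for v
    proof (cases "v = j")
      case True then show ?thesis by (simp add: Node)
    next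
      case False
      then have "tagged ?v v (pre T ! v) = tagged u v (pre T ! v)" by (intro tagged_cong) auto
      then show ?thesis using I that False by simp
    qed
    ultimately show ?thesis unfolding spec_def using e by simp
  qed
qed (use str sN in \<open>auto simp: tokens_def\<close>)

lemma parse_correct:
  assumes str: "stream s ([m, n] @ enc_clauses cl [0..<m] @ tokens T @ rest)" and p: "s [3] = 0" and z: "\<And>l. s (40 # l) = 0"
    and occ: "\<And>b x c. c < m \<Longrightarrow> occ b x c \<longleftrightarrow> (x, b) \<in> set (cl c)"
  shows "spec parse s (\<lambda>u. static u \<and> stream u rest) (9 + (\<Sum>c<m. 4 + 6 * length (cl c)) + 2 * m + 2 * n + 6 * sz T)"
proof -
  let ?s = "s([sm] := m, [sn] := n, [3] := 2)"
  let ?Q = "\<lambda>u. static u \<and> stream u rest"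
  let ?c = "1 + (\<Sum>c<m. 4 + 6 * length (cl c))"
  have rd: "s [0, 0] = m" "s [0, 1] = n" using str p unfolding stream_def by force+
  have str1: "stream (s([3] := 1)) (n # enc_clauses cl [0..<m] @ tokens T @ rest)"
    by (rule stream_tl[of s m]) (use str p in auto)
  have str2: "stream ?s (enc_clauses cl [0..<m] @ tokens T @ rest)"
    by (rule stream_tl[OF str1]) auto
  have "spec (parse_clauses ;; count_nodes ;; parse_tree) ?s ?Q (?c + ((4 + 2 * m + 2 * n) + (1 + 6 * sz T)))"
  proof (rule spec_Seq[OF parse_clauses_correct[OF str2] _ order_refl])
    fix u assume u: "stream u (tokens T @ rest) \<and> (\<forall>b<2. \<forall>x c. u [40, b, x, c] = of_bool (c < m \<and> (x, b = 1) \<in> set (cl c)))"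
      and ag: "agree (writes parse_clauses) ?s u"
    have u45: "u [4] = m" "u [5] = n"
      using agree_tag[OF ag, of 4] agree_tag[OF ag, of 5] by (simp_all add: parse_clauses_def next_in_def)
    show "spec (count_nodes ;; parse_tree) u ?Q ((4 + 2 * m + 2 * n) + (1 + 6 * sz T))"
    proof (rule spec_Seq[OF count_nodes_correct _ order_refl])
      fix u1 assume N: "u1 [sN] = sz T" and ag1: "agree (writes count_nodes) u u1"
      have u1t: "u1 (t # q) = u (t # q)" if "t \<in> {0, 3, 4, 5, 40}" for t q
        by (rule agree_tag[OF ag1]) (use that in \<open>auto simp: count_nodes_def\<close>)
      have "stream u1 (tokens T @ rest)" using u stream_cong[of u1 u] u1t by simp
      then show "spec parse_tree u1 ?Q (1 + 6 * sz T)"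
      proof (rule spec_mono[OF parse_tree_correct])
        fix u2 assume u2: "stream u2 rest \<and> (\<forall>v<sz T. tagged u2 v (pre T ! v))" and ag2: "agree (writes parse_tree) u1 u2"
        have u2t: "u2 (t # q) = u1 (t # q)" if "t \<in> {4, 5, 6, 40}" for t q
          by (rule agree_tag[OF ag2]) (use that in \<open>auto simp: parse_tree_def next_in_def\<close>)
        have "u2 [40, b, x, c] = of_bool (c \<in> occs b x)" if "b < 2" "c < m" for b x c
          using u2t u1t u that occ by (simp add: occs_def)
        then have "static u2" unfolding static_def using u2 u2t u1t u45 N by simp
        then show "?Q u2" using u2 by simp
      qed (use N in auto)
    qed (use u45 in auto)
  qed (use z in auto)
  then have "spec parse s ?Q (Suc (Suc (Suc (?c + ((4 + 2 * m + 2 * n) + (1 + 6 * sz T))))))"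
    unfolding parse_def by (intro spec_AsgSeq) (use rd in simp)
  then show ?thesis by (rule spec_mono) auto
qed

end

section \<open>Reading weights, writing results, whole programs\<close>

text \<open>The common width is the longest weight plus \<open>m\<close>, enough for the sum of all
  \<open>m\<close> weights by \<open>sum_less_power\<close>.\<close>

definition parse_weights :: prog where
  "parse_weights = Asg 15 [] (N 0) ;;
     For 31 (V sm) (
       Asg 16 [] (At 0 [V 3]) ;; next_in ;;
       For 32 (V 16) (Asg aW [V 31, V 32] (At 0 [V 3]) ;; next_in) ;;
       Ife (V 15) (V 16) (Asg 15 [] (V 16)) skip) ;;
     For 31 (V sm) (Asg 15 [] (Inc (V 15)))"

definition unit_weights :: prog where
  "unit_weights = For 31 (V sm) (Asg aW [V 31, N 0] (N 1)) ;; Asg 15 [] (N 1) ;;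
     For 31 (V sm) (Asg 15 [] (Inc (V 15)))"

text \<open>The output length becomes the position behind the last nonzero bit, because
  \<open>binary\<close> has no leading zeros and represents 0 by the empty list.\<close>

definition out_count :: prog where
  "out_count = Asg 2 [] (N 0) ;;
     For 32 (Inc (Sub (At aEnd [N 0]) (N 0))) (
       Asg 1 [V 32] (At aNum [N 0, N 0, N 0, V 32]) ;;
       Ife (N 0) (At aNum [N 0, N 0, N 0, V 32]) (Asg 2 [] (Inc (V 32))) skip)"

definition out_max :: prog where
  "out_max = Asg 2 [] (V sn) ;; For 32 (V sn) (Asg 1 [V 32] (At aSg [N 0, N 0, N 0, V 32]))"

definition main_count :: prog where
  "main_count = parse ;; treeA ;; treeB ;; treeD count_clause count_var count_combine ;; out_count"

definition main_max :: "prog \<Rightarrow> prog" where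
  "main_max p = parse ;; p ;; treeA ;; treeB ;; treeD max_clause max_var max_combine ;; out_max"

definition enc_bits :: "(nat \<Rightarrow> nat list) \<Rightarrow> nat list \<Rightarrow> nat list" where
  "enc_bits bw cs = concat (map (\<lambda>c. length (bw c) # bw c) cs)"

lemma num_head: "num f (Suc K) = f 0 + 2 * num (\<lambda>t. f (Suc t)) K"
  using num_add[of f 1 K] by simp

lemma binary_num:
  assumes "\<And>t. f t \<le> 1" "K = 0 \<or> f (K - 1) = 1"
  shows "map f [0..<K] = binary (num f K)"
  using assms
proof (induction K arbitrary: f)
  case 0 then show ?case by (simp add: binary.simps)
next
  case (Suc K)
  let ?g = "\<lambda>t. f (Suc t)"
  have IH: "map ?g [0..<K] = binary (num ?g K)"
    by (rule Suc.IH) (use Suc.prems in \<open>cases K; auto\<close>)+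
  have "0 < num f (Suc K)" using Suc.prems(2) by simp
  then have "binary (num f (Suc K)) = num f (Suc K) mod 2 # binary (num f (Suc K) div 2)"
    by (subst binary.simps) simp
  moreover have "num f (Suc K) mod 2 = f 0" "num f (Suc K) div 2 = num ?g K"
    using Suc.prems(1)[of 0] unfolding num_head by auto
  moreover have "map f [0..<Suc K] = f 0 # map ?g [0..<K]"
    by (simp add: upt_conv_Cons map_Suc_upt[symmetric] del: upt_Suc map_Suc_upt)
  ultimately show ?case using IH by simp
qed

lemma fst_wr_treeA: "fst ` writes treeA = {7, 27, 43, 44, 45, 24, 25, 49, 10, 23, 11, 22, 46, 52, 8, 9}"
  unfolding treeA_def by (simp add: wr_nodeA insert_commute)

lemma fst_wr_weights: "fst ` writes parse_weights = {15, 31, 16, 3, 32, 53, 11}" "fst ` writes unit_weights = {31, 53, 15}"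
  unfolding parse_weights_def unit_weights_def next_in_def by (simp_all add: insert_commute)

context instance_data
begin

lemma weight_bits_loop:
  assumes "stream s (xs @ rest)" "s [16] = length xs" "s [31] = c" "\<And>t. s [53, c, t] = 0"
  shows "spec (For 32 (V 16) (Asg aW [V 31, V 32] (At 0 [V 3]) ;; next_in)) s
    (\<lambda>u. stream u rest \<and> (\<forall>t. u [53, c, t] = (if t < length xs then xs ! t else 0)) \<and>
      (\<forall>c' t. c' \<noteq> c \<longrightarrow> u [53, c', t] = s [53, c', t])) (1 + 3 * length xs)"
proof (rule spec_For_const[where n="length xs" and c=2 and I="\<lambda>j u. stream u (drop j xs @ rest) \<and>
    (\<forall>t. u [53, c, t] = (if t < j then xs ! t else 0)) \<and> (\<forall>c' t. c' \<noteq> c \<longrightarrow> u [53, c', t] = s [53, c', t])"])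
  let ?body = "Asg aW [V 31, V 32] (At 0 [V 3]) ;; next_in"
  fix j u assume j: "j < length xs" and I: "stream u (drop j xs @ rest) \<and>
    (\<forall>t. u [53, c, t] = (if t < j then xs ! t else 0)) \<and> (\<forall>c' t. c' \<noteq> c \<longrightarrow> u [53, c', t] = s [53, c', t])"
    and ag: "agree (writes (For 32 (V 16) ?body)) s u"
  have u31: "u [31] = c" using agree_tag[OF ag, of 31] assms by (simp add: next_in_def)
  have s0: "stream u (xs ! j # drop (Suc j) xs @ rest)" using I Cons_nth_drop_Suc[OF j] by (metis append_Cons)
  let ?v = "u([32] := j, [53, c, j] := xs ! j, [3] := Suc (u [3]))"
  have e: "run_prog ?body (u([32] := j)) = ?v" using stream_hd[OF s0] u31 by (simp add: next_in_def)
  have "stream ?v (drop (Suc j) xs @ rest)" by (rule stream_tl[OF s0]) auto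
  then show "spec ?body (u([32] := j)) (\<lambda>u. stream u (drop (Suc j) xs @ rest) \<and>
    (\<forall>t. u [53, c, t] = (if t < Suc j then xs ! t else 0)) \<and> (\<forall>c' t. c' \<noteq> c \<longrightarrow> u [53, c', t] = s [53, c', t])) 2"
    unfolding spec_def e using I by (auto simp: next_in_def less_Suc_eq)
qed (use assms in auto)

lemma inc_loop:
  assumes "s [sm] = m"
  shows "spec (For 31 (V sm) (Asg 15 [] (Inc (V 15)))) s (\<lambda>u. u [15] = s [15] + m) (1 + 2 * m)"
  by (rule spec_For_const[where n=m and c=1 and I="\<lambda>j u. u [15] = s [15] + j"]) (use assms in \<open>auto simp: spec_def\<close>)

text \<open>The crude estimate \<open>m < 2 ^ m\<close> avoids a logarithm. The price of
  \<open>m\<close> extra bits is of the same order as the width allowed for the weights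
  themselves.\<close>

lemma sum_less_power:
  fixes w :: "nat \<Rightarrow> nat"
  assumes "\<And>c. c < m \<Longrightarrow> w c < 2 ^ l"
  shows "(\<Sum>c<m. w c) < 2 ^ (l + m)"
proof -
  have "(\<Sum>c<m. w c) \<le> (\<Sum>c<m. 2 ^ l)" using assms by (intro sum_mono) (simp add: less_imp_le)
  also have "\<dots> = m * 2 ^ l" by simp
  also have "\<dots> < 2 ^ m * 2 ^ l" by (intro mult_strict_right_mono) auto
  finally show ?thesis by (simp add: power_add mult.commute)
qed

lemma parse_weights_correct:
  assumes str: "stream s (enc_bits bw [0..<m])" and st: "static s" and z: "\<And>l. s (53 # l) = 0"
    and bw: "\<And>c. c < m \<Longrightarrow> set (bw c) \<subseteq> {..1}" "\<And>c. c < m \<Longrightarrow> length (bw c) \<le> l"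
      "\<And>c. c < m \<Longrightarrow> num (\<lambda>t. bw c ! t) (length (bw c)) = w c"
  shows "spec parse_weights s (\<lambda>u. \<exists>L\<le>l + m. weights w L u \<and> (\<Sum>c<m. w c) < 2 ^ L)
    (3 + (\<Sum>c<m. 7 + 3 * length (bw c)) + 2 * m)"
proof -
  have sm: "s [sm] = m" using st by (simp add: static_def)
  let ?s = "s([15] := 0)"
  let ?in = "For 32 (V 16) (Asg aW [V 31, V 32] (At 0 [V 3]) ;; next_in)"
  let ?max = "Ife (V 15) (V 16) (Asg 15 [] (V 16)) skip"
  let ?body = "Asg 16 [] (At 0 [V 3]) ;; next_in ;; ?in ;; ?max"
  let ?f = "For 31 (V sm) ?body"
  let ?W = "\<lambda>u c t. u [53, c, t] = (if t < length (bw c) then bw c ! t else 0)"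
  let ?I = "\<lambda>j u. stream u (enc_bits bw [j..<m]) \<and> (\<forall>c<j. \<forall>t. ?W u c t) \<and> (\<forall>c\<ge>j. \<forall>t. u [53, c, t] = 0) \<and>
     (\<forall>c<j. length (bw c) \<le> u [15]) \<and> u [15] \<le> l"
  let ?R = "\<lambda>u. (\<forall>c<m. \<forall>t. ?W u c t) \<and> (\<forall>c<m. length (bw c) \<le> u [15]) \<and> u [15] \<le> l"
  have loop: "spec ?f ?s ?R (1 + (\<Sum>c<m. 7 + 3 * length (bw c)))"
  proof (rule spec_For[where n=m and c="\<lambda>c. 6 + 3 * length (bw c)" and I="?I"])
    have "stream ?s (enc_bits bw [0..<m])" using str stream_cong[of ?s s] by simp
    then show "?I 0 ?s" using z by simp
    show "val ?s (V 4) = m" using sm by simp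
  next
    fix j u assume j: "j < m" and I: "?I j u" and ag: "agree (writes ?f) ?s u"
    have s0: "stream u (length (bw j) # bw j @ enc_bits bw [Suc j..<m])"
      using I j unfolding enc_bits_def by (simp add: upt_conv_Cons)
    let ?u = "u([31] := j, [16] := length (bw j), [3] := Suc (u [3]))"
    have e: "run_prog (Asg 16 [] (At 0 [V 3])) (u([31] := j)) = u([31] := j, [16] := length (bw j))"
      "run_prog next_in (u([31] := j, [16] := length (bw j))) = ?u"
      using stream_hd[OF s0] by (simp_all add: next_in_def)
    have "spec (?in ;; ?max) ?u (?I (Suc j)) ((1 + 3 * length (bw j)) + 2)"
    proof (rule spec_Seq[OF weight_bits_loop _ order_refl])
      show "stream ?u (bw j @ enc_bits bw [Suc j..<m])" by (rule stream_tl[OF s0]) auto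
      show "?u [53, j, t] = 0" for t using I by simp
    next
      fix u1 assume u1: "stream u1 (enc_bits bw [Suc j..<m]) \<and> (\<forall>t. ?W u1 j t) \<and>
        (\<forall>c' t. c' \<noteq> j \<longrightarrow> u1 [53, c', t] = ?u [53, c', t])" and ag1: "agree (writes ?in) ?u u1"
      have u1': "u1 [15] = u [15]" "u1 [16] = length (bw j)"
        using agree_tag[OF ag1, of 15] agree_tag[OF ag1, of 16] by (simp_all add: next_in_def)
      have W1: "?W u1 c t" if "c < Suc j" for c t
      proof (cases "c = j")
        case False
        then have "u1 [53, c, t] = u [53, c, t]" using u1 by simp
        then show ?thesis using I that False by simp
      qed (use u1 in simp)
      have Z1: "u1 [53, c, t] = 0" if "c \<ge> Suc j" for c t
      proof -
        have "u1 [53, c, t] = u [53, c, t]" using u1 that by simp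
        then show ?thesis using I that by simp
      qed
      have fin: "?I (Suc j) u2" if "\<And>t l. t \<in> {0, 3, 53} \<Longrightarrow> u2 (t # l) = u1 (t # l)" "u2 [15] = max (u [15]) (length (bw j))" for u2
      proof -
        have "stream u2 (enc_bits bw [Suc j..<m])" using u1 stream_cong[of u2 u1] that(1) by simp
        moreover have "length (bw c) \<le> u2 [15]" if "c < Suc j" for c
          using I that \<open>u2 [15] = _\<close> by (cases "c = j") (auto simp: le_max_iff_disj)
        moreover have "u2 [15] \<le> l" using I bw(2)[OF j] that(2) by simp
        ultimately show ?thesis using W1 Z1 that(1) by simp
      qed
      show "spec ?max u1 (?I (Suc j)) 2"
      proof (rule spec_Ife[where c=1])
        assume "val u1 (V 15) < val u1 (V 16)"
        then have "?I (Suc j) (u1([15] := u1 [16]))" by (intro fin) (use u1' in auto)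
        then show "spec (Asg 15 [] (V 16)) u1 (?I (Suc j)) 1" unfolding spec_def by simp
      next
        assume "\<not> val u1 (V 15) < val u1 (V 16)"
        then have "?I (Suc j) u1" by (intro fin) (use u1' in auto)
        then show "spec skip u1 (?I (Suc j)) 1" unfolding spec_def eff_skip by simp
      qed simp
    qed auto
    then show "spec ?body (u([31] := j)) (?I (Suc j)) (6 + 3 * length (bw j))"
      unfolding spec_def run_prog.simps(2) cost.simps(2) e by (simp add: next_in_def)
  qed simp_all
  have "spec (?f ;; For 31 (V sm) (Asg 15 [] (Inc (V 15)))) ?s (\<lambda>u. \<exists>L\<le>l + m. weights w L u \<and> (\<Sum>c<m. w c) < 2 ^ L)
    ((1 + (\<Sum>c<m. 7 + 3 * length (bw c))) + (1 + 2 * m))"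
  proof (rule spec_Seq[OF loop _ order_refl])
    fix u assume R: "?R u" and ag: "agree (writes ?f) ?s u"
    have um: "u [sm] = m" using agree_tag[OF ag, of sm] sm by (simp add: next_in_def)
    show "spec (For 31 (V sm) (Asg 15 [] (Inc (V 15)))) u (\<lambda>u. \<exists>L\<le>l + m. weights w L u \<and> (\<Sum>c<m. w c) < 2 ^ L) (1 + 2 * m)"
    proof (rule spec_mono[OF inc_loop[of u, OF um]])
      fix u' assume u': "u' [15] = u [15] + m" and ag': "agree (writes (For 31 (V sm) (Asg 15 [] (Inc (V 15))))) u u'"
      let ?L = "u [15] + m"
      have W: "?W u' c t" if "c < m" for c t using agree_tag[OF ag', of 53] R that by simp
      have bit: "bw c ! t \<le> 1" if "c < m" "t < length (bw c)" for c t using bw(1)[OF that(1)] nth_mem[OF that(2)] by auto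
      have wc: "w c < 2 ^ (u [15])" if "c < m" for c
      proof -
        have "w c < 2 ^ length (bw c)" unfolding bw(3)[OF that, symmetric] by (rule num_less) (use bit that in auto)
        also have "\<dots> \<le> 2 ^ (u [15])" using R that by (intro power_increasing) auto
        finally show ?thesis .
      qed
      have nm: "num (\<lambda>t. u' [53, c, t]) ?L = w c" if c: "c < m" for c
      proof -
        have "num (\<lambda>t. u' [53, c, t]) ?L = num (\<lambda>t. u' [53, c, t]) (length (bw c))"
          by (rule num_extend) (use W[OF c] R c in \<open>auto simp: trans_le_add1\<close>)
        also have "\<dots> = num (\<lambda>t. bw c ! t) (length (bw c))" by (rule num_cong) (use W[OF c] in simp)
        finally show ?thesis using bw(3)[OF c] by simp
      qed
      have "weights w ?L u'" unfolding weights_def using u' nm W bit by simp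
      moreover have "(\<Sum>c<m. w c) < 2 ^ ?L" by (rule sum_less_power) (rule wc)
      moreover have "?L \<le> l + m" using R by simp
      ultimately show "\<exists>L\<le>l + m. weights w L u' \<and> (\<Sum>c<m. w c) < 2 ^ L" by blast
    qed simp
  qed
  then have "spec parse_weights s (\<lambda>u. \<exists>L\<le>l + m. weights w L u \<and> (\<Sum>c<m. w c) < 2 ^ L)
    (Suc ((1 + (\<Sum>c<m. 7 + 3 * length (bw c))) + (1 + 2 * m)))"
    unfolding parse_weights_def by (intro spec_AsgSeq) simp
  then show ?thesis by (rule spec_mono) auto
qed

lemma unit_weights_correct:
  assumes st: "static s" and z: "\<And>l. s (53 # l) = 0"
  shows "spec unit_weights s (\<lambda>u. \<exists>L\<le>1 + m. weights (\<lambda>_. 1) L u \<and> (\<Sum>c<m. 1) < (2 :: nat) ^ L) (3 + 4 * m)"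
proof -
  have sm: "s [sm] = m" using st by (simp add: static_def)
  let ?f = "For 31 (V sm) (Asg aW [V 31, N 0] (N 1))" and ?g = "For 31 (V sm) (Asg 15 [] (Inc (V 15)))"
  let ?I = "\<lambda>j u. (\<forall>c<j. u [53, c, 0] = 1) \<and> (\<forall>c t. t \<noteq> 0 \<longrightarrow> u [53, c, t] = 0)"
  have "spec unit_weights s (\<lambda>u. \<exists>L\<le>1 + m. weights (\<lambda>_. 1) L u \<and> (\<Sum>c<m. 1) < (2 :: nat) ^ L) ((1 + 2 * m) + Suc (1 + 2 * m))"
    unfolding unit_weights_def
  proof (rule spec_Seq[OF _ _ order_refl])
    show "spec ?f s (?I m) (1 + 2 * m)"
      by (rule spec_For_const[where n=m and c=1 and I="?I"]) (use sm z in \<open>auto simp: spec_def less_Suc_eq\<close>)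
  next
    fix u assume I: "?I m u" and ag: "agree (writes ?f) s u"
    have um: "(u([15] := 1)) [sm] = m" using agree_tag[OF ag, of sm] sm by simp
    have "spec ?g (u([15] := 1)) (\<lambda>u. \<exists>L\<le>1 + m. weights (\<lambda>_. 1) L u \<and> (\<Sum>c<m. 1) < (2 :: nat) ^ L) (1 + 2 * m)"
    proof (rule spec_mono[OF inc_loop[of "u([15] := 1)", OF um]])
      fix u' assume u': "u' [15] = (u([15] := 1)) [15] + m" and ag': "agree (writes ?g) (u([15] := 1)) u'"
      have W: "u' (53 # q) = u (53 # q)" for q using agree_tag[OF ag', of 53] by simp
      have "num (\<lambda>t. u' [53, c, t]) (1 + m) = 1" if "c < m" for c
      proof -
        have "num (\<lambda>t. u' [53, c, t]) (1 + m) = num (\<lambda>t. u' [53, c, t]) 1"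
          by (rule num_extend) (use W I in auto)
        then show ?thesis using W I that by (simp add: num_def)
      qed
      moreover have "u' [53, c, t] \<le> 1" if "c < m" for c t using W I that by (cases "t = 0") auto
      ultimately have "weights (\<lambda>_. 1) (1 + m) u'" unfolding weights_def using u' by simp
      moreover have "(\<Sum>c<m. 1) < (2 :: nat) ^ (1 + m)" 
      proof -
        have "m < 2 ^ m" by (rule less_exp)
        then have "m < 2 ^ Suc m" unfolding power_Suc by linarith
        then show ?thesis by simp
      qed
      ultimately show "\<exists>L\<le>1 + m. weights (\<lambda>_. 1) L u' \<and> (\<Sum>c<m. 1) < (2 :: nat) ^ L" by blast
    qed simp
    then show "spec (Asg 15 [] (N 1) ;; ?g) u (\<lambda>u. \<exists>L\<le>1 + m. weights (\<lambda>_. 1) L u \<and> (\<Sum>c<m. 1) < (2 :: nat) ^ L) (Suc (1 + 2 * m))"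
      by (intro spec_AsgSeq) simp
  qed
  then show ?thesis by (rule spec_mono) auto
qed

lemma out_count_correct:
  assumes e: "s [aEnd, 0] = sz T" and bits: "\<And>t. s [54, 0, 0, 0, t] \<le> 1"
    and nm: "num (\<lambda>t. s [54, 0, 0, 0, t]) (Suc (sz T)) = x"
  shows "spec out_count s (\<lambda>u. outputs u = binary x \<and> u [2] \<le> Suc (sz T)) (2 + 4 * Suc (sz T))"
proof -
  let ?f = "\<lambda>t. s [54, 0, 0, 0, t]"
  let ?body = "Asg 1 [V 32] (At aNum [N 0, N 0, N 0, V 32]) ;;
       Ife (N 0) (At aNum [N 0, N 0, N 0, V 32]) (Asg 2 [] (Inc (V 32))) skip"
  let ?loop = "For 32 (Inc (Sub (At aEnd [N 0]) (N 0))) ?body"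
  let ?I = "\<lambda>j u. (\<forall>t<j. u [1, t] = ?f t) \<and> u [2] \<le> j \<and> (u [2] = 0 \<or> ?f (u [2] - 1) = 1) \<and> (\<forall>t<j. u [2] \<le> t \<longrightarrow> ?f t = 0)"
  have "spec ?loop (s([2] := 0)) (\<lambda>u. outputs u = binary x \<and> u [2] \<le> Suc (sz T)) (1 + 4 * Suc (sz T))"
  proof (rule spec_For_const[where n="Suc (sz T)" and c=3 and I="?I"])
    show "val (s([2] := 0)) (Inc (Sub (At aEnd [N 0]) (N 0))) = Suc (sz T)" using e by simp
  next
    fix j u assume I: "?I j u" and ag: "agree (writes ?loop) (s([2] := 0)) u"
    have u54: "u (54 # q) = s (54 # q)" for q using agree_tag[OF ag, of 54] by simp
    show "spec ?body (u([32] := j)) (?I (Suc j)) 3"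
    proof (cases "?f j = 0")
      case True
      let ?v = "u([32] := j, [1, j] := 0)"
      have "run_prog ?body (u([32] := j)) = ?v([11] := ?v [11])" using u54 True by simp
      then have e: "run_prog ?body (u([32] := j)) = ?v" by (simp only: fun_upd_triv)
      have "?I (Suc j) ?v" using I True by (auto simp: less_Suc_eq)
      then show ?thesis unfolding spec_def e using u54 True by simp
    next
      case False
      then have f1: "?f j = 1" using bits[of j] by simp
      let ?v = "u([32] := j, [1, j] := 1, [2] := Suc j)"
      have e: "run_prog ?body (u([32] := j)) = ?v" using u54 f1 by simp
      have "?I (Suc j) ?v" using I f1 by (auto simp: less_Suc_eq)
      then show ?thesis unfolding spec_def e using u54 f1 by simp
    qed
  next
    fix u assume I: "?I (Suc (sz T)) u"
    have "num ?f (Suc (sz T)) = num ?f (u [2])" by (rule num_extend) (use I in auto)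
    then have "binary x = map ?f [0..<u [2]]" using binary_num[of ?f "u [2]"] bits I nm by simp
    also have "\<dots> = outputs u" unfolding outputs_def by (rule map_cong) (use I in auto)
    finally show "outputs u = binary x \<and> u [2] \<le> Suc (sz T)" using I by simp
  qed simp_all
  then have "spec out_count s (\<lambda>u. outputs u = binary x \<and> u [2] \<le> Suc (sz T)) (Suc (1 + 4 * Suc (sz T)))"
    unfolding out_count_def by (intro spec_AsgSeq) simp
  then show ?thesis by simp
qed

lemma out_max_correct:
  assumes n: "s [sn] = n" and a: "\<And>x. x < n \<Longrightarrow> s [55, 0, 0, 0, x] = of_bool (x \<in> \<tau>)"
  shows "spec out_max s (\<lambda>u. outputs u = map (\<lambda>x. of_bool (x \<in> \<tau>)) [0..<n] \<and> u [2] = n) (2 + 2 * n)"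
proof -
  let ?loop = "For 32 (V sn) (Asg 1 [V 32] (At aSg [N 0, N 0, N 0, V 32]))"
  have "spec ?loop (s([2] := n)) (\<lambda>u. outputs u = map (\<lambda>x. of_bool (x \<in> \<tau>)) [0..<n] \<and> u [2] = n) (1 + 2 * n)"
  proof (rule spec_For_const[where n=n and c=1 and I="\<lambda>j u. (\<forall>x<j. u [1, x] = of_bool (x \<in> \<tau>)) \<and> u [2] = n"])
    fix j u assume j: "j < n" and I: "(\<forall>x<j. u [1, x] = of_bool (x \<in> \<tau>)) \<and> u [2] = n" and ag: "agree (writes ?loop) (s([2] := n)) u"
    have u55: "u (55 # q) = s (55 # q)" for q using agree_tag[OF ag, of 55] by simp
    show "spec (Asg 1 [V 32] (At aSg [N 0, N 0, N 0, V 32])) (u([32] := j)) (\<lambda>u. (\<forall>x<Suc j. u [1, x] = of_bool (x \<in> \<tau>)) \<and> u [2] = n) 1"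
      unfolding spec_def using u55 a[OF j] I by (auto simp: less_Suc_eq)
  next
    fix u assume "(\<forall>x<n. u [1, x] = of_bool (x \<in> \<tau>)) \<and> u [2] = n"
    then show "outputs u = map (\<lambda>x. of_bool (x \<in> \<tau>)) [0..<n] \<and> u [2] = n" unfolding outputs_def by simp
  qed (use n in auto)
  then have "spec out_max s (\<lambda>u. outputs u = map (\<lambda>x. of_bool (x \<in> \<tau>)) [0..<n] \<and> u [2] = n) (Suc (1 + 2 * n))"
    unfolding out_max_def by (intro spec_AsgSeq) (use n in simp)
  then show ?thesis by simp
qed

section \<open>Running the passes one after another\<close>

context
  fixes k :: nat
  assumes k: "\<And>t. t \<in> nodes T \<Longrightarrow> card (psA t) \<le> k" "\<And>t. t \<in> nodes T \<Longrightarrow> card (psB t) \<le> k"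
begin

definition cost_lists :: nat where
  "cost_lists = (2 + sz T * (2 + costA k)) + (2 + sz T * (6 + 2 * gen_cost k k k m))"

lemma lists_correct:
  assumes st: "static s" and z: "\<And>t l. t \<in> {44, 45, 46, 48} \<Longrightarrow> s (t # l) = 0"
  shows "spec (treeA ;; treeB) s (\<lambda>u. static u \<and> (\<exists>LA LB. (\<forall>v<sz T. doneA u LA v) \<and> readyB u LA LB)) cost_lists"
  unfolding cost_lists_def
proof (rule spec_Seq[OF treeA_correct _ order_refl])
  show "freshA s (sz T)" using z by (simp add: freshA_def)
next
  fix u assume "\<exists>LA. \<forall>v<sz T. doneA u LA v" and ag: "agree (writes treeA) s u"
  then obtain LA where A: "\<And>v. v < sz T \<Longrightarrow> doneA u LA v" by blast
  have stu: "static u" using st static_agree[OF ag] by (simp add: fst_wr_treeA)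
  have zB: "u (48 # l) = 0" for l using agree_tag[OF ag, of 48] z by (simp add: fst_wr_treeA)
  show "spec treeB u (\<lambda>u. static u \<and> (\<exists>LA LB. (\<forall>v<sz T. doneA u LA v) \<and> readyB u LA LB)) (2 + sz T * (6 + 2 * gen_cost k k k m))"
  proof (rule spec_mono[OF treeB_correct[OF k stu A]])
    fix u' assume B: "\<exists>LB. readyB u' LA LB" and ag': "agree (writes treeB) u u'"
    have "static u'" using stu static_agree[OF ag'] by (simp add: fst_wr_treeB)
    moreover have "doneA u' LA v" if "v < sz T" for v
      using A[OF that] doneA_agree[OF ag', of LA v] by (simp add: fst_wr_treeB)
    ultimately show "static u' \<and> (\<exists>LA LB. (\<forall>v<sz T. doneA u' LA v) \<and> readyB u' LA LB)" using B by blast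
  qed (use zB in auto)
qed (use st k in auto)

lemma lists_keep:
  assumes "agree (writes (treeA ;; treeB)) s u" "t \<in> {0, 2, 3, 15, 53, 54, 55}"
  shows "u (t # l) = s (t # l)"
  by (rule agree_tag[OF assms(1)]) (use assms(2) in \<open>auto simp: image_Un fst_wr_treeA fst_wr_treeB\<close>)

definition dp_cost :: "nat \<Rightarrow> nat \<Rightarrow> (nat \<Rightarrow> nat) \<Rightarrow> nat" where
  "dp_cost cC cV cX = 2 + (\<Sum>v<sz T. 2 + (12 + k * (1 + cC) + 2 * cV + k * (2 + k * (2 + k * (4 + cX v)))))"

lemma covered_root: "covered T {} \<tau> = satX {..<n} \<tau>"
  by (auto simp: covered_def vrs_T cls_T satX_def)

lemma LB_root: "readyB u LA LB \<Longrightarrow> LB 0 ! 0 = {}"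
proof -
  assume "readyB u LA LB"
  then have "set (LB 0) = {{}}" by (simp add: readyB_def okB_def pre_0 psB_T)
  then show ?thesis by (metis empty_not_insert length_greater_0_conv list.set(1) nth_mem singletonD)
qed

lemma count_core:
  assumes st: "static s" and z: "\<And>t l. t \<in> {44, 45, 46, 48, 54, 55} \<Longrightarrow> s (t # l) = 0"
  shows "spec (treeA ;; treeB ;; treeD count_clause count_var count_combine ;; out_count) s
    (\<lambda>u. outputs u = binary (card {\<tau>. \<tau> \<subseteq> {..<n} \<and> satX {..<n} \<tau> = {..<m}}) \<and> u [2] \<le> Suc (sz T))
    (cost_lists + (dp_cost 1 3 (\<lambda>v. 123 * merge_cost (pre T ! v)) + (2 + 4 * Suc (sz T))))"
proof -
  let ?x = "card {\<tau>. \<tau> \<subseteq> {..<n} \<and> satX {..<n} \<tau> = {..<m}}"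
  let ?Q = "\<lambda>u. outputs u = binary ?x \<and> u [2] \<le> Suc (sz T)"
  let ?cD = "dp_cost 1 3 (\<lambda>v. 123 * merge_cost (pre T ! v))"
  \<comment> \<open>The two list passes are bracketed to form one block; effect and cost of a
    sequence do not depend on the bracketing.\<close>
  have "spec ((treeA ;; treeB) ;; treeD count_clause count_var count_combine ;; out_count) s ?Q (cost_lists + (?cD + (2 + 4 * Suc (sz T))))"
  proof (rule spec_Seq[OF lists_correct[OF st] _ order_refl])
    fix u assume u: "static u \<and> (\<exists>LA LB. (\<forall>v<sz T. doneA u LA v) \<and> readyB u LA LB)" and ag: "agree (writes (treeA ;; treeB)) s u"
    then obtain LA LB where L: "\<forall>v<sz T. doneA u LA v" "readyB u LA LB" by blast
    interpret d: dp m n occ T LA LB k "\<lambda>_. True" "count_repr LB" count_clause count_var count_combine 1 3 "\<lambda>v. 123 * merge_cost (pre T ! v)"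
      by (rule count_dp[OF k])
    have g: "d.glob u" using u L by (simp add: d.glob_def)
    have zu: "d.zero u v" for v using lists_keep[OF ag] z by (simp add: d.zero_def)
    have cD: "2 + (\<Sum>v<sz T. 2 + d.costD v) = ?cD" by (simp only: dp_cost_def d.costD_def)
    show "spec (treeD count_clause count_var count_combine ;; out_count) u ?Q (?cD + (2 + 4 * Suc (sz T)))"
    proof (rule spec_Seq[OF d.treeD_correct[OF g zu, unfolded cD] _ order_refl])
      fix u' assume R: "count_repr LB u' 0 0 0 (Pow {..<n})" and ag': "agree (writes (treeD count_clause count_var count_combine)) u u'"
      have "43 \<notin> fst ` writes (treeD count_clause count_var count_combine)" using d.wr_nodeD by (auto simp: treeD_def dpT_def)
      then have "u' [43, 0] = sz T" using agree_tag[OF ag'] L(1) by (simp add: doneA_def pre_0)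
      moreover have "card {\<tau> \<in> Pow {..<n}. covered T (LB 0 ! 0) \<tau> = cls T} = ?x"
        unfolding LB_root[OF L(2)] covered_root cls_T Pow_iff ..
      ultimately show "spec out_count u' ?Q (2 + 4 * Suc (sz T))"
        using R unfolding count_repr_def pre_0 by (intro out_count_correct) auto
    qed
  qed (use z in auto)
  then show ?thesis unfolding spec_def by (simp add: add.assoc)
qed

lemma max_core:
  assumes st: "static s" and z: "\<And>t l. t \<in> {44, 45, 46, 48, 54, 55} \<Longrightarrow> s (t # l) = 0"
    and W: "weights w L s" "(\<Sum>c<m. w c) < 2 ^ L"
  shows "spec (treeA ;; treeB ;; treeD max_clause max_var max_combine ;; out_max) s
    (\<lambda>u. \<exists>\<tau>\<subseteq>{..<n}. outputs u = map (\<lambda>x. of_bool (x \<in> \<tau>)) [0..<n] \<and> u [2] = n \<and>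
       (\<forall>\<sigma>\<subseteq>{..<n}. sum w (satX {..<n} \<sigma>) \<le> sum w (satX {..<n} \<tau>)))
    (cost_lists + (dp_cost (2 + 2 * L) 1 (\<lambda>v. 10 + 19 * L + 2 * n) + (2 + 2 * n)))"
proof -
  let ?Q = "\<lambda>u. \<exists>\<tau>\<subseteq>{..<n}. outputs u = map (\<lambda>x. of_bool (x \<in> \<tau>)) [0..<n] \<and> u [2] = n \<and>
       (\<forall>\<sigma>\<subseteq>{..<n}. sum w (satX {..<n} \<sigma>) \<le> sum w (satX {..<n} \<tau>))"
  let ?cD = "dp_cost (2 + 2 * L) 1 (\<lambda>v. 10 + 19 * L + 2 * n)"
  have "spec ((treeA ;; treeB) ;; treeD max_clause max_var max_combine ;; out_max) s ?Q (cost_lists + (?cD + (2 + 2 * n)))"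
  proof (rule spec_Seq[OF lists_correct[OF st] _ order_refl])
    fix u assume u: "static u \<and> (\<exists>LA LB. (\<forall>v<sz T. doneA u LA v) \<and> readyB u LA LB)" and ag: "agree (writes (treeA ;; treeB)) s u"
    then obtain LA LB where L: "\<forall>v<sz T. doneA u LA v" "readyB u LA LB" by blast
    interpret d: dp m n occ T LA LB k "weights w L" "max_repr w L LB" max_clause max_var max_combine "2 + 2 * L" 1 "\<lambda>v. 10 + 19 * L + 2 * n"
      by (rule max_dp[OF k W(2)])
    have Wu: "weights w L u" using W(1) lists_keep[OF ag] by (simp add: weights_def)
    have g: "d.glob u" using u L Wu by (simp add: d.glob_def)
    have zu: "d.zero u v" for v using lists_keep[OF ag] z by (simp add: d.zero_def)
    have cD: "2 + (\<Sum>v<sz T. 2 + d.costD v) = ?cD" by (simp only: dp_cost_def d.costD_def)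
    show "spec (treeD max_clause max_var max_combine ;; out_max) u ?Q (?cD + (2 + 2 * n))"
    proof (rule spec_Seq[OF d.treeD_correct[OF g zu, unfolded cD] _ order_refl])
      fix u' assume R: "max_repr w L LB u' 0 0 0 (Pow {..<n})" and ag': "agree (writes (treeD max_clause max_var max_combine)) u u'"
      have "5 \<notin> fst ` writes (treeD max_clause max_var max_combine)" using d.wr_nodeD by (auto simp: treeD_def dpT_def)
      then have n: "u' [5] = n" using agree_tag[OF ag'] u by (simp add: static_def)
      have wt: "wt w LB 0 0 \<tau> = sum w (satX {..<n} \<tau>)" for \<tau>
        unfolding wt_def pre_0 LB_root[OF L(2)] covered_root ..
      have "Pow {..<n} \<noteq> {}" by auto
      with R obtain \<tau> where t: "\<tau> \<in> Pow {..<n}" "\<forall>\<sigma>\<in>Pow {..<n}. wt w LB 0 0 \<sigma> \<le> wt w LB 0 0 \<tau>"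
        "\<forall>x<n. u' [55, 0, 0, 0, x] = of_bool (x \<in> \<tau>)"
        unfolding max_repr_def by (auto split: if_splits)
      show "spec out_max u' ?Q (2 + 2 * n)"
      proof (rule spec_mono[OF out_max_correct[of u', OF n]])
        fix x assume "x < n" then show "u' [55, 0, 0, 0, x] = of_bool (x \<in> \<tau>)" using t(3) by blast
      next
        fix u2 assume "outputs u2 = map (\<lambda>x. of_bool (x \<in> \<tau>)) [0..<n] \<and> u2 [2] = n"
        then show "?Q u2" using t(1,2) unfolding wt by (intro exI[of _ \<tau>]) simp
      qed simp
    qed
  qed (use z in auto)
  then show ?thesis unfolding spec_def by (simp add: add.assoc)
qed

end

end

section \<open>Estimates in terms of \<open>k ^ 3 * s * (m + n)\<close>\<close>

text \<open>With \<open>k\<close> and \<open>m\<close> written as successors, both sides are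
  polynomials that can be compared coefficient by coefficient. The constants 30 and 59 are the costs
  at \<open>k = m = 1\<close>.\<close>

lemma gen_cost_bound:
  assumes "1 \<le> k" "1 \<le> m"
  shows "gen_cost k k k m \<le> 30 * (k ^ 3 * m)" "gen_cost 2 1 k m \<le> 59 * (k ^ 3 * m)"
proof -
  obtain a b where [simp]: "k = Suc a" "m = Suc b" using assms by (metis Suc_le_D One_nat_def)
  show "gen_cost k k k m \<le> 30 * (k ^ 3 * m)" "gen_cost 2 1 k m \<le> 59 * (k ^ 3 * m)"
    unfolding gen_cost_def ins_cost_def by (simp_all add: algebra_simps power3_eq_cube)
qed

text \<open>The target bound \<open>U\<close> serves as the unit of all later estimates; each
  conclusion treats one monomial that occurs in them.\<close>

lemma unit_bounds:
  fixes k S M m :: nat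
  assumes "1 \<le> k" "1 \<le> m" "m \<le> M" "M \<le> S"
  defines "U \<equiv> k ^ 3 * S * M"
  shows "1 \<le> U" "S \<le> U" "M \<le> U" "k ^ 3 * m * M \<le> U" "k ^ 3 * M * M \<le> U" "k ^ 3 * M \<le> U" "m * m \<le> U"
proof -
  have k: "1 \<le> k ^ 3" using assms by simp
  have SM: "1 \<le> S" "1 \<le> M" using assms by auto
  have "1 * S * 1 \<le> U" unfolding U_def by (intro mult_le_mono k SM order_refl)
  then show S: "S \<le> U" by simp
  show "1 \<le> U" "M \<le> U" using S assms(4) SM by linarith+
  show "k ^ 3 * m * M \<le> U" unfolding U_def by (intro mult_le_mono order_refl order_trans[OF assms(3,4)])
  show "k ^ 3 * M * M \<le> U" unfolding U_def by (intro mult_le_mono order_refl assms(4))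
  have "k ^ 3 * 1 * M \<le> U" unfolding U_def by (intro mult_le_mono order_refl SM)
  then show "k ^ 3 * M \<le> U" by simp
  have "1 * m * m \<le> U" unfolding U_def by (intro mult_le_mono k order_trans[OF assms(3,4)] assms(3))
  then show "m * m \<le> U" by simp
qed

lemma stream_input: "stream (input_store inp) inp" "input_store inp [3] = 0" "t \<noteq> 0 \<Longrightarrow> input_store inp (t # l) = 0"
  by (auto simp: stream_def input_store_def)

context instance_data
begin

context
  fixes k S :: nat and cl :: "nat \<Rightarrow> (nat \<times> bool) list"
  assumes k: "\<And>t. t \<in> nodes T \<Longrightarrow> card (psA t) \<le> k" "\<And>t. t \<in> nodes T \<Longrightarrow> card (psB t) \<le> k"
    and occ: "\<And>b x c. c < m \<Longrightarrow> occ b x c \<longleftrightarrow> (x, b) \<in> set (cl c)"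
    and pos: "1 \<le> k" "1 \<le> m" and S: "m + (\<Sum>c<m. length (cl c)) \<le> S" "m + n \<le> S"
begin

definition U :: nat where "U = k ^ 3 * S * (m + n)"

lemma U_bounds: "1 \<le> U" "S \<le> U" "m + n \<le> U" "k ^ 3 * m * (m + n) \<le> U" "k ^ 3 * (m + n) * (m + n) \<le> U"
  "k ^ 3 * (m + n) \<le> U" "m * m \<le> U"
  using unit_bounds[OF pos(1,2) _ S(2)] unfolding U_def by auto

lemma sz_T_le: "sz T \<le> 2 * (m + n)"
  using sz_T by simp

lemma cost_lists_le: "cost_lists k \<le> 344 * U"
proof -
  let ?K = "k ^ 3 * m"
  have K1: "1 \<le> ?K" using pos by simp
  have g: "gen_cost k k k m \<le> 30 * ?K" "gen_cost 2 1 k m \<le> 59 * ?K" using gen_cost_bound pos by auto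
  have mK: "m \<le> ?K" using pos by simp
  \<comment> \<open>The parts of \<open>costA\<close> give 30 + 59 + 2 + 10, the two calls of the
    top-down pass give 60, and the overhead is 8; the sum 169 is rounded up.\<close>
  have "2 + costA k + (6 + 2 * gen_cost k k k m) \<le> 170 * ?K"
    using costA_def[OF k] g mK K1 by linarith
  then have "sz T * (2 + costA k + (6 + 2 * gen_cost k k k m)) \<le> 2 * (m + n) * (170 * ?K)"
    using sz_T_le by (rule mult_le_mono[rotated])
  also have "\<dots> = 340 * (k ^ 3 * m * (m + n))" by simp
  also have "\<dots> \<le> 340 * U" using U_bounds(4) by simp
  finally have "sz T * (2 + costA k + (6 + 2 * gen_cost k k k m)) \<le> 340 * U" .
  moreover have "cost_lists k = 4 + sz T * (2 + costA k + (6 + 2 * gen_cost k k k m))"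
    using cost_lists_def[OF k] by (simp add: algebra_simps)
  ultimately show ?thesis using U_bounds(1) by linarith
qed

text \<open>Only overhead is charged node by node. The arithmetic is summed over the tree by
  \<open>sum_merge_cost\<close>, since bounding each product on its own by
  \<open>(m + n)\<^sup>2\<close> would lose a factor \<open>m + n\<close>.\<close>

lemma dp_cost_count_le: "dp_cost k 1 3 (\<lambda>v. 123 * merge_cost (pre T ! v)) \<le> 554 * U"
proof -
  let ?K = "k ^ 3"
  obtain a where a: "k = Suc a" using pos by (metis Suc_le_D One_nat_def)
  have summand: "2 + (12 + k * (1 + 1) + 2 * 3 + k * (2 + k * (2 + k * (4 + 123 * x)))) \<le> 30 * ?K + 123 * (?K * x)" for x
    by (simp add: a algebra_simps power3_eq_cube)
  have "(\<Sum>v<sz T. 2 + (12 + k * (1 + 1) + 2 * 3 + k * (2 + k * (2 + k * (4 + 123 * merge_cost (pre T ! v))))))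
     \<le> (\<Sum>v<sz T. 30 * ?K + 123 * (?K * merge_cost (pre T ! v)))" by (intro sum_mono summand)
  also have "\<dots> = sz T * (30 * ?K) + 123 * (?K * (\<Sum>v<sz T. merge_cost (pre T ! v)))"
    by (simp add: sum.distrib sum_distrib_left)
  also have "\<dots> \<le> 2 * (m + n) * (30 * ?K) + 123 * (?K * (2 * (m + n))\<^sup>2)"
  proof (intro add_mono mult_le_mono order_refl)
    show "sz T \<le> 2 * (m + n)" by (rule sz_T_le)
    have "(sz T)\<^sup>2 \<le> (2 * (m + n))\<^sup>2" by (rule power_mono[OF sz_T_le]) simp
    then show "(\<Sum>v<sz T. merge_cost (pre T ! v)) \<le> (2 * (m + n))\<^sup>2" using sum_merge_cost[of T] by linarith
  qed
  also have "\<dots> = 60 * (?K * (m + n)) + 492 * (?K * (m + n) * (m + n))"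
    by (simp only: power2_eq_square mult.assoc mult.left_commute mult.commute)
  also have "\<dots> \<le> 552 * U" using U_bounds(5,6) by linarith
  finally show ?thesis using U_bounds(1) dp_cost_def[OF k, of 1 3 "\<lambda>v. 123 * merge_cost (pre T ! v)"] by linarith
qed

text \<open>Every entry has \<open>L\<close> weight bits and \<open>n\<close> assignment bits
  regardless of the node, and \<open>L\<close> is linear in \<open>m\<close>. So it is enough to
  multiply the number of nodes by the cost \<open>k ^ 3 * O(S)\<close> of one node.\<close>

lemma dp_cost_max_le:
  assumes L: "L \<le> A * m"
  shows "dp_cost k (2 + 2 * L) 1 (\<lambda>v. 10 + 19 * L + 2 * n) \<le> (80 + 42 * A) * U"
proof -
  let ?K = "k ^ 3"
  obtain a where a: "k = Suc a" using pos by (metis Suc_le_D One_nat_def)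
  let ?t = "2 + (12 + k * (1 + (2 + 2 * L)) + 2 * 1 + k * (2 + k * (2 + k * (4 + (10 + 19 * L + 2 * n)))))"
  have "?t \<le> ?K * (37 + 21 * L + 2 * n)"
    by (simp add: a algebra_simps power3_eq_cube)
  also have "\<dots> \<le> ?K * ((39 + 21 * A) * S)"
  proof (intro mult_le_mono order_refl)
    have "A * m \<le> A * S" using S(1) by (intro mult_le_mono) auto
    then have "L \<le> A * S" using L by linarith
    moreover have "1 \<le> S" "n \<le> S" using S pos by auto
    moreover have "(39 + 21 * A) * S = 39 * S + 21 * (A * S)" by (simp add: algebra_simps)
    ultimately show "37 + 21 * L + 2 * n \<le> (39 + 21 * A) * S" by linarith
  qed
  finally have t: "?t \<le> ?K * ((39 + 21 * A) * S)" .
  have "sz T * ?t \<le> 2 * (m + n) * (?K * ((39 + 21 * A) * S))" by (rule mult_le_mono[OF sz_T_le t])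
  also have "\<dots> = (78 + 42 * A) * U" unfolding U_def by (simp add: algebra_simps)
  finally have "sz T * ?t \<le> (78 + 42 * A) * U" .
  moreover have "dp_cost k (2 + 2 * L) 1 (\<lambda>v. 10 + 19 * L + 2 * n) = 2 + (\<Sum>v<sz T. ?t)"
    by (rule dp_cost_def[OF k])
  then have "dp_cost k (2 + 2 * L) 1 (\<lambda>v. 10 + 19 * L + 2 * n) = 2 + sz T * ?t"
    by (simp only: sum_constant card_lessThan of_nat_id)
  moreover have "(80 + 42 * A) * U = (78 + 42 * A) * U + 2 * U" by (simp only: add_mult_distrib)
  ultimately show ?thesis using U_bounds(1) by linarith
qed

lemma parse_cost_le: "9 + (\<Sum>c<m. 4 + 6 * length (cl c)) + 2 * m + 2 * n + 6 * sz T \<le> 29 * U"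
proof -
  have "(\<Sum>c<m. 4 + 6 * length (cl c)) = 4 * m + 6 * (\<Sum>c<m. length (cl c))"
    by (simp add: sum.distrib sum_distrib_left)
  then have "9 + (\<Sum>c<m. 4 + 6 * length (cl c)) + 2 * m + 2 * n + 6 * sz T
      \<le> 9 * 1 + 6 * (m + (\<Sum>c<m. length (cl c))) + 2 * (m + n) + 6 * sz T" by simp
  also have "\<dots> \<le> 9 * U + 6 * S + 2 * U + 6 * (2 * (m + n))"
    using S(1) sz_T_le U_bounds(1,3) by (intro add_mono mult_le_mono) simp_all
  also have "\<dots> \<le> 29 * U" using U_bounds(2,3) by simp
  finally show ?thesis .
qed

lemma main_count_correct:
  assumes "inp = [m, n] @ enc_clauses cl [0..<m] @ tokens T"
  shows "spec main_count (input_store inp)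
    (\<lambda>u. outputs u = binary (card {\<tau>. \<tau> \<subseteq> {..<n} \<and> satX {..<n} \<tau> = {..<m}}) \<and> u [2] \<le> 1000 * U) (1000 * U)"
proof -
  let ?c = "9 + (\<Sum>c<m. 4 + 6 * length (cl c)) + 2 * m + 2 * n + 6 * sz T"
  let ?d = "cost_lists k + (dp_cost k 1 3 (\<lambda>v. 123 * merge_cost (pre T ! v)) + (2 + 4 * Suc (sz T)))"
  let ?Q = "\<lambda>u. outputs u = binary (card {\<tau>. \<tau> \<subseteq> {..<n} \<and> satX {..<n} \<tau> = {..<m}}) \<and> u [2] \<le> Suc (sz T)"
  have "spec main_count (input_store inp) ?Q (?c + ?d)"
    unfolding main_count_def
  proof (rule spec_Seq[OF parse_correct _ order_refl])
    show "stream (input_store inp) ([m, n] @ enc_clauses cl [0..<m] @ tokens T @ [])"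
      using stream_input(1)[of inp] assms by simp
  next
    fix u assume u: "static u \<and> stream u []" and ag: "agree (writes parse) (input_store inp) u"
    show "spec (treeA ;; treeB ;; treeD count_clause count_var count_combine ;; out_count) u ?Q ?d"
    proof (rule count_core[OF k])
      fix t l assume t: "t \<in> {44, 45, 46, 48, 54, 55 :: nat}"
      have "u (t # l) = input_store inp (t # l)" by (rule agree_tag[OF ag]) (use t in \<open>auto simp: fst_wr_parse\<close>)
      then show "u (t # l) = 0" using stream_input(3) t by auto
    qed (use u in auto)
  qed (use occ in \<open>auto simp: stream_input\<close>)
  then show ?thesis
  proof (rule spec_mono)
    have sz: "sz T \<le> 2 * U" by (rule order_trans[OF sz_T_le]) (use U_bounds(3) in simp)
    then have "4 * Suc (sz T) \<le> 12 * U" using U_bounds(1) by simp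
    \<comment> \<open>The coefficients sum to 941 and are rounded up to 1000.\<close>
    then have "?c + ?d \<le> 29 * U + (344 * U + (554 * U + (2 * U + 12 * U)))"
      using parse_cost_le cost_lists_le dp_cost_count_le U_bounds(1) by (intro add_mono) simp_all
    then show "?c + ?d \<le> 1000 * U" by simp
    fix u assume "?Q u"
    then show "outputs u = binary (card {\<tau>. \<tau> \<subseteq> {..<n} \<and> satX {..<n} \<tau> = {..<m}}) \<and> u [2] \<le> 1000 * U"
      using sz U_bounds(1) by simp
  qed
qed

lemma main_max_correct:
  assumes inp: "inp = [m, n] @ enc_clauses cl [0..<m] @ tokens T @ rest"
    and p: "\<And>s. stream s rest \<Longrightarrow> static s \<Longrightarrow> (\<And>l. s (53 # l) = 0) \<Longrightarrow>
       spec p s (\<lambda>u. \<exists>L\<le>A * m. weights w L u \<and> (\<Sum>c<m. w c) < 2 ^ L) (B * U)"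
    and wrp: "fst ` writes p \<inter> {4, 5, 6, 40, 41, 42, 44, 45, 46, 48, 54, 55} = {}"
  shows "spec (main_max p) (input_store inp)
    (\<lambda>u. \<exists>\<tau>\<subseteq>{..<n}. outputs u = map (\<lambda>x. of_bool (x \<in> \<tau>)) [0..<n] \<and> u [2] \<le> U \<and>
       (\<forall>\<sigma>\<subseteq>{..<n}. sum w (satX {..<n} \<sigma>) \<le> sum w (satX {..<n} \<tau>))) ((500 + 42 * A + B) * U)"
proof -
  let ?c = "9 + (\<Sum>c<m. 4 + 6 * length (cl c)) + 2 * m + 2 * n + 6 * sz T"
  let ?d = "344 * U + ((80 + 42 * A) * U + (2 + 2 * n))"
  let ?Q = "\<lambda>u. \<exists>\<tau>\<subseteq>{..<n}. outputs u = map (\<lambda>x. of_bool (x \<in> \<tau>)) [0..<n] \<and> u [2] = n \<and>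
       (\<forall>\<sigma>\<subseteq>{..<n}. sum w (satX {..<n} \<sigma>) \<le> sum w (satX {..<n} \<tau>))"
  have "spec (main_max p) (input_store inp) ?Q (?c + (B * U + ?d))"
    unfolding main_max_def
  proof (rule spec_Seq[OF parse_correct _ order_refl])
    show "stream (input_store inp) ([m, n] @ enc_clauses cl [0..<m] @ tokens T @ rest)"
      using stream_input(1)[of inp] inp by simp
  next
    fix u assume u: "static u \<and> stream u rest" and ag: "agree (writes parse) (input_store inp) u"
    have zu: "u (t # l) = 0" if "t \<in> {44, 45, 46, 48, 53, 54, 55}" for t l
    proof -
      have "u (t # l) = input_store inp (t # l)" by (rule agree_tag[OF ag]) (use that in \<open>auto simp: fst_wr_parse\<close>)
      then show ?thesis using stream_input(3) that by auto
    qed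
    show "spec (p ;; treeA ;; treeB ;; treeD max_clause max_var max_combine ;; out_max) u ?Q (B * U + ?d)"
    proof (rule spec_Seq[OF p _ order_refl])
      fix u1 assume "\<exists>L\<le>A * m. weights w L u1 \<and> (\<Sum>c<m. w c) < 2 ^ L" and ag1: "agree (writes p) u u1"
      then obtain L where L: "L \<le> A * m" "weights w L u1" "(\<Sum>c<m. w c) < 2 ^ L" by blast
      have st: "static u1" using u static_agree[OF ag1] wrp by blast
      have "spec (treeA ;; treeB ;; treeD max_clause max_var max_combine ;; out_max) u1 ?Q
        (cost_lists k + (dp_cost k (2 + 2 * L) 1 (\<lambda>v. 10 + 19 * L + 2 * n) + (2 + 2 * n)))"
      proof (rule max_core[OF k st _ L(2,3)])
        fix t l assume t: "t \<in> {44, 45, 46, 48, 54, 55 :: nat}"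
        have "t \<notin> fst ` writes p" using t wrp by blast
        then have "u1 (t # l) = u (t # l)" by (rule agree_tag[OF ag1])
        then show "u1 (t # l) = 0" using zu t by auto
      qed
      then show "spec (treeA ;; treeB ;; treeD max_clause max_var max_combine ;; out_max) u1 ?Q ?d"
      proof (rule spec_mono)
        show "cost_lists k + (dp_cost k (2 + 2 * L) 1 (\<lambda>v. 10 + 19 * L + 2 * n) + (2 + 2 * n)) \<le> ?d"
          using cost_lists_le dp_cost_max_le[OF L(1)] by (intro add_mono order_refl)
      qed
    qed (use u zu in auto)
  qed (use occ in \<open>auto simp: stream_input\<close>)
  then show ?thesis
  proof (rule spec_mono)
    have "(500 + 42 * A + B) * U = 29 * U + (B * U + (344 * U + ((80 + 42 * A) * U + 47 * U)))"
      by (simp add: algebra_simps)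
    then show "?c + (B * U + ?d) \<le> (500 + 42 * A + B) * U"
      using parse_cost_le U_bounds(1,3) by linarith
    fix u assume "?Q u"
    then show "\<exists>\<tau>\<subseteq>{..<n}. outputs u = map (\<lambda>x. of_bool (x \<in> \<tau>)) [0..<n] \<and> u [2] \<le> U \<and>
       (\<forall>\<sigma>\<subseteq>{..<n}. sum w (satX {..<n} \<sigma>) \<le> sum w (satX {..<n} \<tau>))"
      using U_bounds(3) by (auto intro: order_trans[OF le_add2])
  qed
qed

lemma parse_weights_bound:
  assumes "stream s (enc_bits bw [0..<m])" "static s" "\<And>l. s (53 # l) = 0"
    and "\<And>c. c < m \<Longrightarrow> set (bw c) \<subseteq> {..1}" "\<And>c. c < m \<Longrightarrow> length (bw c) \<le> A * m"
      "\<And>c. c < m \<Longrightarrow> num (\<lambda>t. bw c ! t) (length (bw c)) = w c"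
  shows "spec parse_weights s (\<lambda>u. \<exists>L\<le>(A + 1) * m. weights w L u \<and> (\<Sum>c<m. w c) < 2 ^ L) ((12 + 3 * A) * U)"
proof (rule spec_mono[OF parse_weights_correct[OF assms]])
  have "(\<Sum>c<m. 7 + 3 * length (bw c)) \<le> (\<Sum>c<m. 7 + 3 * (A * m))"
    using assms(5) by (intro sum_mono add_mono mult_le_mono) auto
  also have "\<dots> = 7 * m + 3 * A * (m * m)" by (simp add: algebra_simps)
  also have "\<dots> \<le> 7 * U + 3 * A * U" using U_bounds(3,7) by (intro add_mono mult_le_mono) auto
  finally show "3 + (\<Sum>c<m. 7 + 3 * length (bw c)) + 2 * m \<le> (12 + 3 * A) * U"
    using U_bounds(1,3) by (simp add: algebra_simps)
  have A: "A * m + m = (A + 1) * m" by simp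
  show "\<exists>L\<le>(A + 1) * m. weights w L u \<and> (\<Sum>c<m. w c) < 2 ^ L"
    if "\<exists>L\<le>A * m + m. weights w L u \<and> (\<Sum>c<m. w c) < 2 ^ L" for u
    using that unfolding A .
qed

lemma unit_weights_bound:
  assumes "static s" "\<And>l. s (53 # l) = 0"
  shows "spec unit_weights s (\<lambda>u. \<exists>L\<le>2 * m. weights (\<lambda>_. 1) L u \<and> (\<Sum>c<m. 1) < (2 :: nat) ^ L) (7 * U)"
proof (rule spec_mono[OF unit_weights_correct[OF assms]])
  show "3 + 4 * m \<le> 7 * U" using U_bounds(1,3) by linarith
  have m2: "1 + m \<le> 2 * m" using pos by simp
  fix u assume "\<exists>L\<le>1 + m. weights (\<lambda>_. 1) L u \<and> (\<Sum>c<m. 1) < (2 :: nat) ^ L"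
  then show "\<exists>L\<le>2 * m. weights (\<lambda>_. 1) L u \<and> (\<Sum>c<m. 1) < (2 :: nat) ^ L" using m2 order_trans by blast
qed

text \<open>The compiled program copies the whole input before anything else, so the input length
  enters the running time as well.\<close>

lemma length_enc: "length ([m, n] @ enc_clauses cl [0..<m] @ tokens T) \<le> 8 * U"
proof -
  have "length (enc_pairs D) = 2 * length D" for D unfolding enc_pairs_def by (induction D) auto
  then have "length (enc_clauses cl [0..<m]) = (\<Sum>c<m. Suc (2 * length (cl c)))"
    unfolding enc_clauses_def by (simp add: length_concat o_def interv_sum_list_conv_sum_set_nat atLeast0LessThan)
  also have "\<dots> = m + 2 * (\<Sum>c<m. length (cl c))" by (simp add: sum_Suc sum_distrib_left)
  finally have 1: "length (enc_clauses cl [0..<m]) \<le> 2 * S" using S by linarith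
  have tok: "length (token t) \<le> 2" for t by (cases t rule: token.cases) auto
  have "length (concat (map token ts)) \<le> 2 * length ts" for ts
  proof (induction ts)
    case (Cons t ts) then show ?case using tok[of t] by simp
  qed simp
  from this[of "pre T"] have "length (tokens T) \<le> 2 * sz T" unfolding tokens_def by simp
  then show ?thesis using 1 sz_T_le U_bounds(1-3) by simp
qed

text \<open>Input entries are values of the machine and have to respect the word bound, which is
  derived from the same budget.\<close>

lemma entries_enc:
  assumes "\<And>c x b. c < m \<Longrightarrow> (x, b) \<in> set (cl c) \<Longrightarrow> x < n" "y \<in> set ([m, n] @ enc_clauses cl [0..<m] @ tokens T)"
  shows "y \<le> 2 * U"
proof -
  consider "y = m" | "y = n" | "y \<in> set (enc_clauses cl [0..<m])" | "y \<in> set (tokens T)" using assms(2) by auto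
  then show ?thesis
  proof cases
    case 3
    then obtain c where c: "c < m" "y = length (cl c) \<or> y \<in> set (enc_pairs (cl c))" unfolding enc_clauses_def by auto
    have "length (cl c) \<le> (\<Sum>c<m. length (cl c))" using c(1) by (intro member_le_sum) auto
    moreover have "y \<le> n + 1" if "y \<in> set (enc_pairs (cl c))"
    proof -
      have "\<exists>p\<in>set (cl c). y \<in> set [fst p, of_bool (snd p)]"
        using that unfolding enc_pairs_def by (auto simp: case_prod_beta)
      then obtain x b where "(x, b) \<in> set (cl c)" "y = x \<or> y = of_bool b" by force
      then show ?thesis using assms(1)[OF c(1)] by fastforce
    qed
    ultimately show ?thesis using c(2) S U_bounds by fastforce
  next
    case 4
    then obtain t where t: "t \<in> nodes T" "y \<in> set (token t)" unfolding tokens_def set_pre[symmetric] by auto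
    have "y \<le> m + n + 1"
    proof (cases t rule: token.cases)
      case (1 c) then show ?thesis using node_facts(1)[OF t(1)] t(2) by auto
    next
      case (2 x) then show ?thesis using node_facts(2)[OF t(1)] t(2) by auto
    qed (use t pos in auto)
    then show ?thesis using U_bounds by linarith
  qed (use U_bounds in linarith)+
qed

end

end

section \<open>From formulas to index sets\<close>

lemma nth_position: "x \<in> set xs \<Longrightarrow> position xs x < length xs \<and> xs ! position xs x = x"
  unfolding position_def by (induction xs) auto

lemma position_nth: "distinct xs \<Longrightarrow> i < length xs \<Longrightarrow> position xs (xs ! i) = i"
  using nth_position[of "xs ! i" xs] by (metis nth_eq_iff_index_eq nth_mem)

lemma leaves_map: "leaves (map_btree f t) = map f (leaves t)"
  by (induction t) auto

lemma nodes_map: "nodes (map_btree f t) = map_btree f ` nodes t"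
  by (induction t) auto

lemma finite_nodes: "finite (nodes t)"
  by (induction t) auto

lemma root_node: "t \<in> nodes t"
  by (cases t) auto

lemma lit_val_eq: "lit_val \<tau> l \<longleftrightarrow> (is_Pos l \<longleftrightarrow> \<tau> (lvar l))"
  by (cases l) auto

lemma cla_subformula: "cla (subformula F \<C> X) = cla F \<inter> \<C>"
  by (auto simp: cla_def subformula_def split: if_splits)

lemma lits_subformula: "C \<in> cla F \<Longrightarrow> C \<in> \<C> \<Longrightarrow> lits (subformula F \<C> X) C = {l \<in> lits F C. lvar l \<in> X}"
  by (auto simp: cla_def lits_def subformula_def clause_restrict_def)

lemma sat_subformula:
  "sat (subformula F \<C> X) \<tau> = {C \<in> cla F. C \<in> \<C> \<and> (\<exists>l\<in>lits F C. lvar l \<in> X \<and> lit_val \<tau> l)}"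
proof -
  have "(\<exists>l\<in>lits (subformula F \<C> X) C. lit_val \<tau> l) \<longleftrightarrow> (\<exists>l\<in>lits F C. lvar l \<in> X \<and> lit_val \<tau> l)"
    if "C \<in> cla F" "C \<in> \<C>" for C
    unfolding lits_subformula[OF that] by blast
  then show ?thesis unfolding sat_def cla_subformula by blast
qed

lemma lvar_subformula:
  assumes "C \<in> cla F" "C \<in> \<C>" "l \<in> lits F C" "lvar l \<in> X"
  shows "lvar l \<in> vars (subformula F \<C> X)"
proof -
  have "C \<in> cla (subformula F \<C> X)" "l \<in> lits (subformula F \<C> X) C"
    using assms by (simp_all add: cla_subformula lits_subformula)
  then show ?thesis unfolding vars_def by blast
qed

lemma binary_bits: "set (binary i) \<subseteq> {..1}"
proof (induction i rule: less_induct)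
  case (less i)
  show ?case
  proof (cases "i = 0")
    case False
    then have "i div 2 < i" by simp
    from less[OF this] show ?thesis using False by (subst binary.simps) auto
  qed (simp add: binary.simps)
qed

lemma num_binary: "num (\<lambda>t. binary i ! t) (length (binary i)) = i"
proof (induction i rule: less_induct)
  case (less i)
  show ?case
  proof (cases "i = 0")
    case False
    then have "i div 2 < i" by simp
    from less[OF this] have "num (\<lambda>t. binary (i div 2) ! t) (length (binary (i div 2))) = i div 2" .
    moreover have "binary i = i mod 2 # binary (i div 2)" using False by (subst binary.simps) simp
    ultimately show ?thesis by (simp only: list.size add_0_right add_Suc_right num_head nth_Cons_0 nth_Cons_Suc) presburger
  qed (simp add: binary.simps)
qed

lemma length_binary: "i \<le> 2 ^ e \<Longrightarrow> length (binary i) \<le> Suc e"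
proof (induction e arbitrary: i)
  case 0
  then consider "i = 0" | "i = 1" by force
  then show ?case by cases (simp_all add: binary.simps)
next
  case (Suc e)
  then have "i div 2 \<le> 2 ^ e" by auto
  from Suc.IH[OF this] show ?case by (subst binary.simps) simp
qed

lemma inj_on_map_sum: "inj_on f A \<Longrightarrow> inj_on g B \<Longrightarrow> inj_on (map_sum f g) (Inl ` A \<union> Inr ` B)"
  by (rule inj_onI) (elim UnE imageE; simp add: inj_onD)

section \<open>Transfer between formulas and index sets\<close>

locale listed_instance =
  fixes F :: "('c, 'v) formula" and T :: "'l btree" and \<delta> :: "'l \<Rightarrow> 'c + 'v"
    and cs :: "'c list" and vs :: "'v list" and ls :: "'c \<Rightarrow> 'v literal list"
  assumes cnf: "cnf F" and bd: "branch_decomposition F T \<delta>" and listing: "listing F cs vs ls"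
begin

abbreviation "m \<equiv> length cs"
abbreviation "n \<equiv> length vs"

definition lab :: "'l \<Rightarrow> nat + nat" where
  "lab l = map_sum (position cs) (position vs) (\<delta> l)"

definition cl :: "nat \<Rightarrow> (nat \<times> bool) list" where
  "cl c = map (\<lambda>l. (position vs (lvar l), is_Pos l)) (ls (cs ! c))"

definition asg :: "nat set \<Rightarrow> 'v \<Rightarrow> bool" where
  "asg \<sigma> = (\<lambda>x\<in>vars F. position vs x \<in> \<sigma>)"

lemma cs: "distinct cs" "set cs = cla F" and vs: "distinct vs" "set vs = vars F"
  and ls: "C \<in> cla F \<Longrightarrow> distinct (ls C) \<and> set (ls C) = lits F C"
  using listing unfolding listing_def by auto

lemma card_cla: "card (cla F) = m" and card_vars: "card (vars F) = n"
  using distinct_card[OF cs(1)] distinct_card[OF vs(1)] unfolding cs(2) vs(2) by blast+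

lemma cs_nth: "c < m \<Longrightarrow> cs ! c \<in> cla F"
  using nth_mem[of c cs] unfolding cs(2) .

lemma clause_position: "C \<in> cla F \<Longrightarrow> position cs C < m \<and> cs ! position cs C = C"
  and var_position: "x \<in> vars F \<Longrightarrow> position vs x < n \<and> vs ! position vs x = x"
  by (rule nth_position, simp add: cs(2)) (rule nth_position, simp add: vs(2))

lemma inj_position_vs: "inj_on (position vs) (vars F)" and inj_position_cs: "inj_on (position cs) (cla F)"
  by (rule inj_onI, metis var_position) (rule inj_onI, metis clause_position)

lemma position_image: "distinct xs \<Longrightarrow> position xs ` set xs = {..<length xs}"
proof (intro equalityI subsetI)
  fix i assume "distinct xs" "i \<in> {..<length xs}"
  then have "i = position xs (xs ! i)" "xs ! i \<in> set xs" by (simp_all add: position_nth)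
  then show "i \<in> position xs ` set xs" by (rule image_eqI)
qed (auto simp: nth_position)

lemma position_vars: "position vs ` vars F = {..<n}" and position_cla: "position cs ` cla F = {..<m}"
  using position_image[OF vs(1)] position_image[OF cs(1)] unfolding cs(2) vs(2) .

lemma lits_vars: "C \<in> cla F \<Longrightarrow> l \<in> lits F C \<Longrightarrow> lvar l \<in> vars F"
  unfolding vars_def by blast

lemma set_cl: "c < m \<Longrightarrow> set (cl c) = (\<lambda>l. (position vs (lvar l), is_Pos l)) ` lits F (cs ! c)"
  unfolding cl_def using ls[OF cs_nth] by simp

lemma cl_bound: "c < m \<Longrightarrow> (x, b) \<in> set (cl c) \<Longrightarrow> x < n"
  using set_cl lits_vars[OF cs_nth] var_position by fastforce

lemma delta_leaves: "\<delta> ` set (leaves T) = Inl ` cla F \<union> Inr ` vars F"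
  and inj_leaves: "inj_on \<delta> (set (leaves T))"
  using bd unfolding branch_decomposition_def bij_betw_def by (auto simp: Plus_def)

lemma node_leaves:
  assumes "t \<in> nodes T"
  shows "node_clauses \<delta> t \<subseteq> cla F" "node_vars \<delta> t \<subseteq> vars F"
  using image_mono[OF leaves_nodes[OF assms], of \<delta>]
  unfolding delta_leaves node_clauses_def node_vars_def by blast+

sublocale instance_data m n "\<lambda>b x c. (x, b) \<in> set (cl c)" "map_btree lab T"
proof
  have "inj_on (map_sum (position cs) (position vs)) (\<delta> ` set (leaves T))"
    unfolding delta_leaves by (rule inj_on_map_sum[OF inj_position_cs inj_position_vs])
  from comp_inj_on[OF inj_leaves this] have "inj_on lab (set (leaves T))"
    unfolding lab_def o_def .
  then show "distinct (leaves (map_btree lab T))"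
    using bd by (simp add: leaves_map distinct_map branch_decomposition_def)
  have "lab ` set (leaves T) = map_sum (position cs) (position vs) ` (\<delta> ` set (leaves T))"
    by (simp add: image_image lab_def)
  then show "set (leaves (map_btree lab T)) = Inl ` {..<m} \<union> Inr ` {..<n}"
    unfolding leaves_map set_map delta_leaves position_vars[symmetric] position_cla[symmetric]
    by (simp add: image_Un image_image)
qed

lemma cls_lab: "cls (map_btree lab t) = position cs ` node_clauses \<delta> t"
  and vrs_lab: "vrs (map_btree lab t) = position vs ` node_vars \<delta> t"
proof -
  have "Inl c = lab l \<longleftrightarrow> (\<exists>C. \<delta> l = Inl C \<and> c = position cs C)"
    "Inr x = lab l \<longleftrightarrow> (\<exists>y. \<delta> l = Inr y \<and> x = position vs y)" for c x l
    by (cases "\<delta> l"; simp add: lab_def)+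
  then have "Inl c \<in> lab ` S \<longleftrightarrow> (\<exists>l\<in>S. \<exists>C. \<delta> l = Inl C \<and> c = position cs C)"
    "Inr x \<in> lab ` S \<longleftrightarrow> (\<exists>l\<in>S. \<exists>y. \<delta> l = Inr y \<and> x = position vs y)" for c x S
    unfolding image_iff by simp_all
  moreover have "c \<in> position cs ` {C. Inl C \<in> \<delta> ` S} \<longleftrightarrow> (\<exists>l\<in>S. \<exists>C. \<delta> l = Inl C \<and> c = position cs C)"
    "x \<in> position vs ` {y. Inr y \<in> \<delta> ` S} \<longleftrightarrow> (\<exists>l\<in>S. \<exists>y. \<delta> l = Inr y \<and> x = position vs y)" for c x S
    by (simp_all add: image_iff eq_commute[of "Inl _" "\<delta> _"] eq_commute[of "Inr _" "\<delta> _"]) blast+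
  ultimately show "cls (map_btree lab t) = position cs ` node_clauses \<delta> t"
    "vrs (map_btree lab t) = position vs ` node_vars \<delta> t"
    unfolding cls_def vrs_def node_clauses_def node_vars_def leaves_map set_map set_eq_iff mem_Collect_eq
    by simp_all
qed

lemma satX_position:
  assumes "X \<subseteq> vars F"
  shows "satX (position vs ` X) \<sigma> =
    {c. c < m \<and> (\<exists>l\<in>lits F (cs ! c). lvar l \<in> X \<and> (is_Pos l \<longleftrightarrow> position vs (lvar l) \<in> \<sigma>))}"
proof -
  have "(\<exists>x\<in>position vs ` X. (x, x \<in> \<sigma>) \<in> set (cl c)) \<longleftrightarrow>
     (\<exists>l\<in>lits F (cs ! c). lvar l \<in> X \<and> (is_Pos l \<longleftrightarrow> position vs (lvar l) \<in> \<sigma>))" if c: "c < m" for c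
  proof
    assume "\<exists>x\<in>position vs ` X. (x, x \<in> \<sigma>) \<in> set (cl c)"
    then obtain x l where l: "x \<in> X" "l \<in> lits F (cs ! c)" "position vs x = position vs (lvar l)"
      "is_Pos l \<longleftrightarrow> position vs x \<in> \<sigma>" unfolding set_cl[OF c] by auto
    then have "x = lvar l" using assms lits_vars[OF cs_nth[OF c]] inj_onD[OF inj_position_vs] by blast
    then show "\<exists>l\<in>lits F (cs ! c). lvar l \<in> X \<and> (is_Pos l \<longleftrightarrow> position vs (lvar l) \<in> \<sigma>)" using l by blast
  next
    assume "\<exists>l\<in>lits F (cs ! c). lvar l \<in> X \<and> (is_Pos l \<longleftrightarrow> position vs (lvar l) \<in> \<sigma>)"
    then show "\<exists>x\<in>position vs ` X. (x, x \<in> \<sigma>) \<in> set (cl c)" unfolding set_cl[OF c] by force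
  qed
  then show ?thesis unfolding satX_def by blast
qed

lemma finite_PS: "finite (PS (subformula F \<C> X))"
proof (rule finite_subset)
  show "PS (subformula F \<C> X) \<subseteq> Pow (cla F)" unfolding PS_def sat_subformula by auto
  show "finite (Pow (cla F))" using cnf unfolding cnf_def by simp
qed

text \<open>Restricting \<open>\<sigma>\<close> to the variables that occur in the subformula keeps
  the value of each of its literals. So each set on the left is the index form of a member of
  \<open>PS\<close>, and \<open>PS\<close> maps onto the left-hand family.\<close>

lemma card_PS:
  assumes "X \<subseteq> vars F"
  shows "card ((\<lambda>\<sigma>. {c \<in> satX (position vs ` X) \<sigma>. cs ! c \<in> \<C>}) ` P) \<le> card (PS (subformula F \<C> X))"
proof (rule surj_card_le[OF finite_PS], rule image_subsetI)
  fix \<sigma>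
  let ?\<tau> = "\<lambda>x\<in>vars (subformula F \<C> X). position vs x \<in> \<sigma>"
  have "lit_val ?\<tau> l \<longleftrightarrow> (is_Pos l \<longleftrightarrow> position vs (lvar l) \<in> \<sigma>)"
    if "C \<in> cla F" "C \<in> \<C>" "l \<in> lits F C" "lvar l \<in> X" for C l
    using lvar_subformula[OF that] by (simp add: lit_val_eq)
  then have "{c \<in> satX (position vs ` X) \<sigma>. cs ! c \<in> \<C>} = {c. c < m \<and> cs ! c \<in> sat (subformula F \<C> X) ?\<tau>}"
    unfolding satX_position[OF assms] sat_subformula using cs_nth by blast
  moreover have "sat (subformula F \<C> X) ?\<tau> \<in> PS (subformula F \<C> X)"
    unfolding PS_def assignments_def by auto
  ultimately show "{c \<in> satX (position vs ` X) \<sigma>. cs ! c \<in> \<C>} \<in> (\<lambda>A. {c. c < m \<and> cs ! c \<in> A}) ` PS (subformula F \<C> X)"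
    by blast
qed

text \<open>For the subtree at \<open>v\<close>, \<open>psA\<close> and \<open>psB\<close> are index
  forms of sets in the two families whose sizes make up \<open>ps_value\<close>, and
  \<open>ps_width\<close> is the maximum over all nodes.\<close>

lemma ps_width_bounds:
  assumes "t \<in> nodes (map_btree lab T)"
  shows "card (psA t) \<le> ps_width F T \<delta>" "card (psB t) \<le> ps_width F T \<delta>"
proof -
  obtain v where v: "v \<in> nodes T" "t = map_btree lab v" using assms unfolding nodes_map by blast
  have w: "ps_value F \<delta> v \<le> ps_width F T \<delta>"
    unfolding ps_width_def using v(1) finite_nodes by (intro Max_ge) auto
  have c: "c \<in> cls t \<longleftrightarrow> cs ! c \<in> node_clauses \<delta> v" if "c < m" for c
    unfolding v(2) cls_lab using node_leaves(1)[OF v(1)] clause_position position_nth[OF cs(1) that]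
    by (auto simp: image_iff) metis
  have lt: "c \<in> satX X \<sigma> \<Longrightarrow> c < m" for c X \<sigma> unfolding satX_def by blast
  have "satX (vrs t) \<sigma> - cls t = {c \<in> satX (position vs ` node_vars \<delta> v) \<sigma>. cs ! c \<in> cla F - node_clauses \<delta> v}" for \<sigma>
    using c lt cs_nth unfolding v(2) vrs_lab by blast
  then have A: "psA t = (\<lambda>\<sigma>. {c \<in> satX (position vs ` node_vars \<delta> v) \<sigma>. cs ! c \<in> cla F - node_clauses \<delta> v}) ` Pow (vrs t)"
    unfolding psA_def by (rule image_cong[OF refl])
  have "card (psA t) \<le> card (PS (subformula F (cla F - node_clauses \<delta> v) (node_vars \<delta> v)))"
    unfolding A by (intro card_PS node_leaves(2)[OF v(1)])
  then show "card (psA t) \<le> ps_width F T \<delta>" using w unfolding ps_value_def by linarith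
  have "{..<n} - vrs t = position vs ` (vars F - node_vars \<delta> v)"
    unfolding v(2) vrs_lab position_vars[symmetric]
    by (rule inj_on_image_set_diff[OF inj_position_vs _ node_leaves(2)[OF v(1)], symmetric]) simp
  moreover have "satX X \<sigma> \<inter> cls t = {c \<in> satX X \<sigma>. cs ! c \<in> node_clauses \<delta> v}" for X \<sigma>
    using c lt by blast
  ultimately have B: "psB t = (\<lambda>\<sigma>. {c \<in> satX (position vs ` (vars F - node_vars \<delta> v)) \<sigma>. cs ! c \<in> node_clauses \<delta> v}) ` Pow ({..<n} - vrs t)"
    unfolding psB_def by simp
  have "card (psB t) \<le> card (PS (subformula F (node_clauses \<delta> v) (vars F - node_vars \<delta> v)))"
    unfolding B by (intro card_PS Diff_subset)
  then show "card (psB t) \<le> ps_width F T \<delta>" using w unfolding ps_value_def by linarith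
qed

lemma satX_asg: "satX {..<n} \<sigma> = {c. c < m \<and> cs ! c \<in> sat F (asg \<sigma>)}"
proof -
  have "lit_val (asg \<sigma>) l \<longleftrightarrow> (is_Pos l \<longleftrightarrow> position vs (lvar l) \<in> \<sigma>)" if "C \<in> cla F" "l \<in> lits F C" for C l
    using lits_vars[OF that] by (simp add: lit_val_eq asg_def)
  then show ?thesis
    using satX_position[OF subset_refl, of \<sigma>] cs_nth lits_vars unfolding position_vars sat_def by blast
qed

lemma bij_asg: "bij_betw asg (Pow {..<n}) (assignments (vars F))"
proof (rule bij_betw_byWitness[where f'="\<lambda>\<tau>. position vs ` {x \<in> vars F. \<tau> x}"])
  show "\<forall>\<sigma>\<in>Pow {..<n}. position vs ` {x \<in> vars F. asg \<sigma> x} = \<sigma>"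
  proof
    fix \<sigma> assume "\<sigma> \<in> Pow {..<n}"
    then have s: "\<sigma> \<subseteq> position vs ` vars F" unfolding position_vars by blast
    have "{x \<in> vars F. asg \<sigma> x} = {x \<in> vars F. position vs x \<in> \<sigma>}" by (auto simp: asg_def)
    then show "position vs ` {x \<in> vars F. asg \<sigma> x} = \<sigma>" using s by blast
  qed
  show "\<forall>\<tau>\<in>assignments (vars F). asg (position vs ` {x \<in> vars F. \<tau> x}) = \<tau>"
  proof (intro ballI ext)
    fix \<tau> x assume t: "\<tau> \<in> assignments (vars F)"
    show "asg (position vs ` {x \<in> vars F. \<tau> x}) x = \<tau> x"
    proof (cases "x \<in> vars F")
      case True
      then show ?thesis unfolding asg_def using inj_onD[OF inj_position_vs] by auto
    next
      case False
      then show ?thesis using t by (auto simp: asg_def assignments_def PiE_def extensional_def)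
    qed
  qed
  show "asg ` Pow {..<n} \<subseteq> assignments (vars F)" unfolding asg_def assignments_def by auto
  show "(\<lambda>\<tau>. position vs ` {x \<in> vars F. \<tau> x}) ` assignments (vars F) \<subseteq> Pow {..<n}"
    unfolding position_vars[symmetric] by auto
qed

lemma sat_sub: "sat F \<tau> \<subseteq> cla F"
  unfolding sat_def by blast

lemma bij_nth: "A \<subseteq> cla F \<Longrightarrow> bij_betw ((!) cs) {c. c < m \<and> cs ! c \<in> A} A"
  by (rule bij_betw_byWitness[where f'="position cs"])
    (use clause_position position_nth[OF cs(1)] in auto)

lemma count_eq: "card {\<sigma>. \<sigma> \<subseteq> {..<n} \<and> satX {..<n} \<sigma> = {..<m}} = number_sat F"
proof -
  have "satX {..<n} \<sigma> = {..<m} \<longleftrightarrow> sat F (asg \<sigma>) = cla F" for \<sigma>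
  proof -
    have "satX {..<n} \<sigma> = {..<m} \<longleftrightarrow> (\<forall>c<m. cs ! c \<in> sat F (asg \<sigma>))" unfolding satX_asg by auto
    also have "\<dots> \<longleftrightarrow> set cs \<subseteq> sat F (asg \<sigma>)" by (metis in_set_conv_nth nth_mem subset_code(1))
    also have "\<dots> \<longleftrightarrow> sat F (asg \<sigma>) = cla F" unfolding cs(2) using sat_sub by blast
    finally show ?thesis .
  qed
  then have img: "asg ` {\<sigma>. \<sigma> \<subseteq> {..<n} \<and> satX {..<n} \<sigma> = {..<m}} = {\<tau> \<in> assignments (vars F). sat F \<tau> = cla F}"
    using bij_betw_imp_surj_on[OF bij_asg] by auto
  have inj: "inj_on asg {\<sigma>. \<sigma> \<subseteq> {..<n} \<and> satX {..<n} \<sigma> = {..<m}}"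
    by (rule inj_on_subset[OF bij_betw_imp_inj_on[OF bij_asg]]) auto
  show ?thesis using card_image[OF inj] unfolding number_sat_def img by simp
qed

lemma sum_satX: "sum (\<lambda>c. w (cs ! c)) (satX {..<n} \<sigma>) = (\<Sum>C\<in>sat F (asg \<sigma>). w C)"
  unfolding satX_asg by (rule sum.reindex_bij_betw[OF bij_nth[OF sat_sub]])

lemma weighted_maxsat_asg:
  assumes "\<sigma> \<subseteq> {..<n}"
    and "\<forall>\<rho>\<subseteq>{..<n}. sum (\<lambda>c. w (cs ! c)) (satX {..<n} \<rho>) \<le> sum (\<lambda>c. w (cs ! c)) (satX {..<n} \<sigma>)"
  shows "weighted_maxsat F w (asg \<sigma>)"
proof -
  have "(\<Sum>C\<in>sat F \<tau>. w C) \<le> (\<Sum>C\<in>sat F (asg \<sigma>). w C)" if "\<tau> \<in> assignments (vars F)" for \<tau>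
  proof -
    obtain \<rho> where "\<rho> \<subseteq> {..<n}" "\<tau> = asg \<rho>" using \<open>\<tau> \<in> _\<close> bij_betw_imp_surj_on[OF bij_asg] by blast
    then show ?thesis using assms(2) unfolding sum_satX by blast
  qed
  moreover have "asg \<sigma> \<in> assignments (vars F)" using bij_betwE[OF bij_asg] assms(1) by blast
  ultimately show ?thesis unfolding weighted_maxsat_def is_arg_max_def by (simp add: not_less)
qed

lemma enc_asg: "map (\<lambda>x. of_bool (x \<in> \<sigma>)) [0..<n] = enc_assignment vs (asg \<sigma>)"
proof (rule nth_equalityI)
  fix i assume "i < length (map (\<lambda>x. of_bool (x \<in> \<sigma>) :: nat) [0..<n])"
  then have "i < n" by simp
  then show "map (\<lambda>x. of_bool (x \<in> \<sigma>)) [0..<n] ! i = enc_assignment vs (asg \<sigma>) ! i"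
    using position_nth[OF vs(1)] vs(2) nth_mem by (fastforce simp: enc_assignment_def asg_def)
qed (simp add: enc_assignment_def)

lemma enc_tree_eq: "enc_tree cs vs \<delta> t = tokens (map_btree lab t)"
  unfolding tokens_def by (induction t) (auto simp: lab_def split: sum.splits)

lemma enc_instance_eq: "enc_instance cs vs ls T \<delta> = [m, n] @ enc_clauses cl [0..<m] @ tokens (map_btree lab T)"
proof -
  have lit: "enc_literal vs l = [position vs (lvar l), of_bool (is_Pos l)]" for l by (cases l) auto
  then have lits: "enc_literal vs = (\<lambda>l. [position vs (lvar l), of_bool (is_Pos l)])" by (rule ext)
  have "enc_clause vs (ls (cs ! c)) = length (cl c) # enc_pairs (cl c)" for c
    unfolding enc_clause_def enc_pairs_def cl_def lits by (simp add: o_def)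
  then have "map (\<lambda>C. enc_clause vs (ls C)) cs = map (\<lambda>c. length (cl c) # enc_pairs (cl c)) [0..<m]"
    by (intro nth_equalityI) auto
  then show ?thesis unfolding enc_instance_def enc_clauses_def enc_tree_eq by simp
qed

lemma enc_weights_eq: "enc_weights cs w = enc_bits (\<lambda>c. binary (w (cs ! c))) [0..<m]"
proof -
  have "map (\<lambda>C. length (binary (w C)) # binary (w C)) cs
     = map (\<lambda>c. length (binary (w (cs ! c))) # binary (w (cs ! c))) [0..<m]"
    by (intro nth_equalityI) auto
  then show ?thesis unfolding enc_weights_def enc_bits_def by simp
qed

lemma fsize_eq: "fsize F = m + (\<Sum>c<m. length (cl c))"
proof -
  have "(\<Sum>c<m. length (cl c)) = (\<Sum>c<m. card (lits F (cs ! c)))"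
    unfolding cl_def using ls[OF cs_nth] distinct_card by (intro sum.cong refl) fastforce
  also have "\<dots> = (\<Sum>C\<in>cla F. card (lits F C))"
    using sum.reindex_bij_betw[OF bij_nth[OF subset_refl], of "\<lambda>C. card (lits F C)"] cs_nth
    by (simp add: lessThan_def Collect_conj_eq Int_absorb2 subset_iff)
  finally show ?thesis unfolding fsize_def card_cla by simp
qed

text \<open>Every variable of a formula occurs in one of its clauses, so there are at most as many
  variables as literal occurrences.\<close>

lemma vars_le: "m + n \<le> fsize F"
proof -
  have fin: "finite (cla F)" "C \<in> cla F \<Longrightarrow> finite (lits F C)" for C using cnf unfolding cnf_def by auto
  have "card (vars F) \<le> (\<Sum>C\<in>cla F. card (lvar ` lits F C))"
    unfolding vars_def by (rule card_UN_le[OF fin(1)])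
  also have "\<dots> \<le> (\<Sum>C\<in>cla F. card (lits F C))" by (intro sum_mono card_image_le fin)
  finally show ?thesis unfolding fsize_def card_cla card_vars by simp
qed

text \<open>A tree has at least one leaf, and without clauses there would be neither a clause nor a
  variable to label it.\<close>

lemma clauses_pos: "1 \<le> m"
proof (rule ccontr)
  assume "\<not> 1 \<le> m"
  then have "cla F = {}" using cs(2) by (cases cs) auto
  then have "set (leaves T) = {}" using delta_leaves by (auto simp: vars_def)
  then show False by simp
qed

text \<open>The root already has one outside effect, the empty set.\<close>

lemma width_pos: "1 \<le> ps_width F T \<delta>"
proof -
  have "map_btree lab T \<in> nodes (map_btree lab T)" by (rule root_node)
  from ps_width_bounds(1)[OF this] show ?thesis unfolding psA_T by simp
qed

end

section \<open>Specifications in terms of the formula\<close>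

context listed_instance
begin

abbreviation "budget \<equiv> ps_width F T \<delta> ^ 3 * fsize F * (m + n)"

lemma sizes: "1 \<le> ps_width F T \<delta>" "1 \<le> m" "m + (\<Sum>c<m. length (cl c)) \<le> fsize F" "m + n \<le> fsize F"
  using width_pos clauses_pos fsize_eq vars_le by simp_all

lemma U_budget: "U (ps_width F T \<delta>) (fsize F) = budget"
  by (rule U_def[OF ps_width_bounds refl sizes])

lemma budget_pos: "1 \<le> budget"
  using U_bounds(1)[OF ps_width_bounds refl sizes] unfolding U_budget .

lemma square_le: "m * m \<le> budget"
  using U_bounds(7)[OF ps_width_bounds refl sizes] unfolding U_budget .

lemma main_count_spec:
  "spec main_count (input_store (enc_instance cs vs ls T \<delta>))
    (\<lambda>u. outputs u = binary (number_sat F) \<and> u [2] \<le> 1000 * budget) (1000 * budget)"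
  using main_count_correct[OF ps_width_bounds refl sizes enc_instance_eq] unfolding U_budget count_eq .

lemma main_max_spec:
  assumes "\<And>s. stream s rest \<Longrightarrow> static s \<Longrightarrow> (\<And>l. s (53 # l) = 0) \<Longrightarrow>
       spec p s (\<lambda>u. \<exists>L\<le>A * m. weights (\<lambda>c. w (cs ! c)) L u \<and> (\<Sum>c<m. w (cs ! c)) < 2 ^ L) (B * budget)"
    and "fst ` writes p \<inter> {4, 5, 6, 40, 41, 42, 44, 45, 46, 48, 54, 55} = {}"
  shows "spec (main_max p) (input_store (enc_instance cs vs ls T \<delta> @ rest))
    (\<lambda>u. (\<exists>\<tau>. weighted_maxsat F w \<tau> \<and> outputs u = enc_assignment vs \<tau>) \<and> u [2] \<le> budget)
    ((500 + 42 * A + B) * budget)"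
proof (rule spec_mono[OF main_max_correct[OF ps_width_bounds refl sizes _ _ assms(2), unfolded U_budget]])
  show "enc_instance cs vs ls T \<delta> @ rest = [m, n] @ enc_clauses cl [0..<m] @ tokens (map_btree lab T) @ rest"
    unfolding enc_instance_eq by simp
  show "spec p s (\<lambda>u. \<exists>L\<le>A * m. weights (\<lambda>c. w (cs ! c)) L u \<and> (\<Sum>c<m. w (cs ! c)) < 2 ^ L) (B * budget)"
    if "stream s rest" "static s" "\<And>l. s (53 # l) = 0" for s using that by (rule assms(1))
  fix u assume "\<exists>\<sigma>\<subseteq>{..<n}. outputs u = map (\<lambda>x. of_bool (x \<in> \<sigma>)) [0..<n] \<and> u [2] \<le> budget \<and>
       (\<forall>\<rho>\<subseteq>{..<n}. sum (\<lambda>c. w (cs ! c)) (satX {..<n} \<rho>) \<le> sum (\<lambda>c. w (cs ! c)) (satX {..<n} \<sigma>))"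
  then show "(\<exists>\<tau>. weighted_maxsat F w \<tau> \<and> outputs u = enc_assignment vs \<tau>) \<and> u [2] \<le> budget"
    unfolding enc_asg using weighted_maxsat_asg by blast
qed (assumption | rule order_refl)+

lemma unit_spec:
  "spec (main_max unit_weights) (input_store (enc_instance cs vs ls T \<delta>))
    (\<lambda>u. (\<exists>\<tau>. maxsat F \<tau> \<and> outputs u = enc_assignment vs \<tau>) \<and> u [2] \<le> budget) (591 * budget)"
proof -
  have "spec (main_max unit_weights) (input_store (enc_instance cs vs ls T \<delta> @ []))
    (\<lambda>u. (\<exists>\<tau>. weighted_maxsat F (\<lambda>_. 1) \<tau> \<and> outputs u = enc_assignment vs \<tau>) \<and> u [2] \<le> budget)
    ((500 + 42 * 2 + 7) * budget)"
    by (rule main_max_spec)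
      (use unit_weights_bound[OF ps_width_bounds refl sizes] fst_wr_weights in \<open>simp_all add: U_budget\<close>)
  then show ?thesis unfolding maxsat_def by simp
qed

text \<open>A single weight is at most the total \<open>2 ^ (a * m)\<close> and so has at most
  \<open>a * m + 1\<close> bits; since there is a clause, the extra bit is covered by another
  \<open>m\<close>.\<close>

lemma weight_bits:
  assumes "(\<Sum>C\<in>cla F. w C) \<le> 2 ^ (a * m)" "c < m"
  shows "length (binary (w (cs ! c))) \<le> (a + 1) * m"
proof -
  have "w (cs ! c) \<le> (\<Sum>C\<in>cla F. w C)"
    using cnf cs_nth[OF assms(2)] by (intro member_le_sum) (auto simp: cnf_def)
  then have "length (binary (w (cs ! c))) \<le> Suc (a * m)" using assms(1) by (intro length_binary) simp
  then show ?thesis using clauses_pos by simp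
qed

lemma weighted_spec:
  assumes w: "(\<Sum>C\<in>cla F. w C) \<le> 2 ^ (a * m)"
  shows "spec (main_max parse_weights) (input_store (enc_instance cs vs ls T \<delta> @ enc_weights cs w))
    (\<lambda>u. (\<exists>\<tau>. weighted_maxsat F w \<tau> \<and> outputs u = enc_assignment vs \<tau>) \<and> u [2] \<le> budget)
    ((500 + 42 * (a + 1 + 1) + (12 + 3 * (a + 1))) * budget)"
proof (rule main_max_spec)
  fix s assume "stream s (enc_weights cs w)" "static s" "\<And>l. s (53 # l) = 0"
  from parse_weights_bound[OF ps_width_bounds refl sizes this[unfolded enc_weights_eq] binary_bits weight_bits[OF w] num_binary]
  show "spec parse_weights s
     (\<lambda>u. \<exists>L\<le>(a + 1 + 1) * m. weights (\<lambda>c. w (cs ! c)) L u \<and> (\<Sum>c<m. w (cs ! c)) < 2 ^ L)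
     ((12 + 3 * (a + 1)) * budget)" unfolding U_budget .
qed (use fst_wr_weights in simp)

lemma instance_length: "length (enc_instance cs vs ls T \<delta>) \<le> 8 * budget"
  using length_enc[OF ps_width_bounds refl sizes] unfolding U_budget enc_instance_eq .

lemma instance_entries: "y \<in> set (enc_instance cs vs ls T \<delta>) \<Longrightarrow> y \<le> 2 * budget"
  using entries_enc[OF ps_width_bounds refl sizes cl_bound] unfolding U_budget enc_instance_eq .

lemma weights_length:
  assumes w: "(\<Sum>C\<in>cla F. w C) \<le> 2 ^ (a * m)"
  shows "length (enc_weights cs w) \<le> (a + 2) * budget"
proof -
  have "length (enc_weights cs w) = (\<Sum>c<m. Suc (length (binary (w (cs ! c)))))"
    unfolding enc_weights_eq enc_bits_def
    by (simp add: length_concat o_def interv_sum_list_conv_sum_set_nat atLeast0LessThan)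
  also have "\<dots> \<le> (\<Sum>c<m. (a + 2) * m)"
  proof (rule sum_mono)
    fix c assume "c \<in> {..<m}"
    then have "length (binary (w (cs ! c))) \<le> (a + 1) * m" using weight_bits[OF w] by simp
    then show "Suc (length (binary (w (cs ! c)))) \<le> (a + 2) * m" using clauses_pos by simp
  qed
  also have "\<dots> = (a + 2) * (m * m)" by (simp add: algebra_simps)
  also have "\<dots> \<le> (a + 2) * budget" by (rule mult_le_mono2[OF square_le])
  finally show ?thesis .
qed

lemma weights_entries:
  assumes w: "(\<Sum>C\<in>cla F. w C) \<le> 2 ^ (a * m)" and y: "y \<in> set (enc_weights cs w)"
  shows "y \<le> (a + 2) * budget"
proof -
  obtain c where c: "c < m" "y = length (binary (w (cs ! c))) \<or> y \<in> set (binary (w (cs ! c)))"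
    using y unfolding enc_weights_eq enc_bits_def by auto
  have "m \<le> budget" using U_bounds(3)[OF ps_width_bounds refl sizes] unfolding U_budget by (rule add_leD1)
  then have "(a + 1) * m \<le> (a + 1) * budget" by (rule mult_le_mono2)
  then have "length (binary (w (cs ! c))) \<le> (a + 1) * budget"
    using weight_bits[OF w c(1)] by (rule order_trans[rotated])
  moreover have "z \<le> 1" if "z \<in> set (binary (w (cs ! c)))" for z using that binary_bits by blast
  ultimately have "y \<le> (a + 1) * budget + 1" using c(2) by fastforce
  also have "\<dots> \<le> (a + 2) * budget" using budget_pos by simp
  finally show ?thesis .
qed

end

section \<open>Word bounds and uniform constants\<close>

text \<open>With \<open>k + S + 2\<close> as base, the budget is at most its fifth power, and the
  constant \<open>c + 2\<close> is at most its power \<open>c + 2\<close> because the base is at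
  least 2. Together this gives the exponent \<open>c + 7\<close>.\<close>

lemma word_bound_large:
  fixes k S M c :: nat
  assumes "1 \<le> k ^ 3 * S * M" "M \<le> S"
  shows "(c * (k ^ 3 * S * M) + 2) ^ q \<le> word_bound ((c + 7) * q) k S"
proof -
  let ?y = "k + S + 2"
  have "k ^ 3 * S * M \<le> ?y ^ 3 * ?y * ?y"
    using assms(2) by (intro mult_le_mono power_mono) simp_all
  also have "\<dots> = ?y ^ 5" by (simp only: power_Suc[symmetric] power_add[symmetric] flip: power_Suc2) simp
  finally have U: "k ^ 3 * S * M \<le> ?y ^ 5" .
  have "c * (k ^ 3 * S * M) + 2 \<le> (c + 2) * (k ^ 3 * S * M)" using assms(1) by (simp only: add_mult_distrib)
  also have "\<dots> \<le> ?y ^ (c + 2) * ?y ^ 5"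
  proof (rule mult_le_mono[OF _ U])
    have "c + 2 \<le> 2 ^ (c + 2)" using less_exp[of "c + 2"] by (rule less_imp_le)
    also have "\<dots> \<le> ?y ^ (c + 2)" by (rule power_mono) simp_all
    finally show "c + 2 \<le> ?y ^ (c + 2)" .
  qed
  also have "\<dots> = ?y ^ (c + 7)" by (simp only: power_add[symmetric]) simp
  finally have "(c * (k ^ 3 * S * M) + 2) ^ q \<le> (?y ^ (c + 7)) ^ q" by (rule power_mono) simp
  then show ?thesis unfolding word_bound_def power_mult .
qed

text \<open>\<open>P\<close> and \<open>f\<close> are independent of \<open>c\<close>, so one
  machine program serves all weight exponents, which enter through \<open>c\<close> only. The number
  \<open>f c\<close> is both time factor and word exponent, as the theorem has a single constant for
  the two.\<close>

definition implements :: "com \<Rightarrow> (nat \<Rightarrow> nat) \<Rightarrow> prog \<Rightarrow> bool" where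
  "implements P f p \<longleftrightarrow> (\<forall>c inp k S M Q. 1 \<le> k ^ 3 * S * M \<longrightarrow> M \<le> S \<longrightarrow> length inp \<le> c * (k ^ 3 * S * M) \<longrightarrow>
     (\<forall>x\<in>set inp. x \<le> c * (k ^ 3 * S * M)) \<longrightarrow>
     spec p (input_store inp) (\<lambda>u. Q (outputs u) \<and> u [2] \<le> c * (k ^ 3 * S * M)) (c * (k ^ 3 * S * M)) \<longrightarrow>
     computes P (word_bound (f c) k S) (f c * (k ^ 3 * S * M)) inp Q)"

lemma implementsD:
  assumes "implements P f p" "1 \<le> k ^ 3 * S * M" "M \<le> S" "length inp \<le> c * (k ^ 3 * S * M)"
    and "\<And>x. x \<in> set inp \<Longrightarrow> x \<le> c * (k ^ 3 * S * M)"
    and "spec p (input_store inp) (\<lambda>u. Q (outputs u) \<and> u [2] \<le> c * (k ^ 3 * S * M)) (c * (k ^ 3 * S * M))"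
  shows "computes P (word_bound (f c) k S) (f c * (k ^ 3 * S * M)) inp Q"
  using assms unfolding implements_def by blast

lemma ex_implements: "\<exists>P f. implements P f p"
proof -
  obtain P C q where P: "\<forall>inp t Q W. length inp \<le> t \<longrightarrow> (\<forall>x\<in>set inp. x \<le> t) \<longrightarrow> cost p (input_store inp) \<le> t \<longrightarrow>
     run_prog p (input_store inp) [2] \<le> t \<longrightarrow> Q (outputs (run_prog p (input_store inp))) \<longrightarrow> (t + 2) ^ q \<le> W \<longrightarrow>
     computes P W (C * (t + 1)) inp Q"
    using compile_correct by metis
  let ?f = "\<lambda>c. (c + 7) * q + C * (c + 1)"
  have "computes P (word_bound (?f c) k S) (?f c * (k ^ 3 * S * M)) inp Q"
    if pos: "1 \<le> k ^ 3 * S * M" and "M \<le> S" and "length inp \<le> c * (k ^ 3 * S * M)"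
      "\<forall>x\<in>set inp. x \<le> c * (k ^ 3 * S * M)"
      and sp: "spec p (input_store inp) (\<lambda>u. Q (outputs u) \<and> u [2] \<le> c * (k ^ 3 * S * M)) (c * (k ^ 3 * S * M))"
    for c inp k S M Q
  proof -
    let ?U = "k ^ 3 * S * M"
    have "(c * ?U + 2) ^ q \<le> word_bound ((c + 7) * q) k S" by (rule word_bound_large[OF that(1,2)])
    also have "\<dots> \<le> word_bound (?f c) k S" unfolding word_bound_def by (rule power_increasing) simp_all
    finally have W: "(c * ?U + 2) ^ q \<le> word_bound (?f c) k S" .
    have s: "cost p (input_store inp) \<le> c * ?U" "run_prog p (input_store inp) [2] \<le> c * ?U"
      "Q (outputs (run_prog p (input_store inp)))" using sp unfolding spec_def by blast+
    have "computes P (word_bound (?f c) k S) (C * (c * ?U + 1)) inp Q"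
      using P that(3,4) s W by blast
    moreover have "C * (c * ?U + 1) \<le> ?f c * ?U"
    proof -
      have "C * (c * ?U + 1) \<le> C * (c * ?U + ?U)" using pos by (intro mult_le_mono add_mono) simp_all
      also have "\<dots> = C * (c + 1) * ?U" by (simp only: add_mult_distrib mult_1 mult.assoc)
      also have "\<dots> \<le> ?f c * ?U" by (intro mult_le_mono) simp_all
      finally show ?thesis .
    qed
    ultimately show ?thesis unfolding computes_def using order_trans by blast
  qed
  then show ?thesis unfolding implements_def by (intro exI[of _ P] exI[of _ ?f] allI impI)
qed

theorem theorem3:
  shows
  "(\<exists>P c. \<forall>(F :: ('c, 'v) formula) (T :: 'l btree) \<delta> cs vs ls k s m n.
      cnf F \<and> branch_decomposition F T \<delta> \<and> listing F cs vs ls \<and>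
      k = ps_width F T \<delta> \<and> s = fsize F \<and> m = card (cla F) \<and> n = card (vars F) \<longrightarrow>
      computes P (word_bound c k s) (c * (k ^ 3 * s * (m + n))) (enc_instance cs vs ls T \<delta>)
        (\<lambda>out. \<exists>\<tau>. maxsat F \<tau> \<and> out = enc_assignment vs \<tau>))
   \<and>
   (\<exists>P c. \<forall>(F :: ('c, 'v) formula) (T :: 'l btree) \<delta> cs vs ls k s m n.
      cnf F \<and> branch_decomposition F T \<delta> \<and> listing F cs vs ls \<and>
      k = ps_width F T \<delta> \<and> s = fsize F \<and> m = card (cla F) \<and> n = card (vars F) \<longrightarrow>
      computes P (word_bound c k s) (c * (k ^ 3 * s * (m + n))) (enc_instance cs vs ls T \<delta>)
        (\<lambda>out. out = binary (number_sat F)))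
   \<and>
   (\<exists>P. \<forall>a. \<exists>c. \<forall>(F :: ('c, 'v) formula) (T :: 'l btree) \<delta> cs vs ls w k s m n.
      cnf F \<and> branch_decomposition F T \<delta> \<and> listing F cs vs ls \<and>
      (\<Sum>C\<in>cla F. w C) \<le> 2 ^ (a * m) \<and>
      k = ps_width F T \<delta> \<and> s = fsize F \<and> m = card (cla F) \<and> n = card (vars F) \<longrightarrow>
      computes P (word_bound c k s) (c * (k ^ 3 * s * (m + n)))
        (enc_instance cs vs ls T \<delta> @ enc_weights cs w)
        (\<lambda>out. \<exists>\<tau>. weighted_maxsat F w \<tau> \<and> out = enc_assignment vs \<tau>))"
proof (intro conjI)
  obtain P f where P: "implements P f (main_max unit_weights)" using ex_implements by blast
  show "\<exists>P c. \<forall>(F :: ('c, 'v) formula) (T :: 'l btree) \<delta> cs vs ls k s m n.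
      cnf F \<and> branch_decomposition F T \<delta> \<and> listing F cs vs ls \<and>
      k = ps_width F T \<delta> \<and> s = fsize F \<and> m = card (cla F) \<and> n = card (vars F) \<longrightarrow>
      computes P (word_bound c k s) (c * (k ^ 3 * s * (m + n))) (enc_instance cs vs ls T \<delta>)
        (\<lambda>out. \<exists>\<tau>. maxsat F \<tau> \<and> out = enc_assignment vs \<tau>)"
  \<comment> \<open>The constant is \<open>500 + 42 * A + B\<close> with \<open>A = 2\<close> for
    unit weights of width at most \<open>2 * m\<close> and \<open>B = 7\<close> for writing
    them.\<close>
  proof (rule exI[of _ P], rule exI[of _ "f 591"], intro allI impI, elim conjE)
    fix F :: "('c, 'v) formula" and T :: "'l btree" and \<delta> cs vs ls k s m n
    assume as: "cnf F" "branch_decomposition F T \<delta>" "listing F cs vs ls"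
      and eq: "k = ps_width F T \<delta>" "s = fsize F" "m = card (cla F)" "n = card (vars F)"
    interpret listed_instance F T \<delta> cs vs ls by unfold_locales (rule as)+
    show "computes P (word_bound (f 591) k s) (f 591 * (k ^ 3 * s * (m + n))) (enc_instance cs vs ls T \<delta>)
        (\<lambda>out. \<exists>\<tau>. maxsat F \<tau> \<and> out = enc_assignment vs \<tau>)"
      unfolding eq card_cla card_vars
    proof (rule implementsD[OF P])
      show "spec (main_max unit_weights) (input_store (enc_instance cs vs ls T \<delta>))
         (\<lambda>u. (\<exists>\<tau>. maxsat F \<tau> \<and> outputs u = enc_assignment vs \<tau>) \<and> u [2] \<le> 591 * budget) (591 * budget)"
        by (rule spec_mono[OF unit_spec]) auto
      show "length (enc_instance cs vs ls T \<delta>) \<le> 591 * budget" using instance_length by linarith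
      show "x \<le> 591 * budget" if "x \<in> set (enc_instance cs vs ls T \<delta>)" for x
        using instance_entries[OF that] by linarith
    qed (use budget_pos vars_le in auto)
  qed
next
  obtain P f where P: "implements P f main_count" using ex_implements by blast
  show "\<exists>P c. \<forall>(F :: ('c, 'v) formula) (T :: 'l btree) \<delta> cs vs ls k s m n.
      cnf F \<and> branch_decomposition F T \<delta> \<and> listing F cs vs ls \<and>
      k = ps_width F T \<delta> \<and> s = fsize F \<and> m = card (cla F) \<and> n = card (vars F) \<longrightarrow>
      computes P (word_bound c k s) (c * (k ^ 3 * s * (m + n))) (enc_instance cs vs ls T \<delta>)
        (\<lambda>out. out = binary (number_sat F))"
  proof (rule exI[of _ P], rule exI[of _ "f 1000"], intro allI impI, elim conjE)
    fix F :: "('c, 'v) formula" and T :: "'l btree" and \<delta> cs vs ls k s m n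
    assume as: "cnf F" "branch_decomposition F T \<delta>" "listing F cs vs ls"
      and eq: "k = ps_width F T \<delta>" "s = fsize F" "m = card (cla F)" "n = card (vars F)"
    interpret listed_instance F T \<delta> cs vs ls by unfold_locales (rule as)+
    show "computes P (word_bound (f 1000) k s) (f 1000 * (k ^ 3 * s * (m + n))) (enc_instance cs vs ls T \<delta>)
        (\<lambda>out. out = binary (number_sat F))"
      unfolding eq card_cla card_vars
    proof (rule implementsD[OF P])
      show "spec main_count (input_store (enc_instance cs vs ls T \<delta>))
         (\<lambda>u. outputs u = binary (number_sat F) \<and> u [2] \<le> 1000 * budget) (1000 * budget)"
        by (rule main_count_spec)
      show "length (enc_instance cs vs ls T \<delta>) \<le> 1000 * budget" using instance_length by linarith
      show "x \<le> 1000 * budget" if "x \<in> set (enc_instance cs vs ls T \<delta>)" for x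
        using instance_entries[OF that] by linarith
    qed (use budget_pos vars_le in auto)
  qed
next
  obtain P f where P: "implements P f (main_max parse_weights)" using ex_implements by blast
  \<comment> \<open>Again \<open>500 + 42 * A + B\<close>. Here \<open>A = a + 1 + 1\<close>,
    because a weight has at most \<open>(a + 1) * m\<close> bits and the common width adds another
    \<open>m\<close>; the last bracket is the cost of reading the weights.\<close>
  let ?c = "\<lambda>a. 500 + 42 * (a + 1 + 1) + (12 + 3 * (a + 1))"
  show "\<exists>P. \<forall>a. \<exists>c. \<forall>(F :: ('c, 'v) formula) (T :: 'l btree) \<delta> cs vs ls w k s m n.
      cnf F \<and> branch_decomposition F T \<delta> \<and> listing F cs vs ls \<and>
      (\<Sum>C\<in>cla F. w C) \<le> 2 ^ (a * m) \<and>
      k = ps_width F T \<delta> \<and> s = fsize F \<and> m = card (cla F) \<and> n = card (vars F) \<longrightarrow>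
      computes P (word_bound c k s) (c * (k ^ 3 * s * (m + n)))
        (enc_instance cs vs ls T \<delta> @ enc_weights cs w)
        (\<lambda>out. \<exists>\<tau>. weighted_maxsat F w \<tau> \<and> out = enc_assignment vs \<tau>)"
  proof (rule exI[of _ P], rule allI, rule_tac x="f (?c a)" in exI, intro allI impI, elim conjE)
    fix a :: nat and F :: "('c, 'v) formula" and T :: "'l btree" and \<delta> cs vs ls k s m n and w :: "'c \<Rightarrow> nat"
    assume as: "cnf F" "branch_decomposition F T \<delta>" "listing F cs vs ls" and w: "(\<Sum>C\<in>cla F. w C) \<le> 2 ^ (a * m)"
      and eq: "k = ps_width F T \<delta>" "s = fsize F" "m = card (cla F)" "n = card (vars F)"
    interpret listed_instance F T \<delta> cs vs ls by unfold_locales (rule as)+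
    note w = w[unfolded eq card_cla]
    show "computes P (word_bound (f (?c a)) k s) (f (?c a) * (k ^ 3 * s * (m + n)))
        (enc_instance cs vs ls T \<delta> @ enc_weights cs w)
        (\<lambda>out. \<exists>\<tau>. weighted_maxsat F w \<tau> \<and> out = enc_assignment vs \<tau>)"
      unfolding eq card_cla card_vars
    proof (rule implementsD[OF P])
      \<comment> \<open>The number \<open>a + 10\<close> comes from the input length, 8 budgets for
        the instance and \<open>a + 2\<close> for the weights.\<close>
      have le: "i \<le> ?c a * budget" if "i \<le> (a + 10) * budget" for i
        using that by (rule order_trans) (intro mult_le_mono1, simp)
      show "spec (main_max parse_weights) (input_store (enc_instance cs vs ls T \<delta> @ enc_weights cs w))
         (\<lambda>u. (\<exists>\<tau>. weighted_maxsat F w \<tau> \<and> outputs u = enc_assignment vs \<tau>) \<and> u [2] \<le> ?c a * budget) (?c a * budget)"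
      proof (rule spec_mono[OF weighted_spec[OF w] _ order_refl])
        fix u assume "(\<exists>\<tau>. weighted_maxsat F w \<tau> \<and> outputs u = enc_assignment vs \<tau>) \<and> u [2] \<le> budget"
        moreover have "budget \<le> ?c a * budget" by (rule le) simp
        ultimately show "(\<exists>\<tau>. weighted_maxsat F w \<tau> \<and> outputs u = enc_assignment vs \<tau>) \<and> u [2] \<le> ?c a * budget"
          using order_trans by blast
      qed
      have s: "(a + 10) * budget = 8 * budget + (a + 2) * budget" by (simp only: flip: add_mult_distrib) simp
      show "length (enc_instance cs vs ls T \<delta> @ enc_weights cs w) \<le> ?c a * budget"
        by (rule le) (use instance_length weights_length[OF w] in \<open>unfold s length_append, rule add_mono\<close>)
      fix x assume "x \<in> set (enc_instance cs vs ls T \<delta> @ enc_weights cs w)"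
      then have "x \<le> 2 * budget \<or> x \<le> (a + 2) * budget"
        using instance_entries weights_entries[OF w] by auto
      then show "x \<le> ?c a * budget" by (intro le) (unfold s, linarith)
    qed (use budget_pos vars_le in auto)
  qed
qed

end
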